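(* Let $n\ge 1$, let $\theta$ be a real skew-symmetric $n\times n$ matrix, let $\alpha\in\mathbb{N}_0^n$, $\ell\in\mathbb{N}_0$ and $1<p<\infty$. (i) For every $t>0$, the operator $\delta^{\alpha}L^{\ell}P_t$, defined on $\mathcal{A}_\theta^\infty$, extends uniquely to a completely bounded operator on $L^p(\mathbb{T}_\theta^n)$. Moreover, there exists a constant $C_{\alpha,\ell,n}>0$, depending only on $\alpha,\ell,n$ (in particular independent of $\theta$ and $p$), such that $$\|\delta^{\alpha}L^{\ell}P_t\|_{cb(L^p(\mathbb{T}_\theta^n))}\le \frac{C_{\alpha,\ell,n}}{t^{\ell+|\alpha|/2}}\qquad\text{for all } t>0.$$ In particular, for every $a\in\mathcal{A}_\theta^\infty$, $$\|\delta^{\alpha}\partial_t^{\ell}P_t(a)\|_{L^p(\mathbb{T}_\theta^n)}\le \frac{C_{\alpha,\ell,n}}{t^{\ell+|\alpha|/2}}\,\|a\|_{L^p(\mathbb{T}_\theta^n)}\qquad\text{for all } t>0.$$ (ii) If $(\alpha,\ell)\ne(0,0)$, then there exists a constant $c_{\alpha,\ell,n}>0$ (depending only on $\alpha,\ell,n$) such that, for every $1<p<\infty$ and all sufficiently small $t>0$, $$\sup_{\|a\|_{L^p(\mathbb{T}_\theta^n)}=1}\|\delta^{\alpha}L^{\ell}P_t(a)\|_{L^p(\mathbb{T}_\theta^n)}\ge \frac{c_{\alpha,\ell,n}}{t^{\ell+|\alpha|/2}}.$$ Hence the factor $t^{-\ell-|\alpha|/2}$ in (i) cannot be improved as $t\downarrow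 0$.
   Context: $\mathbb{N}_0=\{0,1,2,\dots\}$. Let $\theta=(\theta_{jk})$ be a real skew-symmetric $n\times n$ matrix. Let $U_1,\dots,U_n$ be unitaries with $U_kU_j=e^{2\pi i\theta_{kj}}U_jU_k$, realized in the standard representation on $\ell^2(\mathbb{Z}^n)$ (with canonical basis $(e_m)$): $U_je_m=e^{2\pi i\sum_{l<j}\theta_{jl}m_l}e_{m+\epsilon_j}$, where $\epsilon_j$ is the $j$-th unit vector. The noncommutative torus $\mathbb{T}_\theta^n=L^\infty(\mathbb{T}_\theta^n)$ is the von Neumann algebra they generate. For $m\in\mathbb{Z}^n$ put $U^m=U_1^{m_1}\cdots U_n^{m_n}$. The smooth algebra $\mathcal{A}_\theta^\infty$ is the set of all series $a=\sum_{m\in\mathbb{Z}^n}c_mU^m$ with rapidly decreasing coefficients $(c_m)$. The canonical trace $\tau$ is the faithful normal tracial state with $\tau(\sum c_mU^m)=c_0$ on $\mathcal{A}_\theta^\infty$. For $1\le p<\infty$, $L^p(\mathbb{T}_\theta^n)$ is the completion of $\mathcal{A}_\theta^\infty$ for $\|a\|_{L^p(\mathbb{T}_\theta^n)}=(\tau(|a|^p))^{1/p}$. For $r\in\mathbb{N}$ identify $M_r(L^p(\mathbb{T}_\theta^n))=L^p(L^\infty(\mathbb{T}_\theta^n)\bar\otimes M_r,\tau\otimes\mathrm{tr}_r)$, with $\mathrm{tr}_r$ the usual trace on $M_r$. For linear $T:L^p(\mathbb{T}_\theta^n)\to L^p(\mathbb{T}_\theta^n)$ set $\|T\|_{cb(L^p(\mathbb{T}_\theta^n))}=\sup_{r\ge1}\|\mathrm{id}_{M_r}\otimes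 T\|_{M_r(L^p(\mathbb{T}_\theta^n))\to M_r(L^p(\mathbb{T}_\theta^n))}$; $T$ is completely bounded if this is finite. The canonical derivations are the linear maps on $\mathcal{A}_\theta^\infty$ acting termwise with $\delta_j(U^m)=2\pi i\,m_jU^m$. For $\alpha\in\mathbb{N}_0^n$: $|\alpha|=\alpha_1+\cdots+\alpha_n$, $\delta^\alpha=\delta_1^{\alpha_1}\cdots\delta_n^{\alpha_n}$. The Laplacian is $L=-\sum_{j=1}^n\delta_j^2$, so $L(U^m)=4\pi^2|m|^2U^m$ with $|m|^2=m_1^2+\cdots+m_n^2$. The heat semigroup is $P_t=e^{-tL}$, i.e. $P_t(U^m)=e^{-4\pi^2|m|^2t}U^m$ (termwise on $\mathcal{A}_\theta^\infty$). *)

theory Defs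
  imports
    "HOL-Analysis.Analysis"
    "HOL-Computational_Algebra.Polynomial"
    "HOL-Library.Landau_Symbols"
begin

section \<open>The Hilbert space of square-summable families\<close>

definition sq_summable :: "('i \<Rightarrow> complex) \<Rightarrow> bool" where
  "sq_summable x \<longleftrightarrow> (\<lambda>i. (cmod (x i))\<^sup>2) summable_on UNIV"

typedef 'i ell2 = "{x :: 'i \<Rightarrow> complex. sq_summable x}"
  morphisms coord Abs_ell2
  by (rule exI[of _ "\<lambda>_. 0"]) (simp add: sq_summable_def)

setup_lifting type_definition_ell2

lemma sq_summableI:
  assumes "\<And>F. finite F \<Longrightarrow> (\<Sum>i\<in>F. (cmod (x i))\<^sup>2) \<le> B"
  shows "sq_summable x"
  unfolding sq_summable_def
  by (rule nonneg_bdd_above_summable_on) (use assms in \<open>auto simp: bdd_above_def\<close>)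

lemma sq_summable_sum_le:
  assumes "sq_summable x" "finite F"
  shows "(\<Sum>i\<in>F. (cmod (x i))\<^sup>2) \<le> (\<Sum>\<^sub>\<infinity>i. (cmod (x i))\<^sup>2)"
  using assms by (intro finite_sum_le_infsum) (auto simp: sq_summable_def)

lemma sq_summable_reindex_sum:
  assumes "sq_summable x" "finite F" "inj_on g S"
    and "\<And>i. i \<in> S \<Longrightarrow> cmod (y i) \<le> c * cmod (x (g i))"
    and "\<And>i. i \<notin> S \<Longrightarrow> y i = 0"
  shows "(\<Sum>i\<in>F. (cmod (y i))\<^sup>2) \<le> c\<^sup>2 * (\<Sum>\<^sub>\<infinity>i. (cmod (x i))\<^sup>2)"
proof -
  have "(\<Sum>i\<in>F. (cmod (y i))\<^sup>2) = (\<Sum>i\<in>F \<inter> S. (cmod (y i))\<^sup>2)"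
    using assms by (intro sum.mono_neutral_right) auto
  also have "\<dots> \<le> (\<Sum>i\<in>F \<inter> S. c\<^sup>2 * (cmod (x (g i)))\<^sup>2)"
  proof (rule sum_mono)
    fix i assume "i \<in> F \<inter> S"
    then have "cmod (y i) \<le> c * cmod (x (g i))" using assms by auto
    then have "(cmod (y i))\<^sup>2 \<le> (c * cmod (x (g i)))\<^sup>2" by (intro power_mono) auto
    then show "(cmod (y i))\<^sup>2 \<le> c\<^sup>2 * (cmod (x (g i)))\<^sup>2" by (simp add: power_mult_distrib)
  qed
  also have "\<dots> = c\<^sup>2 * (\<Sum>i\<in>g ` (F \<inter> S). (cmod (x i))\<^sup>2)"
    using assms(3) by (subst sum.reindex) (auto simp: sum_distrib_left intro: inj_on_subset)
  also have "\<dots> \<le> c\<^sup>2 * (\<Sum>\<^sub>\<infinity>i. (cmod (x i))\<^sup>2)"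
    using assms by (intro mult_left_mono sq_summable_sum_le) auto
  finally show ?thesis .
qed

lemma sq_summable_reindex:
  assumes "sq_summable x" "inj_on g S"
    and "\<And>i. i \<in> S \<Longrightarrow> cmod (y i) \<le> c * cmod (x (g i))"
    and "\<And>i. i \<notin> S \<Longrightarrow> y i = 0"
  shows "sq_summable y"
  by (rule sq_summableI, rule sq_summable_reindex_sum[OF assms(1) _ assms(2-4)])

lemma sq_summable_sum_add:
  assumes "sq_summable x" "sq_summable y" "finite F"
  shows "(\<Sum>i\<in>F. (cmod (x i + y i))\<^sup>2)
    \<le> (sqrt (\<Sum>\<^sub>\<infinity>i. (cmod (x i))\<^sup>2) + sqrt (\<Sum>\<^sub>\<infinity>i. (cmod (y i))\<^sup>2))\<^sup>2"
proof -
  have "L2_set (\<lambda>i. cmod (x i + y i)) F \<le> L2_set (\<lambda>i. cmod (x i) + cmod (y i)) F"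
    by (rule L2_set_mono) (auto intro: norm_triangle_ineq)
  also have "\<dots> \<le> L2_set (\<lambda>i. cmod (x i)) F + L2_set (\<lambda>i. cmod (y i)) F"
    by (rule L2_set_triangle_ineq)
  also have "\<dots> \<le> sqrt (\<Sum>\<^sub>\<infinity>i. (cmod (x i))\<^sup>2) + sqrt (\<Sum>\<^sub>\<infinity>i. (cmod (y i))\<^sup>2)"
    unfolding L2_set_def using assms
    by (intro add_mono real_sqrt_le_mono sq_summable_sum_le) auto
  finally have "sqrt (\<Sum>i\<in>F. (cmod (x i + y i))\<^sup>2)
      \<le> sqrt (\<Sum>\<^sub>\<infinity>i. (cmod (x i))\<^sup>2) + sqrt (\<Sum>\<^sub>\<infinity>i. (cmod (y i))\<^sup>2)"
    by (simp add: L2_set_def)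
  then have "(sqrt (\<Sum>i\<in>F. (cmod (x i + y i))\<^sup>2))\<^sup>2
      \<le> (sqrt (\<Sum>\<^sub>\<infinity>i. (cmod (x i))\<^sup>2) + sqrt (\<Sum>\<^sub>\<infinity>i. (cmod (y i))\<^sup>2))\<^sup>2"
    by (intro power_mono) (auto intro!: sum_nonneg)
  then show ?thesis by (simp add: sum_nonneg)
qed

lemma sq_summable_add:
  "sq_summable x \<Longrightarrow> sq_summable y \<Longrightarrow> sq_summable (\<lambda>i. x i + y i)"
  by (rule sq_summableI, rule sq_summable_sum_add)

lemma sq_summable_scale: "sq_summable x \<Longrightarrow> sq_summable (\<lambda>i. c * x i)"
  by (rule sq_summable_reindex[where g = id and S = UNIV and c = "cmod c"]) (auto simp: norm_mult)

instantiation ell2 :: (type) real_vector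
begin

lift_definition zero_ell2 :: "'a ell2" is "\<lambda>_. 0" by (simp add: sq_summable_def)
lift_definition plus_ell2 :: "'a ell2 \<Rightarrow> 'a ell2 \<Rightarrow> 'a ell2" is "\<lambda>x y i. x i + y i"
  by (rule sq_summable_add)
lift_definition uminus_ell2 :: "'a ell2 \<Rightarrow> 'a ell2" is "\<lambda>x i. - x i"
  by (simp add: sq_summable_def)
lift_definition minus_ell2 :: "'a ell2 \<Rightarrow> 'a ell2 \<Rightarrow> 'a ell2" is "\<lambda>x y i. x i - y i"
proof -
  fix x y :: "'a \<Rightarrow> complex"
  assume "sq_summable x" "sq_summable y"
  then have "sq_summable (\<lambda>i. x i + (-1) * y i)"
    by (intro sq_summable_add sq_summable_scale)
  then show "sq_summable (\<lambda>i. x i - y i)" by simp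
qed
lift_definition scaleR_ell2 :: "real \<Rightarrow> 'a ell2 \<Rightarrow> 'a ell2" is "\<lambda>c x i. complex_of_real c * x i"
  by (rule sq_summable_scale)

instance
  by standard (transfer; auto simp: fun_eq_iff algebra_simps)+

end

instantiation ell2 :: (type) real_normed_vector
begin

lift_definition norm_ell2 :: "'a ell2 \<Rightarrow> real" is "\<lambda>x. sqrt (\<Sum>\<^sub>\<infinity>i. (cmod (x i))\<^sup>2)" .
definition dist_ell2 :: "'a ell2 \<Rightarrow> 'a ell2 \<Rightarrow> real" where "dist_ell2 x y = norm (x - y)"
definition sgn_ell2 :: "'a ell2 \<Rightarrow> 'a ell2" where "sgn_ell2 x = x /\<^sub>R norm x"
definition uniformity_ell2 :: "('a ell2 \<times> 'a ell2) filter" where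
  "uniformity_ell2 = (INF e\<in>{0 <..}. principal {(x, y). dist x y < e})"
definition open_ell2 :: "'a ell2 set \<Rightarrow> bool" where
  "open_ell2 U = (\<forall>x\<in>U. \<forall>\<^sub>F (x', y) in uniformity. x' = x \<longrightarrow> y \<in> U)"

instance
proof
  fix x y :: "'a ell2" and c :: real
  show "(norm x = 0) = (x = 0)"
  proof (transfer, intro iffI)
    fix x :: "'a \<Rightarrow> complex"
    assume x: "sq_summable x" and 0: "sqrt (\<Sum>\<^sub>\<infinity>i. (cmod (x i))\<^sup>2) = 0"
    have "x i = 0" for i
    proof -
      have "(\<Sum>i\<in>{i}. (cmod (x i))\<^sup>2) \<le> 0"
        using sq_summable_sum_le[OF x, of "{i}"] 0 by simp
      then show ?thesis by simp
    qed
    then show "x = (\<lambda>_. 0)" by auto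
  qed auto
  show "norm (x + y) \<le> norm x + norm y"
  proof transfer
    fix x y :: "'a \<Rightarrow> complex"
    assume x: "sq_summable x" and y: "sq_summable y"
    have "(\<Sum>\<^sub>\<infinity>i. (cmod (x i + y i))\<^sup>2)
        \<le> (sqrt (\<Sum>\<^sub>\<infinity>i. (cmod (x i))\<^sup>2) + sqrt (\<Sum>\<^sub>\<infinity>i. (cmod (y i))\<^sup>2))\<^sup>2"
      using sq_summable_add[OF x y] sq_summable_sum_add[OF x y]
      by (intro infsum_le_finite_sums) (auto simp: sq_summable_def)
    then show "sqrt (\<Sum>\<^sub>\<infinity>i. (cmod (x i + y i))\<^sup>2)
        \<le> sqrt (\<Sum>\<^sub>\<infinity>i. (cmod (x i))\<^sup>2) + sqrt (\<Sum>\<^sub>\<infinity>i. (cmod (y i))\<^sup>2)"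
      by (intro real_le_lsqrt) (auto intro!: infsum_nonneg add_nonneg_nonneg)
  qed
  show "norm (c *\<^sub>R x) = \<bar>c\<bar> * norm x"
    by transfer (simp add: norm_mult power_mult_distrib infsum_cmult_right' real_sqrt_mult)
qed (simp_all add: dist_ell2_def sgn_ell2_def uniformity_ell2_def open_ell2_def)

end

lemma norm_ell2_reindex_le:
  assumes "inj_on g S" "0 \<le> c"
    and "\<And>i. i \<in> S \<Longrightarrow> cmod (coord y i) \<le> c * cmod (coord x (g i))"
    and "\<And>i. i \<notin> S \<Longrightarrow> coord y i = 0"
  shows "norm y \<le> norm x * c"
proof -
  have x: "sq_summable (coord x)" and y: "sq_summable (coord y)"
    using coord by auto
  have "(\<Sum>\<^sub>\<infinity>i. (cmod (coord y i))\<^sup>2) \<le> c\<^sup>2 * (\<Sum>\<^sub>\<infinity>i. (cmod (coord x i))\<^sup>2)"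
    using y sq_summable_reindex_sum[OF x _ assms(1,3,4)]
    by (intro infsum_le_finite_sums) (auto simp: sq_summable_def)
  then have "sqrt (\<Sum>\<^sub>\<infinity>i. (cmod (coord y i))\<^sup>2) \<le> sqrt (c\<^sup>2 * (\<Sum>\<^sub>\<infinity>i. (cmod (coord x i))\<^sup>2))"
    by (rule real_sqrt_le_mono)
  then show ?thesis using assms(2) by (simp add: norm_ell2.rep_eq real_sqrt_mult mult.commute)
qed

lemma coord_simps [simp]:
  "coord 0 i = 0" "coord (x + y) i = coord x i + coord y i"
  "coord (- x) i = - coord x i" "coord (x - y) i = coord x i - coord y i"
  "coord (c *\<^sub>R x) i = complex_of_real c * coord x i"
  by (simp_all add: zero_ell2.rep_eq plus_ell2.rep_eq uminus_ell2.rep_eq minus_ell2.rep_eq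
      scaleR_ell2.rep_eq)

lemma ell2_eqI: "(\<And>i. coord x i = coord y i) \<Longrightarrow> x = y"
  by (metis coord_inject ext)

lemma bounded_linear_ell2I:
  assumes "\<And>x y i. coord (f (x + y)) i = coord (f x) i + coord (f y) i"
    and "\<And>c x i. coord (f (c *\<^sub>R x)) i = complex_of_real c * coord (f x) i"
    and "inj_on g S" "0 \<le> c"
    and "\<And>x i. i \<in> S \<Longrightarrow> cmod (coord (f x) i) \<le> c * cmod (coord x (g i))"
    and "\<And>x i. i \<notin> S \<Longrightarrow> coord (f x) i = 0"
  shows "bounded_linear f"
  by (rule bounded_linear_intro[where K = c])
    (use assms in \<open>auto intro!: ell2_eqI norm_ell2_reindex_le[where g = g and S = S]\<close>)

text \<open>The inner product is antilinear in the first argument.\<close>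

definition cinner :: "'i ell2 \<Rightarrow> 'i ell2 \<Rightarrow> complex" where
  "cinner x y = (\<Sum>\<^sub>\<infinity>i. cnj (coord x i) * coord y i)"

lift_definition ket :: "'i \<Rightarrow> 'i ell2" is "\<lambda>i k. if k = i then 1 else 0"
proof -
  fix i :: 'i
  have "(\<lambda>k. (cmod (if k = i then 1 else 0))\<^sup>2) summable_on {i}" by simp
  then show "sq_summable (\<lambda>k. if k = i then 1 else (0::complex))"
    unfolding sq_summable_def by (subst summable_on_cong_neutral[where T = "{i}"]) auto
qed

lemma coord_ket: "coord (ket i) k = (if k = i then 1 else 0)"
  by (simp add: ket.rep_eq)

lemma cinner_ket: "cinner (ket i) y = coord y i"
proof -
  have "cinner (ket i) y = (\<Sum>\<^sub>\<infinity>k\<in>{i}. coord y k)"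
    unfolding cinner_def by (rule infsum_cong_neutral) (auto simp: coord_ket)
  then show ?thesis by simp
qed

lemma norm_coord_le: "cmod (coord x i) \<le> norm x"
proof -
  have "sq_summable (coord x)" using coord by auto
  then have "(cmod (coord x i))\<^sup>2 \<le> (\<Sum>\<^sub>\<infinity>i. (cmod (coord x i))\<^sup>2)"
    using sq_summable_sum_le[of "coord x" "{i}"] by simp
  then show ?thesis
    by (simp add: norm_ell2.rep_eq real_le_rsqrt)
qed

lemma bounded_linear_coord: "bounded_linear (\<lambda>x. coord x i)"
  by (rule bounded_linear_intro[where K = 1]) (auto simp: norm_coord_le scaleR_conv_of_real)


section \<open>Operators\<close>

text \<open>
  The type contains all bounded real-linear operators, with the usual operator norm. All the
  operators constructed below are complex-linear.
\<close>

type_synonym 'i op = "'i ell2 \<Rightarrow>\<^sub>L 'i ell2"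

lift_definition scaleC_ell2 :: "complex \<Rightarrow> 'i ell2 \<Rightarrow> 'i ell2" is "\<lambda>c x i. c * x i"
  by (rule sq_summable_scale)

lift_definition scalar_op :: "complex \<Rightarrow> 'i op" is scaleC_ell2
  by (rule bounded_linear_ell2I[where g = id and S = UNIV and c = "cmod c" for c])
    (auto simp: scaleC_ell2.rep_eq algebra_simps norm_mult)

abbreviation cscale :: "complex \<Rightarrow> 'i op \<Rightarrow> 'i op"  (infixr \<open>*\<^sub>C\<close> 75) where
  "c *\<^sub>C A \<equiv> scalar_op c o\<^sub>L A"

definition adj :: "'i op \<Rightarrow> 'i op" where
  "adj A = (THE B. \<forall>x y. cinner (blinfun_apply A x) y = cinner x (blinfun_apply B y))"

definition op_power :: "'i op \<Rightarrow> nat \<Rightarrow> 'i op" where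
  "op_power A k = ((\<lambda>B. A o\<^sub>L B) ^^ k) id_blinfun"

lemma adj_eqI:
  assumes "\<And>x y. cinner (blinfun_apply A x) y = cinner x (blinfun_apply B y)"
  shows "adj A = B"
  unfolding adj_def
proof (rule the_equality)
  fix B' assume *: "\<forall>x y. cinner (blinfun_apply A x) y = cinner x (blinfun_apply B' y)"
  show "B' = B"
    by (intro blinfun_eqI ell2_eqI) (metis * assms cinner_ket)
qed (use assms in auto)

text \<open>Integer powers of a unitary operator.\<close>

definition unitary_power :: "'i op \<Rightarrow> int \<Rightarrow> 'i op" where
  "unitary_power A k = (if 0 \<le> k then op_power A (nat k) else op_power (adj A) (nat (- k)))"

definition poly_op :: "real poly \<Rightarrow> 'i op \<Rightarrow> 'i op" where
  "poly_op q A = (\<Sum>i\<le>degree q. coeff q i *\<^sub>R op_power A i)"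

text \<open>
  Continuous functional calculus of a positive operator, whose spectrum lies in
  \<open>[0, \<parallel>A\<parallel>]\<close>: the common norm limit of \<open>q\<^sub>k(A)\<close> over all sequences of polynomials
  converging to \<open>f\<close> uniformly on this interval.
\<close>

definition pos_cfc :: "(real \<Rightarrow> real) \<Rightarrow> 'i op \<Rightarrow> 'i op" where
  "pos_cfc f A = (THE B. \<forall>q :: nat \<Rightarrow> real poly.
     uniform_limit {0..norm A} (\<lambda>k s. poly (q k) s) f sequentially
       \<longrightarrow> (\<lambda>k. poly_op (q k) A) \<longlonglongrightarrow> B)"

definition abs_op :: "'i op \<Rightarrow> 'i op" where
  "abs_op A = pos_cfc sqrt (adj A o\<^sub>L A)"

definition abs_powr :: "'i op \<Rightarrow> real \<Rightarrow> 'i op" where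
  "abs_powr A p = pos_cfc (\<lambda>s. s powr p) (abs_op A)"

definition trace_pnorm :: "('i op \<Rightarrow> complex) \<Rightarrow> real \<Rightarrow> 'i op \<Rightarrow> real" where
  "trace_pnorm \<tau> p A = (Re (\<tau> (abs_powr A p))) powr (1 / p)"


section \<open>The smooth algebra of a noncommutative torus\<close>

type_synonym 'n ivec = "(int, 'n) vec"
type_synonym 'n nvec = "(nat, 'n) vec"
type_synonym 'n rmat = "((real, 'n) vec, 'n) vec"

text \<open>The entry \<open>\<theta>\<^sub>j\<^sub>k\<close> is \<open>\<theta> $ j $ k\<close>, and skew-symmetry is \<open>transpose \<theta> = - \<theta>\<close>.\<close>

definition torus_phase :: "'n::{finite,linorder} rmat \<Rightarrow> 'n \<Rightarrow> 'n ivec \<Rightarrow> complex" where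
  "torus_phase \<theta> j m = cis (2 * pi * (\<Sum>l | l < j. \<theta> $ j $ l * real_of_int (m $ l)))"

lift_definition torus_shift ::
    "'n::{finite,linorder} rmat \<Rightarrow> 'n \<Rightarrow> 'n ivec ell2 \<Rightarrow> 'n ivec ell2"
  is "\<lambda>\<theta> j x m. torus_phase \<theta> j (m - axis j 1) * x (m - axis j 1)"
  by (erule sq_summable_reindex[where g = "\<lambda>m. m - axis j 1" and S = UNIV and c = 1 for j])
    (auto simp: norm_mult torus_phase_def inj_on_def)

lift_definition torus_U :: "'n::{finite,linorder} rmat \<Rightarrow> 'n \<Rightarrow> 'n ivec op"
  is torus_shift
  by (rule bounded_linear_ell2I[where g = "\<lambda>m. m - axis j 1" and S = UNIV and c = 1 for j])
    (auto simp: torus_shift.rep_eq algebra_simps norm_mult torus_phase_def inj_on_def)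

lemma torus_U_ket:
  "blinfun_apply (torus_U \<theta> j) (ket m) = scaleC_ell2 (torus_phase \<theta> j m) (ket (m + axis j 1))"
  by (rule ell2_eqI)
    (auto simp: torus_U.rep_eq torus_shift.rep_eq scaleC_ell2.rep_eq ket.rep_eq algebra_simps)

lift_definition torus_unshift ::
    "'n::{finite,linorder} rmat \<Rightarrow> 'n \<Rightarrow> 'n ivec ell2 \<Rightarrow> 'n ivec ell2"
  is "\<lambda>\<theta> j x m. cnj (torus_phase \<theta> j m) * x (m + axis j 1)"
  by (erule sq_summable_reindex[where g = "\<lambda>m. m + axis j 1" and S = UNIV and c = 1 for j])
    (auto simp: norm_mult torus_phase_def inj_on_def)

lift_definition torus_U_inv :: "'n::{finite,linorder} rmat \<Rightarrow> 'n \<Rightarrow> 'n ivec op"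
  is torus_unshift
  by (rule bounded_linear_ell2I[where g = "\<lambda>m. m + axis j 1" and S = UNIV and c = 1 for j])
    (auto simp: torus_unshift.rep_eq algebra_simps norm_mult torus_phase_def inj_on_def)

lemma adj_torus_U: "adj (torus_U \<theta> j) = torus_U_inv \<theta> j"
proof (rule adj_eqI)
  fix x y :: "'a ivec ell2"
  let ?f = "\<lambda>m. cnj (torus_phase \<theta> j (m - axis j 1) * coord x (m - axis j 1)) * coord y m"
  have "bij_betw (\<lambda>m :: 'a ivec. m + axis j 1) UNIV UNIV"
    by (rule bij_betwI[where g = "\<lambda>m. m - axis j 1"]) auto
  from infsum_reindex_bij_betw[OF this, of ?f]
  show "cinner (blinfun_apply (torus_U \<theta> j) x) y = cinner x (blinfun_apply (torus_U_inv \<theta> j) y)"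
    by (simp add: cinner_def torus_U.rep_eq torus_shift.rep_eq torus_U_inv.rep_eq
        torus_unshift.rep_eq mult_ac)
qed

lemma torus_U_unitary:
  "torus_U \<theta> j o\<^sub>L adj (torus_U \<theta> j) = id_blinfun" "adj (torus_U \<theta> j) o\<^sub>L torus_U \<theta> j = id_blinfun"
proof -
  have [simp]: "torus_phase \<theta> j m * (cnj (torus_phase \<theta> j m) * z) = z"
    "cnj (torus_phase \<theta> j m) * (torus_phase \<theta> j m * z) = z" for m z
    by (simp_all add: torus_phase_def cis_cnj cis_mult flip: mult.assoc)
  show "torus_U \<theta> j o\<^sub>L adj (torus_U \<theta> j) = id_blinfun" "adj (torus_U \<theta> j) o\<^sub>L torus_U \<theta> j = id_blinfun"
    by (intro blinfun_eqI ell2_eqI; simp add: adj_torus_U torus_U.rep_eq torus_shift.rep_eq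
        torus_U_inv.rep_eq torus_unshift.rep_eq)+
qed

lemma torus_commutation:
  assumes "transpose \<theta> = - \<theta>"
  shows "torus_U \<theta> k o\<^sub>L torus_U \<theta> j = cis (2 * pi * \<theta> $ k $ j) *\<^sub>C (torus_U \<theta> j o\<^sub>L torus_U \<theta> k)"
proof -
  have skew: "\<theta> $ a $ b = - \<theta> $ b $ a" for a b
    using arg_cong[OF assms, of "\<lambda>A. A $ b $ a"] by (simp add: transpose_def)
  have phase: "torus_phase \<theta> a (m - axis b 1)
      = torus_phase \<theta> a m * (if b < a then cis (- 2 * pi * \<theta> $ a $ b) else 1)" for a b m
  proof -
    have "(\<Sum>l | l < a. \<theta> $ a $ l * real_of_int ((m - axis b 1) $ l))
        = (\<Sum>l | l < a. \<theta> $ a $ l * real_of_int (m $ l)) - (\<Sum>l | l < a. if l = b then \<theta> $ a $ b else 0)"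
      unfolding sum_subtractf[symmetric] by (rule sum.cong) (auto simp: axis_def algebra_simps)
    then show ?thesis
      unfolding torus_phase_def by (simp only:) (simp add: cis_mult right_diff_distrib)
  qed
  show ?thesis
  proof (intro blinfun_eqI ell2_eqI)
    fix x :: "'a ivec ell2" and m :: "'a ivec"
    have swap: "m - axis j 1 - axis k 1 = m - axis k 1 - axis j 1" by (simp add: vec_eq_iff)
    have "torus_phase \<theta> k (m - axis k 1) * torus_phase \<theta> j (m - axis k 1 - axis j 1)
        = cis (2 * pi * \<theta> $ k $ j) * (torus_phase \<theta> j (m - axis j 1) * torus_phase \<theta> k (m - axis k 1 - axis j 1))"
      using skew[of j k] skew[of j j]
      by (cases j k rule: linorder_cases) (simp_all add: phase cis_mult flip: mult.assoc)
    then show "coord (blinfun_apply (torus_U \<theta> k o\<^sub>L torus_U \<theta> j) x) m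
      = coord (blinfun_apply (cis (2 * pi * \<theta> $ k $ j) *\<^sub>C (torus_U \<theta> j o\<^sub>L torus_U \<theta> k)) x) m"
      by (simp add: torus_U.rep_eq torus_shift.rep_eq scalar_op.rep_eq scaleC_ell2.rep_eq swap
          flip: mult.assoc)
  qed
qed

text \<open>\<open>U\<^sup>m = U\<^sub>1\<^bsup>m\<^sub>1\<^esup> \<cdots> U\<^sub>n\<^bsup>m\<^sub>n\<^esup>\<close>, the indices increasing from left to right.\<close>

definition torus_mono :: "'n::{finite,linorder} rmat \<Rightarrow> 'n ivec \<Rightarrow> 'n ivec op" where
  "torus_mono \<theta> m =
     foldr (\<lambda>j A. unitary_power (torus_U \<theta> j) (m $ j) o\<^sub>L A) (sorted_list_of_set UNIV) id_blinfun"

lemma torus_phase_lower: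
  "(\<And>l. l < j \<Longrightarrow> m $ l = 0) \<Longrightarrow> torus_phase \<theta> j m = 1"
  by (simp add: torus_phase_def)

lemma torus_U_power_ket:
  assumes "\<And>l. l < j \<Longrightarrow> m $ l = 0"
  shows "blinfun_apply (unitary_power (torus_U \<theta> j) k) (ket m) = ket (m + axis j k)"
proof -
  have low: "torus_phase \<theta> j (m + axis j i) = 1" for i
    by (rule torus_phase_lower) (auto simp: assms axis_def)
  have pos: "blinfun_apply (op_power (torus_U \<theta> j) i) (ket m) = ket (m + axis j (int i))" for i
  proof (induction i)
    case (Suc i)
    have eq: "m + axis j (int i) + axis j 1 = m + axis j (1 + int i)"
      by (auto simp: vec_eq_iff axis_def)
    have one: "scaleC_ell2 1 x = x" for x :: "'a ivec ell2"
      by (rule ell2_eqI) (simp add: scaleC_ell2.rep_eq)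
    show ?case using Suc
      by (simp add: op_power_def torus_U_ket low one eq)
  next
    case 0
    have "m + axis j (int 0) = m" by (simp add: vec_eq_iff axis_def)
    then show ?case by (simp only: op_power_def) simp
  qed
  have neg: "blinfun_apply (op_power (adj (torus_U \<theta> j)) i) (ket m) = ket (m + axis j (- int i))" for i
  proof (induction i)
    case (Suc i)
    have eq: "m + axis j (- int i) = m + axis j (- int (Suc i)) + axis j 1"
      by (auto simp: vec_eq_iff axis_def)
    show ?case using Suc low[of "- int (Suc i)"]
      by (auto simp: op_power_def adj_torus_U torus_U_inv.rep_eq torus_unshift.rep_eq coord_ket eq
          intro!: ell2_eqI)
  next
    case 0
    have "m + axis j (- int 0) = m" by (simp add: vec_eq_iff axis_def)
    then show ?case by (simp only: op_power_def) simp
  qed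
  show ?thesis using pos[of "nat k"] neg[of "nat (- k)"] by (simp add: unitary_power_def)
qed

lemma torus_mono_ket: "blinfun_apply (torus_mono \<theta> m) (ket 0) = ket m"
proof -
  define F where
    "F js = foldr (\<lambda>j A. unitary_power (torus_U \<theta> j) (m $ j) o\<^sub>L A) js id_blinfun" for js
  have "blinfun_apply (F js) (ket 0) = ket (\<chi> l. if l \<in> set js then m $ l else 0)"
    if "sorted js" "distinct js" for js
    using that
  proof (induction js)
    case Nil
    then show ?case by (simp add: F_def flip: zero_vec_def)
  next
    case (Cons j js)
    then have "(\<chi> l. if l \<in> set js then m $ l else 0) + axis j (m $ j)
        = (\<chi> l. if l \<in> set (j # js) then m $ l else 0)"
      by (auto simp: vec_eq_iff axis_def)
    moreover have "l \<notin> set js" if "l < j" for l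
      using Cons.prems that by auto
    then have "blinfun_apply (F (j # js)) (ket 0)
        = ket ((\<chi> l. if l \<in> set js then m $ l else 0) + axis j (m $ j))"
      using Cons by (auto simp: F_def intro!: torus_U_power_ket)
    ultimately show ?case by simp
  qed
  from this[of "sorted_list_of_set UNIV"] show ?thesis
    by (simp add: F_def torus_mono_def vec_lambda_eta)
qed

definition sqlen :: "'n::finite ivec \<Rightarrow> real" where
  "sqlen m = (\<Sum>j\<in>UNIV. (real_of_int (m $ j))\<^sup>2)"

definition rapidly_decreasing :: "('n::finite ivec \<Rightarrow> complex) \<Rightarrow> bool" where
  "rapidly_decreasing c \<longleftrightarrow>
     (\<forall>k::nat. bounded (range (\<lambda>m. complex_of_real ((1 + sqlen m) ^ k) * c m)))"

definition fourier_expansion ::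
    "'n::{finite,linorder} rmat \<Rightarrow> ('n ivec \<Rightarrow> complex) \<Rightarrow> 'n ivec op \<Rightarrow> bool" where
  "fourier_expansion \<theta> c a \<longleftrightarrow>
     rapidly_decreasing c \<and> ((\<lambda>m. c m *\<^sub>C torus_mono \<theta> m) has_sum a) UNIV"

lemma fourier_expansion_coord:
  assumes "fourier_expansion \<theta> c a"
  shows "coord (blinfun_apply a (ket 0)) m = c m"
proof -
  have lin: "bounded_linear (\<lambda>A :: 'a ivec op. coord (blinfun_apply A (ket 0)) m)"
    by (rule bounded_linear_compose[OF bounded_linear_coord blinfun.bounded_linear_left])
  have "((\<lambda>m. c m *\<^sub>C torus_mono \<theta> m) has_sum a) UNIV"
    using assms by (simp add: fourier_expansion_def)
  from has_sum_bounded_linear[OF lin this]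
  have "((\<lambda>k. coord (blinfun_apply (c k *\<^sub>C torus_mono \<theta> k) (ket 0)) m)
      has_sum coord (blinfun_apply a (ket 0)) m) UNIV"
    by (simp only: o_def)
  then have "((\<lambda>k. if k = m then c k else 0) has_sum coord (blinfun_apply a (ket 0)) m) UNIV"
    by (simp add: torus_mono_ket scalar_op.rep_eq scaleC_ell2.rep_eq coord_ket if_distrib eq_commute
        cong: if_cong)
  moreover have "((\<lambda>k. if k = m then c k else 0) has_sum c m) UNIV"
    using has_sum_finite[of "{m}" c]
    by (subst has_sum_cong_neutral[where T = "{m}" and g = c]) auto
  ultimately show ?thesis using has_sum_unique by blast
qed

definition smooth_torus :: "'n::{finite,linorder} rmat \<Rightarrow> 'n ivec op set" where
  "smooth_torus \<theta> = {a. \<exists>c. fourier_expansion \<theta> c a}"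

definition fourier_coeff ::
    "'n::{finite,linorder} rmat \<Rightarrow> 'n ivec op \<Rightarrow> 'n ivec \<Rightarrow> complex" where
  "fourier_coeff \<theta> a = (THE c. fourier_expansion \<theta> c a)"

lemma fourier_coeff_eq: "fourier_expansion \<theta> c a \<Longrightarrow> fourier_coeff \<theta> a = c"
  unfolding fourier_coeff_def
  by (rule the_equality) (auto simp: fun_eq_iff simp flip: fourier_expansion_coord)

definition termwise ::
    "'n::{finite,linorder} rmat \<Rightarrow> ('n ivec \<Rightarrow> complex) \<Rightarrow> 'n ivec op \<Rightarrow> 'n ivec op"
  where
  "termwise \<theta> \<phi> a = (\<Sum>\<^sub>\<infinity>m. (\<phi> m * fourier_coeff \<theta> a m) *\<^sub>C torus_mono \<theta> m)"

definition deriv_op ::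
    "'n::{finite,linorder} rmat \<Rightarrow> 'n \<Rightarrow> 'n ivec op \<Rightarrow> 'n ivec op" where
  "deriv_op \<theta> j = termwise \<theta> (\<lambda>m. 2 * pi * \<i> * of_int (m $ j))"

definition deriv_multi ::
    "'n::{finite,linorder} rmat \<Rightarrow> 'n nvec \<Rightarrow> 'n ivec op \<Rightarrow> 'n ivec op" where
  "deriv_multi \<theta> \<alpha> =
     foldr (\<lambda>j F. (deriv_op \<theta> j ^^ (\<alpha> $ j)) \<circ> F) (sorted_list_of_set UNIV) id"

definition laplacian ::
    "'n::{finite,linorder} rmat \<Rightarrow> 'n ivec op \<Rightarrow> 'n ivec op" where
  "laplacian \<theta> a = - (\<Sum>j\<in>UNIV. deriv_op \<theta> j (deriv_op \<theta> j a))"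

definition heat ::
    "'n::{finite,linorder} rmat \<Rightarrow> real \<Rightarrow> 'n ivec op \<Rightarrow> 'n ivec op" where
  "heat \<theta> t = termwise \<theta> (\<lambda>m. complex_of_real (exp (- (4 * pi\<^sup>2 * sqlen m * t))))"

text \<open>The derivative is taken with respect to the operator norm.\<close>

definition heat_time_deriv ::
    "'n::{finite,linorder} rmat \<Rightarrow> nat \<Rightarrow> real \<Rightarrow> 'n ivec op \<Rightarrow> 'n ivec op" where
  "heat_time_deriv \<theta> l t a =
     ((\<lambda>f s. vector_derivative f (at s)) ^^ l) (\<lambda>s. heat \<theta> s a) t"

definition heat_op ::
    "'n::{finite,linorder} rmat \<Rightarrow> 'n nvec \<Rightarrow> nat \<Rightarrow> real \<Rightarrow> 'n ivec op \<Rightarrow> 'n ivec op"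
  where
  "heat_op \<theta> \<alpha> l t = deriv_multi \<theta> \<alpha> \<circ> (laplacian \<theta> ^^ l) \<circ> heat \<theta> t"

definition multi_degree :: "'n::finite nvec \<Rightarrow> nat" where
  "multi_degree \<alpha> = (\<Sum>j\<in>UNIV. \<alpha> $ j)"


section \<open>Noncommutative \<open>L\<^sup>p\<close> spaces\<close>

text \<open>
  Since \<open>U\<^sup>m e\<^sub>0 = e\<^sub>m\<close>, the canonical trace of the von Neumann algebra generated by the
  \<open>U\<^sub>j\<close> is the vector state of \<open>e\<^sub>0\<close>. It is applied below to \<open>|a|\<^sup>p\<close>, which belongs to
  this algebra but in general not to the smooth algebra.
\<close>

definition torus_trace :: "'n::finite ivec op \<Rightarrow> complex" where
  "torus_trace A = cinner (ket 0) (blinfun_apply A (ket 0))"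

lemma torus_trace_expansion: "fourier_expansion \<theta> c a \<Longrightarrow> torus_trace a = c 0"
  by (simp add: torus_trace_def cinner_ket fourier_expansion_coord)

abbreviation torus_pnorm :: "real \<Rightarrow> 'n::finite ivec op \<Rightarrow> real" where
  "torus_pnorm \<equiv> trace_pnorm torus_trace"

text \<open>
  To let \<open>r\<close> vary, an \<open>r \<times> r\<close> matrix of operators on \<open>\<ell>\<^sup>2(I)\<close> acts on
  \<open>\<ell>\<^sup>2(I) \<otimes> \<ell>\<^sup>2(\<nat>) = \<ell>\<^sup>2(I \<times> \<nat>)\<close>, as zero on the orthogonal complement of
  \<open>\<ell>\<^sup>2(I) \<otimes> \<complex>\<^sup>r\<close>. This does not affect \<open>|x|\<^sup>p\<close> on the latter subspace.
\<close>

lift_definition slot_inj :: "nat \<Rightarrow> 'i ell2 \<Rightarrow> ('i \<times> nat) ell2"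
  is "\<lambda>i x (m, k). if k = i then x m else 0"
proof -
  fix i and x :: "'i \<Rightarrow> complex"
  assume "sq_summable x"
  then show "sq_summable (\<lambda>(m, k). if k = i then x m else 0)"
    by (rule sq_summable_reindex[where g = fst and S = "UNIV \<times> {i}" and c = 1])
      (auto simp: inj_on_def split: if_splits)
qed

lift_definition slot_proj :: "nat \<Rightarrow> ('i \<times> nat) ell2 \<Rightarrow> 'i ell2" is "\<lambda>i x m. x (m, i)"
  by (erule sq_summable_reindex[where g = "\<lambda>m. (m, i)" and S = UNIV and c = 1 for i])
    (auto simp: inj_on_def)

lift_definition inj_op :: "nat \<Rightarrow> 'i ell2 \<Rightarrow>\<^sub>L ('i \<times> nat) ell2" is slot_inj
proof -
  fix i
  show "bounded_linear (slot_inj i :: 'i ell2 \<Rightarrow> _)"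
    by (rule bounded_linear_ell2I[where g = fst and S = "UNIV \<times> {i}" and c = 1])
      (auto simp: slot_inj.rep_eq inj_on_def split: prod.splits)
qed

lift_definition proj_op :: "nat \<Rightarrow> ('i \<times> nat) ell2 \<Rightarrow>\<^sub>L 'i ell2" is slot_proj
  by (rule bounded_linear_ell2I[where g = "\<lambda>m. (m, i)" and S = UNIV and c = 1 for i])
    (auto simp: slot_proj.rep_eq inj_on_def)

definition mat_op :: "nat \<Rightarrow> (nat \<Rightarrow> nat \<Rightarrow> 'i op) \<Rightarrow> ('i \<times> nat) op" where
  "mat_op r a = (\<Sum>i<r. \<Sum>j<r. inj_op i o\<^sub>L a i j o\<^sub>L proj_op j)"

definition mat_trace :: "nat \<Rightarrow> ('n::finite ivec \<times> nat) op \<Rightarrow> complex" where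
  "mat_trace r A = (\<Sum>i<r. torus_trace (proj_op i o\<^sub>L A o\<^sub>L inj_op i))"

definition mat_pnorm :: "nat \<Rightarrow> real \<Rightarrow> (nat \<Rightarrow> nat \<Rightarrow> 'n::finite ivec op) \<Rightarrow> real" where
  "mat_pnorm r p a = trace_pnorm (mat_trace r) p (mat_op r a)"

text \<open>
  \<open>L\<^sup>p\<close> is the completion of the smooth algebra: Cauchy sequences modulo null sequences.
\<close>

type_synonym 'n lp = "(nat \<Rightarrow> 'n ivec op) set"

definition lp_Cauchy :: "'n::{finite,linorder} rmat \<Rightarrow> real \<Rightarrow> (nat \<Rightarrow> 'n ivec op) set" where
  "lp_Cauchy \<theta> p = {X. (\<forall>k. X k \<in> smooth_torus \<theta>) \<and>
     (\<forall>e>0. \<exists>N. \<forall>k\<ge>N. \<forall>l\<ge>N. torus_pnorm p (X k - X l) < e)}"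

definition lp_rel ::
    "'n::{finite,linorder} rmat \<Rightarrow> real \<Rightarrow> ((nat \<Rightarrow> 'n ivec op) \<times> (nat \<Rightarrow> 'n ivec op)) set"
  where
  "lp_rel \<theta> p = {(X, Y). X \<in> lp_Cauchy \<theta> p \<and> Y \<in> lp_Cauchy \<theta> p \<and>
     (\<lambda>k. torus_pnorm p (X k - Y k)) \<longlonglongrightarrow> 0}"

definition lp_space :: "'n::{finite,linorder} rmat \<Rightarrow> real \<Rightarrow> 'n lp set" where
  "lp_space \<theta> p = lp_Cauchy \<theta> p // lp_rel \<theta> p"

definition lp_embed ::
    "'n::{finite,linorder} rmat \<Rightarrow> real \<Rightarrow> 'n ivec op \<Rightarrow> 'n lp" where
  "lp_embed \<theta> p a = lp_rel \<theta> p `` {\<lambda>_. a}"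

definition lp_add ::
    "'n::{finite,linorder} rmat \<Rightarrow> real \<Rightarrow> 'n lp \<Rightarrow> 'n lp \<Rightarrow> 'n lp" where
  "lp_add \<theta> p x y = (\<Union>X\<in>x. \<Union>Y\<in>y. lp_rel \<theta> p `` {\<lambda>k. X k + Y k})"

definition lp_scale ::
    "'n::{finite,linorder} rmat \<Rightarrow> real \<Rightarrow> complex \<Rightarrow> 'n lp \<Rightarrow> 'n lp" where
  "lp_scale \<theta> p c x = (\<Union>X\<in>x. lp_rel \<theta> p `` {\<lambda>k. c *\<^sub>C X k})"

text \<open>
  An element of \<open>M\<^sub>r(L\<^sup>p)\<close> is a matrix \<open>x\<close> with entries \<open>x i j\<close>, \<open>i, j < r\<close>, in \<open>L\<^sup>p\<close>.
  The norm of \<open>L\<^sup>p(L\<^sup>\<infinity> \<otimes> M\<^sub>r)\<close> is extended from matrices of smooth elements by continuity.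
\<close>

definition lp_mat_space :: "'n::{finite,linorder} rmat \<Rightarrow> real \<Rightarrow> nat \<Rightarrow> (nat \<Rightarrow> nat \<Rightarrow> 'n lp) set" where
  "lp_mat_space \<theta> p r = {x. \<forall>i<r. \<forall>j<r. x i j \<in> lp_space \<theta> p}"

definition lp_mat_norm :: "real \<Rightarrow> nat \<Rightarrow> (nat \<Rightarrow> nat \<Rightarrow> 'n::finite lp) \<Rightarrow> real" where
  "lp_mat_norm p r x = (THE N. \<exists>X. (\<forall>i<r. \<forall>j<r. X i j \<in> x i j) \<and>
     (\<lambda>k. mat_pnorm r p (\<lambda>i j. X i j k)) \<longlonglongrightarrow> N)"

definition lp_linear :: "'n::{finite,linorder} rmat \<Rightarrow> real \<Rightarrow> ('n lp \<Rightarrow> 'n lp) \<Rightarrow> bool" where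
  "lp_linear \<theta> p T \<longleftrightarrow>
     (\<forall>x\<in>lp_space \<theta> p. \<forall>y\<in>lp_space \<theta> p. T (lp_add \<theta> p x y) = lp_add \<theta> p (T x) (T y)) \<and>
     (\<forall>c. \<forall>x\<in>lp_space \<theta> p. T (lp_scale \<theta> p c x) = lp_scale \<theta> p c (T x))"

definition ampl_norm ::
    "'n::{finite,linorder} rmat \<Rightarrow> real \<Rightarrow> nat \<Rightarrow> ('n lp \<Rightarrow> 'n lp) \<Rightarrow> ereal" where
  "ampl_norm \<theta> p r T =
     (SUP x\<in>{x \<in> lp_mat_space \<theta> p r. lp_mat_norm p r x \<le> 1}.
        ereal (lp_mat_norm p r (\<lambda>i j. T (x i j))))"

definition cb_norm ::
    "'n::{finite,linorder} rmat \<Rightarrow> real \<Rightarrow> ('n lp \<Rightarrow> 'n lp) \<Rightarrow> ereal" where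
  "cb_norm \<theta> p T = (SUP r\<in>{1..}. ampl_norm \<theta> p r T)"

text \<open>
  Operators on \<open>L\<^sup>p\<close> are extensional functions, so that equality of operators is equality on
  \<open>L\<^sup>p\<close>.
\<close>

definition cb_extension ::
    "'n::{finite,linorder} rmat \<Rightarrow> real \<Rightarrow> ('n ivec op \<Rightarrow> 'n ivec op)
       \<Rightarrow> ('n lp \<Rightarrow> 'n lp) \<Rightarrow> bool" where
  "cb_extension \<theta> p S T \<longleftrightarrow>
     T \<in> lp_space \<theta> p \<rightarrow>\<^sub>E lp_space \<theta> p \<and> lp_linear \<theta> p T \<and> cb_norm \<theta> p T < \<infinity> \<and>
     (\<forall>a\<in>smooth_torus \<theta>. T (lp_embed \<theta> p a) = lp_embed \<theta> p (S a))"

end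

theory Submission
  imports Defs "HOL-Real_Asymp.Real_Asymp"
begin

text \<open>
  Continuous functions of a positive operator are obtained from Bernstein polynomials. Splitting
  each Bernstein polynomial into squares and using Cauchy--Schwarz for the trace yields
  \<open>\<bar>\<tau>(u f(a) v g(c))\<bar> \<le> \<tau>(F(a)) + \<tau>(G(c))\<close> for contractions \<open>u, v\<close> and positive \<open>a, c\<close> whenever
  \<open>\<bar>f(s) g(t)\<bar> \<le> F(s) + G(t)\<close>. With Young's inequality and a regularised polar decomposition this
  makes \<open>\<tau>(\<bar>x\<bar>\<^sup>p)\<close> convex, hence the \<open>L\<^sup>p\<close> norm satisfies Minkowski's inequality; the trace property
  holds on the commutant of the right translations, which contains the noncommutative torus.

  The dual action of the torus is by \<open>L\<^sup>p\<close> isometries, so every character of \<open>\<int>\<^sup>n\<close> is a completely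
  bounded multiplier of norm at most 1 and a trigonometric sum has at most the \<open>\<ell>\<^sup>1\<close> norm of its
  coefficients. Gaussian symbols are limits of \<open>cos\<^sup>N\<close>, and the symbols of first-order derivatives of
  the heat semigroup are limits of rescaled \<open>i sin cos\<^sup>N\<^sup>-\<^sup>1\<close>, whose coefficients have \<open>\<ell>\<^sup>1\<close> norm of
  order \<open>N\<^sup>-\<^sup>1\<^sup>/\<^sup>2\<close>. This gives a bound independent of \<open>\<theta>\<close> and \<open>p\<close>. The lower bound is already
  visible on a single monomial \<open>U\<^sup>m\<close>.
\<close>

text \<open>The norms are defined through limits of polynomials of an operator, so the analysis
  rests on one fact: a polynomial that is nonnegative on \<open>[0, norm A]\<close> is positive at a
  positive \<open>A\<close>. No spectral measure is formed. Square roots of Bernstein basis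
  polynomials give an operator partition of unity that takes its place, and the Hilbert-Schmidt
  numbers attached to a pair of nodes act like a coupling of two spectral distributions: their row
  and column sums are controlled, so a scalar inequality in two variables can be summed against
  them.

  Complete boundedness asks for one bound for all matrix sizes. The torus and its matrices are
  therefore instances of one locale, and a multiplier bound is from the start a statement about all
  r, p and \<theta>.

  The constants do not see p because characters act isometrically for every p at once, so an average
  of characters costs only the total mass of its weights. The rate t^(-1/2) per derivative is the
  mean displacement of a simple random walk after rescaling. Higher derivatives are reached by
  distributing the heat semigroup over several factors, one first-order derivative each.\<close>

section \<open>Hilbert space preliminaries\<close>

lemma cinner_abs_summable: "(\<lambda>i. norm (cnj (coord x i) * coord y i)) summable_on UNIV"
proof -
  have sq: "(\<lambda>i. (cmod (coord z i))\<^sup>2) summable_on UNIV" for z :: "'a ell2"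
    using coord[of z] by (simp add: sq_summable_def)
  have "(\<lambda>i. ((cmod (coord x i))\<^sup>2 + (cmod (coord y i))\<^sup>2)) summable_on UNIV"
    by (intro summable_on_add sq)
  then show ?thesis
  proof (rule summable_on_comparison_test)
    fix i
    have "0 \<le> (cmod (coord x i) - cmod (coord y i))\<^sup>2" by simp
    moreover have "0 \<le> cmod (coord x i) * cmod (coord y i)" by simp
    ultimately have "cmod (coord x i) * cmod (coord y i) \<le> (cmod (coord x i))\<^sup>2 + (cmod (coord y i))\<^sup>2"
      unfolding power2_diff by linarith
    then show "norm (cnj (coord x i) * coord y i) \<le> (cmod (coord x i))\<^sup>2 + (cmod (coord y i))\<^sup>2"
      by (simp add: norm_mult)
  qed auto
qed

lemma cinner_summable: "(\<lambda>i. cnj (coord x i) * coord y i) summable_on UNIV"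
  using cinner_abs_summable by (rule Infinite_Sum.abs_summable_summable)

lemma cinner_add_left: "cinner (x + y) z = cinner x z + cinner y z"
  by (simp add: cinner_def distrib_right infsum_add[OF cinner_summable cinner_summable])

lemma cinner_add_right: "cinner z (x + y) = cinner z x + cinner z y"
  by (simp add: cinner_def distrib_left infsum_add[OF cinner_summable cinner_summable])

lemma cinner_scaleC_right: "cinner x (scaleC_ell2 c y) = c * cinner x y"
  by (simp add: cinner_def scaleC_ell2.rep_eq mult.left_commute[of _ c] infsum_cmult_right')

lemma cinner_commute: "cinner x y = cnj (cinner y x)"
  by (simp add: cinner_def flip: infsum_cnj) (simp add: mult.commute)

lemma cinner_scaleC_left: "cinner (scaleC_ell2 c x) y = cnj c * cinner x y"
  by (metis cinner_commute cinner_scaleC_right complex_cnj_mult)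

lemma scaleR_ell2_conv: "c *\<^sub>R x = scaleC_ell2 (complex_of_real c) x"
  by (rule ell2_eqI) (simp add: scaleC_ell2.rep_eq)

lemma cinner_scaleR_left: "cinner (c *\<^sub>R x) y = c *\<^sub>R cinner x y"
  by (simp add: scaleR_ell2_conv cinner_scaleC_left scaleR_conv_of_real)

lemma cinner_scaleR_right: "cinner x (c *\<^sub>R y) = c *\<^sub>R cinner x y"
  by (simp add: scaleR_ell2_conv cinner_scaleC_right scaleR_conv_of_real)

lemma cinner_self: "cinner x x = complex_of_real ((norm x)\<^sup>2)"
proof -
  have "(norm x)\<^sup>2 = (\<Sum>\<^sub>\<infinity>i. (cmod (coord x i))\<^sup>2)"
    by (simp add: norm_ell2.rep_eq infsum_nonneg)
  moreover have "(\<lambda>i. (cmod (coord x i))\<^sup>2) summable_on UNIV"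
    using coord[of x] by (simp add: sq_summable_def)
  ultimately have "((\<lambda>i. (cmod (coord x i))\<^sup>2) has_sum (norm x)\<^sup>2) UNIV"
    by simp
  then have "((\<lambda>i. complex_of_real ((cmod (coord x i))\<^sup>2)) has_sum complex_of_real ((norm x)\<^sup>2)) UNIV"
    by (simp only: has_sum_of_real_iff)
  then have "complex_of_real ((norm x)\<^sup>2) = (\<Sum>\<^sub>\<infinity>i. complex_of_real ((cmod (coord x i))\<^sup>2))"
    using infsumI by force
  also have "\<dots> = cinner x x"
    unfolding cinner_def complex_norm_square by (simp add: mult.commute)
  finally show ?thesis by simp
qed

lemma norm_scaleC_ell2: "norm (scaleC_ell2 c x) = cmod c * norm x"
proof -
  have "complex_of_real ((norm (scaleC_ell2 c x))\<^sup>2) = complex_of_real ((cmod c * norm x)\<^sup>2)"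
    unfolding cinner_self[symmetric] cinner_scaleC_left cinner_scaleC_right
    by (simp add: cinner_self power_mult_distrib complex_norm_square flip: of_real_power)
  then show ?thesis
    using of_real_eq_iff power2_eq_imp_eq by (metis mult_nonneg_nonneg norm_ge_zero)
qed

lemma Re_cinner_le: "Re (cinner x y) \<le> norm x * norm y"
proof (cases "x = 0 \<or> y = 0")
  case True
  then show ?thesis
    by (auto simp: cinner_def)
next
  case False
  define u where "u = x /\<^sub>R norm x"
  define v where "v = y /\<^sub>R norm y"
  \<comment> \<open>For unit vectors, expanding the square of the distance already gives the bound 1
    on the real part.\<close>
  have "0 \<le> Re (cinner (u - v) (u - v))"
    by (simp add: cinner_self)
  moreover have "u - v = u + (-1) *\<^sub>R v" by simp
  ultimately have "0 \<le> Re (cinner u u) + Re (cinner v v) - Re (cinner u v) - Re (cinner v u)"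
    by (simp only: cinner_add_left cinner_add_right cinner_scaleR_left cinner_scaleR_right) simp
  moreover have "Re (cinner v u) = Re (cinner u v)"
    by (subst cinner_commute) simp
  moreover have "norm u = 1" "norm v = 1" using False by (auto simp: u_def v_def)
  ultimately have "Re (cinner u v) \<le> 1" by (simp add: cinner_self)
  then show ?thesis using False
    by (simp add: u_def v_def cinner_scaleR_left cinner_scaleR_right field_simps)
qed

text \<open>Rotating \<open>y\<close> by a unimodular scalar turns the inner product into its
  modulus, so the bound on real parts suffices.\<close>

lemma norm_cinner_le: "cmod (cinner x y) \<le> norm x * norm y"
proof (cases "cinner x y = 0")
  case False
  define c where "c = cnj (cinner x y) / cmod (cinner x y)"
  have c: "cmod c = 1" using False by (simp add: c_def norm_divide)
  have "Re (cinner x (scaleC_ell2 c y)) \<le> norm x * norm (scaleC_ell2 c y)"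
    by (rule Re_cinner_le)
  moreover have "cinner x (scaleC_ell2 c y) = cmod (cinner x y)"
    using False unfolding cinner_scaleC_right c_def
    by (simp add: complex_norm_square[symmetric] mult.commute power2_eq_square field_simps)
  ultimately show ?thesis by (simp add: norm_scaleC_ell2 c)
qed simp

lemma bounded_bilinear_cinner: "bounded_bilinear cinner"
  by standard (auto simp: cinner_add_left cinner_add_right cinner_scaleR_left cinner_scaleR_right
      intro!: exI[of _ 1] norm_cinner_le)

interpretation cinner: bounded_bilinear cinner
  by (rule bounded_bilinear_cinner)

lemma cinner_cancel_right: "(\<And>x. cinner x y = cinner x z) \<Longrightarrow> y = z"
  by (rule ell2_eqI) (simp flip: cinner_ket)

lemma norm_ket [simp]: "norm (ket i) = 1"
proof -
  have "complex_of_real ((norm (ket i))\<^sup>2) = 1"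
    unfolding cinner_self[symmetric] cinner_ket by (simp add: coord_ket)
  then have "(norm (ket i))\<^sup>2 = 1" using of_real_eq_1_iff by blast
  then show ?thesis by (simp add: power2_eq_1_iff) (metis norm_ge_zero not_one_le_zero neg_0_le_iff_le)
qed

text \<open>Functions of an operator arise as limits of Cauchy sequences in the operator norm, and
  completeness of that norm is inherited from the target space.\<close>

instance ell2 :: (type) banach
proof
  fix X :: "nat \<Rightarrow> 'a ell2"
  assume X: "Cauchy X"
  have "Cauchy (\<lambda>n. coord (X n) i)" for i
    by (rule bounded_linear.Cauchy[OF bounded_linear_coord X])
  then have "\<exists>z. (\<lambda>n. coord (X n) i) \<longlonglongrightarrow> z" for i
    using Cauchy_convergent convergent_def by blast
  then obtain z where z: "\<And>i. (\<lambda>n. coord (X n) i) \<longlonglongrightarrow> z i" by metis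
  have fin: "(\<Sum>i\<in>F. (cmod (coord y i))\<^sup>2) \<le> (norm y)\<^sup>2" if "finite F" for F and y :: "'a ell2"
    using sq_summable_sum_le[OF coord[of y, simplified] that]
    by (simp add: norm_ell2.rep_eq infsum_nonneg)
  have tail: "\<exists>N. \<forall>n\<ge>N. \<forall>F. finite F \<longrightarrow> (\<Sum>i\<in>F. (cmod (coord (X n) i - z i))\<^sup>2) \<le> e\<^sup>2" if e: "e > 0" for e
  proof -
    obtain N where N: "\<And>m n. m \<ge> N \<Longrightarrow> n \<ge> N \<Longrightarrow> norm (X m - X n) < e"
      using X e unfolding Cauchy_def dist_norm by meson
    have "(\<Sum>i\<in>F. (cmod (coord (X n) i - z i))\<^sup>2) \<le> e\<^sup>2" if "n \<ge> N" "finite F" for n F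
    \<comment> \<open>For a fixed finite \<open>F\<close> the bound survives the coordinatewise
      limit in \<open>m\<close>. Since \<open>N\<close> does not depend on \<open>F\<close>, it then
      controls the whole series.\<close>
    proof (rule tendsto_upperbound)
      show "(\<lambda>m. \<Sum>i\<in>F. (cmod (coord (X n) i - coord (X m) i))\<^sup>2)
          \<longlonglongrightarrow> (\<Sum>i\<in>F. (cmod (coord (X n) i - z i))\<^sup>2)"
        by (intro tendsto_intros z)
      have "(\<Sum>i\<in>F. (cmod (coord (X n) i - coord (X m) i))\<^sup>2) \<le> e\<^sup>2" if "m \<ge> N" for m
      proof -
        have "(\<Sum>i\<in>F. (cmod (coord (X n) i - coord (X m) i))\<^sup>2) \<le> (norm (X n - X m))\<^sup>2"
          using fin[OF \<open>finite F\<close>, of "X n - X m"] by simp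
        also have "\<dots> \<le> e\<^sup>2" using N[OF \<open>n \<ge> N\<close> that] by (intro power_mono) auto
        finally show ?thesis .
      qed
      then show "\<forall>\<^sub>F m in sequentially. (\<Sum>i\<in>F. (cmod (coord (X n) i - coord (X m) i))\<^sup>2) \<le> e\<^sup>2"
        by (auto simp: eventually_sequentially)
    qed simp
    then show ?thesis by blast
  qed
  obtain N where N: "\<And>F. finite F \<Longrightarrow> (\<Sum>i\<in>F. (cmod (coord (X N) i - z i))\<^sup>2) \<le> 1\<^sup>2"
    using tail[of 1] by auto
  have d: "sq_summable (\<lambda>i. coord (X N) i - z i)"
    by (rule sq_summableI[where B = "1\<^sup>2"]) (rule N)
  have "sq_summable (\<lambda>i. coord (X N) i + (-1) * (coord (X N) i - z i))"
    using coord[of "X N"] by (intro sq_summable_add sq_summable_scale d) simp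
  then have "sq_summable z" by simp
  define Z where "Z = Abs_ell2 z"
  have cZ: "coord Z = z" using \<open>sq_summable z\<close> by (simp add: Z_def Abs_ell2_inverse)
  have "X \<longlonglongrightarrow> Z"
  proof (rule LIMSEQ_I)
    fix r :: real assume "r > 0"
    obtain N where N: "\<And>n F. n \<ge> N \<Longrightarrow> finite F \<Longrightarrow> (\<Sum>i\<in>F. (cmod (coord (X n) i - z i))\<^sup>2) \<le> (r/2)\<^sup>2"
      using tail[of "r/2"] \<open>r > 0\<close> by auto
    have "norm (X n - Z) < r" if "n \<ge> N" for n
    proof -
      have "(\<Sum>\<^sub>\<infinity>i. (cmod (coord (X n - Z) i))\<^sup>2) \<le> (r/2)\<^sup>2"
        using coord[of "X n - Z"] N[OF that]
        by (intro infsum_le_finite_sums) (auto simp: cZ sq_summable_def)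
      then have "norm (X n - Z) \<le> r/2"
        using \<open>r > 0\<close> unfolding norm_ell2.rep_eq by (intro real_le_lsqrt) (auto intro!: infsum_nonneg)
      then show ?thesis using \<open>r > 0\<close> by linarith
    qed
    then show "\<exists>N. \<forall>n\<ge>N. norm (X n - Z) < r" by blast
  qed
  then show "convergent X" by (auto simp: convergent_def)
qed

lemma blinfun_compose_assoc: "(A o\<^sub>L B) o\<^sub>L C = A o\<^sub>L (B o\<^sub>L C)"
  by (rule blinfun_eqI) simp

lemma blinfun_compose_id [simp]: "A o\<^sub>L id_blinfun = A" "id_blinfun o\<^sub>L A = A"
  by (auto intro: blinfun_eqI)

subsection \<open>Adjoints and positivity\<close>

text \<open>A relation rather than the function \<open>adj\<close>: the operator type also contains
  merely real-linear maps, such as coordinatewise conjugation, which have no adjoint for the complex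
  inner product. The relation also covers operators between different index sets.\<close>

definition is_adj :: "('i ell2 \<Rightarrow>\<^sub>L 'j ell2) \<Rightarrow> ('j ell2 \<Rightarrow>\<^sub>L 'i ell2) \<Rightarrow> bool" where
  "is_adj A B \<longleftrightarrow> (\<forall>x y. cinner (blinfun_apply A x) y = cinner x (blinfun_apply B y))"

lemma is_adjD: "is_adj A B \<Longrightarrow> cinner (blinfun_apply A x) y = cinner x (blinfun_apply B y)"
  by (simp add: is_adj_def)

lemma is_adj_adj: "is_adj A B \<Longrightarrow> adj A = B"
  by (rule adj_eqI) (simp add: is_adj_def)

lemma is_adj_sym: "is_adj A B \<Longrightarrow> is_adj B A"
  unfolding is_adj_def by (metis cinner_commute)

lemma is_adj_compose: "is_adj A B \<Longrightarrow> is_adj C D \<Longrightarrow> is_adj (A o\<^sub>L C) (D o\<^sub>L B)"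
  by (simp add: is_adj_def)

lemma is_adj_add: "is_adj A B \<Longrightarrow> is_adj C D \<Longrightarrow> is_adj (A + C) (B + D)"
  by (simp add: is_adj_def blinfun.bilinear_simps cinner_add_left cinner_add_right)

lemma is_adj_scaleR: "is_adj A B \<Longrightarrow> is_adj (c *\<^sub>R A) (c *\<^sub>R B)"
  by (simp add: is_adj_def blinfun.bilinear_simps cinner_scaleR_left cinner_scaleR_right)

lemma is_adj_diff: "is_adj A B \<Longrightarrow> is_adj C D \<Longrightarrow> is_adj (A - C) (B - D)"
  using is_adj_add[OF _ is_adj_scaleR[of C D "-1"], of A B] by simp

lemma is_adj_id [simp]: "is_adj id_blinfun id_blinfun"
  by (simp add: is_adj_def)

lemma is_adj_0 [simp]: "is_adj 0 0"
  by (simp add: is_adj_def cinner.zero_left cinner.zero_right)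

lemma is_adj_sum: "(\<And>i. i \<in> F \<Longrightarrow> is_adj (A i) (B i)) \<Longrightarrow> is_adj (\<Sum>i\<in>F. A i) (\<Sum>i\<in>F. B i)"
  by (induction F rule: infinite_finite_induct) (auto intro: is_adj_add)

lemma is_adj_scalar_op: "is_adj (scalar_op c) (scalar_op (cnj c))"
  by (simp add: is_adj_def scalar_op.rep_eq cinner_scaleC_left cinner_scaleC_right)

lemma is_adj_norm_le: assumes "is_adj A B" shows "norm B \<le> norm A"
proof (rule norm_blinfun_bound)
  fix x
  let ?y = "blinfun_apply B x"
  have "complex_of_real ((norm ?y)\<^sup>2) = cinner (blinfun_apply A ?y) x"
    unfolding cinner_self[symmetric] by (simp add: is_adjD[OF assms])
  then have "(norm ?y)\<^sup>2 = cmod (cinner (blinfun_apply A ?y) x)"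
    by (metis abs_of_nonneg norm_of_real zero_le_power2)
  also have "\<dots> \<le> norm (blinfun_apply A ?y) * norm x" by (rule norm_cinner_le)
  also have "\<dots> \<le> norm A * norm ?y * norm x"
    by (intro mult_right_mono norm_blinfun) auto
  finally have "norm ?y * norm ?y \<le> norm ?y * (norm A * norm x)"
    by (simp add: power2_eq_square mult_ac)
  then show "norm ?y \<le> norm A * norm x"
    by (cases "norm ?y = 0") (auto simp: mult_le_cancel_left)
qed auto

lemma is_adj_norm: "is_adj A B \<Longrightarrow> norm B = norm A"
  by (meson antisym is_adj_norm_le is_adj_sym)

text \<open>The C*-identity. It makes the absolute value have the same norm as the operator and
  bounds the norm of a polar part by that of a function of the absolute value.\<close>

lemma is_adj_norm_square:
  assumes "is_adj A B" shows "norm (B o\<^sub>L A) = (norm A)\<^sup>2"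
proof (rule antisym)
  show "norm (B o\<^sub>L A) \<le> (norm A)\<^sup>2"
    using norm_blinfun_compose[of B A] is_adj_norm[OF assms] by (simp add: power2_eq_square)
  have "norm A \<le> sqrt (norm (B o\<^sub>L A))"
  proof (rule norm_blinfun_bound)
    fix x
    have "complex_of_real ((norm (blinfun_apply A x))\<^sup>2) = cinner x (blinfun_apply (B o\<^sub>L A) x)"
      unfolding cinner_self[symmetric] by (simp add: is_adjD[OF assms])
    then have "(norm (blinfun_apply A x))\<^sup>2 = cmod (cinner x (blinfun_apply (B o\<^sub>L A) x))"
      by (metis abs_of_nonneg norm_of_real zero_le_power2)
    also have "\<dots> \<le> norm x * (norm (B o\<^sub>L A) * norm x)"
      by (intro order.trans[OF norm_cinner_le] mult_left_mono norm_blinfun) auto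
    also have "\<dots> = (sqrt (norm (B o\<^sub>L A)) * norm x)\<^sup>2"
      by (simp add: power_mult_distrib power2_eq_square)
    finally show "norm (blinfun_apply A x) \<le> sqrt (norm (B o\<^sub>L A)) * norm x"
      by (rule power2_le_imp_le) auto
  qed auto
  then have "(norm A)\<^sup>2 \<le> (sqrt (norm (B o\<^sub>L A)))\<^sup>2" by (intro power_mono) auto
  then show "(norm A)\<^sup>2 \<le> norm (B o\<^sub>L A)" by simp
qed

lemma is_adj_tendsto:
  assumes "F \<noteq> bot" "(A \<longlongrightarrow> a) F" "(B \<longlongrightarrow> b) F" "\<forall>\<^sub>F i in F. is_adj (A i) (B i)"
  shows "is_adj a b"
  unfolding is_adj_def
proof (intro allI)
  fix x y
  have 1: "((\<lambda>i. cinner (blinfun_apply (A i) x) y) \<longlongrightarrow> cinner (blinfun_apply a x) y) F"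
    by (intro cinner.tendsto tendsto_intros blinfun.tendsto assms)
  have 2: "((\<lambda>i. cinner x (blinfun_apply (B i) y)) \<longlongrightarrow> cinner x (blinfun_apply b y)) F"
    by (intro cinner.tendsto tendsto_intros blinfun.tendsto assms)
  have "\<forall>\<^sub>F i in F. cinner (blinfun_apply (A i) x) y = cinner x (blinfun_apply (B i) y)"
    using assms(4) by eventually_elim (rule is_adjD)
  from tendsto_cong[OF this] 1 2 show "cinner (blinfun_apply a x) y = cinner x (blinfun_apply b y)"
    using tendsto_unique[OF assms(1)] by blast
qed

text \<open>Taking adjoints is isometric, so the adjoints of a convergent sequence are Cauchy. This
  makes the adjointable operators a closed set.\<close>

lemma adjoint_lim_exists:
  fixes A :: "nat \<Rightarrow> 'i ell2 \<Rightarrow>\<^sub>L 'j ell2"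
  assumes "A \<longlonglongrightarrow> a" "\<And>n. is_adj (A n) (B n)"
  shows "\<exists>b. B \<longlonglongrightarrow> b \<and> is_adj a b"
proof -
  have "Cauchy A" using assms(1) by (rule LIMSEQ_imp_Cauchy)
  moreover have "norm (B m - B n) = norm (A m - A n)" for m n
    by (intro is_adj_norm is_adj_diff assms)
  ultimately have "Cauchy B" by (simp add: Cauchy_def dist_norm)
  then obtain b where "B \<longlonglongrightarrow> b" using Cauchy_convergent convergent_def by blast
  with is_adj_tendsto[OF _ assms(1)] assms(2) show ?thesis by auto
qed

text \<open>Self-adjointness is a separate condition because only the real part of the quadratic
  form is tested, which vanishes for skew-adjoint operators.\<close>

definition posop :: "'i op \<Rightarrow> bool" where
  "posop A \<longleftrightarrow> is_adj A A \<and> (\<forall>x. 0 \<le> Re (cinner x (blinfun_apply A x)))"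

lemma posop_add: "posop A \<Longrightarrow> posop B \<Longrightarrow> posop (A + B)"
  by (auto simp: posop_def is_adj_add blinfun.bilinear_simps cinner_add_right)

lemma posop_scaleR: "posop A \<Longrightarrow> 0 \<le> c \<Longrightarrow> posop (c *\<^sub>R A)"
  by (auto simp: posop_def is_adj_scaleR blinfun.bilinear_simps cinner_scaleR_right)

lemma posop_0 [simp]: "posop 0"
  by (simp add: posop_def cinner.zero_right)

lemma posop_id [simp]: "posop id_blinfun"
  by (simp add: posop_def cinner_self)

lemma posop_sum: "(\<And>i. i \<in> F \<Longrightarrow> posop (A i)) \<Longrightarrow> posop (\<Sum>i\<in>F. A i)"
  by (induction F rule: infinite_finite_induct) (auto intro: posop_add)

lemma posop_conj:
  assumes "posop A" "is_adj C D" shows "posop (D o\<^sub>L A o\<^sub>L C)"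
  using assms is_adj_compose[OF is_adj_compose[OF is_adj_sym[OF assms(2)], of A A] assms(2)]
  by (auto simp: posop_def is_adjD[OF assms(2), symmetric] blinfun_compose_assoc)

lemma posop_square: "is_adj C D \<Longrightarrow> posop (D o\<^sub>L C)"
  using posop_conj[of id_blinfun C D] by (simp add: blinfun_compose_id)

lemma posop_tendsto:
  assumes "F \<noteq> bot" "(A \<longlongrightarrow> a) F" "\<forall>\<^sub>F i in F. posop (A i)"
  shows "posop a"
  unfolding posop_def
proof (intro conjI allI)
  show "is_adj a a"
    by (rule is_adj_tendsto[OF assms(1,2,2)]) (use assms(3) in \<open>auto simp: posop_def elim: eventually_mono\<close>)
  fix x
  show "0 \<le> Re (cinner x (blinfun_apply a x))"
  proof (rule tendsto_lowerbound[OF _ _ assms(1)])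
    show "((\<lambda>i. Re (cinner x (blinfun_apply (A i) x))) \<longlongrightarrow> Re (cinner x (blinfun_apply a x))) F"
      by (intro tendsto_intros cinner.tendsto blinfun.tendsto assms)
    show "\<forall>\<^sub>F i in F. 0 \<le> Re (cinner x (blinfun_apply (A i) x))"
      using assms(3) by (auto simp: posop_def elim: eventually_mono)
  qed
qed

lemma posop_one_minus:
  assumes "posop A" "norm A \<le> 1" shows "posop (id_blinfun - A)"
  unfolding posop_def
proof (intro conjI allI)
  show "is_adj (id_blinfun - A) (id_blinfun - A)"
    using assms by (intro is_adj_diff) (auto simp: posop_def)
  fix x
  have "Re (cinner x (blinfun_apply A x)) \<le> norm x * (norm A * norm x)"
    by (intro order.trans[OF Re_cinner_le] mult_left_mono norm_blinfun) auto
  also have "\<dots> \<le> norm x * (1 * norm x)"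
    using assms by (intro mult_left_mono mult_right_mono) auto
  finally show "0 \<le> Re (cinner x (blinfun_apply (id_blinfun - A) x))"
    by (simp add: blinfun.bilinear_simps cinner.diff_right cinner_self power2_eq_square)
qed

section \<open>Polynomials of an operator\<close>

interpretation op_comp: bounded_bilinear "(o\<^sub>L)"
  by (rule bounded_bilinear_blinfun_compose)

lemma op_power_0 [simp]: "op_power A 0 = id_blinfun"
  and op_power_Suc [simp]: "op_power A (Suc k) = A o\<^sub>L op_power A k"
  by (simp_all add: op_power_def)

lemma poly_op_alt: "degree q \<le> n \<Longrightarrow> poly_op q A = (\<Sum>i\<le>n. coeff q i *\<^sub>R op_power A i)"
  unfolding poly_op_def by (rule sum.mono_neutral_left) (auto simp: coeff_eq_0)

lemma poly_op_0 [simp]: "poly_op 0 A = 0"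
  by (simp add: poly_op_def)

lemma poly_op_add: "poly_op (p + q) A = poly_op p A + poly_op q A"
  using poly_op_alt[of p "max (degree p) (degree q)" A] poly_op_alt[of q "max (degree p) (degree q)" A]
    poly_op_alt[of "p + q" "max (degree p) (degree q)" A] degree_add_le_max[of p q]
  by (simp add: scaleR_left_distrib sum.distrib)

lemma poly_op_smult: "poly_op (smult c q) A = c *\<^sub>R poly_op q A"
  using poly_op_alt[of "smult c q" "degree q" A]
  by (simp add: poly_op_def scaleR_right.sum)

lemma poly_op_diff: "poly_op (p - q) A = poly_op p A - poly_op q A"
  using poly_op_add[of p "smult (-1) q" A] poly_op_smult[of "-1" q A] by simp

lemma poly_op_sum: "poly_op (\<Sum>i\<in>F. q i) A = (\<Sum>i\<in>F. poly_op (q i) A)"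
  by (induction F rule: infinite_finite_induct) (auto simp: poly_op_add)

lemma poly_op_pCons: "poly_op (pCons c q) A = c *\<^sub>R id_blinfun + (A o\<^sub>L poly_op q A)"
proof -
  have "poly_op (pCons c q) A = (\<Sum>i\<le>Suc (degree q). coeff (pCons c q) i *\<^sub>R op_power A i)"
    by (rule poly_op_alt) (rule degree_pCons_le)
  also have "\<dots> = c *\<^sub>R id_blinfun + (A o\<^sub>L poly_op q A)"
    by (simp only: sum.atMost_Suc_shift) (simp add: poly_op_def op_comp.sum_right op_comp.scaleR_right)
  finally show ?thesis .
qed

lemma poly_op_const [simp]: "poly_op [:c:] A = c *\<^sub>R id_blinfun"
  by (simp add: poly_op_pCons op_comp.zero_right)

lemma poly_op_1 [simp]: "poly_op 1 A = id_blinfun"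
  using poly_op_const[of 1 A] by (simp add: one_pCons)

lemma poly_op_mult: "poly_op (p * q) A = poly_op p A o\<^sub>L poly_op q A"
  by (induction p)
    (auto simp: poly_op_pCons poly_op_add poly_op_smult op_comp.add_left op_comp.scaleR_left
      op_comp.zero_left blinfun_compose_assoc)

lemma poly_op_X [simp]: "poly_op [:0, 1:] A = A"
  by (simp add: poly_op_pCons op_comp.zero_right)

lemma poly_op_pcompose: "poly_op (pcompose p q) A = poly_op p (poly_op q A)"
  by (induction p) (auto simp: poly_op_pCons poly_op_add poly_op_mult pcompose_pCons)

lemma poly_op_commute: "poly_op p A o\<^sub>L poly_op q A = poly_op q A o\<^sub>L poly_op p A"
  by (simp add: mult.commute flip: poly_op_mult)

lemma poly_op_herm: "is_adj A A \<Longrightarrow> is_adj (poly_op q A) (poly_op q A)"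
proof (induction q)
  case (pCons c q)
  have "is_adj (A o\<^sub>L poly_op q A) (poly_op q A o\<^sub>L A)"
    using pCons by (intro is_adj_compose) auto
  moreover have "poly_op q A o\<^sub>L A = A o\<^sub>L poly_op q A"
    using poly_op_commute[of q A "[:0,1:]"] by simp
  ultimately show ?case
    unfolding poly_op_pCons by (intro is_adj_add is_adj_scaleR) (simp_all only: is_adj_id)
qed auto

lemma poly_op_mem:
  assumes "id_blinfun \<in> S" "A \<in> S" "\<And>B C. B \<in> S \<Longrightarrow> C \<in> S \<Longrightarrow> B + C \<in> S"
    "\<And>B C. B \<in> S \<Longrightarrow> C \<in> S \<Longrightarrow> B o\<^sub>L C \<in> S" "\<And>c B. B \<in> S \<Longrightarrow> c *\<^sub>R B \<in> S"
  shows "poly_op q A \<in> S"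
proof (induction q)
  case 0
  show ?case using assms(5)[OF assms(1), of 0] by simp
qed (auto simp: poly_op_pCons intro!: assms)

lemma poly_op_zero_coeff:
  assumes "coeff q 0 = 0"
  obtains r where "q = pCons 0 r"
  using assms by (cases q) auto

text \<open>\<open>\<Phi>\<close> may be the embedding of a matrix corner, which does not preserve
  the identity. Hence the constant coefficient must vanish.\<close>

lemma poly_op_hom:
  assumes lin: "linear \<Phi>" and mult: "\<And>B C. \<Phi> (B o\<^sub>L C) = \<Phi> B o\<^sub>L \<Phi> C"
    and q0: "coeff q 0 = 0"
  shows "poly_op q (\<Phi> A) = \<Phi> (poly_op q A)"
proof -
  obtain r where q: "q = pCons 0 r" using q0 by (rule poly_op_zero_coeff)
  have "\<Phi> A o\<^sub>L poly_op r (\<Phi> A) = \<Phi> (A o\<^sub>L poly_op r A)"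
  proof (induction r)
    case 0
    then show ?case by (simp add: linear_0[OF lin] op_comp.zero_right)
  next
    case (pCons c r)
    then show ?case
      by (simp add: poly_op_pCons op_comp.add_right op_comp.scaleR_right linear_add[OF lin]
          linear_scale[OF lin] mult)
  qed
  then show ?thesis by (simp add: q poly_op_pCons)
qed

lemma smult_sum_right: "smult c (\<Sum>i\<in>F. q i) = (\<Sum>i\<in>F. smult c (q i :: real poly))"
  by (induction F rule: infinite_finite_induct) (auto simp: smult_add_right)

subsection \<open>Positivity of polynomials of a positive operator\<close>

abbreviation (input) X_poly :: "real poly" where "X_poly \<equiv> [:0, 1:]"
abbreviation (input) Y_poly :: "real poly" where "Y_poly \<equiv> [:1, -1:]"

lemma posop_poly_square_mult:
  assumes "is_adj A A" "posop (poly_op p A)"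
  shows "posop (poly_op (r * r * p) A)"
proof -
  have "posop (poly_op r A o\<^sub>L poly_op p A o\<^sub>L poly_op r A)"
    by (rule posop_conj[OF assms(2) poly_op_herm[OF assms(1)]])
  moreover have "r * r * p = r * p * r" by simp
  ultimately show ?thesis by (simp only: poly_op_mult)
qed

text \<open>Even powers split off as a square \<open>r * r\<close>, which preserves positivity. What
  remains is one of 1, X, Y and XY, with Y = 1 - X.\<close>

lemma posop_bernstein_monomial:
  assumes A: "posop A" "norm A \<le> 1"
  shows "posop (poly_op ([:0, 1:] ^ k * [:1, -1:] ^ l) A)"
proof -
  have h: "is_adj A A" using A by (simp add: posop_def)
  have X: "posop (poly_op X_poly A)" using A by simp
  have Y: "posop (poly_op Y_poly A)"
    using posop_one_minus[OF A] by (simp add: poly_op_pCons op_comp.minus_right op_comp.zero_right)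
  have XY: "posop (poly_op (X_poly * Y_poly) A)"
  proof -
    \<comment> \<open>This is XY(X + Y), as X + Y = 1; each summand is a square times a positive
      factor, so a product of two positive operators need not be treated directly.\<close>
    have "X_poly * Y_poly = Y_poly * Y_poly * X_poly + X_poly * X_poly * Y_poly"
      by simp
    then have "poly_op (X_poly * Y_poly) A
        = poly_op (Y_poly * Y_poly * X_poly) A + poly_op (X_poly * X_poly * Y_poly) A"
      by (simp only: poly_op_add)
    then show ?thesis
      using posop_add[OF posop_poly_square_mult[OF h X] posop_poly_square_mult[OF h Y]] by metis
  qed
  define r where "r = X_poly ^ (k div 2) * Y_poly ^ (l div 2)"
  define s where "s = X_poly ^ (k mod 2) * Y_poly ^ (l mod 2)"
  have split: "x ^ n = x ^ (n div 2) * x ^ (n div 2) * x ^ (n mod 2)" for x :: "real poly" and n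
    by (metis div_mult_mod_eq mult_2_right power_add)
  have "X_poly ^ k * Y_poly ^ l = r * r * s"
    unfolding r_def s_def by (subst split[of _ k], subst split[of _ l]) (simp only: mult_ac)
  moreover have "posop (poly_op s A)"
    unfolding s_def
    by (cases "even k"; cases "even l") (use X Y XY in \<open>simp_all add: odd_iff_mod_2_eq_one\<close>)
  ultimately show ?thesis using posop_poly_square_mult[OF h] by simp
qed

text \<open>
  \<open>fall_ratio j k N\<close> is \<open>[k]\<^sub>j / [N]\<^sub>j\<close>, the coefficient of the \<open>k\<close>-th Bernstein polynomial of degree
  \<open>N\<close> in the expansion of \<open>x\<^sup>j\<close>; it tends to \<open>(k / N)\<^sup>j\<close> uniformly in \<open>k\<close>.
\<close>

definition fall_ratio :: "nat \<Rightarrow> nat \<Rightarrow> nat \<Rightarrow> real" where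
  "fall_ratio j k N = (if j \<le> k then real ((N - j) choose (k - j)) / real (N choose k) else 0)"

lemma fall_ratio_Suc:
  assumes "k \<le> N" "Suc j \<le> N"
  shows "fall_ratio (Suc j) k N = fall_ratio j k N * ((real k - real j) / (real N - real j))"
proof (cases "Suc j \<le> k")
  case True
  have "Suc (N - Suc j) = N - j" "Suc (k - Suc j) = k - j" using assms True by auto
  then have "real (k - j) * real ((N - j) choose (k - j))
      = real (N - j) * real ((N - Suc j) choose (k - Suc j))"
    using Suc_times_binomial[of "k - Suc j" "N - Suc j"] by (metis of_nat_mult)
  then have "real ((N - Suc j) choose (k - Suc j))
      = real ((N - j) choose (k - j)) * ((real k - real j) / (real N - real j))"
    using True assms by (simp add: of_nat_diff field_simps)
  then show ?thesis
    using True assms by (simp add: fall_ratio_def)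
next
  \<comment> \<open>Both sides vanish: for \<open>k = j\<close> the numerator
    \<open>real k - real j\<close> is 0, and for \<open>k < j\<close> the ratio at \<open>j\<close>
    is already 0.\<close>
  case False
  then show ?thesis by (auto simp: fall_ratio_def not_less_eq_eq le_antisym)
qed

lemma fall_ratio_bounds:
  assumes "k \<le> N" "j \<le> N" shows "0 \<le> fall_ratio j k N \<and> fall_ratio j k N \<le> 1"
  using assms(2)
proof (induction j)
  case 0
  then show ?case using assms(1) by (simp add: fall_ratio_def)
next
  case (Suc j)
  then have IH: "0 \<le> fall_ratio j k N" "fall_ratio j k N \<le> 1" by auto
  show ?case
  proof (cases "j \<le> k")
    case True
    then have "0 \<le> (real k - real j) / (real N - real j)" "(real k - real j) / (real N - real j) \<le> 1"
      using Suc assms by (auto simp: divide_simps)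
    then show ?thesis
      using IH unfolding fall_ratio_Suc[OF assms(1) Suc.prems]
      by (meson mult_le_one mult_nonneg_nonneg)
  qed (simp add: fall_ratio_def)
qed

text \<open>Each new factor is within d/(N - d) of k/N. As the partial products and k/N lie in
  [0, 1], the errors of the factors only add up. What matters is that the bound does not depend on
  \<open>k\<close>.\<close>

lemma fall_ratio_error:
  assumes "k \<le> N" "d \<le> N" "j \<le> d" "d < N"
  shows "\<bar>fall_ratio j k N - (real k / real N) ^ j\<bar> \<le> real (j * d) / (real N - real d)"
  using assms(3)
proof (induction j)
  case 0
  then show ?case using assms by (simp add: fall_ratio_def)
next
  case (Suc j)
  define f where "f = fall_ratio j k N"
  define x where "x = real k / real N"
  define y where "y = (real k - real j) / (real N - real j)"
  have x: "0 \<le> x" "x \<le> 1" using assms by (auto simp: x_def)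
  have f: "0 \<le> f" "f \<le> 1" using fall_ratio_bounds[of k N j] assms Suc.prems by (auto simp: f_def)
  have "\<bar>x - y\<bar> \<le> real d / (real N - real d)"
  proof -
    have N: "real N > 0" "real N - real j > 0" "real N - real d > 0" using assms Suc.prems by auto
    have "x - y = real j * (real N - real k) / (real N * (real N - real j))"
      using N by (simp add: x_def y_def field_simps)
    also have "\<dots> = (real j / (real N - real j)) * ((real N - real k) / real N)"
      by simp
    finally have "\<bar>x - y\<bar> = (real j / (real N - real j)) * ((real N - real k) / real N)"
      using N assms by simp
    also have "\<dots> \<le> (real d / (real N - real d)) * 1"
      using N assms Suc.prems by (intro mult_mono frac_le) auto
    finally show ?thesis by simp
  qed
  moreover have "\<bar>f * y - x ^ Suc j\<bar> \<le> \<bar>f - x ^ j\<bar> + \<bar>x - y\<bar>"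
  proof -
    have "f * y - x ^ Suc j = (f - x ^ j) * x - f * (x - y)" by (simp add: algebra_simps)
    then have "\<bar>f * y - x ^ Suc j\<bar> \<le> \<bar>(f - x ^ j) * x\<bar> + \<bar>f * (x - y)\<bar>"
      by (metis abs_triangle_ineq4)
    also have "\<dots> \<le> \<bar>f - x ^ j\<bar> * 1 + 1 * \<bar>x - y\<bar>"
      unfolding abs_mult using x f by (intro add_mono mult_mono) auto
    finally show ?thesis by simp
  qed
  moreover have "fall_ratio (Suc j) k N = f * y"
    using fall_ratio_Suc[of k N j] assms Suc.prems by (simp add: f_def y_def)
  ultimately have "\<bar>fall_ratio (Suc j) k N - x ^ Suc j\<bar>
      \<le> real (j * d) / (real N - real d) + real d / (real N - real d)"
    using Suc by (simp add: f_def x_def)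
  also have "\<dots> = real (Suc j * d) / (real N - real d)"
    by (simp add: add_divide_distrib[symmetric] algebra_simps)
  finally show ?case by (simp add: x_def)
qed

text \<open>Multiply the monomial by 1 = (X + Y)^(N - j), expand, and shift the summation index by
  \<open>j\<close>.\<close>

lemma monomial_bernstein_expansion:
  assumes "j \<le> N"
  shows "X_poly ^ j = (\<Sum>k\<le>N. smult (fall_ratio j k N * real (N choose k)) (X_poly ^ k * Y_poly ^ (N - k)))"
proof -
  have "(X_poly + Y_poly) ^ (N - j) = (\<Sum>k\<le>N - j. of_nat ((N - j) choose k) * X_poly ^ k * Y_poly ^ (N - j - k))"
    by (rule binomial_ring)
  moreover have "X_poly + Y_poly = 1" by (simp add: one_pCons)
  ultimately have "1 = (\<Sum>k\<le>N - j. of_nat ((N - j) choose k) * X_poly ^ k * Y_poly ^ (N - j - k))"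
    by (simp only: power_one)
  then have "X_poly ^ j = (\<Sum>k\<le>N - j. X_poly ^ j * (of_nat ((N - j) choose k) * X_poly ^ k * Y_poly ^ (N - j - k)))"
    by (simp only: sum_distrib_left[symmetric] mult_1_right)
  also have "\<dots> = (\<Sum>k\<le>N - j. smult (real ((N - j) choose k)) (X_poly ^ (k + j) * Y_poly ^ (N - (k + j))))"
    by (rule sum.cong[OF refl])
      (simp only: power_add of_nat_mult_conv_smult mult_smult_left mult_smult_right mult.assoc,
       simp add: mult_ac diff_diff_eq add.commute)
  also have "\<dots> = (\<Sum>k\<in>{j..N}. smult (real ((N - j) choose (k - j))) (X_poly ^ k * Y_poly ^ (N - k)))"
    by (rule sum.reindex_bij_witness[where i = "\<lambda>k. k - j" and j = "\<lambda>k. k + j"]) (use assms in auto)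
  also have "\<dots> = (\<Sum>k\<le>N. smult (fall_ratio j k N * real (N choose k)) (X_poly ^ k * Y_poly ^ (N - k)))"
    by (rule sum.mono_neutral_cong_left) (auto simp: fall_ratio_def)
  finally show ?thesis .
qed

lemma poly_bernstein_expansion:
  assumes "degree q \<le> N"
  shows "q = (\<Sum>k\<le>N. smult ((\<Sum>j\<le>degree q. coeff q j * fall_ratio j k N) * real (N choose k))
      (X_poly ^ k * Y_poly ^ (N - k)))"
proof -
  have "q = (\<Sum>j\<le>degree q. smult (coeff q j) (X_poly ^ j))"
    by (subst poly_as_sum_of_monoms[of q, symmetric]) (simp add: monom_altdef)
  also have "\<dots> = (\<Sum>j\<le>degree q. smult (coeff q j)
      (\<Sum>k\<le>N. smult (fall_ratio j k N * real (N choose k)) (X_poly ^ k * Y_poly ^ (N - k))))"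
    by (rule sum.cong[OF refl], subst monomial_bernstein_expansion[where N = N]) (use assms in auto)
  also have "\<dots> = (\<Sum>k\<le>N. \<Sum>j\<le>degree q. smult (coeff q j * fall_ratio j k N * real (N choose k))
      (X_poly ^ k * Y_poly ^ (N - k)))"
    by (subst sum.swap) (simp add: smult_sum_right mult.assoc)
  finally show ?thesis by (simp add: sum_distrib_right smult_sum)
qed

text \<open>The Bernstein coefficients of \<open>q\<close> differ from its values at the nodes k/N
  by at most \<open>e N\<close>, which tends to 0. Adding the constant \<open>e N\<close> makes all
  coefficients nonnegative. Without the shift this can fail at every degree: (x - 1/2)^2 has an
  interior zero, which a nonzero nonnegative combination of Bernstein polynomials cannot
  have.\<close>

lemma posop_poly_op_unit:
  assumes A: "posop A" "norm A \<le> 1" and q: "\<And>s. 0 \<le> s \<Longrightarrow> s \<le> 1 \<Longrightarrow> 0 \<le> poly q s"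
  shows "posop (poly_op q A)"
proof (rule posop_tendsto)
  define d where "d = degree q"
  define e where "e N = (\<Sum>j\<le>d. \<bar>coeff q j\<bar> * (real (j * d) / (real N - real d)))" for N
  have "(\<lambda>N. real (j * d) / (real N - real d)) \<longlonglongrightarrow> 0" for j
  proof (rule tendsto_divide_0[OF tendsto_const])
    have "filterlim (\<lambda>N. - real d + real N) at_top sequentially"
      by (rule filterlim_tendsto_add_at_top[OF tendsto_const filterlim_real_sequentially])
    then show "filterlim (\<lambda>N. real N - real d) at_infinity sequentially"
      by (simp add: filterlim_at_top_imp_at_infinity)
  qed
  then have "e \<longlonglongrightarrow> (\<Sum>j\<le>d. \<bar>coeff q j\<bar> * 0)"
    unfolding e_def by (intro tendsto_sum tendsto_mult tendsto_const)
  then have e: "e \<longlonglongrightarrow> 0" by simp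
  have "(\<lambda>N. poly_op q A + e N *\<^sub>R id_blinfun) \<longlonglongrightarrow> poly_op q A + 0 *\<^sub>R id_blinfun"
    by (intro tendsto_add tendsto_scaleR tendsto_const e)
  then show "(\<lambda>N. poly_op q A + e N *\<^sub>R id_blinfun) \<longlonglongrightarrow> poly_op q A"
    by simp
  have "posop (poly_op q A + e N *\<^sub>R id_blinfun)" if N: "N > d" for N
  proof -
    define c where "c k = (\<Sum>j\<le>d. coeff q j * fall_ratio j k N)" for k
    have one: "1 = (\<Sum>k\<le>N. smult (real (N choose k)) (X_poly ^ k * Y_poly ^ (N - k)))"
      using monomial_bernstein_expansion[of 0 N] by (simp add: fall_ratio_def)
    have "q + smult (e N) 1 = (\<Sum>k\<le>N. smult ((c k + e N) * real (N choose k)) (X_poly ^ k * Y_poly ^ (N - k)))"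
      (is "_ = ?rhs")
    proof -
      have "q = (\<Sum>k\<le>N. smult (c k * real (N choose k)) (X_poly ^ k * Y_poly ^ (N - k)))"
        unfolding c_def d_def by (rule poly_bernstein_expansion) (use N d_def in simp)
      moreover have "smult (e N) 1 = (\<Sum>k\<le>N. smult (e N * real (N choose k)) (X_poly ^ k * Y_poly ^ (N - k)))"
        by (subst one) (simp only: smult_sum_right smult_smult)
      ultimately have "q + smult (e N) 1 = (\<Sum>k\<le>N. smult (c k * real (N choose k)) (X_poly ^ k * Y_poly ^ (N - k)))
         + (\<Sum>k\<le>N. smult (e N * real (N choose k)) (X_poly ^ k * Y_poly ^ (N - k)))"
        by (rule arg_cong2)
      then show ?thesis by (simp only: sum.distrib[symmetric] smult_add_left[symmetric] distrib_right)
    qed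
    then have "poly_op q A + e N *\<^sub>R id_blinfun
       = (\<Sum>k\<le>N. ((c k + e N) * real (N choose k)) *\<^sub>R poly_op (X_poly ^ k * Y_poly ^ (N - k)) A)"
      by (simp only: poly_op_1[symmetric, of A] poly_op_smult[symmetric] poly_op_add[symmetric] poly_op_sum[symmetric])
    moreover have "posop \<dots>"
    proof (intro posop_sum posop_scaleR posop_bernstein_monomial[OF A] mult_nonneg_nonneg)
      fix k assume k: "k \<in> {..N}"
      have "poly q (real k / real N) - c k = (\<Sum>j\<le>d. coeff q j * ((real k / real N) ^ j - fall_ratio j k N))"
        by (simp add: poly_altdef c_def d_def sum_subtractf right_diff_distrib)
      also have "\<dots> \<le> (\<Sum>j\<le>d. \<bar>coeff q j\<bar> * \<bar>(real k / real N) ^ j - fall_ratio j k N\<bar>)"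
        by (intro sum_mono) (metis abs_ge_self abs_mult)
      also have "\<dots> \<le> e N"
        unfolding e_def
        by (intro sum_mono mult_left_mono) (use N k fall_ratio_error[of k N d] in \<open>auto simp: abs_minus_commute\<close>)
      finally have "poly q (real k / real N) \<le> c k + e N" by simp
      moreover have "0 \<le> poly q (real k / real N)" using k N by (intro q) auto
      ultimately show "0 \<le> c k + e N" by linarith
    qed auto
    ultimately show ?thesis by simp
  qed
  then show "\<forall>\<^sub>F N in sequentially. posop (poly_op q A + e N *\<^sub>R id_blinfun)"
    by (auto simp: eventually_sequentially intro!: exI[of _ "Suc d"])
qed simp

lemma posop_poly_op:
  assumes A: "posop A" "norm A \<le> K" "0 < K" and q: "\<And>s. 0 \<le> s \<Longrightarrow> s \<le> K \<Longrightarrow> 0 \<le> poly q s"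
  shows "posop (poly_op q A)"
proof -
  define B where "B = (1 / K) *\<^sub>R A"
  have B: "posop B" "norm B \<le> 1" using A by (auto simp: B_def intro!: posop_scaleR)
  have "posop (poly_op (pcompose q [:0, K:]) B)"
    by (rule posop_poly_op_unit[OF B]) (use A in \<open>auto simp: poly_pcompose mult_left_le_one_le intro!: q\<close>)
  moreover have "poly_op [:0, K:] B = A"
    using A by (simp add: poly_op_pCons B_def op_comp.zero_right op_comp.scaleR_right)
  ultimately show ?thesis by (simp add: poly_op_pcompose)
qed

text \<open>The polynomial c^2 - q^2 is nonnegative on the interval, and its positivity at
  \<open>A\<close> says that q(A) stretches no vector by more than \<open>c\<close>. This estimate
  does the work of the spectral theorem below.\<close>

lemma poly_op_norm_le:
  assumes A: "posop A" and q: "\<And>s. 0 \<le> s \<Longrightarrow> s \<le> norm A \<Longrightarrow> \<bar>poly q s\<bar> \<le> c"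
  shows "norm (poly_op q A) \<le> c"
proof (cases "A = 0")
  \<comment> \<open>The positivity lemma works on an interval of positive length, so the zero
    operator is treated by hand.\<close>
  case True
  obtain a r where qr: "q = pCons a r" by (cases q)
  have "norm (poly_op q A) = \<bar>a\<bar> * norm (id_blinfun :: 'a op)"
    by (simp add: True qr poly_op_pCons op_comp.zero_left)
  also have "\<dots> \<le> \<bar>a\<bar> * 1" by (intro mult_left_mono norm_blinfun_id_le) auto
  finally show ?thesis using q[of 0] by (simp add: qr)
next
  case False
  have c: "0 \<le> c" using q[of 0] by auto
  have h: "is_adj A A" using A by (simp add: posop_def)
  have "posop (poly_op ([:c\<^sup>2:] - q * q) A)"
  proof (rule posop_poly_op[OF A order.refl])
    show "0 < norm A" using False by simp
    fix s assume s: "0 \<le> s" "s \<le> norm A"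
    have "\<bar>poly q s\<bar>\<^sup>2 \<le> c\<^sup>2" by (rule power_mono[OF q[OF s]]) simp
    then show "0 \<le> poly ([:c\<^sup>2:] - q * q) s" by (simp add: power2_eq_square)
  qed
  then have pos: "posop (c\<^sup>2 *\<^sub>R id_blinfun - (poly_op q A o\<^sub>L poly_op q A))"
    by (simp add: poly_op_diff poly_op_mult)
  show ?thesis
  proof (rule norm_blinfun_bound[OF c])
    fix x
    have "0 \<le> Re (cinner x (blinfun_apply (c\<^sup>2 *\<^sub>R id_blinfun - (poly_op q A o\<^sub>L poly_op q A)) x))"
      using pos by (simp add: posop_def)
    then have "(norm (blinfun_apply (poly_op q A) x))\<^sup>2 \<le> (c * norm x)\<^sup>2"
      by (simp add: blinfun.bilinear_simps cinner.diff_right cinner_scaleR_right cinner_self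
          is_adjD[OF poly_op_herm[OF h], symmetric] power_mult_distrib)
    then show "norm (blinfun_apply (poly_op q A) x) \<le> c * norm x"
      by (rule power2_le_imp_le) (use c in auto)
  qed
qed

section \<open>Continuous functional calculus of positive operators\<close>

text \<open>Bernstein basis polynomials on \<open>[0, K]\<close>. Letting \<open>K\<close> be any
  upper bound of the norm allows two operators to be expanded at the same nodes.\<close>

definition bern_basis :: "real \<Rightarrow> nat \<Rightarrow> nat \<Rightarrow> real poly" where
  "bern_basis K N k = smult (real (N choose k)) ([:0, 1 / K:] ^ k * [:1, - 1 / K:] ^ (N - k))"

definition bern :: "real \<Rightarrow> nat \<Rightarrow> (real \<Rightarrow> real) \<Rightarrow> real poly" where
  "bern K N f = (\<Sum>k\<le>N. smult (f (K * (real k / real N))) (bern_basis K N k))"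

lemma poly_bern_basis: "poly (bern_basis K N k) s = Bernstein N k (s / K)"
  by (simp add: bern_basis_def Bernstein_def poly_power)

lemma bern_basis_nonneg: "0 < K \<Longrightarrow> 0 \<le> s \<Longrightarrow> s \<le> K \<Longrightarrow> 0 \<le> poly (bern_basis K N k) s"
  by (simp add: poly_bern_basis Bernstein_nonneg)

lemma sum_bern_basis: "(\<Sum>k\<le>N. bern_basis K N k) = 1"
proof -
  have "([:0, 1 / K:] + [:1, - 1 / K:]) ^ N
      = (\<Sum>k\<le>N. of_nat (N choose k) * [:0, 1 / K:] ^ k * [:1, - 1 / K:] ^ (N - k))"
    by (rule binomial_ring)
  moreover have "[:0, 1 / K:] + [:1, - 1 / K:] = 1" by (simp add: one_pCons)
  ultimately show ?thesis
    by (simp only: bern_basis_def of_nat_mult_conv_smult mult_smult_left power_one)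
qed

lemma poly_sum': "poly (\<Sum>i\<in>F. q i) s = (\<Sum>i\<in>F. poly (q i) s)"
  by (induction F rule: infinite_finite_induct) auto

lemma bern_uniform_limit:
  assumes "continuous_on {0..K} f" "0 < K"
  shows "uniform_limit {0..K} (\<lambda>N s. poly (bern K N f) s) f sequentially"
proof (rule uniform_limitI)
  fix e :: real assume e: "0 < e"
  have cont: "continuous_on {0..1} (\<lambda>x. f (K * x))"
    by (rule continuous_on_compose2[OF assms(1)]) (use assms in \<open>auto intro!: continuous_intros simp: mult_left_le\<close>)
  obtain N0 where N0: "\<And>n x. N0 \<le> n \<Longrightarrow> x \<in> {0..1} \<Longrightarrow>
      \<bar>f (K * x) - (\<Sum>k\<le>n. f (K * (real k / real n)) * Bernstein n k x)\<bar> < e"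
    using Bernstein_Weierstrass[OF cont e] by metis
  have "dist (poly (bern K N f) s) (f s) < e" if "N \<ge> N0" "s \<in> {0..K}" for N s
    using N0[OF that(1), of "s / K"] that assms(2)
    by (simp add: bern_def poly_sum' poly_bern_basis dist_real_def abs_minus_commute)
  then show "\<forall>\<^sub>F N in sequentially. \<forall>s\<in>{0..K}. dist (poly (bern K N f) s) (f s) < e"
    unfolding eventually_sequentially by (intro exI[of _ N0]) simp
qed

lemma poly_approx_exists:
  assumes "continuous_on {0..K} f" "0 \<le> K"
  obtains q :: "nat \<Rightarrow> real poly" where "uniform_limit {0..K} (\<lambda>n s. poly (q n) s) f sequentially"
proof (cases "K = 0")
  case True
  then have "uniform_limit {0..K} (\<lambda>n s. poly [:f 0:] s) f sequentially"
    by (intro uniform_limitI) auto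
  then show ?thesis using that[of "\<lambda>_. [:f 0:]"] by blast
next
  case False
  then have "0 < K" using assms(2) by simp
  then show ?thesis by (rule that[OF bern_uniform_limit[OF assms(1)]])
qed

text \<open>Two approximating sequences differ at \<open>A\<close> by at most the supremum of their
  difference. Hence each is Cauchy and all share one limit, which is what makes the definite
  description in \<open>pos_cfc\<close> meaningful.\<close>

lemma pos_cfc_tendsto:
  assumes A: "posop A" and q: "uniform_limit {0..norm A} (\<lambda>k s. poly (q k) s) f sequentially"
  shows "(\<lambda>k. poly_op (q k) A) \<longlonglongrightarrow> pos_cfc f A"
proof -
  have close: "\<exists>N. \<forall>m\<ge>N. \<forall>n\<ge>N. norm (poly_op (q1 m) A - poly_op (q2 n) A) < e"
    if q1: "uniform_limit {0..norm A} (\<lambda>k s. poly (q1 k) s) f sequentially"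
      and q2: "uniform_limit {0..norm A} (\<lambda>k s. poly (q2 k) s) f sequentially" and e: "e > 0" for q1 q2 e
  proof -
    obtain N1 N2 where N: "\<And>n s. n \<ge> N1 \<Longrightarrow> s \<in> {0..norm A} \<Longrightarrow> dist (poly (q1 n) s) (f s) < e/3"
      "\<And>n s. n \<ge> N2 \<Longrightarrow> s \<in> {0..norm A} \<Longrightarrow> dist (poly (q2 n) s) (f s) < e/3"
      using uniform_limitD[OF q1, of "e/3"] uniform_limitD[OF q2, of "e/3"] e
      unfolding eventually_sequentially by (metis divide_pos_pos zero_less_numeral)
    have "norm (poly_op (q1 m) A - poly_op (q2 n) A) < e" if "m \<ge> max N1 N2" "n \<ge> max N1 N2" for m n
    proof -
      have "norm (poly_op (q1 m - q2 n) A) \<le> 2 * (e/3)"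
      proof (rule poly_op_norm_le[OF A])
        fix s assume s: "0 \<le> s" "s \<le> norm A"
        have "\<bar>poly (q1 m) s - f s\<bar> < e/3" "\<bar>poly (q2 n) s - f s\<bar> < e/3"
          using N(1)[of m s] N(2)[of n s] s that by (auto simp: dist_real_def)
        then have "\<bar>poly (q1 m) s - poly (q2 n) s\<bar> \<le> 2 * (e/3)" by arith
        then show "\<bar>poly (q1 m - q2 n) s\<bar> \<le> 2 * (e/3)" by simp
      qed
      then show ?thesis using e by (simp add: poly_op_diff)
    qed
    then show ?thesis by blast
  qed
  have "Cauchy (\<lambda>k. poly_op (q k) A)"
    using close[OF q q] by (simp add: Cauchy_def dist_norm)
  then obtain B where B: "(\<lambda>k. poly_op (q k) A) \<longlonglongrightarrow> B"
    using Cauchy_convergent convergent_def by blast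
  have lim: "(\<lambda>k. poly_op (r k) A) \<longlonglongrightarrow> B"
    if r: "uniform_limit {0..norm A} (\<lambda>k s. poly (r k) s) f sequentially" for r
  proof -
    have "(\<lambda>k. poly_op (r k) A - poly_op (q k) A) \<longlonglongrightarrow> 0"
      by (rule LIMSEQ_I) (use close[OF r q] in fastforce)
    from tendsto_add[OF this B] show ?thesis by simp
  qed
  have "pos_cfc f A = B"
    unfolding pos_cfc_def
  proof (rule the_equality)
    fix B' assume "\<forall>q. uniform_limit {0..norm A} (\<lambda>k s. poly (q k) s) f sequentially
      \<longrightarrow> (\<lambda>k. poly_op (q k) A) \<longlonglongrightarrow> B'"
    then show "B' = B" using q B LIMSEQ_unique by blast
  qed (use lim in blast)
  then show ?thesis using B by simp
qed

lemma pos_cfc_cong: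
  assumes "posop A" "continuous_on {0..norm A} f" "\<And>s. 0 \<le> s \<Longrightarrow> s \<le> norm A \<Longrightarrow> f s = g s"
  shows "pos_cfc f A = pos_cfc g A"
proof -
  obtain q where q: "uniform_limit {0..norm A} (\<lambda>n s. poly (q n) s) f sequentially"
    using poly_approx_exists[OF assms(2)] by auto
  moreover have "uniform_limit {0..norm A} (\<lambda>n s. poly (q n) s) g sequentially"
    using q by (subst uniform_limit_cong'[where g = "\<lambda>n s. poly (q n) s" and i = f]) (use assms(3) in auto)
  ultimately show ?thesis
    using pos_cfc_tendsto[OF assms(1)] LIMSEQ_unique by blast
qed

lemma pos_cfc_poly:
  assumes "posop A" shows "pos_cfc (poly q) A = poly_op q A"
proof -
  have "uniform_limit {0..norm A} (\<lambda>n s. poly q s) (poly q) sequentially"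
    by (rule uniform_limitI) auto
  from pos_cfc_tendsto[OF assms this] show ?thesis
    by (simp only: LIMSEQ_const_iff)
qed

lemma pos_cfc_id:
  assumes "posop A" shows "pos_cfc (\<lambda>s. s) A = A"
proof -
  have "pos_cfc (\<lambda>s. s) A = pos_cfc (poly [:0, 1:]) A"
    by (rule pos_cfc_cong[OF assms continuous_on_id]) simp
  also have "\<dots> = A" by (simp only: pos_cfc_poly[OF assms] poly_op_X)
  finally show ?thesis .
qed

lemma pos_cfc_const:
  assumes "posop A" shows "pos_cfc (\<lambda>s. c) A = c *\<^sub>R id_blinfun"
proof -
  have "pos_cfc (\<lambda>s. c) A = pos_cfc (poly [:c:]) A"
    by (rule pos_cfc_cong[OF assms continuous_on_const]) simp
  also have "\<dots> = c *\<^sub>R id_blinfun" by (simp only: pos_cfc_poly[OF assms] poly_op_const)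
  finally show ?thesis .
qed

lemma pos_cfc_add:
  assumes A: "posop A" and f: "continuous_on {0..norm A} f" and g: "continuous_on {0..norm A} g"
  shows "pos_cfc (\<lambda>s. f s + g s) A = pos_cfc f A + pos_cfc g A"
proof -
  obtain q where q: "uniform_limit {0..norm A} (\<lambda>n s. poly (q n) s) f sequentially"
    using poly_approx_exists[OF f] by auto
  obtain r where r: "uniform_limit {0..norm A} (\<lambda>n s. poly (r n) s) g sequentially"
    using poly_approx_exists[OF g] by auto
  have "uniform_limit {0..norm A} (\<lambda>n s. poly (q n + r n) s) (\<lambda>s. f s + g s) sequentially"
    using uniform_limit_add[OF q r] by simp
  from pos_cfc_tendsto[OF A this] tendsto_add[OF pos_cfc_tendsto[OF A q] pos_cfc_tendsto[OF A r]]
  show ?thesis using LIMSEQ_unique unfolding poly_op_add by blast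
qed

lemma pos_cfc_mult:
  assumes A: "posop A" and f: "continuous_on {0..norm A} f" and g: "continuous_on {0..norm A} g"
  shows "pos_cfc (\<lambda>s. f s * g s) A = pos_cfc f A o\<^sub>L pos_cfc g A"
proof -
  obtain q where q: "uniform_limit {0..norm A} (\<lambda>n s. poly (q n) s) f sequentially"
    using poly_approx_exists[OF f] by auto
  obtain r where r: "uniform_limit {0..norm A} (\<lambda>n s. poly (r n) s) g sequentially"
    using poly_approx_exists[OF g] by auto
  have b: "bounded (f ` {0..norm A})" "bounded (g ` {0..norm A})"
    by (intro compact_imp_bounded compact_continuous_image f g compact_Icc)+
  have "uniform_limit {0..norm A} (\<lambda>n s. poly (q n * r n) s) (\<lambda>s. f s * g s) sequentially"
    using uniform_lim_mult[OF q r b] by simp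
  from pos_cfc_tendsto[OF A this] op_comp.tendsto[OF pos_cfc_tendsto[OF A q] pos_cfc_tendsto[OF A r]]
  show ?thesis using LIMSEQ_unique unfolding poly_op_mult by blast
qed

lemma pos_cfc_scale:
  assumes A: "posop A" and f: "continuous_on {0..norm A} f"
  shows "pos_cfc (\<lambda>s. c * f s) A = c *\<^sub>R pos_cfc f A"
  using pos_cfc_mult[OF A continuous_on_const f, of c]
  by (simp add: pos_cfc_const[OF A] op_comp.scaleR_left)

lemma pos_cfc_diff:
  assumes A: "posop A" and f: "continuous_on {0..norm A} f" and g: "continuous_on {0..norm A} g"
  shows "pos_cfc (\<lambda>s. f s - g s) A = pos_cfc f A - pos_cfc g A"
proof -
  have "continuous_on {0..norm A} (\<lambda>s. (-1) * g s)" by (intro continuous_on_mult continuous_on_const g)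
  from pos_cfc_add[OF A f this] show ?thesis unfolding pos_cfc_scale[OF A g] by simp
qed

lemma pos_cfc_norm_le:
  assumes A: "posop A" and f: "continuous_on {0..norm A} f"
    and c: "\<And>s. 0 \<le> s \<Longrightarrow> s \<le> norm A \<Longrightarrow> \<bar>f s\<bar> \<le> c"
  shows "norm (pos_cfc f A) \<le> c"
proof (rule field_le_epsilon)
  fix e :: real assume e: "e > 0"
  obtain q where q: "uniform_limit {0..norm A} (\<lambda>n s. poly (q n) s) f sequentially"
    using poly_approx_exists[OF f] by auto
  show "norm (pos_cfc f A) \<le> c + e"
  proof (rule tendsto_upperbound[OF tendsto_norm[OF pos_cfc_tendsto[OF A q]]])
    show "\<forall>\<^sub>F n in sequentially. norm (poly_op (q n) A) \<le> c + e"
      using uniform_limitD[OF q e]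
    proof eventually_elim
      case (elim n)
      show ?case
      proof (rule poly_op_norm_le[OF A])
        fix s assume s: "0 \<le> s" "s \<le> norm A"
        then have "\<bar>poly (q n) s - f s\<bar> < e" using elim by (auto simp: dist_real_def)
        then show "\<bar>poly (q n) s\<bar> \<le> c + e" using c[OF s] by linarith
      qed
    qed
  qed simp
qed

lemma pos_cfc_uniform_tendsto:
  assumes A: "posop A" and g: "continuous_on {0..norm A} g"
    and f: "\<And>n. continuous_on {0..norm A} (f n)"
    and lim: "uniform_limit {0..norm A} f g F"
  shows "((\<lambda>n. pos_cfc (f n) A) \<longlongrightarrow> pos_cfc g A) F"
proof (rule tendstoI)
  fix e :: real assume e: "e > 0"
  then have "e / 2 > 0" by simp
  from uniform_limitD[OF lim this]
  show "\<forall>\<^sub>F n in F. dist (pos_cfc (f n) A) (pos_cfc g A) < e"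
  proof eventually_elim
    case (elim n)
    have "norm (pos_cfc (\<lambda>s. f n s - g s) A) \<le> e / 2"
      by (rule pos_cfc_norm_le[OF A]) (use elim f g in \<open>auto simp: dist_real_def intro!: continuous_intros less_imp_le\<close>)
    then show ?case using e by (simp add: pos_cfc_diff[OF A f g] dist_norm)
  qed
qed

lemma pos_cfc_herm:
  assumes A: "posop A" and f: "continuous_on {0..norm A} f"
  shows "is_adj (pos_cfc f A) (pos_cfc f A)"
proof -
  obtain q where q: "uniform_limit {0..norm A} (\<lambda>n s. poly (q n) s) f sequentially"
    using poly_approx_exists[OF f] by auto
  show ?thesis
    by (rule is_adj_tendsto[OF _ pos_cfc_tendsto[OF A q] pos_cfc_tendsto[OF A q]])
      (use A in \<open>simp_all add: posop_def poly_op_herm\<close>)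
qed

lemma posop_pos_cfc:
  assumes A: "posop A" and f: "continuous_on {0..norm A} f"
    and nonneg: "\<And>s. 0 \<le> s \<Longrightarrow> s \<le> norm A \<Longrightarrow> 0 \<le> f s"
  shows "posop (pos_cfc f A)"
proof -
  have c: "continuous_on {0..norm A} (\<lambda>s. sqrt (f s))" using f by (rule continuous_on_real_sqrt)
  have "pos_cfc f A = pos_cfc (\<lambda>s. sqrt (f s) * sqrt (f s)) A"
    by (rule pos_cfc_cong[OF A f]) (use nonneg in auto)
  also have "\<dots> = pos_cfc (\<lambda>s. sqrt (f s)) A o\<^sub>L pos_cfc (\<lambda>s. sqrt (f s)) A"
    by (rule pos_cfc_mult[OF A c c])
  finally show ?thesis using posop_square[OF pos_cfc_herm[OF A c]] by simp
qed

lemma pos_cfc_mem: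
  assumes S: "id_blinfun \<in> S" "\<And>B C. B \<in> S \<Longrightarrow> C \<in> S \<Longrightarrow> B + C \<in> S"
    "\<And>B C. B \<in> S \<Longrightarrow> C \<in> S \<Longrightarrow> B o\<^sub>L C \<in> S" "\<And>c B. B \<in> S \<Longrightarrow> c *\<^sub>R B \<in> S" "closed S"
    and A: "posop A" "A \<in> S" and f: "continuous_on {0..norm A} f"
  shows "pos_cfc f A \<in> S"
proof -
  obtain q where q: "uniform_limit {0..norm A} (\<lambda>n s. poly (q n) s) f sequentially"
    using poly_approx_exists[OF f] by auto
  show ?thesis
    by (rule closed_sequentially[OF S(5) _ pos_cfc_tendsto[OF A(1) q]])
      (use poly_op_mem[OF S(1) A(2) S(2,3,4)] in blast)
qed

text \<open>For homomorphisms that need not preserve the identity, hence \<open>f 0 = 0\<close>.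
  Equality of the norms makes one sequence of polynomials serve on both sides.\<close>

lemma pos_cfc_hom:
  assumes lin: "bounded_linear \<Phi>" and mult: "\<And>B C. \<Phi> (B o\<^sub>L C) = \<Phi> B o\<^sub>L \<Phi> C"
    and A: "posop A" "posop (\<Phi> A)" "norm (\<Phi> A) = norm A"
    and f: "continuous_on {0..norm A} f" "f 0 = 0"
  shows "pos_cfc f (\<Phi> A) = \<Phi> (pos_cfc f A)"
proof -
  interpret \<Phi>: bounded_linear \<Phi> by (rule lin)
  obtain q where q: "uniform_limit {0..norm A} (\<lambda>n s. poly (q n) s) f sequentially"
    using poly_approx_exists[OF f(1)] by auto
  \<comment> \<open>The constants removed tend to \<open>f 0 = 0\<close>, so the corrected
    polynomials still approximate \<open>f\<close>.\<close>
  define r where "r n = q n - [:poly (q n) 0:]" for n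
  have "(\<lambda>n. poly (q n) 0) \<longlonglongrightarrow> f 0"
    by (rule tendsto_uniform_limitI[OF q]) auto
  then have "uniform_limit {0..norm A} (\<lambda>n s. poly (q n) 0) (\<lambda>s. f 0) sequentially"
    by (simp add: uniform_limit_iff tendsto_iff)
  from uniform_limit_minus[OF q this] have r: "uniform_limit {0..norm A} (\<lambda>n s. poly (r n) s) f sequentially"
    by (simp add: r_def f(2))
  have "poly_op (r n) (\<Phi> A) = \<Phi> (poly_op (r n) A)" for n
    by (rule poly_op_hom[OF \<Phi>.linear mult]) (simp add: r_def poly_0_coeff_0)
  moreover have "(\<lambda>n. poly_op (r n) (\<Phi> A)) \<longlonglongrightarrow> pos_cfc f (\<Phi> A)"
    by (rule pos_cfc_tendsto[OF A(2)]) (use r A(3) in simp)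
  moreover have "(\<lambda>n. \<Phi> (poly_op (r n) A)) \<longlonglongrightarrow> \<Phi> (pos_cfc f A)"
    by (rule \<Phi>.tendsto[OF pos_cfc_tendsto[OF A(1) r]])
  ultimately show ?thesis using LIMSEQ_unique by simp
qed

lemma pos_cfc_scaled:
  assumes A: "posop A" and r: "0 \<le> r" and f: "continuous_on {0..r * norm A} f"
  shows "pos_cfc f (r *\<^sub>R A) = pos_cfc (\<lambda>s. f (r * s)) A"
proof -
  obtain q where q: "uniform_limit {0..r * norm A} (\<lambda>n s. poly (q n) s) f sequentially"
    using poly_approx_exists[OF f] r by auto
  have *: "poly_op (pcompose (q n) [:0, r:]) A = poly_op (q n) (r *\<^sub>R A)" for n
    by (simp add: poly_op_pcompose poly_op_pCons op_comp.scaleR_right)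
  have "uniform_limit {0..norm A} (\<lambda>n s. poly (pcompose (q n) [:0, r:]) s) (\<lambda>s. f (r * s)) sequentially"
    using uniform_limit_compose'[OF q, of "\<lambda>s. r * s" "{0..norm A}"] r
    by (simp add: poly_pcompose Pi_iff mult_left_mono mult.commute[of _ r])
  from pos_cfc_tendsto[OF A this] have "(\<lambda>n. poly_op (pcompose (q n) [:0, r:]) A) \<longlonglongrightarrow> pos_cfc (\<lambda>s. f (r * s)) A" .
  moreover have "(\<lambda>n. poly_op (q n) (r *\<^sub>R A)) \<longlonglongrightarrow> pos_cfc f (r *\<^sub>R A)"
    by (rule pos_cfc_tendsto[OF posop_scaleR[OF A r]]) (use q r in simp)
  ultimately show ?thesis unfolding * using LIMSEQ_unique by blast
qed

lemma norm_id_op [simp]: "norm (id_blinfun :: 'i op) = 1"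
proof (rule antisym)
  show "norm (id_blinfun :: 'i op) \<le> 1" by (rule norm_blinfun_id_le)
  show "1 \<le> norm (id_blinfun :: 'i op)"
    using norm_blinfun[of "id_blinfun :: 'i op" "ket undefined"] by simp
qed

lemma pos_cfc_of_id:
  assumes f: "continuous_on {0..1} f"
  shows "pos_cfc f id_blinfun = f 1 *\<^sub>R (id_blinfun :: 'i op)"
proof -
  have "pos_cfc f (id_blinfun :: 'i op) = pos_cfc (\<lambda>s. f 1) id_blinfun" 
  proof -
    have p: "poly_op q (id_blinfun :: 'i op) = poly q 1 *\<^sub>R id_blinfun" for q
      by (induction q) (auto simp: poly_op_pCons scaleR_add_left)
    obtain q where q: "uniform_limit {0..1} (\<lambda>n s. poly (q n) s) f sequentially"
      using poly_approx_exists[OF f] by auto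
    have "(\<lambda>n. poly (q n) 1) \<longlonglongrightarrow> f 1"
      by (rule tendsto_uniform_limitI[OF q]) auto
    then have "(\<lambda>n. poly_op (q n) (id_blinfun :: 'i op)) \<longlonglongrightarrow> f 1 *\<^sub>R id_blinfun"
      unfolding p by (intro tendsto_intros)
    moreover have "(\<lambda>n. poly_op (q n) (id_blinfun :: 'i op)) \<longlonglongrightarrow> pos_cfc f id_blinfun"
      by (rule pos_cfc_tendsto) (use q in auto)
    ultimately show ?thesis using LIMSEQ_unique by (simp only: pos_cfc_const posop_id)
  qed
  then show ?thesis by (simp add: pos_cfc_const)
qed

subsection \<open>The absolute value\<close>

lemma continuous_on_powr_Icc: "0 < p \<Longrightarrow> continuous_on {0..K} (\<lambda>s::real. s powr p)"
  by (intro continuous_on_powr' continuous_on_id continuous_on_const) auto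

lemma continuous_on_sqrt: "continuous_on S sqrt"
  by (rule continuous_on_real_sqrt[OF continuous_on_id])

lemma abs_op_eq: "is_adj A B \<Longrightarrow> abs_op A = pos_cfc sqrt (B o\<^sub>L A)"
  by (simp add: abs_op_def is_adj_adj)

lemma
  assumes "is_adj A B"
  shows posop_abs_op: "posop (abs_op A)"
    and abs_op_square: "abs_op A o\<^sub>L abs_op A = B o\<^sub>L A"
    and norm_abs_op: "norm (abs_op A) = norm A"
proof -
  have P: "posop (B o\<^sub>L A)" using assms by (rule posop_square)
  show pos: "posop (abs_op A)"
    unfolding abs_op_eq[OF assms] by (rule posop_pos_cfc[OF P]) (auto intro: continuous_on_sqrt)
  have "abs_op A o\<^sub>L abs_op A = pos_cfc (\<lambda>s. sqrt s * sqrt s) (B o\<^sub>L A)"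
    unfolding abs_op_eq[OF assms] by (rule pos_cfc_mult[OF P, symmetric]) (rule continuous_on_sqrt)+
  also have "\<dots> = pos_cfc (\<lambda>s. s) (B o\<^sub>L A)"
    by (rule pos_cfc_cong[OF P]) (auto intro!: continuous_intros)
  also have "\<dots> = B o\<^sub>L A" by (rule pos_cfc_id[OF P])
  finally show sq: "abs_op A o\<^sub>L abs_op A = B o\<^sub>L A" .
  have "(norm (abs_op A))\<^sup>2 = (norm A)\<^sup>2"
    using is_adj_norm_square[of "abs_op A" "abs_op A"] is_adj_norm_square[OF assms] pos
    unfolding sq posop_def by metis
  then show "norm (abs_op A) = norm A" by (rule power2_eq_imp_eq) auto
qed

lemma abs_powr_norm_le:
  assumes "is_adj A B" "0 < p" shows "norm (abs_powr A p) \<le> norm A powr p"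
  unfolding abs_powr_def
  by (rule pos_cfc_norm_le[OF posop_abs_op[OF assms(1)] continuous_on_powr_Icc[OF assms(2)]])
    (use assms(2) in \<open>simp add: norm_abs_op[OF assms(1)] powr_mono2\<close>)

lemma posop_abs_powr: "is_adj A B \<Longrightarrow> 0 < p \<Longrightarrow> posop (abs_powr A p)"
  unfolding abs_powr_def
  by (erule posop_pos_cfc[OF posop_abs_op continuous_on_powr_Icc]) simp_all

text \<open>Only the square of the absolute value of \<open>W\<close> has to be an image under
  \<open>\<Phi>\<close>, not \<open>W\<close> itself. This covers a matrix with a single
  off-diagonal entry, whose absolute value sits on the diagonal, as well as conjugation by a
  unitary.\<close>

lemma abs_powr_hom:
  assumes lin: "bounded_linear \<Phi>" and mult: "\<And>B C. \<Phi> (B o\<^sub>L C) = \<Phi> B o\<^sub>L \<Phi> C"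
    and iso: "\<And>B. norm (\<Phi> B) = norm B" and herm: "\<And>B. is_adj B B \<Longrightarrow> is_adj (\<Phi> B) (\<Phi> B)"
    and A: "is_adj A B" "is_adj W V" "V o\<^sub>L W = \<Phi> (B o\<^sub>L A)" and p: "0 < p"
  shows "abs_powr W p = \<Phi> (abs_powr A p)"
proof -
  have pos: "posop (\<Phi> C)" if "posop C" for C
  proof -
    \<comment> \<open>A positive operator is the square of a self-adjoint one, and such squares are
      preserved.\<close>
    define S where "S = pos_cfc sqrt C"
    have S: "is_adj S S" unfolding S_def by (rule pos_cfc_herm[OF that continuous_on_sqrt])
    have "S o\<^sub>L S = pos_cfc (\<lambda>s. sqrt s * sqrt s) C"
      unfolding S_def by (rule pos_cfc_mult[OF that, symmetric]) (rule continuous_on_sqrt)+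
    also have "\<dots> = pos_cfc (\<lambda>s. s) C"
      by (rule pos_cfc_cong[OF that]) (auto intro!: continuous_intros)
    finally have "C = S o\<^sub>L S" by (simp add: pos_cfc_id[OF that])
    then show ?thesis using posop_square[OF herm[OF S]] by (simp add: mult)
  qed
  have P: "posop (B o\<^sub>L A)" using A(1) by (rule posop_square)
  have abs: "abs_op W = \<Phi> (abs_op A)"
    unfolding abs_op_eq[OF A(1)] abs_op_eq[OF A(2)] A(3)
    by (rule pos_cfc_hom[OF lin mult P pos[OF P] iso continuous_on_sqrt]) simp
  show ?thesis
    unfolding abs_powr_def abs
    by (rule pos_cfc_hom[OF lin mult posop_abs_op[OF A(1)] pos[OF posop_abs_op[OF A(1)]] iso
        continuous_on_powr_Icc[OF p]]) simp
qed

lemma scalar_op_mult: "scalar_op a o\<^sub>L scalar_op b = scalar_op (a * b)"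
  by (rule blinfun_eqI, rule ell2_eqI) (simp add: scalar_op.rep_eq scaleC_ell2.rep_eq)

lemma scalar_op_of_real: "scalar_op (complex_of_real r) = r *\<^sub>R id_blinfun"
  by (rule blinfun_eqI, rule ell2_eqI)
    (simp add: scalar_op.rep_eq scaleC_ell2.rep_eq blinfun.bilinear_simps)

lemma abs_powr_scaleC:
  assumes A: "is_adj A B" and p: "0 < p"
  shows "abs_powr (c *\<^sub>C A) p = (cmod c powr p) *\<^sub>R abs_powr A p"
proof -
  have P: "posop (B o\<^sub>L A)" using A(1) by (rule posop_square)
  have "is_adj (c *\<^sub>C A) (B o\<^sub>L scalar_op (cnj c))"
    by (rule is_adj_compose[OF is_adj_scalar_op A])
  moreover have "(B o\<^sub>L scalar_op (cnj c)) o\<^sub>L (c *\<^sub>C A) = B o\<^sub>L ((scalar_op (cnj c) o\<^sub>L scalar_op c) o\<^sub>L A)"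
    by (simp only: blinfun_compose_assoc)
  then have "(B o\<^sub>L scalar_op (cnj c)) o\<^sub>L (c *\<^sub>C A) = (cmod c)\<^sup>2 *\<^sub>R (B o\<^sub>L A)"
    by (simp add: scalar_op_mult mult.commute[of "cnj c"] complex_norm_square[symmetric] scalar_op_of_real
        op_comp.scaleR_left op_comp.scaleR_right del: of_real_power)
  ultimately have "abs_op (c *\<^sub>C A) = pos_cfc sqrt ((cmod c)\<^sup>2 *\<^sub>R (B o\<^sub>L A))"
    by (simp add: abs_op_eq)
  also have "\<dots> = pos_cfc (\<lambda>s. cmod c * sqrt s) (B o\<^sub>L A)"
    by (subst pos_cfc_scaled[OF P]) (auto simp: real_sqrt_mult intro: continuous_on_sqrt)
  also have "\<dots> = cmod c *\<^sub>R abs_op A"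
    unfolding abs_op_eq[OF A] by (rule pos_cfc_scale[OF P continuous_on_sqrt])
  finally have "abs_powr (c *\<^sub>C A) p = pos_cfc (\<lambda>s. (cmod c * s) powr p) (abs_op A)"
    unfolding abs_powr_def
    using pos_cfc_scaled[OF posop_abs_op[OF A], of "cmod c" "\<lambda>s. s powr p"] p
    by (simp add: continuous_on_powr_Icc)
  also have "\<dots> = pos_cfc (\<lambda>s. cmod c powr p * s powr p) (abs_op A)"
  proof (rule pos_cfc_cong[OF posop_abs_op[OF A]])
    show "continuous_on {0..norm (abs_op A)} (\<lambda>s. (cmod c * s) powr p)"
      by (rule continuous_on_compose2[OF continuous_on_powr_Icc[OF p, of "cmod c * norm (abs_op A)"]])
        (auto intro!: continuous_intros mult_left_mono)
  qed (simp add: powr_mult)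
  also have "\<dots> = (cmod c powr p) *\<^sub>R abs_powr A p"
    unfolding abs_powr_def
    by (rule pos_cfc_scale[OF posop_abs_op[OF A] continuous_on_powr_Icc[OF p]])
  finally show ?thesis .
qed

lemma abs_powr_isometry:
  assumes "is_adj U V" "V o\<^sub>L U = id_blinfun" "0 < p"
  shows "abs_powr U p = id_blinfun"
proof -
  have "abs_op U = id_blinfun"
    unfolding abs_op_eq[OF assms(1)] assms(2) by (subst pos_cfc_of_id) (auto intro: continuous_on_sqrt)
  then show ?thesis
    unfolding abs_powr_def using assms(3)
    by (simp add: pos_cfc_of_id continuous_on_powr_Icc)
qed

section \<open>Noncommutative Minkowski inequality\<close>

text \<open>A finite sum of vector states. The canonical trace is the case of the single index 0;
  the trace on matrices uses the indices \<open>(0, i)\<close> with \<open>i < r\<close>.\<close>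

definition ket_trace :: "'i set \<Rightarrow> 'i op \<Rightarrow> complex" where
  "ket_trace S A = (\<Sum>i\<in>S. cinner (ket i) (blinfun_apply A (ket i)))"

text \<open>The trace of the adjoint of \<open>A\<close> times \<open>A\<close>, written so that no
  adjoint occurs.\<close>

definition hs_square :: "'i set \<Rightarrow> 'i op \<Rightarrow> real" where
  "hs_square S A = (\<Sum>i\<in>S. (norm (blinfun_apply A (ket i)))\<^sup>2)"

lemma bounded_linear_ket_trace: "bounded_linear (ket_trace S)"
  unfolding ket_trace_def
  by (intro bounded_linear_sum bounded_linear_compose[OF cinner.bounded_linear_right blinfun.bounded_linear_left])

lemmas ket_trace_sum = linear_sum[OF bounded_linear.linear[OF bounded_linear_ket_trace]]
lemmas ket_trace_add = linear_add[OF bounded_linear.linear[OF bounded_linear_ket_trace]]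
lemmas ket_trace_scaleR = linear_scale[OF bounded_linear.linear[OF bounded_linear_ket_trace]]
lemmas ket_trace_tendsto = bounded_linear.tendsto[OF bounded_linear_ket_trace]

lemma hs_square_nonneg: "0 \<le> hs_square S A"
  by (simp add: hs_square_def sum_nonneg)

lemma ket_trace_square: "is_adj X V \<Longrightarrow> ket_trace S (V o\<^sub>L X) = complex_of_real (hs_square S X)"
  by (simp add: ket_trace_def hs_square_def is_adjD[symmetric] cinner_self)

lemma cmod_ket_trace_product_le:
  assumes "is_adj X V"
  shows "cmod (ket_trace S (V o\<^sub>L Y)) \<le> (hs_square S X + hs_square S Y) / 2"
proof -
  have "cmod (ket_trace S (V o\<^sub>L Y)) \<le> (\<Sum>i\<in>S. cmod (cinner (blinfun_apply X (ket i)) (blinfun_apply Y (ket i))))"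
    unfolding ket_trace_def by (rule sum_norm_le) (simp add: is_adjD[OF assms])
  also have "\<dots> \<le> (\<Sum>i\<in>S. ((norm (blinfun_apply X (ket i)))\<^sup>2 + (norm (blinfun_apply Y (ket i)))\<^sup>2) / 2)"
  proof (rule sum_mono)
    fix i
    define a where "a = norm (blinfun_apply X (ket i))"
    define b where "b = norm (blinfun_apply Y (ket i))"
    have "0 \<le> (a - b)\<^sup>2" by simp
    then have "a * b \<le> (a\<^sup>2 + b\<^sup>2) / 2" unfolding power2_diff by simp
    with norm_cinner_le show "cmod (cinner (blinfun_apply X (ket i)) (blinfun_apply Y (ket i)))
        \<le> ((norm (blinfun_apply X (ket i)))\<^sup>2 + (norm (blinfun_apply Y (ket i)))\<^sup>2) / 2"
      unfolding a_def b_def by (rule order.trans)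
  qed
  also have "\<dots> = (hs_square S X + hs_square S Y) / 2"
    by (simp add: hs_square_def sum.distrib flip: sum_divide_distrib)
  finally show ?thesis .
qed

lemma hs_square_contraction: "norm v \<le> 1 \<Longrightarrow> hs_square S (v o\<^sub>L X) \<le> hs_square S X"
  unfolding hs_square_def
proof (rule sum_mono, rule power_mono)
  fix i assume "norm v \<le> 1"
  then have "norm v * norm (blinfun_apply X (ket i)) \<le> 1 * norm (blinfun_apply X (ket i))"
    by (intro mult_right_mono) auto
  then show "norm (blinfun_apply (v o\<^sub>L X) (ket i)) \<le> norm (blinfun_apply X (ket i))"
    using norm_blinfun[of v "blinfun_apply X (ket i)"] by simp
qed auto

lemma posop_ket_trace_nonneg: "posop A \<Longrightarrow> 0 \<le> Re (ket_trace S A)"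
  by (simp add: ket_trace_def posop_def sum_nonneg)

lemma cmod_ket_trace_le: "finite S \<Longrightarrow> cmod (ket_trace S A) \<le> real (card S) * norm A"
proof -
  have "cmod (cinner (ket i) (blinfun_apply A (ket i))) \<le> norm A" for i
    using norm_cinner_le[of "ket i" "blinfun_apply A (ket i)"] norm_blinfun[of A "ket i"] by simp
  then have "cmod (ket_trace S A) \<le> (\<Sum>i\<in>S. norm A)" unfolding ket_trace_def by (intro sum_norm_le)
  then show ?thesis by simp
qed

subsection \<open>Square roots of Bernstein polynomials\<close>

text \<open>These self-adjoint operators are a smoothed substitute for the spectral projections of
  \<open>a\<close> near the nodes: their squares are the Bernstein polynomials at \<open>a\<close>
  and sum to the identity.\<close>

definition bern_root :: "real \<Rightarrow> nat \<Rightarrow> nat \<Rightarrow> 'i op \<Rightarrow> 'i op" where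
  "bern_root K N k a = pos_cfc (\<lambda>s. sqrt (poly (bern_basis K N k) s)) a"

lemma
  assumes a: "posop a" "norm a \<le> K" "0 < K"
  shows bern_root_herm: "is_adj (bern_root K N k a) (bern_root K N k a)"
    and bern_root_square: "bern_root K N k a o\<^sub>L bern_root K N k a = poly_op (bern_basis K N k) a"
proof -
  have c: "continuous_on {0..norm a} (\<lambda>s. sqrt (poly (bern_basis K N k) s))"
    by (intro continuous_on_real_sqrt continuous_intros)
  show "is_adj (bern_root K N k a) (bern_root K N k a)"
    unfolding bern_root_def by (rule pos_cfc_herm[OF a(1) c])
  have "bern_root K N k a o\<^sub>L bern_root K N k a
      = pos_cfc (\<lambda>s. sqrt (poly (bern_basis K N k) s) * sqrt (poly (bern_basis K N k) s)) a"
    unfolding bern_root_def by (rule pos_cfc_mult[OF a(1) c c, symmetric])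
  also have "\<dots> = pos_cfc (poly (bern_basis K N k)) a"
    by (rule pos_cfc_cong[OF a(1) continuous_on_mult[OF c c]]) (use a(2) bern_basis_nonneg[OF a(3)] in simp)
  finally show "bern_root K N k a o\<^sub>L bern_root K N k a = poly_op (bern_basis K N k) a"
    by (simp add: pos_cfc_poly[OF a(1)])
qed

lemma sum_hs_square_bern_root:
  assumes a: "posop a" "norm a \<le> K" "0 < K"
  shows "(\<Sum>k\<le>N. hs_square S (bern_root K N k a o\<^sub>L X)) = hs_square S X"
proof -
  have "(\<Sum>k\<le>N. (norm (blinfun_apply (bern_root K N k a) x))\<^sup>2) = (norm x)\<^sup>2" for x
  proof -
    have "complex_of_real (\<Sum>k\<le>N. (norm (blinfun_apply (bern_root K N k a) x))\<^sup>2)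
        = (\<Sum>k\<le>N. cinner x (blinfun_apply (poly_op (bern_basis K N k) a) x))"
      unfolding of_real_sum cinner_self[symmetric] is_adjD[OF bern_root_herm[OF a]]
        bern_root_square[OF a, symmetric] by simp
    also have "\<dots> = cinner x (blinfun_apply (poly_op (\<Sum>k\<le>N. bern_basis K N k) a) x)"
      by (simp add: poly_op_sum blinfun.sum_left cinner.sum_right)
    also have "\<dots> = complex_of_real ((norm x)\<^sup>2)"
      unfolding sum_bern_basis by (simp only: poly_op_1 blinfun_apply_id_blinfun id_apply cinner_self)
    finally show ?thesis by (simp only: of_real_eq_iff)
  qed
  then show ?thesis
    unfolding hs_square_def by (subst sum.swap) simp
qed

lemma poly_op_bern:
  assumes a: "posop a" "norm a \<le> K" "0 < K"
  shows "poly_op (bern K N f) a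
    = (\<Sum>k\<le>N. f (K * (real k / real N)) *\<^sub>R (bern_root K N k a o\<^sub>L bern_root K N k a))"
  by (simp add: bern_def poly_op_sum poly_op_smult bern_root_square[OF a])

lemma poly_op_bern_tendsto:
  assumes a: "posop a" "norm a \<le> K" "0 < K" and f: "continuous_on {0..K} f"
  shows "(\<lambda>N. poly_op (bern K N f) a) \<longlonglongrightarrow> pos_cfc f a"
  by (rule pos_cfc_tendsto[OF a(1) uniform_limit_on_subset[OF bern_uniform_limit[OF f a(3)]]])
    (use a(2) in auto)

subsection \<open>Tracial operator algebras\<close>

text \<open>Norm closedness is the right topology here, since only continuous functions of operators
  are formed. Positivity and continuity of the trace come from its being a finite sum of vector
  states; only the trace property is an assumption on it.\<close>

locale tracial_algebra =
  fixes M :: "'i op set" and S :: "'i set"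
  assumes finite_S: "finite S"
    and id_mem: "id_blinfun \<in> M"
    and add_mem: "A \<in> M \<Longrightarrow> B \<in> M \<Longrightarrow> A + B \<in> M"
    and comp_mem: "A \<in> M \<Longrightarrow> B \<in> M \<Longrightarrow> A o\<^sub>L B \<in> M"
    and scaleR_mem: "A \<in> M \<Longrightarrow> c *\<^sub>R A \<in> M"
    and closed_M: "closed M"
    and adj_mem: "A \<in> M \<Longrightarrow> \<exists>B\<in>M. is_adj A B"
    and trace_comm: "A \<in> M \<Longrightarrow> B \<in> M \<Longrightarrow> ket_trace S (A o\<^sub>L B) = ket_trace S (B o\<^sub>L A)"
begin

lemma cfc_mem: "posop A \<Longrightarrow> A \<in> M \<Longrightarrow> continuous_on {0..norm A} f \<Longrightarrow> pos_cfc f A \<in> M"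
  by (rule pos_cfc_mem[of M, OF id_mem add_mem comp_mem scaleR_mem closed_M])

lemma bern_root_mem: "posop a \<Longrightarrow> a \<in> M \<Longrightarrow> bern_root K N k a \<in> M"
  unfolding bern_root_def by (intro cfc_mem continuous_on_real_sqrt continuous_intros) auto

lemma hs_square_adj: "A \<in> M \<Longrightarrow> B \<in> M \<Longrightarrow> is_adj A B \<Longrightarrow> hs_square S A = hs_square S B"
  by (metis ket_trace_square is_adj_sym trace_comm of_real_eq_iff)

text \<open>Expanding both functions at the nodes gives f(x_k) g(x_l) times a mixed trace.
  Cauchy-Schwarz bounds that trace by the mean of two nonnegative weights whose row and column sums
  are at most the traces of the squares of \<open>P k\<close> and of \<open>Q l\<close>. The scalar
  inequality, summed against the weights, then splits into the two traces on the right.\<close>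

lemma bernstein_trace_inequality:
  assumes a: "posop a" "a \<in> M" "norm a \<le> K" and c: "posop c" "c \<in> M" "norm c \<le> K" and K: "0 < K"
    and u: "u \<in> M" "norm u \<le> 1" and v: "v \<in> M" "norm v \<le> 1"
    and fg: "\<And>s t. 0 \<le> s \<Longrightarrow> s \<le> K \<Longrightarrow> 0 \<le> t \<Longrightarrow> t \<le> K \<Longrightarrow> \<bar>f s * g t\<bar> \<le> F s + G t"
    and FG: "\<And>s. 0 \<le> F s" "\<And>s. 0 \<le> G s"
  shows "cmod (ket_trace S (u o\<^sub>L poly_op (bern K N f) a o\<^sub>L v o\<^sub>L poly_op (bern K N g) c))
    \<le> Re (ket_trace S (poly_op (bern K N F) a)) + Re (ket_trace S (poly_op (bern K N G) c))"
proof -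
  define x where "x k = K * (real k / real N)" for k
  have x: "0 \<le> x k" "x k \<le> K" if "k \<le> N" for k
    using that K by (auto simp: x_def divide_simps mult_left_le)
  define P where "P k = bern_root K N k a" for k
  define Q where "Q k = bern_root K N k c" for k
  note a' = a(1,3) K and c' = c(1,3) K
  have P: "P k \<in> M" "is_adj (P k) (P k)" for k
    by (simp_all add: P_def bern_root_mem a bern_root_herm[OF a'])
  have Q: "Q k \<in> M" "is_adj (Q k) (Q k)" for k
    by (simp_all add: Q_def bern_root_mem c bern_root_herm[OF c'])
  obtain u' where u': "u' \<in> M" "is_adj u u'" using adj_mem[OF u(1)] by auto
  obtain v' where v': "v' \<in> M" "is_adj v v'" using adj_mem[OF v(1)] by auto
  have nu': "norm u' \<le> 1" using is_adj_norm[OF u'(2)] u(2) by simp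
  have nv': "norm v' \<le> 1" using is_adj_norm[OF v'(2)] v(2) by simp
  \<comment> \<open>The two weights come from the two sides of Cauchy-Schwarz. The adjoint of
    \<open>u\<close> appears in the first because the left factor of the inner product is
    conjugated.\<close>
  define w1 where "w1 k l = hs_square S (P k o\<^sub>L (u' o\<^sub>L Q l))" for k l
  define w2 where "w2 k l = hs_square S (P k o\<^sub>L (v o\<^sub>L Q l))" for k l
  define p where "p k = hs_square S (P k)" for k
  define q where "q k = hs_square S (Q k)" for k
  have bound: "(\<Sum>k\<le>N. hs_square S (P k o\<^sub>L (y o\<^sub>L Q l))) \<le> q l"
      "(\<Sum>l\<le>N. hs_square S (P k o\<^sub>L (y o\<^sub>L Q l))) \<le> p k"
    if y: "y \<in> M" "norm y \<le> 1" "y' \<in> M" "is_adj y y'" "norm y' \<le> 1" for y y' k l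
  proof -
    show "(\<Sum>k\<le>N. hs_square S (P k o\<^sub>L (y o\<^sub>L Q l))) \<le> q l"
      unfolding P_def sum_hs_square_bern_root[OF a'] q_def by (rule hs_square_contraction[OF y(2)])
    \<comment> \<open>The sum over \<open>l\<close> concerns the inner factor. Passing to the
      adjoint, which by the trace property keeps the value, brings \<open>Q l\<close> to the left,
      where the partition of unity applies.\<close>
    have "hs_square S (P k o\<^sub>L (y o\<^sub>L Q l)) = hs_square S (Q l o\<^sub>L (y' o\<^sub>L P k))" for l
      unfolding blinfun_compose_assoc[symmetric]
      by (rule hs_square_adj)
        (use is_adj_compose[OF P(2)[of k] is_adj_compose[OF y(4) Q(2)[of l]]] y P Q comp_mem
          in \<open>simp_all add: blinfun_compose_assoc\<close>)
    then have "(\<Sum>l\<le>N. hs_square S (P k o\<^sub>L (y o\<^sub>L Q l))) = hs_square S (y' o\<^sub>L P k)"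
      unfolding Q_def using sum_hs_square_bern_root[OF c'] by simp
    also have "\<dots> \<le> p k" unfolding p_def by (rule hs_square_contraction[OF y(5)])
    finally show "(\<Sum>l\<le>N. hs_square S (P k o\<^sub>L (y o\<^sub>L Q l))) \<le> p k" .
  qed
  have w1: "(\<Sum>k\<le>N. w1 k l) \<le> q l" "(\<Sum>l\<le>N. w1 k l) \<le> p k" for k l
    unfolding w1_def using bound[OF u'(1) nu' u(1) is_adj_sym[OF u'(2)] u(2)] by auto
  have w2: "(\<Sum>k\<le>N. w2 k l) \<le> q l" "(\<Sum>l\<le>N. w2 k l) \<le> p k" for k l
    unfolding w2_def using bound[OF v(1,2) v'(1,2) nv'] by auto
  \<comment> \<open>One copy of \<open>Q l\<close> is moved to the front by the trace property. The
    term is then the pairing of \<open>P k o\<^sub>L (u' o\<^sub>L Q l)\<close> with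
    \<open>P k o\<^sub>L (v o\<^sub>L Q l)\<close>.\<close>
  have term_le: "cmod (ket_trace S (u o\<^sub>L (P k o\<^sub>L P k) o\<^sub>L v o\<^sub>L (Q l o\<^sub>L Q l))) \<le> (w1 k l + w2 k l) / 2" for k l
  proof -
    have "ket_trace S (u o\<^sub>L (P k o\<^sub>L P k) o\<^sub>L v o\<^sub>L (Q l o\<^sub>L Q l))
        = ket_trace S ((u o\<^sub>L (P k o\<^sub>L P k) o\<^sub>L v o\<^sub>L Q l) o\<^sub>L Q l)"
      by (simp only: blinfun_compose_assoc)
    also have "\<dots> = ket_trace S (Q l o\<^sub>L (u o\<^sub>L (P k o\<^sub>L P k) o\<^sub>L v o\<^sub>L Q l))"
      by (intro trace_comm comp_mem P Q u v)
    also have "\<dots> = ket_trace S ((Q l o\<^sub>L u o\<^sub>L P k) o\<^sub>L (P k o\<^sub>L (v o\<^sub>L Q l)))"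
      by (simp only: blinfun_compose_assoc)
    finally have eq: "ket_trace S (u o\<^sub>L (P k o\<^sub>L P k) o\<^sub>L v o\<^sub>L (Q l o\<^sub>L Q l))
      = ket_trace S ((Q l o\<^sub>L u o\<^sub>L P k) o\<^sub>L (P k o\<^sub>L (v o\<^sub>L Q l)))" .
    have "is_adj (P k o\<^sub>L (u' o\<^sub>L Q l)) ((Q l o\<^sub>L u) o\<^sub>L P k)"
      by (intro is_adj_compose P Q is_adj_sym[OF u'(2)])
    from cmod_ket_trace_product_le[OF this] show ?thesis unfolding eq w1_def w2_def .
  qed
  have expand: "u o\<^sub>L poly_op (bern K N f) a o\<^sub>L v o\<^sub>L poly_op (bern K N g) c
      = (\<Sum>k\<le>N. \<Sum>l\<le>N. (f (x k) * g (x l)) *\<^sub>R (u o\<^sub>L (P k o\<^sub>L P k) o\<^sub>L v o\<^sub>L (Q l o\<^sub>L Q l)))"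
    unfolding poly_op_bern[OF a'] poly_op_bern[OF c'] P_def[symmetric] Q_def[symmetric] x_def[symmetric]
    by (simp add: op_comp.sum_left op_comp.sum_right op_comp.scaleR_left op_comp.scaleR_right
        scaleR_right.sum mult.commute) (rule sum.swap)
  have "cmod (ket_trace S (u o\<^sub>L poly_op (bern K N f) a o\<^sub>L v o\<^sub>L poly_op (bern K N g) c))
      \<le> (\<Sum>k\<le>N. \<Sum>l\<le>N. \<bar>f (x k) * g (x l)\<bar> * ((w1 k l + w2 k l) / 2))"
    unfolding expand ket_trace_sum ket_trace_scaleR
    by (intro sum_norm_le) (simp only: norm_scaleR, intro mult_left_mono term_le abs_ge_zero)
  also have "\<dots> \<le> (\<Sum>k\<le>N. \<Sum>l\<le>N. (F (x k) + G (x l)) * ((w1 k l + w2 k l) / 2))"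
    by (intro sum_mono mult_right_mono fg) (auto simp: x w1_def w2_def hs_square_nonneg)
  also have "\<dots> = (\<Sum>k\<le>N. F (x k) * ((\<Sum>l\<le>N. w1 k l) + (\<Sum>l\<le>N. w2 k l)) / 2)
      + (\<Sum>k\<le>N. \<Sum>l\<le>N. G (x l) * (w1 k l + w2 k l) / 2)"
    by (simp add: distrib_right sum.distrib sum_distrib_left sum_divide_distrib distrib_left add_divide_distrib)
  also have "(\<Sum>k\<le>N. \<Sum>l\<le>N. G (x l) * (w1 k l + w2 k l) / 2)
      = (\<Sum>l\<le>N. G (x l) * ((\<Sum>k\<le>N. w1 k l) + (\<Sum>k\<le>N. w2 k l)) / 2)"
    by (subst sum.swap) (simp add: sum.distrib sum_distrib_left sum_divide_distrib distrib_left add_divide_distrib)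
  also have "(\<Sum>k\<le>N. F (x k) * ((\<Sum>l\<le>N. w1 k l) + (\<Sum>l\<le>N. w2 k l)) / 2)
      \<le> (\<Sum>k\<le>N. F (x k) * (p k + p k) / 2)"
    by (intro sum_mono divide_right_mono mult_left_mono add_mono w1 w2 FG) auto
  also have "(\<Sum>l\<le>N. G (x l) * ((\<Sum>k\<le>N. w1 k l) + (\<Sum>k\<le>N. w2 k l)) / 2)
      \<le> (\<Sum>l\<le>N. G (x l) * (q l + q l) / 2)"
    by (intro sum_mono divide_right_mono mult_left_mono add_mono w1 w2 FG) auto
  also have "(\<Sum>k\<le>N. F (x k) * (p k + p k) / 2) = Re (ket_trace S (poly_op (bern K N F) a))"
    unfolding poly_op_bern[OF a'] P_def[symmetric] x_def[symmetric] ket_trace_sum ket_trace_scaleR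
    by (simp add: ket_trace_square[OF P(2)] p_def)
  also have "(\<Sum>l\<le>N. G (x l) * (q l + q l) / 2) = Re (ket_trace S (poly_op (bern K N G) c))"
    unfolding poly_op_bern[OF c'] Q_def[symmetric] x_def[symmetric] ket_trace_sum ket_trace_scaleR
    by (simp add: ket_trace_square[OF Q(2)] q_def)
  finally show ?thesis by simp
qed

lemma trace_inequality:
  assumes a: "posop a" "a \<in> M" "norm a \<le> K" and c: "posop c" "c \<in> M" "norm c \<le> K" and K: "0 < K"
    and u: "u \<in> M" "norm u \<le> 1" and v: "v \<in> M" "norm v \<le> 1"
    and fg: "\<And>s t. 0 \<le> s \<Longrightarrow> s \<le> K \<Longrightarrow> 0 \<le> t \<Longrightarrow> t \<le> K \<Longrightarrow> \<bar>f s * g t\<bar> \<le> F s + G t"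
    and FG: "\<And>s. 0 \<le> F s" "\<And>s. 0 \<le> G s"
    and cont: "continuous_on {0..K} f" "continuous_on {0..K} g" "continuous_on {0..K} F" "continuous_on {0..K} G"
  shows "cmod (ket_trace S (u o\<^sub>L pos_cfc f a o\<^sub>L v o\<^sub>L pos_cfc g c))
    \<le> Re (ket_trace S (pos_cfc F a)) + Re (ket_trace S (pos_cfc G c))"
proof (rule tendsto_le)
  note ta = poly_op_bern_tendsto[OF a(1,3) K] and tc = poly_op_bern_tendsto[OF c(1,3) K]
  show "(\<lambda>N. cmod (ket_trace S (u o\<^sub>L poly_op (bern K N f) a o\<^sub>L v o\<^sub>L poly_op (bern K N g) c)))
      \<longlonglongrightarrow> cmod (ket_trace S (u o\<^sub>L pos_cfc f a o\<^sub>L v o\<^sub>L pos_cfc g c))"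
    by (intro tendsto_norm ket_trace_tendsto op_comp.tendsto tendsto_const ta tc cont)
  show "(\<lambda>N. Re (ket_trace S (poly_op (bern K N F) a)) + Re (ket_trace S (poly_op (bern K N G) c)))
      \<longlonglongrightarrow> Re (ket_trace S (pos_cfc F a)) + Re (ket_trace S (pos_cfc G c))"
    by (intro tendsto_add tendsto_Re ket_trace_tendsto ta tc cont)
  show "\<forall>\<^sub>F N in sequentially. cmod (ket_trace S (u o\<^sub>L poly_op (bern K N f) a o\<^sub>L v o\<^sub>L poly_op (bern K N g) c))
    \<le> Re (ket_trace S (poly_op (bern K N F) a)) + Re (ket_trace S (poly_op (bern K N G) c))"
    by (intro always_eventually allI bernstein_trace_inequality[OF a c K u v fg FG])
qed simp

end

subsection \<open>Regularised polar decomposition\<close>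

text \<open>A regularised inverse of the absolute value. The exact polar part would in general leave
  a norm-closed algebra, whereas this is a continuous function of the absolute value.\<close>

definition polar_inv :: "real \<Rightarrow> 'i op \<Rightarrow> 'i op" where
  "polar_inv e z = pos_cfc (\<lambda>s. 1 / sqrt (s\<^sup>2 + e\<^sup>2)) (abs_op z)"

lemma continuous_on_polar_inv: "0 < e \<Longrightarrow> continuous_on T (\<lambda>s::real. 1 / sqrt (s\<^sup>2 + e\<^sup>2))"
  by (intro continuous_intros) (auto simp: add_nonneg_eq_0_iff)

lemma continuous_on_polar: "continuous_on T (\<lambda>s::real. sqrt (s\<^sup>2 + e\<^sup>2))"
  by (intro continuous_intros)

text \<open>The square of the absolute value of the polar part is s^2/(s^2 + e^2) evaluated at
  \<open>abs_op z\<close>, which is at most 1. The decomposition holds exactly, with the absolute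
  value replaced by its regularisation.\<close>

lemma
  assumes z: "is_adj z z'" and e: "0 < e"
  shows is_adj_polar: "is_adj (z o\<^sub>L polar_inv e z) (polar_inv e z o\<^sub>L z')"
    and norm_polar_le: "norm (z o\<^sub>L polar_inv e z) \<le> 1"
    and polar_decomposition: "z = (z o\<^sub>L polar_inv e z) o\<^sub>L pos_cfc (\<lambda>s. sqrt (s\<^sup>2 + e\<^sup>2)) (abs_op z)"
proof -
  note P = posop_abs_op[OF z] and cR = continuous_on_polar_inv[OF e]
  define R where "R = polar_inv e z"
  have sq: "abs_op z = pos_cfc (\<lambda>s. s) (abs_op z)" using pos_cfc_id[OF P] by simp
  have "is_adj R R" unfolding R_def polar_inv_def by (rule pos_cfc_herm[OF P cR])
  then show adj: "is_adj (z o\<^sub>L polar_inv e z) (polar_inv e z o\<^sub>L z')"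
    unfolding R_def[symmetric] by (rule is_adj_compose[OF z])
  have "(R o\<^sub>L z') o\<^sub>L (z o\<^sub>L R) = R o\<^sub>L (z' o\<^sub>L z) o\<^sub>L R"
    by (simp only: blinfun_compose_assoc)
  also have "\<dots> = (R o\<^sub>L abs_op z) o\<^sub>L (abs_op z o\<^sub>L R)"
    unfolding abs_op_square[OF z, symmetric] by (simp only: blinfun_compose_assoc)
  also have "R o\<^sub>L abs_op z = pos_cfc (\<lambda>s. 1 / sqrt (s\<^sup>2 + e\<^sup>2) * s) (abs_op z)"
    unfolding R_def polar_inv_def
    by (subst (2) sq) (rule pos_cfc_mult[OF P cR continuous_on_id, symmetric])
  also have "abs_op z o\<^sub>L R = pos_cfc (\<lambda>s. s * (1 / sqrt (s\<^sup>2 + e\<^sup>2))) (abs_op z)"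
    unfolding R_def polar_inv_def
    by (subst sq) (rule pos_cfc_mult[OF P continuous_on_id cR, symmetric])
  also have "pos_cfc (\<lambda>s. 1 / sqrt (s\<^sup>2 + e\<^sup>2) * s) (abs_op z) o\<^sub>L pos_cfc (\<lambda>s. s * (1 / sqrt (s\<^sup>2 + e\<^sup>2))) (abs_op z)
     = pos_cfc (\<lambda>s. (1 / sqrt (s\<^sup>2 + e\<^sup>2) * s) * (s * (1 / sqrt (s\<^sup>2 + e\<^sup>2)))) (abs_op z)"
    by (rule pos_cfc_mult[OF P, symmetric]) (intro continuous_on_mult cR continuous_on_id)+
  finally have eq: "(R o\<^sub>L z') o\<^sub>L (z o\<^sub>L R)
      = pos_cfc (\<lambda>s. (1 / sqrt (s\<^sup>2 + e\<^sup>2) * s) * (s * (1 / sqrt (s\<^sup>2 + e\<^sup>2)))) (abs_op z)" .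
  have "norm ((R o\<^sub>L z') o\<^sub>L (z o\<^sub>L R)) \<le> 1"
    unfolding eq
  proof (rule pos_cfc_norm_le[OF P])
    show "continuous_on {0..norm (abs_op z)} (\<lambda>s. (1 / sqrt (s\<^sup>2 + e\<^sup>2) * s) * (s * (1 / sqrt (s\<^sup>2 + e\<^sup>2))))"
      by (intro continuous_on_mult cR continuous_on_id)
    fix s :: real
    have pos: "0 < s\<^sup>2 + e\<^sup>2" using e by (simp add: add_nonneg_pos)
    have "(1 / sqrt (s\<^sup>2 + e\<^sup>2) * s) * (s * (1 / sqrt (s\<^sup>2 + e\<^sup>2))) = s\<^sup>2 / (s\<^sup>2 + e\<^sup>2)"
      using pos by (simp add: power2_eq_square[of s])
    then show "\<bar>(1 / sqrt (s\<^sup>2 + e\<^sup>2) * s) * (s * (1 / sqrt (s\<^sup>2 + e\<^sup>2)))\<bar> \<le> 1"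
      using pos by (simp only: abs_divide) simp
  qed
  then show "norm (z o\<^sub>L polar_inv e z) \<le> 1"
    using is_adj_norm_square[OF adj] by (simp add: R_def abs_square_le_1)
  have "polar_inv e z o\<^sub>L pos_cfc (\<lambda>s. sqrt (s\<^sup>2 + e\<^sup>2)) (abs_op z)
     = pos_cfc (\<lambda>s. 1 / sqrt (s\<^sup>2 + e\<^sup>2) * sqrt (s\<^sup>2 + e\<^sup>2)) (abs_op z)"
    unfolding polar_inv_def by (rule pos_cfc_mult[OF P cR continuous_on_polar, symmetric])
  also have "\<dots> = pos_cfc (\<lambda>s. 1) (abs_op z)"
  proof (rule pos_cfc_cong[OF P])
    show "continuous_on {0..norm (abs_op z)} (\<lambda>s. 1 / sqrt (s\<^sup>2 + e\<^sup>2) * sqrt (s\<^sup>2 + e\<^sup>2))"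
      by (intro continuous_on_mult cR continuous_on_polar)
    fix s :: real
    have "0 < s\<^sup>2 + e\<^sup>2" using e by (simp add: add_nonneg_pos)
    then have "sqrt (s\<^sup>2 + e\<^sup>2) \<noteq> 0" by (metis less_irrefl real_sqrt_eq_zero_cancel_iff)
    then show "1 / sqrt (s\<^sup>2 + e\<^sup>2) * sqrt (s\<^sup>2 + e\<^sup>2) = 1"
      by (metis nonzero_eq_divide_eq)
  qed
  also have "\<dots> = id_blinfun" by (simp add: pos_cfc_const[OF P])
  finally show "z = (z o\<^sub>L polar_inv e z) o\<^sub>L pos_cfc (\<lambda>s. sqrt (s\<^sup>2 + e\<^sup>2)) (abs_op z)"
    by (simp add: blinfun_compose_assoc)
qed

lemma young_powr:
  fixes a b p :: real
  assumes "0 \<le> a" "0 \<le> b" "1 < p"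
  shows "a * b powr (p - 1) \<le> a powr p / p + (1 - 1 / p) * b powr p"
proof -
  define q where "q = p / (p - 1)"
  have "1 < q" "1 / p + 1 / q = 1" using assms by (auto simp: q_def field_simps)
  from Youngs_inequality[OF assms(3) this assms(1), of "b powr (p - 1)"]
  have "a * b powr (p - 1) \<le> a powr p / p + b powr ((p - 1) * q) / q"
    by (simp add: powr_powr)
  moreover have "(p - 1) * q = p" "1 / q = 1 - 1 / p" using assms by (auto simp: q_def field_simps)
  ultimately show ?thesis by (metis mult.commute times_divide_eq_left mult_1 divide_inverse inverse_eq_divide)
qed

lemma sqrt_square_plus_le: "0 \<le> s \<Longrightarrow> 0 \<le> e \<Longrightarrow> s \<le> sqrt (s\<^sup>2 + e\<^sup>2) \<and> sqrt (s\<^sup>2 + e\<^sup>2) \<le> s + e"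
  by (auto intro!: real_le_rsqrt real_le_lsqrt simp: power2_sum)

lemma polar_powr_uniform_limit:
  assumes p: "0 < p"
  shows "uniform_limit {0..K} (\<lambda>n s. (sqrt (s\<^sup>2 + (1 / real (Suc n))\<^sup>2)) powr p) (\<lambda>s. s powr p) sequentially"
proof (rule uniform_limit_compose_uniformly_continuous_on[where B = "{0..K + 1}"
      and f = "\<lambda>s. s powr p" and g' = "\<lambda>s. s"])
  show "uniformly_continuous_on {0..K + 1} (\<lambda>s. s powr p)"
    by (intro compact_uniformly_continuous continuous_on_powr_Icc p compact_Icc)
  show "uniform_limit {0..K} (\<lambda>n s. sqrt (s\<^sup>2 + (1 / real (Suc n))\<^sup>2)) (\<lambda>s. s) sequentially"
  proof (rule metric_uniform_limit_imp_uniform_limit)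
    show "uniform_limit {0..K} (\<lambda>n s. 1 / real (Suc n)) (\<lambda>s. 0) sequentially"
      using LIMSEQ_inverse_real_of_nat
      by (auto simp: uniform_limit_iff tendsto_iff inverse_eq_divide elim: eventually_mono)
    show "\<forall>\<^sub>F n in sequentially. \<forall>s\<in>{0..K}. dist (sqrt (s\<^sup>2 + (1 / real (Suc n))\<^sup>2)) s \<le> dist (1 / real (Suc n)) 0"
    proof (intro always_eventually allI ballI)
      fix n s assume "s \<in> {0..K}"
      then show "dist (sqrt (s\<^sup>2 + (1 / real (Suc n))\<^sup>2)) s \<le> dist (1 / real (Suc n)) 0"
        using sqrt_square_plus_le[of s "1 / real (Suc n)"] by (auto simp: dist_real_def)
    qed
  qed
  show "\<forall>\<^sub>F n in sequentially. \<forall>s\<in>{0..K}. sqrt (s\<^sup>2 + (1 / real (Suc n))\<^sup>2) \<in> {0..K + 1}"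
  proof (intro always_eventually allI ballI)
    fix n s assume s: "s \<in> {0..K}"
    have "1 / real (Suc n) \<le> 1" by simp
    moreover have "0 \<le> sqrt (s\<^sup>2 + (1 / real (Suc n))\<^sup>2)" by (intro real_sqrt_ge_zero add_nonneg_nonneg) auto
    moreover have "sqrt (s\<^sup>2 + (1 / real (Suc n))\<^sup>2) \<le> s + 1 / real (Suc n)"
      using sqrt_square_plus_le[of s "1 / real (Suc n)"] s by (simp only: atLeastAtMost_iff) simp
    ultimately show "sqrt (s\<^sup>2 + (1 / real (Suc n))\<^sup>2) \<in> {0..K + 1}"
      using s unfolding atLeastAtMost_iff by linarith
  qed
qed simp

text \<open>With h = sqrt(s^2 + e^2) the error is s^(p-1) (s/h) (h - s), and s \<le> h \<le> s + e.
  So it is at most e times the maximum of s^(p-1).\<close>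

lemma polar_dual_uniform_limit:
  assumes p: "1 < p"
  shows "uniform_limit {0..K} (\<lambda>n s. s powr (p - 1) * (1 / sqrt (s\<^sup>2 + (1 / real (Suc n))\<^sup>2) * (s * s)))
    (\<lambda>s. s powr p) sequentially"
proof (rule metric_uniform_limit_imp_uniform_limit)
  define C where "C = (max K 0) powr (p - 1)"
  have "(\<lambda>n. C * (1 / real (Suc n))) \<longlonglongrightarrow> C * 0"
    using LIMSEQ_inverse_real_of_nat by (intro tendsto_mult tendsto_const) (simp add: inverse_eq_divide)
  then show "uniform_limit {0..K} (\<lambda>n s. C * (1 / real (Suc n))) (\<lambda>s. 0) sequentially"
    by (auto simp: uniform_limit_iff tendsto_iff elim: eventually_mono)
  show "\<forall>\<^sub>F n in sequentially. \<forall>s\<in>{0..K}.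
     dist (s powr (p - 1) * (1 / sqrt (s\<^sup>2 + (1 / real (Suc n))\<^sup>2) * (s * s))) (s powr p)
       \<le> dist (C * (1 / real (Suc n))) 0"
  proof (intro always_eventually allI ballI)
    fix n s assume s: "s \<in> {0..K}"
    define e where "e = 1 / real (Suc n)"
    define h where "h = sqrt (s\<^sup>2 + e\<^sup>2)"
    have e: "e > 0" by (simp add: e_def)
    have h: "s \<le> h" "h \<le> s + e" "h > 0"
      using sqrt_square_plus_le[of s e] s e by (auto simp: h_def add_nonneg_pos)
    have sp: "s powr p = s powr (p - 1) * s"
      using s p powr_mult_base[of s "p - 1"] by (cases "s = 0") (auto simp: mult.commute)
    have "s powr (p - 1) * (1 / h * (s * s)) - s powr p = - (s powr (p - 1) * ((s / h) * (h - s)))"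
      using h(3) by (simp add: sp field_simps)
    then have "\<bar>s powr (p - 1) * (1 / h * (s * s)) - s powr p\<bar> = s powr (p - 1) * ((s / h) * (h - s))"
      using s h by (simp add: abs_mult)
    also have "\<dots> \<le> C * (1 * e)"
      unfolding C_def using s h p by (intro mult_mono powr_mono2) (auto simp: divide_simps)
    finally show "dist (s powr (p - 1) * (1 / sqrt (s\<^sup>2 + (1 / real (Suc n))\<^sup>2) * (s * s))) (s powr p)
       \<le> dist (C * (1 / real (Suc n))) 0"
      by (simp add: dist_real_def h_def e_def C_def abs_mult)
  qed
qed

subsection \<open>Convexity of the trace power functional\<close>

definition trace_power :: "'i set \<Rightarrow> real \<Rightarrow> 'i op \<Rightarrow> real" where
  "trace_power S p x = Re (ket_trace S (abs_powr x p))"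

lemma trace_pnorm_eq: "trace_pnorm (ket_trace S) p x = trace_power S p x powr (1 / p)"
  by (simp add: trace_pnorm_def trace_power_def)

lemma trace_power_nonneg: "is_adj x y \<Longrightarrow> 0 < p \<Longrightarrow> 0 \<le> trace_power S p x"
  unfolding trace_power_def by (intro posop_ket_trace_nonneg posop_abs_powr)

lemma trace_power_scaleC:
  "is_adj x y \<Longrightarrow> 0 < p \<Longrightarrow> trace_power S p (c *\<^sub>C x) = cmod c powr p * trace_power S p x"
  by (simp add: trace_power_def abs_powr_scaleC ket_trace_scaleR)

lemma scaleR_eq_scaleC: "r *\<^sub>R A = complex_of_real r *\<^sub>C A"
  by (simp add: scalar_op_of_real op_comp.scaleR_left)

lemma trace_power_scaleR:
  "is_adj x y \<Longrightarrow> 0 < p \<Longrightarrow> trace_power S p (r *\<^sub>R x) = \<bar>r\<bar> powr p * trace_power S p x"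
  by (simp only: scaleR_eq_scaleC trace_power_scaleC norm_of_real)

context tracial_algebra
begin

lemma abs_op_mem: "x \<in> M \<Longrightarrow> abs_op x \<in> M"
  using adj_mem[of x] abs_op_eq[of x] by (auto intro!: cfc_mem posop_square comp_mem continuous_on_sqrt)

lemma posop_abs_op': "x \<in> M \<Longrightarrow> posop (abs_op x)"
  using adj_mem[of x] posop_abs_op by blast

text \<open>The second factor is the element dual to \<open>z\<close>: the power p - 1 of its
  absolute value times the adjoint of its polar part. Writing \<open>x\<close> as polar part times
  regularised absolute value and cycling leaves two functions separated by contractions, and the
  trace inequality turns Young's inequality for numbers into the claim.\<close>

lemma trace_duality_regularised:
  assumes x: "x \<in> M" and z: "z \<in> M" "z' \<in> M" "is_adj z z'" and p: "1 < p" and d: "0 < d" and e: "0 < e"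
  shows "cmod (ket_trace S (x o\<^sub>L (pos_cfc (\<lambda>s. s powr (p - 1)) (abs_op z) o\<^sub>L (polar_inv d z o\<^sub>L z'))))
    \<le> Re (ket_trace S (pos_cfc (\<lambda>s. (sqrt (s\<^sup>2 + e\<^sup>2)) powr p) (abs_op x))) / p
      + (1 - 1 / p) * trace_power S p z"
proof -
  obtain x' where x': "x' \<in> M" "is_adj x x'" using adj_mem[OF x] by auto
  \<comment> \<open>One interval for both absolute values; the 1 keeps it nondegenerate.\<close>
  define K where "K = norm x + norm z + 1"
  define f where "f = pos_cfc (\<lambda>s. sqrt (s\<^sup>2 + e\<^sup>2)) (abs_op x)"
  define g where "g = pos_cfc (\<lambda>s. s powr (p - 1)) (abs_op z)"
  define u where "u = polar_inv d z o\<^sub>L z'"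
  define w where "w = x o\<^sub>L polar_inv e x"
  have px: "posop (abs_op x)" "abs_op x \<in> M" "norm (abs_op x) \<le> K"
    using posop_abs_op' abs_op_mem norm_abs_op[OF x'(2)] x by (auto simp: K_def)
  have pz: "posop (abs_op z)" "abs_op z \<in> M" "norm (abs_op z) \<le> K"
    using posop_abs_op' abs_op_mem norm_abs_op[OF z(3)] z by (auto simp: K_def)
  have "0 < K" by (simp add: K_def add_nonneg_pos)
  have p1: "0 < p - 1" "0 < p" using p by auto
  have um: "u \<in> M" "norm u \<le> 1"
    unfolding u_def using is_adj_norm[OF is_adj_polar[OF z(3) d]] norm_polar_le[OF z(3) d] pz z
    by (auto simp: polar_inv_def intro!: comp_mem cfc_mem continuous_on_polar_inv d)
  have wm: "w \<in> M" "norm w \<le> 1"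
    unfolding w_def using norm_polar_le[OF x'(2) e] px x
    by (auto simp: polar_inv_def intro!: comp_mem cfc_mem continuous_on_polar_inv e)
  have fm: "f \<in> M" unfolding f_def by (intro cfc_mem px continuous_on_polar)
  have gm: "g \<in> M" unfolding g_def by (intro cfc_mem pz continuous_on_powr_Icc p1)
  have "ket_trace S (x o\<^sub>L (g o\<^sub>L u)) = ket_trace S ((w o\<^sub>L f o\<^sub>L g) o\<^sub>L u)"
    using polar_decomposition[OF x'(2) e] by (simp add: w_def f_def blinfun_compose_assoc)
  also have "\<dots> = ket_trace S (u o\<^sub>L (w o\<^sub>L f o\<^sub>L g))"
    by (intro trace_comm comp_mem wm fm gm um)
  also have "\<dots> = ket_trace S ((u o\<^sub>L w) o\<^sub>L f o\<^sub>L id_blinfun o\<^sub>L g)"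
    by (simp add: blinfun_compose_assoc)
  finally have eq: "ket_trace S (x o\<^sub>L (g o\<^sub>L u)) = ket_trace S ((u o\<^sub>L w) o\<^sub>L f o\<^sub>L id_blinfun o\<^sub>L g)" .
  have "norm (u o\<^sub>L w) \<le> 1"
    using norm_blinfun_compose[of u w] um(2) wm(2) by (meson mult_le_one norm_ge_zero order.trans)
  then have "cmod (ket_trace S (x o\<^sub>L (g o\<^sub>L u)))
      \<le> Re (ket_trace S (pos_cfc (\<lambda>s. 1 / p * (sqrt (s\<^sup>2 + e\<^sup>2)) powr p) (abs_op x)))
       + Re (ket_trace S (pos_cfc (\<lambda>t. (1 - 1 / p) * t powr p) (abs_op z)))"
    unfolding eq unfolding f_def g_def
  proof (intro trace_inequality[OF px pz \<open>0 < K\<close> comp_mem[OF um(1) wm(1)]] id_mem)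
    fix s t :: real assume "0 \<le> s" "s \<le> K" "0 \<le> t" "t \<le> K"
    then show "\<bar>sqrt (s\<^sup>2 + e\<^sup>2) * t powr (p - 1)\<bar> \<le> 1 / p * sqrt (s\<^sup>2 + e\<^sup>2) powr p + (1 - 1 / p) * t powr p"
      using young_powr[of "sqrt (s\<^sup>2 + e\<^sup>2)" t p] p by (simp add: abs_mult)
  next
    show "continuous_on {0..K} (\<lambda>s. 1 / p * sqrt (s\<^sup>2 + e\<^sup>2) powr p)"
      using e p by (intro continuous_intros continuous_on_powr') (auto simp: add_nonneg_eq_0_iff)
  qed (use p in \<open>auto intro!: continuous_on_polar continuous_on_powr_Icc continuous_on_mult continuous_on_const\<close>)
  moreover have "pos_cfc (\<lambda>s. 1 / p * (sqrt (s\<^sup>2 + e\<^sup>2)) powr p) (abs_op x)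
      = (1 / p) *\<^sub>R pos_cfc (\<lambda>s. (sqrt (s\<^sup>2 + e\<^sup>2)) powr p) (abs_op x)"
    by (rule pos_cfc_scale[OF px(1)])
      (use e in \<open>intro continuous_intros continuous_on_powr'; auto simp: add_nonneg_eq_0_iff\<close>)
  moreover have "pos_cfc (\<lambda>t. (1 - 1 / p) * t powr p) (abs_op z) = (1 - 1 / p) *\<^sub>R abs_powr z p"
    unfolding abs_powr_def by (rule pos_cfc_scale[OF pz(1) continuous_on_powr_Icc[OF p1(2)]])
  ultimately show ?thesis
    unfolding g_def u_def by (simp only: ket_trace_scaleR trace_power_def) simp
qed

text \<open>The regularisation of \<open>x\<close> is sent to 0 while that of \<open>z\<close> stays
  fixed, so the bound holds for the same dual element used in the attainment statement.\<close>

lemma trace_duality: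
  assumes x: "x \<in> M" and z: "z \<in> M" "z' \<in> M" "is_adj z z'" and p: "1 < p" and d: "0 < d"
  shows "cmod (ket_trace S (x o\<^sub>L (pos_cfc (\<lambda>s. s powr (p - 1)) (abs_op z) o\<^sub>L (polar_inv d z o\<^sub>L z'))))
    \<le> trace_power S p x / p + (1 - 1 / p) * trace_power S p z"
proof (rule tendsto_lowerbound)
  show "(\<lambda>n. Re (ket_trace S (pos_cfc (\<lambda>s. (sqrt (s\<^sup>2 + (1 / real (Suc n))\<^sup>2)) powr p) (abs_op x))) / p
      + (1 - 1 / p) * trace_power S p z) \<longlonglongrightarrow> trace_power S p x / p + (1 - 1 / p) * trace_power S p z"
    unfolding trace_power_def[of S p x] abs_powr_def
  proof (intro tendsto_add tendsto_divide tendsto_Re ket_trace_tendsto tendsto_const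
      pos_cfc_uniform_tendsto posop_abs_op' x polar_powr_uniform_limit continuous_on_powr_Icc)
    fix n :: nat
    show "continuous_on {0..norm (abs_op x)} (\<lambda>s. sqrt (s\<^sup>2 + (1 / real (Suc n))\<^sup>2) powr p)"
      by (intro continuous_on_powr' continuous_on_polar continuous_on_const)
        (auto simp: add_nonneg_eq_0_iff simp del: of_nat_Suc)
  qed (use p in auto)
  show "\<forall>\<^sub>F n in sequentially.
     cmod (ket_trace S (x o\<^sub>L (pos_cfc (\<lambda>s. s powr (p - 1)) (abs_op z) o\<^sub>L (polar_inv d z o\<^sub>L z'))))
     \<le> Re (ket_trace S (pos_cfc (\<lambda>s. (sqrt (s\<^sup>2 + (1 / real (Suc n))\<^sup>2)) powr p) (abs_op x))) / p
      + (1 - 1 / p) * trace_power S p z"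
    by (intro always_eventually allI trace_duality_regularised x z p d) simp
qed simp

text \<open>Cycling \<open>z\<close> to the end produces the square of its absolute value, so the
  pairing is the trace of a function of \<open>abs_op z\<close> alone, and these functions converge
  uniformly to s^p.\<close>

lemma trace_duality_attained:
  assumes z: "z \<in> M" "z' \<in> M" "is_adj z z'" and p: "1 < p"
  shows "(\<lambda>n. Re (ket_trace S (z o\<^sub>L (pos_cfc (\<lambda>s. s powr (p - 1)) (abs_op z)
      o\<^sub>L (polar_inv (1 / real (Suc n)) z o\<^sub>L z'))))) \<longlonglongrightarrow> trace_power S p z"
proof -
  note P = posop_abs_op[OF z(3)]
  have p1: "0 < p - 1" "0 < p" using p by auto
  define k where "k n s = s powr (p - 1) * (1 / sqrt (s\<^sup>2 + (1 / real (Suc n))\<^sup>2) * (s * s))" for n and s :: real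
  have ck: "continuous_on {0..norm (abs_op z)} (k n)" for n
    unfolding k_def by (intro continuous_on_mult continuous_on_powr_Icc p1 continuous_on_polar_inv continuous_on_id) simp
  have "ket_trace S (z o\<^sub>L (pos_cfc (\<lambda>s. s powr (p - 1)) (abs_op z)
      o\<^sub>L (polar_inv (1 / real (Suc n)) z o\<^sub>L z'))) = ket_trace S (pos_cfc (k n) (abs_op z))" for n
  proof -
    define e where "e = 1 / real (Suc n)"
    have e: "0 < e" by (simp add: e_def)
    define g where "g = pos_cfc (\<lambda>s. s powr (p - 1)) (abs_op z)"
    have gm: "g \<in> M" unfolding g_def by (intro cfc_mem P abs_op_mem z continuous_on_powr_Icc p1)
    have rm: "polar_inv e z \<in> M"
      unfolding polar_inv_def by (intro cfc_mem P abs_op_mem z continuous_on_polar_inv e)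
    have "pos_cfc (k n) (abs_op z)
        = g o\<^sub>L pos_cfc (\<lambda>s. 1 / sqrt (s\<^sup>2 + e\<^sup>2) * (s * s)) (abs_op z)"
      unfolding k_def g_def e_def[symmetric]
      by (rule pos_cfc_mult[OF P])
        (intro continuous_on_mult continuous_on_powr_Icc p1 continuous_on_polar_inv continuous_on_id e)+
    also have "pos_cfc (\<lambda>s. 1 / sqrt (s\<^sup>2 + e\<^sup>2) * (s * s)) (abs_op z)
        = polar_inv e z o\<^sub>L pos_cfc (\<lambda>s. s * s) (abs_op z)"
      unfolding polar_inv_def
      by (rule pos_cfc_mult[OF P])
        (intro continuous_on_mult continuous_on_polar_inv continuous_on_id e)+
    also have "pos_cfc (\<lambda>s. s * s) (abs_op z) = z' o\<^sub>L z"
      using pos_cfc_mult[OF P continuous_on_id continuous_on_id] abs_op_square[OF z(3)]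
      by (simp add: pos_cfc_id[OF P])
    finally have "ket_trace S (pos_cfc (k n) (abs_op z)) = ket_trace S ((g o\<^sub>L (polar_inv e z o\<^sub>L z')) o\<^sub>L z)"
      by (simp only: blinfun_compose_assoc)
    also have "\<dots> = ket_trace S (z o\<^sub>L (g o\<^sub>L (polar_inv e z o\<^sub>L z')))"
      by (intro trace_comm comp_mem gm rm z)
    finally show ?thesis by (simp add: g_def e_def)
  qed
  moreover have "(\<lambda>n. Re (ket_trace S (pos_cfc (k n) (abs_op z)))) \<longlonglongrightarrow> trace_power S p z"
    unfolding trace_power_def abs_powr_def
    by (intro tendsto_Re ket_trace_tendsto pos_cfc_uniform_tendsto P ck continuous_on_powr_Icc p1)
      (unfold k_def, rule polar_dual_uniform_limit[OF p])
  ultimately show ?thesis by simp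
qed

text \<open>A supporting-functional argument: pairing with the dual element of \<open>z\<close> is
  linear, tends to the full value at \<open>z\<close> itself, and is bounded at \<open>x\<close> and
  \<open>y\<close> by duality. The terms with factor 1 - 1/p cancel against part of the left
  side.\<close>

lemma trace_power_convex:
  assumes x: "x \<in> M" and y: "y \<in> M" and p: "1 < p" and t: "0 \<le> t" "t \<le> 1"
  shows "trace_power S p (t *\<^sub>R x + (1 - t) *\<^sub>R y) \<le> t * trace_power S p x + (1 - t) * trace_power S p y"
proof -
  define z where "z = t *\<^sub>R x + (1 - t) *\<^sub>R y"
  have zm: "z \<in> M" unfolding z_def by (intro add_mem scaleR_mem x y)
  obtain z' where z': "z' \<in> M" "is_adj z z'" using adj_mem[OF zm] by auto
  define \<Phi> where "\<Phi> = trace_power S p"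
  have "\<Phi> z \<le> t * (\<Phi> x / p + (1 - 1 / p) * \<Phi> z) + (1 - t) * (\<Phi> y / p + (1 - 1 / p) * \<Phi> z)"
  proof (rule tendsto_upperbound)
    show "(\<lambda>n. Re (ket_trace S (z o\<^sub>L (pos_cfc (\<lambda>s. s powr (p - 1)) (abs_op z)
      o\<^sub>L (polar_inv (1 / real (Suc n)) z o\<^sub>L z'))))) \<longlonglongrightarrow> \<Phi> z"
      unfolding \<Phi>_def by (rule trace_duality_attained[OF zm z' p])
    have "Re (ket_trace S (z o\<^sub>L W)) \<le> t * (\<Phi> x / p + (1 - 1 / p) * \<Phi> z) + (1 - t) * (\<Phi> y / p + (1 - 1 / p) * \<Phi> z)"
      if "W = pos_cfc (\<lambda>s. s powr (p - 1)) (abs_op z) o\<^sub>L (polar_inv (1 / real (Suc n)) z o\<^sub>L z')" for n W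
    proof -
      have bound: "Re (ket_trace S (v o\<^sub>L W)) \<le> \<Phi> v / p + (1 - 1 / p) * \<Phi> z" if "v \<in> M" for v
        using trace_duality[OF that zm z' p, of "1 / real (Suc n)"] complex_Re_le_cmod
        unfolding \<open>W = _\<close> \<Phi>_def by (meson order.trans divide_pos_pos zero_less_one of_nat_0_less_iff zero_less_Suc)
      have "z o\<^sub>L W = t *\<^sub>R (x o\<^sub>L W) + (1 - t) *\<^sub>R (y o\<^sub>L W)"
        unfolding z_def by (simp only: op_comp.add_left op_comp.scaleR_left)
      then have "Re (ket_trace S (z o\<^sub>L W)) = t * Re (ket_trace S (x o\<^sub>L W)) + (1 - t) * Re (ket_trace S (y o\<^sub>L W))"
        by (simp only: ket_trace_add ket_trace_scaleR) simp
      also have "\<dots> \<le> t * (\<Phi> x / p + (1 - 1 / p) * \<Phi> z) + (1 - t) * (\<Phi> y / p + (1 - 1 / p) * \<Phi> z)"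
        by (intro add_mono mult_left_mono bound x y) (use t in auto)
      finally show ?thesis .
    qed
    then show "\<forall>\<^sub>F n in sequentially. Re (ket_trace S (z o\<^sub>L (pos_cfc (\<lambda>s. s powr (p - 1)) (abs_op z)
      o\<^sub>L (polar_inv (1 / real (Suc n)) z o\<^sub>L z'))))
      \<le> t * (\<Phi> x / p + (1 - 1 / p) * \<Phi> z) + (1 - t) * (\<Phi> y / p + (1 - 1 / p) * \<Phi> z)"
      by simp
  qed simp
  then have "\<Phi> z / p \<le> (t * \<Phi> x + (1 - t) * \<Phi> y) / p"
    by (simp add: algebra_simps add_divide_distrib diff_divide_distrib)
  then show ?thesis using p by (simp add: \<Phi>_def z_def divide_le_cancel)
qed

abbreviation pnorm :: "real \<Rightarrow> 'i op \<Rightarrow> real" where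
  "pnorm \<equiv> trace_pnorm (ket_trace S)"

lemma pnorm_nonneg: "0 \<le> pnorm p x"
  by (simp add: trace_pnorm_eq)

lemma pnorm_scaleC:
  assumes "x \<in> M" "1 < p" shows "pnorm p (c *\<^sub>C x) = cmod c * pnorm p x"
proof -
  obtain x' where x': "is_adj x x'" using adj_mem[OF assms(1)] by auto
  show ?thesis
    using trace_power_nonneg[OF x', of p S] assms(2)
    by (simp add: trace_pnorm_eq trace_power_scaleC[OF x'] powr_mult powr_powr)
qed

text \<open>The usual passage from convexity to subadditivity of a homogeneous functional:
  \<open>x + y\<close> is \<open>a + b\<close> times a convex combination of rescaled summands in
  the unit ball.\<close>

theorem pnorm_triangle:
  assumes x: "x \<in> M" and y: "y \<in> M" and p: "1 < p"
  shows "pnorm p (x + y) \<le> pnorm p x + pnorm p y"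
proof (rule field_le_epsilon)
  fix e :: real assume e: "0 < e"
  obtain x' y' where adj: "is_adj x x'" "is_adj y y'" using adj_mem x y by meson
  \<comment> \<open>The surplus \<open>e / 2\<close> makes the scaling factor positive even when the
    norm is 0.\<close>
  define a where "a = pnorm p x + e / 2"
  define b where "b = pnorm p y + e / 2"
  have ab: "a > 0" "b > 0" using e pnorm_nonneg[of p] by (auto simp: a_def b_def add_nonneg_pos)
  have p0: "0 < p" using p by simp
  have le1: "trace_power S p ((1 / c) *\<^sub>R v) \<le> 1"
    if "is_adj v v'" "pnorm p v \<le> c" "c > 0" for v v' c
  proof -
    have "pnorm p v powr p \<le> c powr p"
      using that p0 pnorm_nonneg by (intro powr_mono2) auto
    moreover have "pnorm p v powr p = trace_power S p v"
      using trace_power_nonneg[OF that(1) p0, of S] p0 by (simp add: trace_pnorm_eq powr_powr)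
    ultimately have "trace_power S p v \<le> c powr p" by simp
    then show ?thesis
      using that p0 by (simp add: trace_power_scaleR[OF that(1) p0] powr_divide divide_simps)
  qed
  define t where "t = a / (a + b)"
  have t: "0 \<le> t" "t \<le> 1" "1 - t = b / (a + b)" using ab by (auto simp: t_def field_simps)
  define v where "v = t *\<^sub>R ((1 / a) *\<^sub>R x) + (1 - t) *\<^sub>R ((1 / b) *\<^sub>R y)"
  have "trace_power S p v \<le> t * trace_power S p ((1 / a) *\<^sub>R x) + (1 - t) * trace_power S p ((1 / b) *\<^sub>R y)"
    unfolding v_def by (intro trace_power_convex scaleR_mem x y p t)
  also have "\<dots> \<le> t * 1 + (1 - t) * 1"
    by (intro add_mono mult_left_mono le1[OF adj(1)] le1[OF adj(2)])
      (use t e ab in \<open>auto simp: a_def b_def\<close>)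
  finally have v1: "trace_power S p v \<le> 1" by simp
  have "x + y = (a + b) *\<^sub>R v"
    using ab t(3) by (simp add: v_def t_def scaleR_add_right)
  moreover have "is_adj v (t *\<^sub>R ((1 / a) *\<^sub>R x') + (1 - t) *\<^sub>R ((1 / b) *\<^sub>R y'))"
    unfolding v_def by (intro is_adj_add is_adj_scaleR adj)
  ultimately have "trace_power S p (x + y) = (a + b) powr p * trace_power S p v"
    and nn: "0 \<le> trace_power S p (x + y)"
    using ab p0 by (simp_all add: trace_power_scaleR trace_power_nonneg)
  then have "trace_power S p (x + y) \<le> (a + b) powr p"
    using v1 by (simp add: mult_left_le)
  then have "pnorm p (x + y) \<le> ((a + b) powr p) powr (1 / p)"
    unfolding trace_pnorm_eq using nn p0 by (intro powr_mono2) auto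
  also have "\<dots> = a + b" using ab p0 by (simp add: powr_powr)
  finally show "pnorm p (x + y) \<le> pnorm p x + pnorm p y + e" by (simp add: a_def b_def)
qed

end

lemma ket_trace_pnorm_le:
  assumes "finite S" "is_adj x y" "0 < p"
  shows "trace_pnorm (ket_trace S) p x \<le> real (card S) powr (1 / p) * norm x"
proof -
  have "trace_power S p x \<le> real (card S) * norm (abs_powr x p)"
    unfolding trace_power_def using cmod_ket_trace_le[OF assms(1)] complex_Re_le_cmod by (rule order.trans[rotated])
  also have "\<dots> \<le> real (card S) * norm x powr p"
    by (intro mult_left_mono abs_powr_norm_le[OF assms(2,3)]) simp
  finally have "trace_power S p x powr (1 / p) \<le> (real (card S) * norm x powr p) powr (1 / p)"
    using trace_power_nonneg[OF assms(2,3)] assms(3) by (intro powr_mono2) auto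
  also have "\<dots> = real (card S) powr (1 / p) * norm x"
    using assms(3) by (simp add: powr_mult powr_powr)
  finally show ?thesis by (simp add: trace_pnorm_eq)
qed

section \<open>The commutant of the right translations\<close>

text \<open>Weighted permutation operators serve for the right translations and for the diagonal
  unitaries of the dual action. The formula has its meaning for injective \<open>g\<close> and
  unimodular weights.\<close>

definition wperm :: "('i \<Rightarrow> complex) \<Rightarrow> ('i \<Rightarrow> 'i) \<Rightarrow> 'i op" where
  "wperm w g = Blinfun (\<lambda>x. Abs_ell2 (\<lambda>i. w i * coord x (g i)))"

lemma coord_wperm:
  assumes "inj g" "\<And>i. cmod (w i) = 1"
  shows "coord (blinfun_apply (wperm w g) x) i = w i * coord x (g i)"
proof -
  define f where "f x = Abs_ell2 (\<lambda>i. w i * coord x (g i))" for x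
  have "sq_summable (\<lambda>i. w i * coord x (g i))" for x
    by (rule sq_summable_reindex[where x = "coord x" and g = g and S = UNIV and c = 1])
      (use coord[of x] assms in \<open>simp_all add: norm_mult\<close>)
  then have f: "coord (f x) i = w i * coord x (g i)" for x i
    by (simp add: f_def Abs_ell2_inverse)
  have "bounded_linear f"
    by (rule bounded_linear_ell2I[where g = g and S = UNIV and c = 1])
      (auto simp: f assms norm_mult algebra_simps)
  then have "blinfun_apply (wperm w g) = f"
    unfolding wperm_def f_def by (rule bounded_linear_Blinfun_apply)
  then show ?thesis by (simp add: f)
qed

lemma is_adj_wperm:
  assumes g: "\<And>i. h (g i) = i" "\<And>i. g (h i) = i" and w: "\<And>i. cmod (w i) = 1"
  shows "is_adj (wperm w g) (wperm (\<lambda>i. cnj (w (h i))) h)"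
  unfolding is_adj_def
proof (intro allI)
  fix x y :: "'a ell2"
  have inj: "inj g" "inj h" using g by (metis injI)+
  have bij: "bij_betw h UNIV UNIV" by (rule bij_betwI[where g = g]) (auto simp: g)
  from infsum_reindex_bij_betw[OF bij, of "\<lambda>i. cnj (w i * coord x (g i)) * coord y i"]
  show "cinner (blinfun_apply (wperm w g) x) y = cinner x (blinfun_apply (wperm (\<lambda>i. cnj (w (h i))) h) y)"
    by (simp add: cinner_def coord_wperm inj w g mult_ac)
qed

lemma wperm_unitary:
  assumes g: "\<And>i. h (g i) = i" "\<And>i. g (h i) = i" and w: "\<And>i. cmod (w i) = 1"
  shows "wperm w g o\<^sub>L wperm (\<lambda>i. cnj (w (h i))) h = id_blinfun"
    and "wperm (\<lambda>i. cnj (w (h i))) h o\<^sub>L wperm w g = id_blinfun"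
proof -
  have inj: "inj g" "inj h" using g by (metis injI)+
  have ww: "w i * cnj (w i) = 1" for i using complex_norm_square[of "w i"] w[of i] by simp
  then have ww': "w i * (cnj (w i) * z) = z" "cnj (w i) * (w i * z) = z" for i z
    using mult.assoc[of "w i" "cnj (w i)" z] mult.assoc[of "cnj (w i)" "w i" z] mult.commute[of "w i" "cnj (w i)"]
    by simp_all
  show "wperm w g o\<^sub>L wperm (\<lambda>i. cnj (w (h i))) h = id_blinfun"
    "wperm (\<lambda>i. cnj (w (h i))) h o\<^sub>L wperm w g = id_blinfun"
    by (intro blinfun_eqI ell2_eqI; simp add: coord_wperm inj w g ww')+
qed

section \<open>Unitary operators and right translations\<close>

definition unitary_op :: "'i op \<Rightarrow> bool" where
  "unitary_op A \<longleftrightarrow> (\<exists>B. is_adj A B \<and> B o\<^sub>L A = id_blinfun \<and> A o\<^sub>L B = id_blinfun)"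

lemma unitary_op_norm:
  assumes "unitary_op A" shows "norm A = 1"
proof -
  have "(norm A)\<^sup>2 = 1\<^sup>2"
    using assms is_adj_norm_square[of A] unfolding unitary_op_def by fastforce
  then show ?thesis by (rule power2_eq_imp_eq) auto
qed

lemma unitary_op_compose: "unitary_op A \<Longrightarrow> unitary_op B \<Longrightarrow> unitary_op (A o\<^sub>L B)"
  unfolding unitary_op_def
proof safe
  fix A' B' assume *: "is_adj A A'" "A' o\<^sub>L A = id_blinfun" "A o\<^sub>L A' = id_blinfun"
    "is_adj B B'" "B' o\<^sub>L B = id_blinfun" "B o\<^sub>L B' = id_blinfun"
  have "(B' o\<^sub>L A') o\<^sub>L (A o\<^sub>L B) = B' o\<^sub>L (A' o\<^sub>L A) o\<^sub>L B" "(A o\<^sub>L B) o\<^sub>L (B' o\<^sub>L A') = A o\<^sub>L (B o\<^sub>L B') o\<^sub>L A'"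
    by (simp_all only: blinfun_compose_assoc)
  with * is_adj_compose[of A A' B B'] show "\<exists>C. is_adj (A o\<^sub>L B) C \<and> C o\<^sub>L (A o\<^sub>L B) = id_blinfun \<and> A o\<^sub>L B o\<^sub>L C = id_blinfun"
    by (metis blinfun_compose_id(1))
qed

lemma unitary_op_id: "unitary_op id_blinfun"
  unfolding unitary_op_def by (intro exI[of _ id_blinfun] conjI is_adj_id blinfun_compose_id)

text \<open>The bilinear form of the strictly lower triangular part of \<theta>. The phases of the
  generators and of the right translations are both its values, so that left and right translations
  commute by bilinearity.\<close>

definition lower_form :: "'n::{finite,linorder} rmat \<Rightarrow> 'n ivec \<Rightarrow> 'n ivec \<Rightarrow> real" where
  "lower_form \<theta> x y = (\<Sum>j\<in>UNIV. \<Sum>l | l < j. \<theta> $ j $ l * real_of_int (x $ j) * real_of_int (y $ l))"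

lemma lower_form_simps:
  "lower_form \<theta> (x + x') y = lower_form \<theta> x y + lower_form \<theta> x' y"
  "lower_form \<theta> (x - x') y = lower_form \<theta> x y - lower_form \<theta> x' y"
  "lower_form \<theta> x (y + y') = lower_form \<theta> x y + lower_form \<theta> x y'"
  "lower_form \<theta> x (y - y') = lower_form \<theta> x y - lower_form \<theta> x y'"
  "lower_form \<theta> (- x) y = - lower_form \<theta> x y" "lower_form \<theta> x (- y) = - lower_form \<theta> x y"
  "lower_form \<theta> 0 y = 0" "lower_form \<theta> x 0 = 0"
  by (simp_all add: lower_form_def algebra_simps sum.distrib sum_subtractf sum_negf)

lemma torus_phase_lower_form: "torus_phase \<theta> j m = cis (2 * pi * lower_form \<theta> (axis j 1) m)"
proof -
  have "lower_form \<theta> (axis j 1) m = (\<Sum>i\<in>{j}. \<Sum>l | l < i. \<theta> $ i $ l * real_of_int (axis j 1 $ i) * real_of_int (m $ l))"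
    unfolding lower_form_def by (rule sum.mono_neutral_right) (auto simp: axis_def)
  then show ?thesis by (simp add: torus_phase_def axis_def)
qed

text \<open>The right translation \<open>R\<^sub>k\<close> maps \<open>e\<^sub>m\<close> to \<open>\<chi>\<^sub>k(m) e\<^bsub>m+k\<^esub>\<close>; the phase \<open>\<chi>\<^sub>k\<close> is the
  one that makes it commute with all \<open>U\<^sub>j\<close>.\<close>

definition right_phase :: "'n::{finite,linorder} rmat \<Rightarrow> 'n ivec \<Rightarrow> 'n ivec \<Rightarrow> complex" where
  "right_phase \<theta> k m = cis (2 * pi * lower_form \<theta> m k)"

definition right_shift :: "'n::{finite,linorder} rmat \<Rightarrow> 'n ivec \<Rightarrow> 'n ivec op" where
  "right_shift \<theta> k = wperm (\<lambda>m. right_phase \<theta> k (m - k)) (\<lambda>m. m - k)"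

lemma inj_minus_ivec: "inj (\<lambda>m :: 'n::finite ivec. m - k)"
  by (rule injI) simp

lemma coord_right_shift:
  "coord (blinfun_apply (right_shift \<theta> k) x) m = right_phase \<theta> k (m - k) * coord x (m - k)"
  unfolding right_shift_def by (subst coord_wperm[OF inj_minus_ivec]) (auto simp: right_phase_def)

lemma right_shift_ket_0: "blinfun_apply (right_shift \<theta> k) (ket 0) = ket k"
  by (rule ell2_eqI) (simp add: coord_right_shift coord_ket right_phase_def lower_form_simps)

lemma right_shift_unitary:
  obtains R where "is_adj (right_shift \<theta> k) R" "R o\<^sub>L right_shift \<theta> k = id_blinfun"
    "right_shift \<theta> k o\<^sub>L R = id_blinfun"
proof
  define h :: "'a ivec \<Rightarrow> 'a ivec" where "h m = m + k" for m
  define w where "w m = right_phase \<theta> k (m - k)" for m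
  have "h (m - k) = m" "h m - k = m" "cmod (w m) = 1" for m
    by (simp_all add: h_def w_def right_phase_def)
  from is_adj_wperm[of h "\<lambda>m. m - k" w, OF this] wperm_unitary[of h "\<lambda>m. m - k" w, OF this]
  show "is_adj (right_shift \<theta> k) (wperm (\<lambda>m. cnj (w (h m))) h)"
    "wperm (\<lambda>m. cnj (w (h m))) h o\<^sub>L right_shift \<theta> k = id_blinfun"
    "right_shift \<theta> k o\<^sub>L wperm (\<lambda>m. cnj (w (h m))) h = id_blinfun"
    by (simp_all add: right_shift_def w_def[abs_def])
qed

text \<open>Membership is a system of equations stable under norm limits, and an element is
  determined by its value at the zero ket. An adjoint is required because the operator type also
  contains real-linear maps that are not complex-linear.\<close>

definition torus_algebra :: "'n::{finite,linorder} rmat \<Rightarrow> 'n ivec op set" where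
  "torus_algebra \<theta> = {a. (\<exists>b. is_adj a b) \<and> (\<forall>k. a o\<^sub>L right_shift \<theta> k = right_shift \<theta> k o\<^sub>L a)}"

lemma adjointable_closed: "closed {A :: 'i op. \<exists>B. is_adj A B}"
  unfolding closed_sequential_limits
proof (intro allI impI, elim conjE)
  fix A :: "nat \<Rightarrow> 'i op" and a assume "\<forall>n. A n \<in> {A. \<exists>B. is_adj A B}" and lim: "A \<longlonglongrightarrow> a"
  then have "\<forall>n. \<exists>B. is_adj (A n) B" by simp
  then obtain B where "\<And>n. is_adj (A n) (B n)" by metis
  from adjoint_lim_exists[OF lim this] show "a \<in> {A. \<exists>B. is_adj A B}" by auto
qed

lemma closed_torus_algebra: "closed (torus_algebra \<theta>)"
proof -
  have "torus_algebra \<theta> = {a. \<exists>b. is_adj a b} \<inter> (\<Inter>k. {a. a o\<^sub>L right_shift \<theta> k = right_shift \<theta> k o\<^sub>L a})"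
    by (auto simp: torus_algebra_def)
  moreover have "closed {a :: 'a ivec op. a o\<^sub>L right_shift \<theta> k = right_shift \<theta> k o\<^sub>L a}" for k
    by (intro closed_Collect_eq op_comp.continuous_on continuous_on_id continuous_on_const)
  then have "closed (\<Inter>k. {a :: 'a ivec op. a o\<^sub>L right_shift \<theta> k = right_shift \<theta> k o\<^sub>L a})"
    by (intro closed_INT) blast
  ultimately show ?thesis using closed_Int[OF adjointable_closed] by simp
qed

lemma torus_algebraI:
  "is_adj a b \<Longrightarrow> (\<And>k. a o\<^sub>L right_shift \<theta> k = right_shift \<theta> k o\<^sub>L a) \<Longrightarrow> a \<in> torus_algebra \<theta>"
  unfolding torus_algebra_def by blast

lemma torus_algebraE:
  assumes "a \<in> torus_algebra \<theta>"
  obtains b where "is_adj a b" "\<And>k. a o\<^sub>L right_shift \<theta> k = right_shift \<theta> k o\<^sub>L a"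
  using assms unfolding torus_algebra_def by blast

lemma torus_algebra_compose:
  assumes "a \<in> torus_algebra \<theta>" "b \<in> torus_algebra \<theta>" shows "a o\<^sub>L b \<in> torus_algebra \<theta>"
proof -
  obtain a' where a: "is_adj a a'" "\<And>k. a o\<^sub>L right_shift \<theta> k = right_shift \<theta> k o\<^sub>L a"
    using assms(1) by (rule torus_algebraE) blast
  obtain b' where b: "is_adj b b'" "\<And>k. b o\<^sub>L right_shift \<theta> k = right_shift \<theta> k o\<^sub>L b"
    using assms(2) by (rule torus_algebraE) blast
  show ?thesis
  proof (rule torus_algebraI[OF is_adj_compose[OF a(1) b(1)]])
    show "(a o\<^sub>L b) o\<^sub>L right_shift \<theta> k = right_shift \<theta> k o\<^sub>L (a o\<^sub>L b)" for k
      using a(2)[of k] b(2)[of k] blinfun_compose_assoc[of a b] blinfun_compose_assoc[of a "right_shift \<theta> k"]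
        blinfun_compose_assoc[of "right_shift \<theta> k" a] by metis
  qed
qed

lemma torus_algebra_add:
  assumes "a \<in> torus_algebra \<theta>" "b \<in> torus_algebra \<theta>" shows "a + b \<in> torus_algebra \<theta>"
proof -
  obtain a' where a: "is_adj a a'" "\<And>k. a o\<^sub>L right_shift \<theta> k = right_shift \<theta> k o\<^sub>L a"
    using assms(1) by (rule torus_algebraE) blast
  obtain b' where b: "is_adj b b'" "\<And>k. b o\<^sub>L right_shift \<theta> k = right_shift \<theta> k o\<^sub>L b"
    using assms(2) by (rule torus_algebraE) blast
  show ?thesis
    by (rule torus_algebraI[OF is_adj_add[OF a(1) b(1)]]) (simp only: op_comp.add_left op_comp.add_right a b)
qed

lemma torus_algebra_scaleC:
  assumes "a \<in> torus_algebra \<theta>" shows "c *\<^sub>C a \<in> torus_algebra \<theta>"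
proof -
  obtain a' where a: "is_adj a a'" "\<And>k. a o\<^sub>L right_shift \<theta> k = right_shift \<theta> k o\<^sub>L a"
    using assms by (rule torus_algebraE) blast
  show ?thesis
  proof (rule torus_algebraI[OF is_adj_compose[OF is_adj_scalar_op a(1)]])
    fix k
    have "scalar_op c o\<^sub>L right_shift \<theta> k = right_shift \<theta> k o\<^sub>L scalar_op c"
      by (intro blinfun_eqI ell2_eqI) (simp add: coord_right_shift scalar_op.rep_eq scaleC_ell2.rep_eq)
    then show "(c *\<^sub>C a) o\<^sub>L right_shift \<theta> k = right_shift \<theta> k o\<^sub>L (c *\<^sub>C a)"
      using a(2)[of k] by (metis blinfun_compose_assoc)
  qed
qed

lemma torus_algebra_scaleR: "a \<in> torus_algebra \<theta> \<Longrightarrow> r *\<^sub>R a \<in> torus_algebra \<theta>"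
  unfolding scaleR_eq_scaleC by (rule torus_algebra_scaleC)

lemma torus_algebra_minus: "a \<in> torus_algebra \<theta> \<Longrightarrow> - a \<in> torus_algebra \<theta>"
  using torus_algebra_scaleR[of a \<theta> "-1"] by simp

lemma torus_algebra_diff: "a \<in> torus_algebra \<theta> \<Longrightarrow> b \<in> torus_algebra \<theta> \<Longrightarrow> a - b \<in> torus_algebra \<theta>"
  using torus_algebra_add[of a \<theta> "- b"] torus_algebra_minus by auto

lemma torus_algebra_id: "id_blinfun \<in> torus_algebra \<theta>"
  by (rule torus_algebraI[OF is_adj_id]) simp

lemma torus_algebra_0: "0 \<in> torus_algebra \<theta>"
  using torus_algebra_scaleR[OF torus_algebra_id, of 0] by simp

lemma torus_algebra_sum: "(\<And>i. i \<in> F \<Longrightarrow> a i \<in> torus_algebra \<theta>) \<Longrightarrow> (\<Sum>i\<in>F. a i) \<in> torus_algebra \<theta>"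
  by (induction F rule: infinite_finite_induct) (auto intro: torus_algebra_0 torus_algebra_add)

lemma is_adj_unique: "is_adj A B \<Longrightarrow> is_adj A C \<Longrightarrow> B = C"
  by (intro blinfun_eqI cinner_cancel_right) (simp add: is_adjD[symmetric])

text \<open>Taking adjoints shows that \<open>b\<close> commutes with the inverses of the right
  translations; multiplying by the translation on both sides gives the commutation itself.\<close>

lemma torus_algebra_is_adj:
  assumes a: "a \<in> torus_algebra \<theta>" "is_adj a b"
  shows "b \<in> torus_algebra \<theta>"
  unfolding torus_algebra_def mem_Collect_eq
proof (intro conjI exI allI)
  show "is_adj b a" using a(2) by (rule is_adj_sym)
  fix k
  obtain R where R: "is_adj (right_shift \<theta> k) R" "R o\<^sub>L right_shift \<theta> k = id_blinfun"
    "right_shift \<theta> k o\<^sub>L R = id_blinfun" by (rule right_shift_unitary)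
  have "a o\<^sub>L right_shift \<theta> k = right_shift \<theta> k o\<^sub>L a" using a(1) by (simp add: torus_algebra_def)
  then have "R o\<^sub>L b = b o\<^sub>L R"
    using is_adj_unique is_adj_compose[OF a(2) R(1)] is_adj_compose[OF R(1) a(2)] by metis
  then have "right_shift \<theta> k o\<^sub>L (R o\<^sub>L b) o\<^sub>L right_shift \<theta> k = right_shift \<theta> k o\<^sub>L (b o\<^sub>L R) o\<^sub>L right_shift \<theta> k"
    by simp
  moreover have "right_shift \<theta> k o\<^sub>L (R o\<^sub>L b) o\<^sub>L right_shift \<theta> k = (right_shift \<theta> k o\<^sub>L R) o\<^sub>L b o\<^sub>L right_shift \<theta> k"
    "right_shift \<theta> k o\<^sub>L (b o\<^sub>L R) o\<^sub>L right_shift \<theta> k = right_shift \<theta> k o\<^sub>L b o\<^sub>L (R o\<^sub>L right_shift \<theta> k)"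
    by (simp_all only: blinfun_compose_assoc)
  ultimately show "b o\<^sub>L right_shift \<theta> k = right_shift \<theta> k o\<^sub>L b" by (simp add: R)
qed

lemma coord_adjoint_ket_0:
  assumes a: "a \<in> torus_algebra \<theta>" "is_adj a b"
  shows "cnj (coord (blinfun_apply b (ket 0)) m) = right_phase \<theta> m (- m) * coord (blinfun_apply a (ket 0)) (- m)"
proof -
  have "a o\<^sub>L right_shift \<theta> m = right_shift \<theta> m o\<^sub>L a" using a(1) by (simp add: torus_algebra_def)
  then have eq: "blinfun_apply a (ket m) = blinfun_apply (right_shift \<theta> m) (blinfun_apply a (ket 0))"
    by (metis blinfun_apply_blinfun_compose right_shift_ket_0)
  have "cnj (coord (blinfun_apply b (ket 0)) m) = cnj (cinner (blinfun_apply a (ket m)) (ket 0))"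
    by (simp add: is_adjD[OF a(2)] cinner_ket)
  also have "\<dots> = coord (blinfun_apply a (ket m)) 0"
    by (simp add: cinner_commute[of _ "ket 0"] cinner_ket)
  finally show ?thesis by (simp add: eq coord_right_shift)
qed

text \<open>Since \<open>a\<close> at the ket \<open>m\<close> is a right translate of
  \<open>a\<close> at the zero ket, the adjoint's coefficient at \<open>m\<close> is a phase times
  the conjugate of the coefficient at \<open>- m\<close>. The trace of a product is therefore a
  twisted convolution at 0, and the reflection of the lattice exchanges the factors.\<close>

lemma torus_trace_comm:
  assumes a: "a \<in> torus_algebra \<theta>" and b: "b \<in> torus_algebra \<theta>"
  shows "torus_trace (a o\<^sub>L b) = torus_trace (b o\<^sub>L a)"
proof -
  have expand: "torus_trace (x o\<^sub>L y) = (\<Sum>\<^sub>\<infinity>m. right_phase \<theta> m (- m) * coord (blinfun_apply x (ket 0)) (- m)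
      * coord (blinfun_apply y (ket 0)) m)" if x: "x \<in> torus_algebra \<theta>" for x y
  proof -
    obtain x' where x': "is_adj x x'" using x by (auto simp: torus_algebra_def)
    have "torus_trace (x o\<^sub>L y) = cinner (blinfun_apply x' (ket 0)) (blinfun_apply y (ket 0))"
      by (simp add: torus_trace_def is_adjD[OF is_adj_sym[OF x']])
    then show ?thesis by (simp add: cinner_def coord_adjoint_ket_0[OF x x'])
  qed
  have bij: "bij_betw uminus UNIV (UNIV :: 'a ivec set)" by (rule bij_betwI[where g = uminus]) auto
  \<comment> \<open>Both signs enter bilinearly, so each side has phase minus the form at
    \<open>(m, m)\<close>; the twist is even.\<close>
  have "right_phase \<theta> (- m) m = right_phase \<theta> m (- m)" for m
    by (simp add: right_phase_def lower_form_simps)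
  then show ?thesis
    unfolding expand[OF a] expand[OF b]
    using infsum_reindex_bij_betw[OF bij, of "\<lambda>m. right_phase \<theta> m (- m) * coord (blinfun_apply b (ket 0)) (- m)
      * coord (blinfun_apply a (ket 0)) m"]
    by (simp add: mult_ac)
qed

text \<open>Coordinates of the adjoint are inner products with images of kets, so equality on kets
  is equality of adjoints, without any density argument.\<close>

lemma op_eq_on_kets:
  assumes "is_adj A A'" "is_adj B B'" "\<And>i. blinfun_apply A (ket i) = blinfun_apply B (ket i)"
  shows "A = B"
proof -
  have "A' = B'"
    by (intro blinfun_eqI ell2_eqI)
      (metis assms cinner_ket is_adjD)
  then show ?thesis using is_adj_unique[OF is_adj_sym[OF assms(1)]] is_adj_sym[OF assms(2)] by simp
qed

text \<open>The zero ket is separating: right translations carry it to every ket and commute with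
  the algebra.\<close>

lemma torus_algebra_eqI:
  assumes "a \<in> torus_algebra \<theta>" "b \<in> torus_algebra \<theta>"
    and "blinfun_apply a (ket 0) = blinfun_apply b (ket 0)"
  shows "a = b"
proof -
  obtain a' b' where adj: "is_adj a a'" "is_adj b b'" using assms by (auto simp: torus_algebra_def)
  have *: "blinfun_apply c (ket k) = blinfun_apply (right_shift \<theta> k) (blinfun_apply c (ket 0))"
    if "c \<in> torus_algebra \<theta>" for c k
    using that unfolding torus_algebra_def
    by (metis (mono_tags, lifting) blinfun_apply_blinfun_compose right_shift_ket_0 mem_Collect_eq)
  show ?thesis
  proof (rule op_eq_on_kets[OF adj])
    show "blinfun_apply a (ket i) = blinfun_apply b (ket i)" for i
      unfolding *[OF assms(1), of i] *[OF assms(2), of i] assms(3) ..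
  qed
qed

subsection \<open>Monomials\<close>

lemma is_adj_torus_U: "is_adj (torus_U \<theta> j) (torus_U_inv \<theta> j)"
  unfolding is_adj_def
proof (intro allI)
  fix x y :: "'a ivec ell2"
  let ?f = "\<lambda>m. cnj (torus_phase \<theta> j (m - axis j 1) * coord x (m - axis j 1)) * coord y m"
  have "bij_betw (\<lambda>m :: 'a ivec. m + axis j 1) UNIV UNIV"
    by (rule bij_betwI[where g = "\<lambda>m. m - axis j 1"]) auto
  from infsum_reindex_bij_betw[OF this, of ?f]
  show "cinner (blinfun_apply (torus_U \<theta> j) x) y = cinner x (blinfun_apply (torus_U_inv \<theta> j) y)"
    by (simp add: cinner_def torus_U.rep_eq torus_shift.rep_eq torus_U_inv.rep_eq
        torus_unshift.rep_eq mult_ac)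
qed

lemma torus_U_mem: "torus_U \<theta> j \<in> torus_algebra \<theta>"
  unfolding torus_algebra_def mem_Collect_eq
proof (intro conjI exI allI)
  show "is_adj (torus_U \<theta> j) (torus_U_inv \<theta> j)" by (rule is_adj_torus_U)
  fix k
  show "torus_U \<theta> j o\<^sub>L right_shift \<theta> k = right_shift \<theta> k o\<^sub>L torus_U \<theta> j"
  proof (intro blinfun_eqI ell2_eqI)
    fix x :: "'a ivec ell2" and m :: "'a ivec"
    have swap: "m - axis j 1 - k = m - k - axis j 1" by (simp add: algebra_simps)
    have "torus_phase \<theta> j (m - axis j 1) * right_phase \<theta> k (m - axis j 1 - k)
        = right_phase \<theta> k (m - k) * torus_phase \<theta> j (m - k - axis j 1)"
      unfolding torus_phase_lower_form right_phase_def cis_mult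
      by (simp add: lower_form_simps algebra_simps)
    then show "coord (blinfun_apply (torus_U \<theta> j o\<^sub>L right_shift \<theta> k) x) m
      = coord (blinfun_apply (right_shift \<theta> k o\<^sub>L torus_U \<theta> j) x) m"
      by (simp add: torus_U.rep_eq torus_shift.rep_eq coord_right_shift swap mult.assoc[symmetric])
  qed
qed

lemma torus_U_unitary_op: "unitary_op (torus_U \<theta> j)" "unitary_op (adj (torus_U \<theta> j))"
  using is_adj_torus_U[of \<theta> j] is_adj_sym[OF is_adj_torus_U[of \<theta> j]] torus_U_unitary[of \<theta> j]
  unfolding unitary_op_def adj_torus_U by blast+

lemma op_power_closed:
  assumes "P id_blinfun" "P A" "\<And>A B. P A \<Longrightarrow> P B \<Longrightarrow> P (A o\<^sub>L B)"
  shows "P (op_power A k)"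
  by (induction k) (auto intro: assms)

text \<open>Induction along the ordered product, used for membership in the algebra and for
  unitarity.\<close>

lemma torus_mono_closed:
  assumes P: "P id_blinfun" "\<And>A B. P A \<Longrightarrow> P B \<Longrightarrow> P (A o\<^sub>L B)"
    and U: "\<And>j. P (torus_U \<theta> j)" "\<And>j. P (adj (torus_U \<theta> j))"
  shows "P (torus_mono \<theta> m)"
proof -
  have "P (unitary_power (torus_U \<theta> j) k)" for j k
    unfolding unitary_power_def by (auto intro!: op_power_closed[of P] P U)
  then have "P (foldr (\<lambda>j A. unitary_power (torus_U \<theta> j) (m $ j) o\<^sub>L A) js id_blinfun)" for js
    by (induction js) (auto intro: P)
  then show ?thesis by (simp add: torus_mono_def)
qed

lemma torus_mono_mem: "torus_mono \<theta> m \<in> torus_algebra \<theta>"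
  by (rule torus_mono_closed[of "\<lambda>a. a \<in> torus_algebra \<theta>"])
    (auto intro: torus_algebra_id torus_algebra_compose torus_U_mem
      torus_algebra_is_adj[OF torus_U_mem is_adj_torus_U] simp: adj_torus_U)

lemma torus_mono_unitary: "unitary_op (torus_mono \<theta> m)"
  by (rule torus_mono_closed[of unitary_op]) (auto intro: unitary_op_id unitary_op_compose torus_U_unitary_op)

lemma norm_torus_mono: "norm (torus_mono \<theta> m) = 1"
  by (rule unitary_op_norm[OF torus_mono_unitary])

section \<open>Matrices over the torus\<close>

lemma coord_inj_op: "coord (blinfun_apply (inj_op i) x) mk = (if snd mk = i then coord x (fst mk) else 0)"
  by (cases mk) (simp add: inj_op.rep_eq slot_inj.rep_eq)

lemma coord_proj_op: "coord (blinfun_apply (proj_op i) x) m = coord x (m, i)"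
  by (simp add: proj_op.rep_eq slot_proj.rep_eq)

lemma proj_inj_op: "proj_op i o\<^sub>L inj_op j = (if i = j then id_blinfun else 0)"
  by (intro blinfun_eqI ell2_eqI) (simp add: coord_proj_op coord_inj_op)

lemma is_adj_inj_op: "is_adj (inj_op i :: 'i ell2 \<Rightarrow>\<^sub>L _) (proj_op i)"
  unfolding is_adj_def
proof (intro allI)
  fix x :: "'i ell2" and y
  have "cinner (blinfun_apply (inj_op i) x) y = (\<Sum>\<^sub>\<infinity>mk\<in>(\<lambda>m. (m, i)) ` UNIV. cnj (coord x (fst mk)) * coord y mk)"
    unfolding cinner_def by (rule infsum_cong_neutral) (auto simp: coord_inj_op)
  also have "\<dots> = (\<Sum>\<^sub>\<infinity>m. cnj (coord x m) * coord y (m, i))"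
    by (subst infsum_reindex) (auto simp: inj_on_def o_def)
  finally show "cinner (blinfun_apply (inj_op i) x) y = cinner x (blinfun_apply (proj_op i) y)"
    by (simp add: cinner_def coord_proj_op)
qed

lemma inj_op_ket: "blinfun_apply (inj_op i) (ket m) = ket (m, i)"
  by (rule ell2_eqI) (auto simp: coord_inj_op coord_ket)

definition slots_proj :: "nat \<Rightarrow> ('i \<times> nat) op" where
  "slots_proj r = (\<Sum>i<r. inj_op i o\<^sub>L proj_op i)"

lemma slots_proj_inj:
  assumes "i < r" shows "slots_proj r o\<^sub>L inj_op i = inj_op i"
proof -
  have "slots_proj r o\<^sub>L inj_op i = (\<Sum>k<r. if k = i then inj_op i else 0)"
    unfolding slots_proj_def op_comp.sum_left blinfun_compose_assoc proj_inj_op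
    by (rule sum.cong) (auto simp: op_comp.zero_right)
  then show ?thesis using assms by simp
qed

lemma proj_slots_proj: "j < r \<Longrightarrow> proj_op j o\<^sub>L slots_proj r = proj_op j"
proof -
  assume "j < r"
  have "proj_op j o\<^sub>L slots_proj r = (\<Sum>k<r. if k = j then proj_op j else 0)"
    unfolding slots_proj_def op_comp.sum_right blinfun_compose_assoc[symmetric] proj_inj_op
    by (rule sum.cong) (auto simp: op_comp.zero_left)
  then show ?thesis using \<open>j < r\<close> by simp
qed

lemma is_adj_slots_proj: "is_adj (slots_proj r) (slots_proj r)"
  unfolding slots_proj_def
  by (intro is_adj_sum is_adj_compose is_adj_inj_op is_adj_sym[OF is_adj_inj_op])

text \<open>The operators may act outside the first \<open>r\<close> slots. This keeps the identity
  inside, as functional calculus demands; commuting with the slot projection makes the entries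
  multiply as matrices nevertheless.\<close>

definition matrix_algebra :: "'n::{finite,linorder} rmat \<Rightarrow> nat \<Rightarrow> ('n ivec \<times> nat) op set" where
  "matrix_algebra \<theta> r = {A. (\<exists>B. is_adj A B) \<and> A o\<^sub>L slots_proj r = slots_proj r o\<^sub>L A \<and>
     (\<forall>i<r. \<forall>j<r. proj_op i o\<^sub>L A o\<^sub>L inj_op j \<in> torus_algebra \<theta>)}"

lemma matrix_algebraI:
  "is_adj A B \<Longrightarrow> A o\<^sub>L slots_proj r = slots_proj r o\<^sub>L A \<Longrightarrow>
    (\<And>i j. i < r \<Longrightarrow> j < r \<Longrightarrow> proj_op i o\<^sub>L A o\<^sub>L inj_op j \<in> torus_algebra \<theta>) \<Longrightarrow> A \<in> matrix_algebra \<theta> r"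
  unfolding matrix_algebra_def by blast

lemma matrix_algebraE:
  assumes "A \<in> matrix_algebra \<theta> r"
  obtains B where "is_adj A B" "A o\<^sub>L slots_proj r = slots_proj r o\<^sub>L A"
    "\<And>i j. i < r \<Longrightarrow> j < r \<Longrightarrow> proj_op i o\<^sub>L A o\<^sub>L inj_op j \<in> torus_algebra \<theta>"
  using assms unfolding matrix_algebra_def by blast

text \<open>Insert the slot projection before \<open>inj_op j\<close>, move it past
  \<open>B\<close>, and expand it as the sum over the slots.\<close>

lemma matrix_entry_compose:
  assumes B: "B o\<^sub>L slots_proj r = slots_proj r o\<^sub>L B" and j: "j < r"
  shows "proj_op i o\<^sub>L (A o\<^sub>L B) o\<^sub>L inj_op j
    = (\<Sum>k<r. (proj_op i o\<^sub>L A o\<^sub>L inj_op k) o\<^sub>L (proj_op k o\<^sub>L B o\<^sub>L inj_op j))"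
proof -
  have "B o\<^sub>L inj_op j = (B o\<^sub>L slots_proj r) o\<^sub>L inj_op j"
    by (simp only: blinfun_compose_assoc slots_proj_inj[OF j])
  also have "\<dots> = (\<Sum>k<r. inj_op k o\<^sub>L (proj_op k o\<^sub>L B o\<^sub>L inj_op j))"
    by (subst B) (simp only: slots_proj_def op_comp.sum_left blinfun_compose_assoc)
  finally have "proj_op i o\<^sub>L A o\<^sub>L (B o\<^sub>L inj_op j)
      = (\<Sum>k<r. proj_op i o\<^sub>L A o\<^sub>L (inj_op k o\<^sub>L (proj_op k o\<^sub>L B o\<^sub>L inj_op j)))"
    by (simp only: op_comp.sum_right)
  then show ?thesis by (simp only: blinfun_compose_assoc)
qed

lemma torus_trace_eq: "torus_trace = ket_trace {0}"
  by (rule ext) (simp add: torus_trace_def ket_trace_def)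

lemma mat_trace_eq: "mat_trace r = ket_trace ((\<lambda>i. (0, i)) ` {..<r})"
proof
  fix A :: "('n::finite ivec \<times> nat) op"
  show "mat_trace r A = ket_trace ((\<lambda>i. (0, i)) ` {..<r}) A"
    unfolding mat_trace_def ket_trace_def
    by (subst sum.reindex) (auto simp: inj_on_def torus_trace_def cinner_ket inj_op_ket coord_proj_op)
qed

lemma torus_trace_sum: "torus_trace (\<Sum>i\<in>F. A i) = (\<Sum>i\<in>F. torus_trace (A i))"
  unfolding torus_trace_eq by (rule ket_trace_sum)

lemma mat_trace_comm:
  assumes A: "A \<in> matrix_algebra \<theta> r" and B: "B \<in> matrix_algebra \<theta> r"
  shows "mat_trace r (A o\<^sub>L B) = mat_trace r (B o\<^sub>L A)"
proof -
  define e where "e C i k = proj_op i o\<^sub>L C o\<^sub>L inj_op k" for C :: "('a ivec \<times> nat) op" and i k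
  have expand: "mat_trace r (C o\<^sub>L D) = (\<Sum>i<r. \<Sum>k<r. torus_trace (e C i k o\<^sub>L e D k i))"
    if D: "D \<in> matrix_algebra \<theta> r" for C D
  proof -
    have "D o\<^sub>L slots_proj r = slots_proj r o\<^sub>L D" using D by (rule matrix_algebraE) blast
    then have "torus_trace (proj_op i o\<^sub>L (C o\<^sub>L D) o\<^sub>L inj_op i) = (\<Sum>k<r. torus_trace (e C i k o\<^sub>L e D k i))"
      if "i < r" for i
      using that by (simp only: matrix_entry_compose e_def torus_trace_sum)
    then show ?thesis
      unfolding mat_trace_def by (intro sum.cong refl) simp
  qed
  have "torus_trace (e A i k o\<^sub>L e B k i) = torus_trace (e B k i o\<^sub>L e A i k)" if "i < r" "k < r" for i k
    using A B that unfolding e_def by (intro torus_trace_comm[of _ \<theta>]) (auto elim: matrix_algebraE)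
  then have "mat_trace r (A o\<^sub>L B) = (\<Sum>i<r. \<Sum>k<r. torus_trace (e B k i o\<^sub>L e A i k))"
    unfolding expand[OF B] by (intro sum.cong refl) simp
  also have "\<dots> = mat_trace r (B o\<^sub>L A)"
    unfolding expand[OF A] by (rule sum.swap)
  finally show ?thesis .
qed

lemma closed_matrix_algebra: "closed (matrix_algebra \<theta> r)"
proof -
  have "matrix_algebra \<theta> r = {A. \<exists>B. is_adj A B} \<inter> {A. A o\<^sub>L slots_proj r = slots_proj r o\<^sub>L A}
      \<inter> (\<Inter>i\<in>{..<r}. \<Inter>j\<in>{..<r}. (\<lambda>A. proj_op i o\<^sub>L A o\<^sub>L inj_op j) -` torus_algebra \<theta>)"
    by (auto simp: matrix_algebra_def)
  moreover have "closed ((\<lambda>A. proj_op i o\<^sub>L A o\<^sub>L inj_op j) -` torus_algebra \<theta>)" for i j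
    by (intro closed_vimage closed_torus_algebra op_comp.continuous_on continuous_on_const continuous_on_id)
  then have "closed (\<Inter>i\<in>{..<r}. \<Inter>j\<in>{..<r}. (\<lambda>A. proj_op i o\<^sub>L A o\<^sub>L inj_op j) -` torus_algebra \<theta>)"
    by (intro closed_INT ballI)
  moreover have "closed {A :: ('a ivec \<times> nat) op. A o\<^sub>L slots_proj r = slots_proj r o\<^sub>L A}"
    by (intro closed_Collect_eq op_comp.continuous_on continuous_on_id continuous_on_const)
  ultimately show ?thesis by (simp only: closed_Int[OF closed_Int[OF adjointable_closed]])
qed

interpretation mat: tracial_algebra "matrix_algebra \<theta> r" "(\<lambda>i. (0, i)) ` {..<r}"
  for \<theta> :: "'n::{finite,linorder} rmat" and r
proof
  show "id_blinfun \<in> matrix_algebra \<theta> r"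
    by (rule matrix_algebraI[OF is_adj_id])
      (auto simp: proj_inj_op torus_algebra_id torus_algebra_0)
  fix A B assume A: "A \<in> matrix_algebra \<theta> r" and B: "B \<in> matrix_algebra \<theta> r"
  obtain A' where A': "is_adj A A'" "A o\<^sub>L slots_proj r = slots_proj r o\<^sub>L A"
    "\<And>i j. i < r \<Longrightarrow> j < r \<Longrightarrow> proj_op i o\<^sub>L A o\<^sub>L inj_op j \<in> torus_algebra \<theta>"
    using A by (rule matrix_algebraE) blast
  obtain B' where B': "is_adj B B'" "B o\<^sub>L slots_proj r = slots_proj r o\<^sub>L B"
    "\<And>i j. i < r \<Longrightarrow> j < r \<Longrightarrow> proj_op i o\<^sub>L B o\<^sub>L inj_op j \<in> torus_algebra \<theta>"
    using B by (rule matrix_algebraE) blast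
  show "A + B \<in> matrix_algebra \<theta> r"
  proof (rule matrix_algebraI[OF is_adj_add[OF A'(1) B'(1)]])
    show "(A + B) o\<^sub>L slots_proj r = slots_proj r o\<^sub>L (A + B)"
      by (simp only: op_comp.add_left op_comp.add_right A'(2) B'(2))
    show "proj_op i o\<^sub>L (A + B) o\<^sub>L inj_op j \<in> torus_algebra \<theta>" if "i < r" "j < r" for i j
      using torus_algebra_add[OF A'(3)[OF that] B'(3)[OF that]]
      by (simp only: op_comp.add_left op_comp.add_right)
  qed
  show "A o\<^sub>L B \<in> matrix_algebra \<theta> r"
  proof (rule matrix_algebraI[OF is_adj_compose[OF A'(1) B'(1)]])
    show "(A o\<^sub>L B) o\<^sub>L slots_proj r = slots_proj r o\<^sub>L (A o\<^sub>L B)"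
      using A'(2) B'(2) blinfun_compose_assoc by metis
    show "proj_op i o\<^sub>L (A o\<^sub>L B) o\<^sub>L inj_op j \<in> torus_algebra \<theta>" if "i < r" "j < r" for i j
      unfolding matrix_entry_compose[OF B'(2) that(2)]
      by (intro torus_algebra_sum torus_algebra_compose A'(3) B'(3) that) auto
  qed
  show "c *\<^sub>R A \<in> matrix_algebra \<theta> r" for c
  proof (rule matrix_algebraI[OF is_adj_scaleR[OF A'(1)]])
    show "(c *\<^sub>R A) o\<^sub>L slots_proj r = slots_proj r o\<^sub>L (c *\<^sub>R A)"
      by (simp only: op_comp.scaleR_left op_comp.scaleR_right A'(2))
    show "proj_op i o\<^sub>L (c *\<^sub>R A) o\<^sub>L inj_op j \<in> torus_algebra \<theta>" if "i < r" "j < r" for i j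
      using torus_algebra_scaleR[OF A'(3)[OF that], of c]
      by (simp only: op_comp.scaleR_left op_comp.scaleR_right)
  qed
  show "\<exists>C\<in>matrix_algebra \<theta> r. is_adj A C"
  proof (intro bexI[of _ A'] A'(1), rule matrix_algebraI[OF is_adj_sym[OF A'(1)]])
    have "is_adj (A o\<^sub>L slots_proj r) (slots_proj r o\<^sub>L A')"
      by (intro is_adj_compose is_adj_slots_proj A'(1))
    moreover have "is_adj (A o\<^sub>L slots_proj r) (A' o\<^sub>L slots_proj r)"
      unfolding A'(2) by (intro is_adj_compose is_adj_slots_proj A'(1))
    ultimately show "A' o\<^sub>L slots_proj r = slots_proj r o\<^sub>L A'" by (rule is_adj_unique[rotated])
    fix i j assume "i < r" "j < r"
    have "is_adj (proj_op j o\<^sub>L A o\<^sub>L inj_op i) (proj_op i o\<^sub>L (A' o\<^sub>L inj_op j))"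
      by (intro is_adj_compose is_adj_inj_op is_adj_sym[OF is_adj_inj_op] A'(1))
    from torus_algebra_is_adj[OF A'(3)[OF \<open>j < r\<close> \<open>i < r\<close>] this]
    show "proj_op i o\<^sub>L A' o\<^sub>L inj_op j \<in> torus_algebra \<theta>" by (simp only: blinfun_compose_assoc)
  qed
  show "ket_trace ((\<lambda>i. (0, i)) ` {..<r}) (A o\<^sub>L B) = ket_trace ((\<lambda>i. (0, i)) ` {..<r}) (B o\<^sub>L A)"
    using mat_trace_comm[OF A B] by (simp only: mat_trace_eq)
qed (auto simp: closed_matrix_algebra)

interpretation torus: tracial_algebra "torus_algebra \<theta>" "{0}"
  for \<theta> :: "'n::{finite,linorder} rmat"
proof
  fix a b assume a: "a \<in> torus_algebra \<theta>" and b: "b \<in> torus_algebra \<theta>"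
  show "\<exists>c\<in>torus_algebra \<theta>. is_adj a c"
    using a torus_algebra_is_adj[OF a] unfolding torus_algebra_def by blast
  show "ket_trace {0} (a o\<^sub>L b) = ket_trace {0} (b o\<^sub>L a)"
    using torus_trace_comm[OF a b] by (simp only: torus_trace_eq)
qed (auto intro: torus_algebra_id torus_algebra_add torus_algebra_compose torus_algebra_scaleR closed_torus_algebra)

lemma mat_op_add: "mat_op r (\<lambda>i j. a i j + b i j) = mat_op r a + mat_op r b"
  unfolding mat_op_def by (simp only: op_comp.add_left op_comp.add_right sum.distrib)

lemma scalar_op_inj: "scalar_op c o\<^sub>L inj_op i = inj_op i o\<^sub>L scalar_op c"
  by (intro blinfun_eqI ell2_eqI) (simp add: coord_inj_op scalar_op.rep_eq scaleC_ell2.rep_eq)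

lemma mat_op_scaleC: "mat_op r (\<lambda>i j. c *\<^sub>C a i j) = c *\<^sub>C mat_op r a"
  unfolding mat_op_def op_comp.sum_right
proof (intro sum.cong refl)
  fix i j
  show "inj_op i o\<^sub>L (c *\<^sub>C a i j) o\<^sub>L proj_op j = c *\<^sub>C (inj_op i o\<^sub>L a i j o\<^sub>L proj_op j)"
    using scalar_op_inj[of c i] by (metis blinfun_compose_assoc)
qed

lemma mat_op_cong: "(\<And>i j. i < r \<Longrightarrow> j < r \<Longrightarrow> a i j = b i j) \<Longrightarrow> mat_op r a = mat_op r b"
  unfolding mat_op_def by (intro sum.cong refl) auto

lemma mat_op_mem:
  assumes a: "\<And>i j. i < r \<Longrightarrow> j < r \<Longrightarrow> a i j \<in> torus_algebra \<theta>"
  shows "mat_op r a \<in> matrix_algebra \<theta> r"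
proof (rule matrix_algebraI)
  define b where "b i j = (SOME b. is_adj (a i j) b)" for i j
  have b: "is_adj (a i j) (b i j)" if "i < r" "j < r" for i j
    unfolding b_def using a[OF that] by (intro someI_ex[of "is_adj (a i j)"]) (auto simp: torus_algebra_def)
  show "is_adj (mat_op r a) (\<Sum>i<r. \<Sum>j<r. inj_op j o\<^sub>L (b i j o\<^sub>L proj_op i))"
    unfolding mat_op_def
    by (intro is_adj_sum is_adj_compose is_adj_inj_op is_adj_sym[OF is_adj_inj_op] b) auto
  have "mat_op r a o\<^sub>L slots_proj r = mat_op r a"
    unfolding mat_op_def op_comp.sum_left blinfun_compose_assoc
    by (intro sum.cong refl) (simp add: proj_slots_proj)
  moreover have "slots_proj r o\<^sub>L mat_op r a = mat_op r a"
    unfolding mat_op_def op_comp.sum_right blinfun_compose_assoc[symmetric]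
    by (intro sum.cong refl) (simp add: slots_proj_inj)
  ultimately show "mat_op r a o\<^sub>L slots_proj r = slots_proj r o\<^sub>L mat_op r a" by simp
  fix i j assume ij: "i < r" "j < r"
  have "proj_op i o\<^sub>L mat_op r a o\<^sub>L inj_op j
      = (\<Sum>k<r. \<Sum>l<r. (proj_op i o\<^sub>L inj_op k) o\<^sub>L a k l o\<^sub>L (proj_op l o\<^sub>L inj_op j))"
    unfolding mat_op_def op_comp.sum_left op_comp.sum_right by (simp only: blinfun_compose_assoc)
  also have "\<dots> = (\<Sum>k<r. \<Sum>l<r. if k = i then if l = j then a i j else 0 else 0)"
    by (intro sum.cong refl) (auto simp: proj_inj_op op_comp.zero_left op_comp.zero_right)
  also have "\<dots> = (\<Sum>k<r. if k = i then (\<Sum>l<r. if l = j then a i j else 0) else 0)"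
    by (intro sum.cong refl) auto
  also have "\<dots> = a i j" using ij by simp
  finally show "proj_op i o\<^sub>L mat_op r a o\<^sub>L inj_op j \<in> torus_algebra \<theta>" using a ij by simp
qed

subsection \<open>Norms of matrices\<close>

abbreviation torus_matrix :: "'n::{finite,linorder} rmat \<Rightarrow> nat \<Rightarrow> (nat \<Rightarrow> nat \<Rightarrow> 'n ivec op) \<Rightarrow> bool" where
  "torus_matrix \<theta> r a \<equiv> \<forall>i<r. \<forall>j<r. a i j \<in> torus_algebra \<theta>"

lemma mat_pnorm_nonneg: "0 \<le> mat_pnorm r p a"
  by (simp add: mat_pnorm_def trace_pnorm_def)

lemma torus_pnorm_nonneg: "0 \<le> torus_pnorm p a"
  by (simp add: trace_pnorm_def)

lemma mat_pnorm_cong: "(\<And>i j. i < r \<Longrightarrow> j < r \<Longrightarrow> a i j = b i j) \<Longrightarrow> mat_pnorm r p a = mat_pnorm r p b"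
  unfolding mat_pnorm_def by (simp cong: mat_op_cong)

lemma mat_pnorm_triangle:
  assumes "torus_matrix \<theta> r a" "torus_matrix \<theta> r b" "1 < p"
  shows "mat_pnorm r p (\<lambda>i j. a i j + b i j) \<le> mat_pnorm r p a + mat_pnorm r p b"
  unfolding mat_pnorm_def mat_trace_eq mat_op_add
  by (intro mat.pnorm_triangle[of _ \<theta>] mat_op_mem) (use assms in auto)

lemma mat_pnorm_scaleC:
  assumes "torus_matrix \<theta> r a" "1 < p"
  shows "mat_pnorm r p (\<lambda>i j. c *\<^sub>C a i j) = cmod c * mat_pnorm r p a"
  unfolding mat_pnorm_def mat_trace_eq mat_op_scaleC
  by (intro mat.pnorm_scaleC[of _ \<theta>] mat_op_mem) (use assms in auto)

lemma minus_eq_scaleC: "- a = (- 1) *\<^sub>C a"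
  using scaleR_eq_scaleC[of "-1" a] by simp

lemma mat_pnorm_minus:
  assumes "torus_matrix \<theta> r a" "1 < p"
  shows "mat_pnorm r p (\<lambda>i j. - a i j) = mat_pnorm r p a"
  unfolding minus_eq_scaleC mat_pnorm_scaleC[OF assms] by simp

lemma torus_matrix_diff: "torus_matrix \<theta> r a \<Longrightarrow> torus_matrix \<theta> r b \<Longrightarrow> torus_matrix \<theta> r (\<lambda>i j. a i j - b i j)"
  by (auto intro: torus_algebra_diff)

lemma mat_pnorm_diff_le:
  assumes a: "torus_matrix \<theta> r a" and b: "torus_matrix \<theta> r b" and p: "1 < p"
  shows "\<bar>mat_pnorm r p a - mat_pnorm r p b\<bar> \<le> mat_pnorm r p (\<lambda>i j. a i j - b i j)"
proof -
  have le: "mat_pnorm r p x \<le> mat_pnorm r p (\<lambda>i j. x i j - y i j) + mat_pnorm r p y"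
    if "torus_matrix \<theta> r x" "torus_matrix \<theta> r y" for x y
    using mat_pnorm_triangle[OF torus_matrix_diff[OF that] that(2) p] by simp
  have "mat_pnorm r p (\<lambda>i j. b i j - a i j) = mat_pnorm r p (\<lambda>i j. a i j - b i j)"
    using mat_pnorm_minus[OF torus_matrix_diff[OF a b] p] by simp
  then show ?thesis using le[OF a b] le[OF b a] by linarith
qed

lemma mat_pnorm_0:
  assumes "1 < p" shows "mat_pnorm r p (\<lambda>i j. 0 :: 'n::{finite,linorder} ivec op) = 0"
proof -
  have "torus_matrix (0 :: 'n rmat) r (\<lambda>i j. 0)" by (simp add: torus_algebra_0)
  from mat_pnorm_scaleC[OF this assms, of 0] show ?thesis by (simp add: op_comp.zero_right)
qed

lemma mat_pnorm_sum_le: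
  assumes "finite F" "\<And>k. k \<in> F \<Longrightarrow> torus_matrix \<theta> r (a k)" "1 < p"
  shows "mat_pnorm r p (\<lambda>i j. \<Sum>k\<in>F. a k i j) \<le> (\<Sum>k\<in>F. mat_pnorm r p (a k))"
  using assms(1,2)
proof (induction F)
  case (insert x F)
  have "mat_pnorm r p (\<lambda>i j. \<Sum>k\<in>insert x F. a k i j) \<le> mat_pnorm r p (a x) + mat_pnorm r p (\<lambda>i j. \<Sum>k\<in>F. a k i j)"
    unfolding sum.insert[OF insert.hyps]
    by (rule mat_pnorm_triangle[where \<theta> = \<theta>]) (use insert.prems assms(3) in \<open>auto intro!: torus_algebra_sum\<close>)
  then show ?case using insert by fastforce
qed (simp add: mat_pnorm_0 assms)

section \<open>Matrices with one entry, and comparison of matrix norms with entry norms\<close>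

definition slot_embed :: "nat \<Rightarrow> 'i op \<Rightarrow> ('i \<times> nat) op" where
  "slot_embed j B = inj_op j o\<^sub>L B o\<^sub>L proj_op j"

lemma bounded_linear_slot_embed: "bounded_linear (slot_embed j)"
  unfolding slot_embed_def
  by (rule bounded_linear_compose[OF op_comp.bounded_linear_left op_comp.bounded_linear_right])

lemma proj_inj_cancel: "proj_op j o\<^sub>L (inj_op j o\<^sub>L A) = A"
  by (simp add: blinfun_compose_assoc[symmetric] proj_inj_op)

lemma slot_embed_compose: "slot_embed j (B o\<^sub>L C) = slot_embed j B o\<^sub>L slot_embed j C"
  unfolding slot_embed_def by (simp add: blinfun_compose_assoc proj_inj_cancel)

lemma norm_inj_op: "norm (inj_op i :: 'i ell2 \<Rightarrow>\<^sub>L _) = 1"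
proof -
  have "(norm (inj_op i :: 'i ell2 \<Rightarrow>\<^sub>L _))\<^sup>2 = 1\<^sup>2"
    unfolding is_adj_norm_square[OF is_adj_inj_op, symmetric] by (simp add: proj_inj_op)
  then show ?thesis by (rule power2_eq_imp_eq) auto
qed

lemma norm_proj_op: "norm (proj_op i :: _ \<Rightarrow>\<^sub>L 'i ell2) = 1"
  using is_adj_norm[OF is_adj_inj_op] norm_inj_op by metis

lemma norm_compose_le:
  assumes "norm A \<le> 1" "norm C \<le> 1" shows "norm (A o\<^sub>L B o\<^sub>L C) \<le> norm B"
proof -
  have "norm (A o\<^sub>L B o\<^sub>L C) \<le> (norm A * norm B) * norm C"
    by (rule order.trans[OF norm_blinfun_compose]) (intro mult_right_mono norm_blinfun_compose norm_ge_zero)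
  also have "\<dots> \<le> (1 * norm B) * 1" using assms by (intro mult_mono) auto
  finally show ?thesis by simp
qed

lemma norm_slot_embed: "norm (slot_embed j B) = norm B"
proof (rule antisym)
  show "norm (slot_embed j B) \<le> norm B"
    unfolding slot_embed_def by (rule norm_compose_le) (simp_all add: norm_inj_op norm_proj_op)
  have "B = proj_op j o\<^sub>L slot_embed j B o\<^sub>L inj_op j"
    by (simp add: slot_embed_def blinfun_compose_assoc proj_inj_cancel proj_inj_op)
  then have "norm B = norm (proj_op j o\<^sub>L slot_embed j B o\<^sub>L inj_op j)" by simp
  also have "\<dots> \<le> norm (slot_embed j B)"
    by (rule norm_compose_le) (simp_all add: norm_inj_op norm_proj_op)
  finally show "norm B \<le> norm (slot_embed j B)" .
qed

lemma mat_trace_slot_embed: "j < r \<Longrightarrow> mat_trace r (slot_embed j B) = torus_trace B"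
proof -
  assume "j < r"
  have "mat_trace r (slot_embed j B) = (\<Sum>i<r. torus_trace ((proj_op i o\<^sub>L inj_op j) o\<^sub>L B o\<^sub>L (proj_op j o\<^sub>L inj_op i)))"
    unfolding mat_trace_def slot_embed_def by (simp only: blinfun_compose_assoc)
  also have "\<dots> = (\<Sum>i<r. if i = j then torus_trace B else 0)"
    by (intro sum.cong refl) (auto simp: proj_inj_op op_comp.zero_left op_comp.zero_right torus_trace_def cinner.zero_right)
  also have "\<dots> = torus_trace B" using \<open>j < r\<close> by simp
  finally show ?thesis .
qed

text \<open>The adjoint of \<open>W\<close> times \<open>W\<close> lies entirely in the diagonal
  slot \<open>j\<close>, so the absolute value of \<open>W\<close> is that of \<open>a\<close>
  embedded there.\<close>

lemma mat_pnorm_single: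
  assumes a: "a \<in> torus_algebra \<theta>" and ij: "i < r" "j < r" and p: "1 < p"
  shows "mat_pnorm r p (\<lambda>k l. if k = i \<and> l = j then a else 0) = torus_pnorm p a"
proof -
  obtain a' where a': "is_adj a a'" using a by (auto elim: torus_algebraE)
  define W where "W = inj_op i o\<^sub>L (a o\<^sub>L proj_op j)"
  define V where "V = inj_op j o\<^sub>L a' o\<^sub>L proj_op i"
  have "mat_op r (\<lambda>k l. if k = i \<and> l = j then a else 0) = (\<Sum>k<r. \<Sum>l<r. if l = j then if k = i then W else 0 else 0)"
    unfolding mat_op_def W_def
    by (intro sum.cong refl) (auto simp: op_comp.zero_left op_comp.zero_right blinfun_compose_assoc)
  also have "\<dots> = W" using ij by simp
  finally have W: "mat_op r (\<lambda>k l. if k = i \<and> l = j then a else 0) = W" .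
  have adj: "is_adj W V"
    unfolding W_def V_def by (intro is_adj_compose is_adj_inj_op is_adj_sym[OF is_adj_inj_op] a')
  have VW: "V o\<^sub>L W = slot_embed j (a' o\<^sub>L a)"
    unfolding V_def W_def slot_embed_def by (simp add: blinfun_compose_assoc proj_inj_cancel)
  have herm: "is_adj (slot_embed j B) (slot_embed j B)" if "is_adj B B" for B
  proof -
    have "is_adj (inj_op j o\<^sub>L B o\<^sub>L proj_op j) (inj_op j o\<^sub>L (B o\<^sub>L proj_op j))"
      by (intro is_adj_compose is_adj_inj_op is_adj_sym[OF is_adj_inj_op] that)
    then show ?thesis by (simp add: slot_embed_def blinfun_compose_assoc)
  qed
  have "abs_powr W p = slot_embed j (abs_powr a p)"
    by (rule abs_powr_hom[OF bounded_linear_slot_embed slot_embed_compose norm_slot_embed herm a' adj VW])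
      (use p in auto)
  then show ?thesis
    unfolding mat_pnorm_def W trace_pnorm_def by (simp add: mat_trace_slot_embed[OF ij(2)])
qed

lemma torus_pnorm_eq_mat_pnorm:
  assumes "a \<in> torus_algebra \<theta>" "1 < p"
  shows "torus_pnorm p a = mat_pnorm 1 p (\<lambda>i j. a)"
  unfolding mat_pnorm_single[OF assms(1), of 0 1 0 p, OF zero_less_one zero_less_one assms(2), symmetric]
  by (rule mat_pnorm_cong) simp

text \<open>Convergence of all entries forces convergence of matrix norms. This is how statements
  about the torus norm reach matrices, both for limits of multipliers and for the completed
  spaces.\<close>

lemma mat_pnorm_le_sum:
  assumes a: "torus_matrix \<theta> r a" and p: "1 < p"
  shows "mat_pnorm r p a \<le> (\<Sum>i<r. \<Sum>j<r. torus_pnorm p (a i j))"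
proof -
  define e where "e = (\<lambda>(i, j) k l. if k = i \<and> l = j then a i j else 0)"
  have "(\<Sum>ij\<in>{..<r} \<times> {..<r}. e ij k l) = a k l" if "k < r" "l < r" for k l
  proof -
    have "(\<Sum>ij\<in>{..<r} \<times> {..<r}. e ij k l) = (\<Sum>ij\<in>{..<r} \<times> {..<r}. if ij = (k, l) then a k l else 0)"
      by (intro sum.cong refl) (auto simp: e_def split: if_splits)
    then show ?thesis using that by simp
  qed
  then have "mat_pnorm r p a = mat_pnorm r p (\<lambda>k l. \<Sum>ij\<in>{..<r} \<times> {..<r}. e ij k l)"
    by (intro mat_pnorm_cong) simp
  also have "\<dots> \<le> (\<Sum>ij\<in>{..<r} \<times> {..<r}. mat_pnorm r p (e ij))"
    by (rule mat_pnorm_sum_le[where \<theta> = \<theta>]) (use a p torus_algebra_0 in \<open>auto simp: e_def\<close>)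
  also have "\<dots> = (\<Sum>(i, j)\<in>{..<r} \<times> {..<r}. torus_pnorm p (a i j))"
    by (intro sum.cong refl) (use a p in \<open>auto simp: e_def intro!: mat_pnorm_single\<close>)
  finally show ?thesis by (simp add: sum.cartesian_product)
qed

lemma torus_pnorm_le_norm:
  assumes "a \<in> torus_algebra \<theta>" "1 < p" shows "torus_pnorm p a \<le> norm a"
proof -
  obtain a' where a': "is_adj a a'" using assms by (auto elim: torus_algebraE)
  show ?thesis
    using ket_trace_pnorm_le[of "{0}" a a' p] a' assms(2) by (simp add: torus_trace_eq)
qed

lemma torus_pnorm_unitary:
  assumes "unitary_op a" "1 < p" shows "torus_pnorm p a = 1"
proof -
  obtain b where "is_adj a b" "b o\<^sub>L a = id_blinfun" using assms(1) by (auto simp: unitary_op_def)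
  then have "abs_powr a p = id_blinfun" using assms(2) by (intro abs_powr_isometry) auto
  then show ?thesis by (simp add: trace_pnorm_def torus_trace_def cinner_self)
qed

subsection \<open>The dual action of the torus\<close>

definition rot :: "real \<Rightarrow> 'n \<Rightarrow> 'n::finite ivec op" where
  "rot h k = wperm (\<lambda>m. cis (h * real_of_int (m $ k))) (\<lambda>m. m)"

definition rot_amp :: "real \<Rightarrow> 'n \<Rightarrow> ('n::finite ivec \<times> nat) op" where
  "rot_amp h k = wperm (\<lambda>mi. cis (h * real_of_int (fst mi $ k))) (\<lambda>mi. mi)"

lemma coord_rot: "coord (blinfun_apply (rot h k) x) m = cis (h * real_of_int (m $ k)) * coord x m"
  unfolding rot_def by (subst coord_wperm) auto

lemma coord_rot_amp: "coord (blinfun_apply (rot_amp h k) x) mi = cis (h * real_of_int (fst mi $ k)) * coord x mi"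
  unfolding rot_amp_def by (subst coord_wperm) auto

lemma is_adj_rot: "is_adj (rot h k) (rot (- h) k)"
  using is_adj_wperm[of "\<lambda>m. m" "\<lambda>m. m" "\<lambda>m. cis (h * real_of_int (m $ k))"]
  by (simp add: rot_def cis_cnj)

lemma is_adj_rot_amp: "is_adj (rot_amp h k) (rot_amp (- h) k)"
  using is_adj_wperm[of "\<lambda>m. m" "\<lambda>m. m" "\<lambda>mi. cis (h * real_of_int (fst mi $ k))"]
  by (simp add: rot_amp_def cis_cnj)

lemma cis_cancel: "cis (- x) * (cis x * z) = z" "cis x * (cis (- x) * z) = z"
  by (simp_all add: mult.assoc[symmetric] cis_mult)

lemma rot_amp_inverse: "rot_amp (- h) k o\<^sub>L rot_amp h k = id_blinfun"
  by (intro blinfun_eqI ell2_eqI) (simp add: coord_rot_amp cis_cancel)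

lemma rot_ket_0: "blinfun_apply (rot h k) (ket 0) = ket 0"
  by (rule ell2_eqI) (simp add: coord_rot coord_ket)

text \<open>Having an adjoint forces complex linearity, which real-linear operators otherwise
  lack.\<close>

lemma adjointable_scalar_op:
  assumes "is_adj A B" shows "A o\<^sub>L scalar_op c = scalar_op c o\<^sub>L A"
proof (intro blinfun_eqI cinner_cancel_right)
  fix x y
  show "cinner y (blinfun_apply (A o\<^sub>L scalar_op c) x) = cinner y (blinfun_apply (scalar_op c o\<^sub>L A) x)"
    using is_adjD[OF is_adj_sym[OF assms], symmetric]
    by (simp add: scalar_op.rep_eq cinner_scaleC_right)
qed

lemma scalar_op_one: "scalar_op 1 = id_blinfun"
  using scalar_op_of_real[of 1] by simp

definition dual_action :: "real \<Rightarrow> 'n \<Rightarrow> 'n::finite ivec op \<Rightarrow> 'n ivec op" where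
  "dual_action h k a = rot h k o\<^sub>L a o\<^sub>L rot (- h) k"

text \<open>A diagonal unitary commutes with a right translation up to a unimodular scalar. The
  conjugate scalar comes from its inverse on the other side, and the two cancel.\<close>

lemma dual_action_mem:
  assumes a: "a \<in> torus_algebra \<theta>" shows "dual_action h k a \<in> torus_algebra \<theta>"
proof -
  obtain a' where a': "is_adj a a'" "\<And>k. a o\<^sub>L right_shift \<theta> k = right_shift \<theta> k o\<^sub>L a"
    using a by (rule torus_algebraE) blast
  have rot: "rot h k o\<^sub>L right_shift \<theta> q = cis (h * real_of_int (q $ k)) *\<^sub>C (right_shift \<theta> q o\<^sub>L rot h k)" for h q
  proof (intro blinfun_eqI ell2_eqI)
    fix x :: "'a ivec ell2" and m :: "'a ivec"
    have "cis (h * real_of_int (m $ k)) = cis (h * real_of_int (q $ k)) * cis (h * real_of_int ((m - q) $ k))"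
      by (simp add: cis_mult algebra_simps)
    then show "coord (blinfun_apply (rot h k o\<^sub>L right_shift \<theta> q) x) m
      = coord (blinfun_apply (cis (h * real_of_int (q $ k)) *\<^sub>C (right_shift \<theta> q o\<^sub>L rot h k)) x) m"
      by (simp only: blinfun_apply_blinfun_compose coord_rot coord_right_shift scalar_op.rep_eq
          scaleC_ell2.rep_eq mult_ac)
  qed
  have adj: "is_adj (dual_action h k a) (rot h k o\<^sub>L (a' o\<^sub>L rot (- h) k))"
    unfolding dual_action_def
    by (intro is_adj_compose a' is_adj_rot is_adj_sym[OF is_adj_rot])
  show ?thesis
  proof (rule torus_algebraI[OF adj])
    fix q
    define z where "z = cis (h * real_of_int (q $ k))"
    have z: "cis (- h * real_of_int (q $ k)) = cnj z" "cnj z * z = 1"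
      by (simp_all add: z_def cis_cnj cis_mult)
    have sr: "scalar_op c o\<^sub>L rot h k = rot h k o\<^sub>L scalar_op c" for c
      by (rule adjointable_scalar_op[OF is_adj_rot, symmetric])
    have sa: "scalar_op c o\<^sub>L a = a o\<^sub>L scalar_op c" for c
      by (rule adjointable_scalar_op[OF a'(1), symmetric])
    have "dual_action h k a o\<^sub>L right_shift \<theta> q = rot h k o\<^sub>L (a o\<^sub>L (rot (- h) k o\<^sub>L right_shift \<theta> q))"
      by (simp only: dual_action_def blinfun_compose_assoc)
    also have "\<dots> = rot h k o\<^sub>L (a o\<^sub>L (scalar_op (cnj z) o\<^sub>L (right_shift \<theta> q o\<^sub>L rot (- h) k)))"
      unfolding rot z ..
    also have "\<dots> = rot h k o\<^sub>L ((a o\<^sub>L scalar_op (cnj z)) o\<^sub>L (right_shift \<theta> q o\<^sub>L rot (- h) k))"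
      by (simp only: blinfun_compose_assoc)
    also have "\<dots> = (rot h k o\<^sub>L scalar_op (cnj z)) o\<^sub>L ((a o\<^sub>L right_shift \<theta> q) o\<^sub>L rot (- h) k)"
      unfolding sa[symmetric] by (simp only: blinfun_compose_assoc)
    also have "\<dots> = scalar_op (cnj z) o\<^sub>L ((rot h k o\<^sub>L right_shift \<theta> q) o\<^sub>L (a o\<^sub>L rot (- h) k))"
      unfolding sr[symmetric] a'(2) by (simp only: blinfun_compose_assoc)
    also have "\<dots> = (scalar_op (cnj z) o\<^sub>L scalar_op z) o\<^sub>L (right_shift \<theta> q o\<^sub>L (rot h k o\<^sub>L a o\<^sub>L rot (- h) k))"
      unfolding rot z_def by (simp only: blinfun_compose_assoc)
    also have "\<dots> = right_shift \<theta> q o\<^sub>L dual_action h k a"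
      by (simp add: scalar_op_mult z(2) dual_action_def scalar_op_one)
    finally show "dual_action h k a o\<^sub>L right_shift \<theta> q = right_shift \<theta> q o\<^sub>L dual_action h k a" .
  qed
qed

lemma dual_action_mono:
  "dual_action h k (torus_mono \<theta> m) = cis (h * real_of_int (m $ k)) *\<^sub>C torus_mono \<theta> m"
proof (rule torus_algebra_eqI)
  show "dual_action h k (torus_mono \<theta> m) \<in> torus_algebra \<theta>"
    by (intro dual_action_mem torus_mono_mem)
  show "cis (h * real_of_int (m $ k)) *\<^sub>C torus_mono \<theta> m \<in> torus_algebra \<theta>"
    by (intro torus_algebra_scaleC torus_mono_mem)
  show "blinfun_apply (dual_action h k (torus_mono \<theta> m)) (ket 0)
      = blinfun_apply (cis (h * real_of_int (m $ k)) *\<^sub>C torus_mono \<theta> m) (ket 0)"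
    by (rule ell2_eqI)
      (simp add: dual_action_def rot_ket_0 torus_mono_ket coord_rot scalar_op.rep_eq scaleC_ell2.rep_eq coord_ket)
qed

lemma bounded_linear_dual_action: "bounded_linear (dual_action h k)"
  unfolding dual_action_def
  by (rule bounded_linear_compose[OF op_comp.bounded_linear_left op_comp.bounded_linear_right])

text \<open>Acting on all entries is conjugation by the unitary \<open>rot_amp h k\<close>. It
  commutes with the formation of absolute powers and preserves the trace, because
  \<open>rot h k\<close> fixes the zero ket.\<close>

lemma mat_pnorm_dual_action:
  assumes a: "torus_matrix \<theta> r a" and p: "1 < p"
  shows "mat_pnorm r p (\<lambda>i j. dual_action h k (a i j)) = mat_pnorm r p a"
proof -
  define W where "W = (rot_amp h k :: ('a ivec \<times> nat) op)"
  define W' where "W' = (rot_amp (- h) k :: ('a ivec \<times> nat) op)"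
  define \<Phi> where "\<Phi> B = W o\<^sub>L B o\<^sub>L W'" for B
  have W: "is_adj W W'" "is_adj W' W" "W' o\<^sub>L W = id_blinfun" "W o\<^sub>L W' = id_blinfun"
    using is_adj_rot_amp[of h k] is_adj_rot_amp[of "- h" k] rot_amp_inverse[of h k] rot_amp_inverse[of "- h" k]
    by (simp_all add: W_def W'_def)
  have nW: "norm W = 1" "norm W' = 1"
    using W unfolding unitary_op_def[abs_def] by (auto intro!: unitary_op_norm simp: unitary_op_def)
  have lin: "bounded_linear \<Phi>"
    unfolding \<Phi>_def by (rule bounded_linear_compose[OF op_comp.bounded_linear_left op_comp.bounded_linear_right])
  have cancel: "W' o\<^sub>L (W o\<^sub>L C) = C" "W o\<^sub>L (W' o\<^sub>L C) = C" for C
    by (simp_all add: blinfun_compose_assoc[symmetric] W)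
  have mult: "\<Phi> (B o\<^sub>L C) = \<Phi> B o\<^sub>L \<Phi> C" for B C
    by (simp add: \<Phi>_def blinfun_compose_assoc cancel)
  have iso: "norm (\<Phi> B) = norm B" for B
  proof (rule antisym)
    show "norm (\<Phi> B) \<le> norm B" unfolding \<Phi>_def by (rule norm_compose_le) (simp_all add: nW)
    have "B = W' o\<^sub>L \<Phi> B o\<^sub>L W" by (simp add: \<Phi>_def blinfun_compose_assoc cancel W)
    then have "norm B = norm (W' o\<^sub>L \<Phi> B o\<^sub>L W)" by simp
    also have "\<dots> \<le> norm (\<Phi> B)" by (rule norm_compose_le) (simp_all add: nW)
    finally show "norm B \<le> norm (\<Phi> B)" .
  qed
  have adj: "is_adj (\<Phi> B) (\<Phi> C)" if "is_adj B C" for B C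
    using is_adj_compose[OF is_adj_compose[OF W(1) that] W(2)] by (simp add: \<Phi>_def blinfun_compose_assoc)
  have wi: "W o\<^sub>L inj_op i = inj_op i o\<^sub>L rot h k" "proj_op i o\<^sub>L W' = rot (- h) k o\<^sub>L proj_op i"
    "W' o\<^sub>L inj_op i = inj_op i o\<^sub>L rot (- h) k" "proj_op i o\<^sub>L W = rot h k o\<^sub>L proj_op i" for i
    unfolding W_def W'_def
    by (intro blinfun_eqI ell2_eqI; simp add: coord_inj_op coord_proj_op coord_rot coord_rot_amp)+
  have op: "mat_op r (\<lambda>i j. dual_action h k (a i j)) = \<Phi> (mat_op r a)"
    unfolding mat_op_def \<Phi>_def op_comp.sum_left op_comp.sum_right dual_action_def
  proof (intro sum.cong refl)
    fix i j
    have "W o\<^sub>L (inj_op i o\<^sub>L a i j o\<^sub>L proj_op j) o\<^sub>L W' = (W o\<^sub>L inj_op i) o\<^sub>L a i j o\<^sub>L (proj_op j o\<^sub>L W')"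
      by (simp only: blinfun_compose_assoc)
    then show "inj_op i o\<^sub>L (rot h k o\<^sub>L a i j o\<^sub>L rot (- h) k) o\<^sub>L proj_op j = W o\<^sub>L (inj_op i o\<^sub>L a i j o\<^sub>L proj_op j) o\<^sub>L W'"
      unfolding wi by (simp only: blinfun_compose_assoc)
  qed
  have "mat_op r a \<in> matrix_algebra \<theta> r" by (rule mat_op_mem) (use a in auto)
  then obtain B where B: "is_adj (mat_op r a) B" by (rule matrix_algebraE) blast
  have "abs_powr (\<Phi> (mat_op r a)) p = \<Phi> (abs_powr (mat_op r a) p)"
    by (rule abs_powr_hom[OF lin mult iso adj B adj[OF B] mult[symmetric]]) (use p in auto)
  moreover have "mat_trace r (\<Phi> C) = mat_trace r C" for C
    unfolding mat_trace_def
  proof (intro sum.cong refl)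
    fix i
    have "proj_op i o\<^sub>L \<Phi> C o\<^sub>L inj_op i = (proj_op i o\<^sub>L W) o\<^sub>L C o\<^sub>L (W' o\<^sub>L inj_op i)"
      unfolding \<Phi>_def by (simp only: blinfun_compose_assoc)
    then show "torus_trace (proj_op i o\<^sub>L \<Phi> C o\<^sub>L inj_op i) = torus_trace (proj_op i o\<^sub>L C o\<^sub>L inj_op i)"
      unfolding wi by (simp add: torus_trace_def cinner_ket coord_rot rot_ket_0)
  qed
  ultimately show ?thesis
    unfolding mat_pnorm_def op trace_pnorm_def by simp
qed

section \<open>Series with rapidly decreasing coefficients\<close>

lemma sqlen_nonneg [simp]: "0 \<le> sqlen m"
  by (simp add: sqlen_def sum_nonneg)

lemma sqlen_ge: "(real_of_int (m $ j))\<^sup>2 \<le> sqlen m"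
  unfolding sqlen_def by (rule member_le_sum) auto

lemma sum_inverse_one_plus_square_le:
  obtains C :: real where "\<And>B. (\<Sum>i\<in>{- int B..int B}. 1 / (1 + (real_of_int i)\<^sup>2)) \<le> C"
proof -
  have "summable (\<lambda>n. 1 / (1 + (real n)\<^sup>2))"
  proof (rule summable_comparison_test')
    show "summable (\<lambda>n. inverse (real n ^ 2))" by (rule inverse_power_summable) simp
    show "norm (1 / (1 + (real n)\<^sup>2)) \<le> inverse (real n ^ 2)" if "n \<ge> 1" for n
      using that by (simp add: inverse_eq_divide frac_le)
  qed
  define T where "T = (\<Sum>n. 1 / (1 + (real n)\<^sup>2))"
  have "(\<Sum>i\<in>{- int B..int B}. 1 / (1 + (real_of_int i)\<^sup>2)) \<le> T + T" for B
  proof -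
    have "(\<Sum>i\<in>{- int B..int B}. 1 / (1 + (real_of_int i)\<^sup>2))
        \<le> (\<Sum>i\<in>(\<lambda>n. int n) ` {..B} \<union> (\<lambda>n. - int n) ` {..B}. 1 / (1 + (real_of_int i)\<^sup>2))"
    proof (rule sum_mono2)
      show "{- int B..int B} \<subseteq> (\<lambda>n. int n) ` {..B} \<union> (\<lambda>n. - int n) ` {..B}"
      proof
        fix i assume i: "i \<in> {- int B..int B}"
        show "i \<in> (\<lambda>n. int n) ` {..B} \<union> (\<lambda>n. - int n) ` {..B}"
        proof (cases "0 \<le> i")
          case True
          then have "i = int (nat i)" "nat i \<le> B" using i by auto
          then show ?thesis by blast
        next
          case False
          then have "i = - int (nat (- i))" "nat (- i) \<le> B" using i by auto
          then show ?thesis by blast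
        qed
      qed
    qed auto
    also have "\<dots> \<le> (\<Sum>i\<in>(\<lambda>n. int n) ` {..B}. 1 / (1 + (real_of_int i)\<^sup>2))
        + (\<Sum>i\<in>(\<lambda>n. - int n) ` {..B}. 1 / (1 + (real_of_int i)\<^sup>2))"
      by (subst sum_Un) (auto intro!: sum_nonneg)
    also have "\<dots> = (\<Sum>n\<le>B. 1 / (1 + (real n)\<^sup>2)) + (\<Sum>n\<le>B. 1 / (1 + (real n)\<^sup>2))"
      by (subst (1 2) sum.reindex) (auto simp: inj_on_def)
    also have "\<dots> \<le> T + T"
      unfolding T_def using \<open>summable _\<close> by (intro add_mono sum_le_suminf) auto
    finally show ?thesis .
  qed
  then show ?thesis by (rule that)
qed

text \<open>The n-th power of 1 + |m|^2 dominates the product of the 1 + m_j^2. On a box the sum of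
  the reciprocal products factorises into n one-dimensional sums with a common bound.\<close>

lemma summable_lattice: "(\<lambda>m :: 'n::finite ivec. 1 / (1 + sqlen m) ^ CARD('n)) summable_on UNIV"
proof -
  obtain C :: real where C: "\<And>B. (\<Sum>i\<in>{- int B..int B}. 1 / (1 + (real_of_int i)\<^sup>2)) \<le> C"
    by (rule sum_inverse_one_plus_square_le) blast
  have "(\<Sum>m\<in>F. 1 / (1 + sqlen m) ^ CARD('n)) \<le> C ^ CARD('n)" if F: "finite F" for F :: "'n ivec set"
  proof -
    obtain B :: nat where B: "\<And>m j. m \<in> F \<Longrightarrow> \<bar>m $ j\<bar> \<le> int B"
    proof
      fix m j assume "m \<in> F"
      then have "nat \<bar>m $ j\<bar> \<le> (\<Sum>m\<in>F. \<Sum>j\<in>UNIV. nat \<bar>m $ j\<bar>)"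
        using F by (intro order.trans[OF _ member_le_sum[of m F "\<lambda>m. \<Sum>j\<in>UNIV. nat \<bar>m $ j\<bar>"]] member_le_sum[of j UNIV]) auto
      then show "\<bar>m $ j\<bar> \<le> int (\<Sum>m\<in>F. \<Sum>j\<in>UNIV. nat \<bar>m $ j\<bar>)" by linarith
    qed
    have "(\<Sum>m\<in>F. 1 / (1 + sqlen m) ^ CARD('n)) \<le> (\<Sum>m\<in>F. \<Prod>j\<in>UNIV. 1 / (1 + (real_of_int (m $ j))\<^sup>2))"
    proof (rule sum_mono)
      fix m :: "'n ivec"
      have "(\<Prod>j\<in>(UNIV :: 'n set). 1 / (1 + sqlen m)) \<le> (\<Prod>j\<in>UNIV. 1 / (1 + (real_of_int (m $ j))\<^sup>2))"
        by (intro prod_mono conjI frac_le) (auto simp: add_pos_nonneg sqlen_ge add_nonneg_nonneg)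
      then show "1 / (1 + sqlen m) ^ CARD('n) \<le> (\<Prod>j\<in>UNIV. 1 / (1 + (real_of_int (m $ j))\<^sup>2))"
        by (simp add: power_one_over)
    qed
    also have "\<dots> = (\<Sum>g\<in>vec_nth ` F. \<Prod>j\<in>(UNIV :: 'n set). 1 / (1 + (real_of_int (g j))\<^sup>2))"
      by (subst sum.reindex) (auto simp: inj_on_def vec_eq_iff)
    also have "\<dots> \<le> (\<Sum>g\<in>PiE UNIV (\<lambda>_. {- int B..int B}). \<Prod>j\<in>(UNIV :: 'n set). 1 / (1 + (real_of_int (g j))\<^sup>2))"
    proof (rule sum_mono2)
      have "- int B \<le> m $ j \<and> m $ j \<le> int B" if "m \<in> F" for m j
        using B[OF that, of j] by linarith
      then show "vec_nth ` F \<subseteq> PiE UNIV (\<lambda>_. {- int B..int B})" by (auto simp: PiE_UNIV_domain)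
    qed (auto intro!: finite_PiE prod_nonneg)
    also have "\<dots> = (\<Prod>j\<in>(UNIV :: 'n set). \<Sum>i\<in>{- int B..int B}. 1 / (1 + (real_of_int i)\<^sup>2))"
      by (subst prod_sum_PiE) auto
    also have "\<dots> \<le> (\<Prod>j\<in>(UNIV :: 'n set). C)"
      by (intro prod_mono conjI sum_nonneg C) auto
    finally show ?thesis by simp
  qed
  then show ?thesis by (intro nonneg_bdd_above_summable_on) (auto simp: bdd_above_def)
qed

section \<open>Rapid decrease and symbols of polynomial growth\<close>

lemma rapidly_decreasing_iff:
  "rapidly_decreasing c \<longleftrightarrow> (\<forall>k. \<exists>B. \<forall>m. (1 + sqlen m) ^ k * cmod (c m) \<le> B)"
proof -
  have "cmod (complex_of_real ((1 + sqlen m) ^ k) * c m) = (1 + sqlen m) ^ k * cmod (c m)" for k m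
    by (simp only: norm_mult norm_of_real) simp
  then show ?thesis by (simp add: rapidly_decreasing_def bounded_iff del: of_real_power)
qed

lemma rapidly_decreasing_summable:
  fixes c :: "'n::finite ivec \<Rightarrow> complex"
  assumes "rapidly_decreasing c"
  shows "(\<lambda>m. (1 + sqlen m) ^ k * cmod (c m)) summable_on UNIV"
proof -
  obtain B where B: "\<And>m. (1 + sqlen m) ^ (k + CARD('n)) * cmod (c m) \<le> B"
    using assms unfolding rapidly_decreasing_iff by meson
  have "(\<lambda>m :: 'n ivec. B * (1 / (1 + sqlen m) ^ CARD('n))) summable_on UNIV"
    by (intro summable_on_cmult_right summable_lattice)
  then show ?thesis
  proof (rule summable_on_comparison_test)
    fix m :: "'n ivec"
    have pos: "0 < 1 + sqlen m" by (simp add: add_pos_nonneg)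
    then show "(1 + sqlen m) ^ k * cmod (c m) \<le> B * (1 / (1 + sqlen m) ^ CARD('n))"
      using B[of m] by (simp add: field_simps power_add)
    show "0 \<le> (1 + sqlen m) ^ k * cmod (c m)" using pos by simp
  qed
qed

text \<open>The growth condition under which termwise multiplication preserves rapid decrease, so
  that the operators with such symbols map the smooth algebra to itself.\<close>

definition moderate :: "('n::finite ivec \<Rightarrow> complex) \<Rightarrow> bool" where
  "moderate \<phi> \<longleftrightarrow> (\<exists>C k. \<forall>m. cmod (\<phi> m) \<le> C * (1 + sqlen m) ^ k)"

lemma moderateI: "(\<And>m. cmod (\<phi> m) \<le> C * (1 + sqlen m) ^ k) \<Longrightarrow> moderate \<phi>"
  unfolding moderate_def by blast

lemma moderate_mult:
  assumes "moderate \<phi>" "moderate \<psi>" shows "moderate (\<lambda>m. \<phi> m * \<psi> m)"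
proof -
  obtain C k D l where *: "\<And>m. cmod (\<phi> m) \<le> C * (1 + sqlen m) ^ k" "\<And>m. cmod (\<psi> m) \<le> D * (1 + sqlen m) ^ l"
    using assms unfolding moderate_def by blast
  show ?thesis
  proof (rule moderateI)
    fix m
    have "cmod (\<phi> m * \<psi> m) \<le> (C * (1 + sqlen m) ^ k) * (D * (1 + sqlen m) ^ l)"
      unfolding norm_mult using * order.trans[OF norm_ge_zero *(1)] by (intro mult_mono) auto
    then show "cmod (\<phi> m * \<psi> m) \<le> (C * D) * (1 + sqlen m) ^ (k + l)"
      by (simp add: power_add mult_ac)
  qed
qed

lemma moderate_add:
  assumes "moderate \<phi>" "moderate \<psi>" shows "moderate (\<lambda>m. \<phi> m + \<psi> m)"
proof -
  obtain C k D l where *: "\<And>m. cmod (\<phi> m) \<le> C * (1 + sqlen m) ^ k" "\<And>m. cmod (\<psi> m) \<le> D * (1 + sqlen m) ^ l"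
    using assms unfolding moderate_def by blast
  have CD: "0 \<le> C" "0 \<le> D"
    using order.trans[OF norm_ge_zero *(1)[of 0]] order.trans[OF norm_ge_zero *(2)[of 0]]
    by (simp_all add: sqlen_def)
  show ?thesis
  proof (rule moderateI)
    fix m
    have "cmod (\<phi> m + \<psi> m) \<le> C * (1 + sqlen m) ^ k + D * (1 + sqlen m) ^ l"
      by (rule order.trans[OF norm_triangle_ineq add_mono[OF *]])
    also have "\<dots> \<le> C * (1 + sqlen m) ^ (k + l) + D * (1 + sqlen m) ^ (k + l)"
      by (intro add_mono mult_left_mono power_increasing CD) auto
    finally show "cmod (\<phi> m + \<psi> m) \<le> (C + D) * (1 + sqlen m) ^ (k + l)" by (simp add: distrib_right)
  qed
qed

lemma moderate_bounded: "(\<And>m. cmod (\<phi> m) \<le> C) \<Longrightarrow> moderate \<phi>"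
  by (rule moderateI[of _ C 0]) simp

lemma moderate_const: "moderate (\<lambda>m. c)"
  by (rule moderate_bounded[of _ "cmod c"]) simp

lemma moderate_power: "moderate \<phi> \<Longrightarrow> moderate (\<lambda>m. \<phi> m ^ k)"
  by (induction k) (auto intro: moderate_const moderate_mult)

lemma moderate_prod: "(\<And>i. i \<in> F \<Longrightarrow> moderate (\<phi> i)) \<Longrightarrow> moderate (\<lambda>m. \<Prod>i\<in>F. \<phi> i m)"
  by (induction F rule: infinite_finite_induct) (auto intro: moderate_const moderate_mult)

lemma abs_coord_le: "\<bar>real_of_int (m $ j)\<bar> \<le> 1 + sqlen m"
proof -
  have "\<bar>real_of_int (m $ j)\<bar> \<le> 1 + (real_of_int (m $ j))\<^sup>2"
  proof -
    have "0 \<le> (\<bar>real_of_int (m $ j)\<bar> - 1)\<^sup>2" by simp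
    then have "2 * \<bar>real_of_int (m $ j)\<bar> \<le> 1 + (real_of_int (m $ j))\<^sup>2"
      unfolding power2_diff by simp
    then show ?thesis by linarith
  qed
  then show ?thesis using sqlen_ge[of m j] by linarith
qed

lemma moderate_coord: "moderate (\<lambda>m. of_int (m $ j))"
  by (rule moderateI[of _ 1 1]) (use abs_coord_le in simp)

lemma moderate_sqlen: "moderate (\<lambda>m. of_real (sqlen m))"
  by (rule moderateI[of _ 1 1]) simp

lemma rapidly_decreasing_moderate_mult:
  assumes "moderate \<phi>" "rapidly_decreasing c" shows "rapidly_decreasing (\<lambda>m. \<phi> m * c m)"
  unfolding rapidly_decreasing_iff
proof
  fix k
  obtain C l where C: "\<And>m. cmod (\<phi> m) \<le> C * (1 + sqlen m) ^ l"
    using assms(1) unfolding moderate_def by blast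
  obtain B where B: "\<And>m. (1 + sqlen m) ^ (l + k) * cmod (c m) \<le> B"
    using assms(2) unfolding rapidly_decreasing_iff by meson
  have C0: "0 \<le> C" using order.trans[OF norm_ge_zero C[of 0]] by (simp add: sqlen_def)
  have "(1 + sqlen m) ^ k * cmod (\<phi> m * c m) \<le> C * B" for m
  proof -
    have "(1 + sqlen m) ^ k * cmod (\<phi> m * c m) \<le> (1 + sqlen m) ^ k * (C * (1 + sqlen m) ^ l * cmod (c m))"
      unfolding norm_mult by (intro mult_left_mono mult_right_mono C) auto
    also have "\<dots> = C * ((1 + sqlen m) ^ (l + k) * cmod (c m))" by (simp add: power_add mult_ac)
    also have "\<dots> \<le> C * B" by (intro mult_left_mono B C0)
    finally show ?thesis .
  qed
  then show "\<exists>B. \<forall>m. (1 + sqlen m) ^ k * cmod (\<phi> m * c m) \<le> B" by blast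
qed

lemma rapidly_decreasing_scale: "rapidly_decreasing c \<Longrightarrow> rapidly_decreasing (\<lambda>m. z * c m)"
  by (rule rapidly_decreasing_moderate_mult[OF moderate_const])

lemma rapidly_decreasing_add:
  assumes "rapidly_decreasing c" "rapidly_decreasing d" shows "rapidly_decreasing (\<lambda>m. c m + d m)"
  unfolding rapidly_decreasing_iff
proof
  fix k
  obtain B D where *: "\<And>m. (1 + sqlen m) ^ k * cmod (c m) \<le> B" "\<And>m. (1 + sqlen m) ^ k * cmod (d m) \<le> D"
    using assms unfolding rapidly_decreasing_iff by meson
  have "(1 + sqlen m) ^ k * cmod (c m + d m) \<le> B + D" for m
  proof -
    have "(1 + sqlen m) ^ k * cmod (c m + d m) \<le> (1 + sqlen m) ^ k * (cmod (c m) + cmod (d m))"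
      by (intro mult_left_mono norm_triangle_ineq) auto
    also have "\<dots> \<le> B + D" unfolding distrib_left by (intro add_mono *)
    finally show ?thesis .
  qed
  then show "\<exists>B. \<forall>m. (1 + sqlen m) ^ k * cmod (c m + d m) \<le> B" by blast
qed

lemma rapidly_decreasing_diff:
  "rapidly_decreasing c \<Longrightarrow> rapidly_decreasing d \<Longrightarrow> rapidly_decreasing (\<lambda>m. c m - d m)"
  using rapidly_decreasing_add[OF _ rapidly_decreasing_scale[of d "-1"], of c] by simp

lemma rapidly_decreasing_single: "rapidly_decreasing (\<lambda>m. if m = k then z else 0)"
  unfolding rapidly_decreasing_iff
proof
  fix l
  show "\<exists>B. \<forall>m. (1 + sqlen m) ^ l * cmod (if m = k then z else 0) \<le> B"
    by (rule exI[of _ "(1 + sqlen k) ^ l * cmod z"]) auto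
qed

section \<open>Absolutely convergent Fourier series as operators\<close>

definition torus_series :: "'n::{finite,linorder} rmat \<Rightarrow> ('n ivec \<Rightarrow> complex) \<Rightarrow> 'n ivec op" where
  "torus_series \<theta> c = (\<Sum>\<^sub>\<infinity>m. c m *\<^sub>C torus_mono \<theta> m)"

lemma scalar_op_zero: "scalar_op 0 = 0"
  using scalar_op_of_real[of 0] by simp

lemma norm_scalar_op_le: "norm (scalar_op c :: 'i op) \<le> cmod c"
  by (rule norm_blinfun_bound) (auto simp: scalar_op.rep_eq norm_scaleC_ell2)

lemma norm_scaled_mono_le: "norm (c *\<^sub>C torus_mono \<theta> m) \<le> cmod c"
  by (rule order.trans[OF norm_blinfun_compose]) (simp add: norm_torus_mono norm_scalar_op_le)

lemma rapidly_decreasing_abs_summable: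
  "rapidly_decreasing c \<Longrightarrow> (\<lambda>m. cmod (c m)) summable_on UNIV"
  using rapidly_decreasing_summable[of c 0] by simp

lemma torus_series_abs_summable:
  assumes "rapidly_decreasing c" shows "(\<lambda>m. norm (c m *\<^sub>C torus_mono \<theta> m)) summable_on UNIV"
  by (rule summable_on_comparison_test[OF rapidly_decreasing_abs_summable[OF assms]])
    (simp_all add: norm_scaled_mono_le)

lemma torus_series_has_sum:
  "rapidly_decreasing c \<Longrightarrow> ((\<lambda>m. c m *\<^sub>C torus_mono \<theta> m) has_sum torus_series \<theta> c) UNIV"
  unfolding torus_series_def
  by (rule has_sum_infsum[OF Infinite_Sum.abs_summable_summable[OF torus_series_abs_summable]])

lemma fourier_expansion_torus_series: "rapidly_decreasing c \<Longrightarrow> fourier_expansion \<theta> c (torus_series \<theta> c)"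
  by (simp add: fourier_expansion_def torus_series_has_sum)

lemma smooth_torus_eq: "smooth_torus \<theta> = torus_series \<theta> ` {c. rapidly_decreasing c}"
proof -
  have "a = torus_series \<theta> c" if "fourier_expansion \<theta> c a" for c a
    using that torus_series_has_sum[of c \<theta>] has_sum_unique unfolding fourier_expansion_def by blast
  moreover have "rapidly_decreasing c" if "fourier_expansion \<theta> c a" for c a
    using that by (simp add: fourier_expansion_def)
  ultimately show ?thesis
    unfolding smooth_torus_def using fourier_expansion_torus_series by blast
qed

lemma norm_torus_series_le:
  assumes "rapidly_decreasing c" shows "norm (torus_series \<theta> c) \<le> (\<Sum>\<^sub>\<infinity>m. cmod (c m))"
proof -
  have "norm (torus_series \<theta> c) \<le> (\<Sum>\<^sub>\<infinity>m. norm (c m *\<^sub>C torus_mono \<theta> m))"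
    unfolding torus_series_def by (rule norm_infsum_bound[OF torus_series_abs_summable[OF assms]])
  also have "\<dots> \<le> (\<Sum>\<^sub>\<infinity>m. cmod (c m))"
    by (intro infsum_mono torus_series_abs_summable rapidly_decreasing_abs_summable norm_scaled_mono_le assms)
  finally show ?thesis .
qed

lemma scalar_op_add: "scalar_op (a + b) = scalar_op a + scalar_op b"
  by (intro blinfun_eqI ell2_eqI)
    (simp add: scalar_op.rep_eq scaleC_ell2.rep_eq blinfun.bilinear_simps distrib_right)

lemma torus_series_add:
  assumes "rapidly_decreasing c" "rapidly_decreasing d"
  shows "torus_series \<theta> (\<lambda>m. c m + d m) = torus_series \<theta> c + torus_series \<theta> d"
proof -
  have "((\<lambda>m. (c m + d m) *\<^sub>C torus_mono \<theta> m) has_sum (torus_series \<theta> c + torus_series \<theta> d)) UNIV"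
    using has_sum_add[OF torus_series_has_sum[OF assms(1), of \<theta>] torus_series_has_sum[OF assms(2), of \<theta>]]
    by (simp add: scalar_op_add op_comp.add_left)
  then show ?thesis unfolding torus_series_def[of \<theta> "\<lambda>m. c m + d m"] by (rule infsumI)
qed

lemma torus_series_scale:
  assumes "rapidly_decreasing c"
  shows "torus_series \<theta> (\<lambda>m. z * c m) = z *\<^sub>C torus_series \<theta> c"
proof -
  have "((\<lambda>m. (z * c m) *\<^sub>C torus_mono \<theta> m) has_sum (z *\<^sub>C torus_series \<theta> c)) UNIV"
    using has_sum_bounded_linear[OF op_comp.bounded_linear_right torus_series_has_sum[OF assms, of \<theta>], of "scalar_op z"]
    by (simp add: scalar_op_mult[symmetric] blinfun_compose_assoc)
  then show ?thesis unfolding torus_series_def[of \<theta> "\<lambda>m. z * c m"] by (rule infsumI)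
qed

lemma torus_series_diff:
  assumes "rapidly_decreasing c" "rapidly_decreasing d"
  shows "torus_series \<theta> (\<lambda>m. c m - d m) = torus_series \<theta> c - torus_series \<theta> d"
  using torus_series_add[OF assms(1) rapidly_decreasing_scale[OF assms(2), of "-1"], of \<theta>]
    torus_series_scale[OF assms(2), of \<theta> "-1"] minus_eq_scaleC[of "torus_series \<theta> d"] by simp

lemma torus_series_single: "torus_series \<theta> (\<lambda>m. if m = k then 1 else 0) = torus_mono \<theta> k"
proof -
  have "torus_series \<theta> (\<lambda>m. if m = k then 1 else 0) = (\<Sum>\<^sub>\<infinity>m\<in>{k}. 1 *\<^sub>C torus_mono \<theta> m)"
    unfolding torus_series_def
    by (rule infsum_cong_neutral) (auto simp: op_comp.zero_left scalar_op_zero)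
  then show ?thesis by (simp add: scalar_op_one)
qed

lemma torus_series_mem:
  assumes "rapidly_decreasing c" shows "torus_series \<theta> c \<in> torus_algebra \<theta>"
proof (rule Lim_in_closed_set[OF closed_torus_algebra])
  show "(sum (\<lambda>m. c m *\<^sub>C torus_mono \<theta> m) \<longlongrightarrow> torus_series \<theta> c) (finite_subsets_at_top UNIV)"
    using torus_series_has_sum[OF assms] by (simp add: has_sum_def)
  show "\<forall>\<^sub>F F in finite_subsets_at_top UNIV. sum (\<lambda>m. c m *\<^sub>C torus_mono \<theta> m) F \<in> torus_algebra \<theta>"
    by (intro always_eventually allI torus_algebra_sum torus_algebra_scaleC torus_mono_mem)
qed simp

lemma smooth_torus_mem: "a \<in> smooth_torus \<theta> \<Longrightarrow> a \<in> torus_algebra \<theta>"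
  by (auto simp: smooth_torus_eq torus_series_mem)

lemma dual_action_series:
  assumes "rapidly_decreasing c"
  shows "dual_action h k (torus_series \<theta> c) = torus_series \<theta> (\<lambda>m. cis (h * real_of_int (m $ k)) * c m)"
proof -
  have "dual_action h k (z *\<^sub>C a) = z *\<^sub>C dual_action h k a" for z a
    unfolding dual_action_def using adjointable_scalar_op[OF is_adj_rot, of h k z]
    by (simp add: blinfun_compose_assoc[symmetric])
  then have "((\<lambda>m. (cis (h * real_of_int (m $ k)) * c m) *\<^sub>C torus_mono \<theta> m) has_sum dual_action h k (torus_series \<theta> c)) UNIV"
    using has_sum_bounded_linear[OF bounded_linear_dual_action torus_series_has_sum[OF assms, of \<theta>], of h k]
    by (simp add: dual_action_mono blinfun_compose_assoc[symmetric] scalar_op_mult mult.commute)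
  then show ?thesis unfolding torus_series_def[of \<theta> "\<lambda>m. cis (h * real_of_int (m $ k)) * c m"]
    by (rule infsumI[symmetric])
qed

lemma termwise_series:
  "rapidly_decreasing c \<Longrightarrow> termwise \<theta> \<phi> (torus_series \<theta> c) = torus_series \<theta> (\<lambda>m. \<phi> m * c m)"
  by (simp add: termwise_def fourier_coeff_eq[OF fourier_expansion_torus_series])
    (simp only: torus_series_def)

section \<open>Symbols of the derivations, the Laplacian and the heat semigroup\<close>

definition deriv_symbol :: "'n \<Rightarrow> 'n::finite ivec \<Rightarrow> complex" where
  "deriv_symbol j m = 2 * pi * \<i> * of_int (m $ j)"

lemma moderate_deriv_symbol: "moderate (deriv_symbol j)"
  unfolding deriv_symbol_def by (intro moderate_mult moderate_const moderate_coord)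

lemma deriv_op_series:
  "rapidly_decreasing c \<Longrightarrow> deriv_op \<theta> j (torus_series \<theta> c) = torus_series \<theta> (\<lambda>m. deriv_symbol j m * c m)"
  by (simp add: deriv_op_def deriv_symbol_def termwise_series)

lemma deriv_op_power_series:
  "rapidly_decreasing c \<Longrightarrow>
    (deriv_op \<theta> j ^^ k) (torus_series \<theta> c) = torus_series \<theta> (\<lambda>m. deriv_symbol j m ^ k * c m)"
proof (induction k)
  case (Suc k)
  have "rapidly_decreasing (\<lambda>m. deriv_symbol j m ^ k * c m)"
    by (intro rapidly_decreasing_moderate_mult moderate_power moderate_deriv_symbol Suc)
  then show ?case using Suc by (simp add: deriv_op_series mult.assoc)
qed simp

definition multi_symbol :: "'n nvec \<Rightarrow> 'n::finite ivec \<Rightarrow> complex" where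
  "multi_symbol \<alpha> m = (\<Prod>j\<in>UNIV. deriv_symbol j m ^ (\<alpha> $ j))"

lemma moderate_multi_symbol: "moderate (multi_symbol \<alpha>)"
  unfolding multi_symbol_def by (intro moderate_prod moderate_power moderate_deriv_symbol)

lemma deriv_multi_series:
  fixes \<alpha> :: "'n::{finite,linorder} nvec"
  assumes "rapidly_decreasing c"
  shows "deriv_multi \<theta> \<alpha> (torus_series \<theta> c) = torus_series \<theta> (\<lambda>m. multi_symbol \<alpha> m * c m)"
proof -
  define F where "F js = foldr (\<lambda>j F. (deriv_op \<theta> j ^^ (\<alpha> $ j)) \<circ> F) js id" for js
  define s where "s js m = (\<Prod>j\<in>set js. deriv_symbol j m ^ (\<alpha> $ j))" for js :: "'n list" and m
  have "F js (torus_series \<theta> c) = torus_series \<theta> (\<lambda>m. s js m * c m)" if "distinct js" for js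
    using that
  proof (induction js)
    case Nil
    then show ?case by (simp add: F_def s_def)
  next
    case (Cons j js)
    have "rapidly_decreasing (\<lambda>m. s js m * c m)"
      unfolding s_def by (intro rapidly_decreasing_moderate_mult moderate_prod moderate_power moderate_deriv_symbol assms)
    then have "F (j # js) (torus_series \<theta> c) = torus_series \<theta> (\<lambda>m. deriv_symbol j m ^ (\<alpha> $ j) * (s js m * c m))"
      using Cons by (simp add: F_def deriv_op_power_series)
    also have "(\<lambda>m. deriv_symbol j m ^ (\<alpha> $ j) * (s js m * c m)) = (\<lambda>m. s (j # js) m * c m)"
      using Cons.prems by (simp add: s_def mult.assoc)
    finally show ?case .
  qed
  from this[of "sorted_list_of_set UNIV"] show ?thesis
    by (simp add: F_def s_def deriv_multi_def multi_symbol_def)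
qed

lemma torus_series_sum:
  "(\<And>i. i \<in> F \<Longrightarrow> rapidly_decreasing (c i)) \<Longrightarrow> finite F \<Longrightarrow>
    torus_series \<theta> (\<lambda>m. \<Sum>i\<in>F. c i m) = (\<Sum>i\<in>F. torus_series \<theta> (c i)) \<and> rapidly_decreasing (\<lambda>m. \<Sum>i\<in>F. c i m)"
proof (induction F rule: infinite_finite_induct)
  case empty
  then show ?case
    using rapidly_decreasing_single[of 0 0] torus_series_scale[OF rapidly_decreasing_single[of 0 0], of \<theta> 0]
    by (simp add: op_comp.zero_left scalar_op_zero)
next
  case (insert x F)
  then show ?case by (simp add: torus_series_add rapidly_decreasing_add)
qed simp

lemma deriv_symbol_square_sum: "- (\<Sum>j\<in>UNIV. deriv_symbol j m * deriv_symbol j m) = of_real (4 * pi\<^sup>2 * sqlen m)"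
proof -
  have "deriv_symbol j m * deriv_symbol j m = - of_real (4 * pi\<^sup>2 * (real_of_int (m $ j))\<^sup>2)" for j
    by (simp add: deriv_symbol_def power2_eq_square algebra_simps)
  then have "(\<Sum>j\<in>UNIV. deriv_symbol j m * deriv_symbol j m) = - of_real (\<Sum>j\<in>UNIV. 4 * pi\<^sup>2 * (real_of_int (m $ j))\<^sup>2)"
    by (simp only: sum_negf of_real_sum)
  then show ?thesis by (simp only: sqlen_def sum_distrib_left minus_minus)
qed

lemma laplacian_series:
  assumes c: "rapidly_decreasing c"
  shows "laplacian \<theta> (torus_series \<theta> c) = torus_series \<theta> (\<lambda>m. of_real (4 * pi\<^sup>2 * sqlen m) * c m)"
proof -
  have r: "rapidly_decreasing (\<lambda>m. deriv_symbol j m * c m)" for j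
    by (intro rapidly_decreasing_moderate_mult moderate_deriv_symbol c)
  have rr: "rapidly_decreasing (\<lambda>m. deriv_symbol j m * (deriv_symbol j m * c m))" for j
    by (intro rapidly_decreasing_moderate_mult moderate_deriv_symbol c)
  have sum: "torus_series \<theta> (\<lambda>m. \<Sum>j\<in>UNIV. deriv_symbol j m * (deriv_symbol j m * c m))
      = (\<Sum>j\<in>UNIV. torus_series \<theta> (\<lambda>m. deriv_symbol j m * (deriv_symbol j m * c m)))"
    and sr: "rapidly_decreasing (\<lambda>m. \<Sum>j\<in>UNIV. deriv_symbol j m * (deriv_symbol j m * c m))"
    using torus_series_sum[of UNIV "\<lambda>j m. deriv_symbol j m * (deriv_symbol j m * c m)" \<theta>] rr by auto
  have "laplacian \<theta> (torus_series \<theta> c) = - torus_series \<theta> (\<lambda>m. \<Sum>j\<in>UNIV. deriv_symbol j m * (deriv_symbol j m * c m))"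
    unfolding laplacian_def sum by (simp add: deriv_op_series c r)
  also have "\<dots> = torus_series \<theta> (\<lambda>m. (-1) * (\<Sum>j\<in>UNIV. deriv_symbol j m * (deriv_symbol j m * c m)))"
    unfolding minus_eq_scaleC[of "torus_series \<theta> _"] by (rule torus_series_scale[OF sr, symmetric])
  also have "(\<lambda>m. (-1) * (\<Sum>j\<in>UNIV. deriv_symbol j m * (deriv_symbol j m * c m))) = (\<lambda>m. of_real (4 * pi\<^sup>2 * sqlen m) * c m)"
    unfolding deriv_symbol_square_sum[symmetric] by (simp add: sum_distrib_right mult.assoc)
  finally show ?thesis .
qed

definition lap_symbol :: "'n::finite ivec \<Rightarrow> complex" where
  "lap_symbol m = of_real (4 * pi\<^sup>2 * sqlen m)"

lemma moderate_lap_symbol: "moderate lap_symbol"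
  unfolding lap_symbol_def of_real_mult by (rule moderate_mult[OF moderate_const moderate_sqlen])

lemma laplacian_power_series:
  "rapidly_decreasing c \<Longrightarrow>
    (laplacian \<theta> ^^ l) (torus_series \<theta> c) = torus_series \<theta> (\<lambda>m. lap_symbol m ^ l * c m)"
proof (induction l)
  case (Suc l)
  have "rapidly_decreasing (\<lambda>m. lap_symbol m ^ l * c m)"
    by (intro rapidly_decreasing_moderate_mult moderate_power moderate_lap_symbol Suc)
  then show ?case using Suc by (simp add: laplacian_series lap_symbol_def mult.assoc)
qed simp

definition heat_symbol :: "real \<Rightarrow> 'n::finite ivec \<Rightarrow> complex" where
  "heat_symbol t m = of_real (exp (- (4 * pi\<^sup>2 * sqlen m * t)))"

lemma moderate_heat_symbol: "0 \<le> t \<Longrightarrow> moderate (heat_symbol t)"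
  by (rule moderate_bounded[of _ 1]) (simp add: heat_symbol_def)

lemma heat_series:
  "rapidly_decreasing c \<Longrightarrow> heat \<theta> t (torus_series \<theta> c) = torus_series \<theta> (\<lambda>m. heat_symbol t m * c m)"
  by (simp add: heat_def heat_symbol_def termwise_series)

lemma heat_op_series:
  assumes c: "rapidly_decreasing c" and t: "0 \<le> t"
  shows "heat_op \<theta> \<alpha> l t (torus_series \<theta> c)
    = torus_series \<theta> (\<lambda>m. multi_symbol \<alpha> m * lap_symbol m ^ l * heat_symbol t m * c m)"
proof -
  have h: "rapidly_decreasing (\<lambda>m. heat_symbol t m * c m)"
    by (intro rapidly_decreasing_moderate_mult moderate_heat_symbol c t)
  then have "rapidly_decreasing (\<lambda>m. lap_symbol m ^ l * (heat_symbol t m * c m))"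
    by (rule rapidly_decreasing_moderate_mult[OF moderate_power[OF moderate_lap_symbol]])
  then show ?thesis
    by (simp only: heat_op_def o_apply heat_series[OF c] laplacian_power_series[OF h] deriv_multi_series mult.assoc)
qed

section \<open>Completely bounded Fourier multipliers\<close>

text \<open>\<open>K\<close> is an upper bound, uniform in \<theta>, p and the matrix size, so sums,
  products and limits can be formed without tracking these. Only matrices of smooth elements occur;
  the completion is treated separately.\<close>

definition cb_multiplier :: "real \<Rightarrow> ('n::{finite,linorder} ivec \<Rightarrow> complex) \<Rightarrow> bool" where
  "cb_multiplier K \<phi> \<longleftrightarrow> moderate \<phi> \<and> 0 \<le> K \<and>
    (\<forall>\<theta> r p c. 1 < p \<longrightarrow> (\<forall>i<r. \<forall>j<r. rapidly_decreasing (c i j)) \<longrightarrow>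
      mat_pnorm r p (\<lambda>i j. torus_series \<theta> (\<lambda>m. \<phi> m * c i j m))
        \<le> K * mat_pnorm r p (\<lambda>i j. torus_series \<theta> (c i j)))"

lemma cb_multiplierI:
  assumes "moderate \<phi>" "0 \<le> K"
    "\<And>\<theta> r p c. 1 < p \<Longrightarrow> \<forall>i<r. \<forall>j<r. rapidly_decreasing (c i j) \<Longrightarrow>
      mat_pnorm r p (\<lambda>i j. torus_series \<theta> (\<lambda>m. \<phi> m * c i j m))
        \<le> K * mat_pnorm r p (\<lambda>i j. torus_series \<theta> (c i j))"
  shows "cb_multiplier K \<phi>"
  using assms unfolding cb_multiplier_def by simp

lemma cb_multiplierD:
  assumes "cb_multiplier K \<phi>"
  shows "moderate \<phi>" "0 \<le> K"
    "\<And>\<theta> r p c. 1 < p \<Longrightarrow> \<forall>i<r. \<forall>j<r. rapidly_decreasing (c i j) \<Longrightarrow>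
      mat_pnorm r p (\<lambda>i j. torus_series \<theta> (\<lambda>m. \<phi> m * c i j m))
        \<le> K * mat_pnorm r p (\<lambda>i j. torus_series \<theta> (c i j))"
  using assms unfolding cb_multiplier_def by simp_all

lemma cb_multiplier_mono:
  assumes "cb_multiplier K \<phi>" "K \<le> K'" shows "cb_multiplier K' \<phi>"
proof (rule cb_multiplierI)
  note \<phi> = cb_multiplierD[OF assms(1)]
  show "moderate \<phi>" "0 \<le> K'" using \<phi>(1,2) assms(2) by auto
  fix \<theta> :: "'a rmat" and r :: nat and p :: real and c :: "nat \<Rightarrow> nat \<Rightarrow> 'a ivec \<Rightarrow> complex"
  assume p: "1 < p" and c: "\<forall>i<r. \<forall>j<r. rapidly_decreasing (c i j)"
  show "mat_pnorm r p (\<lambda>i j. torus_series \<theta> (\<lambda>m. \<phi> m * c i j m))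
      \<le> K' * mat_pnorm r p (\<lambda>i j. torus_series \<theta> (c i j))"
    by (rule order.trans[OF \<phi>(3)[OF p c]]) (intro mult_right_mono assms(2) mat_pnorm_nonneg)
qed

lemma cb_multiplier_const: "cb_multiplier (cmod z) (\<lambda>m :: 'n::{finite,linorder} ivec. z)"
proof (rule cb_multiplierI[OF moderate_const norm_ge_zero])
  fix \<theta> :: "'n rmat" and r :: nat and p :: real and c :: "nat \<Rightarrow> nat \<Rightarrow> 'n ivec \<Rightarrow> complex"
  assume p: "1 < p" and c: "\<forall>i<r. \<forall>j<r. rapidly_decreasing (c i j)"
  have "mat_pnorm r p (\<lambda>i j. torus_series \<theta> (\<lambda>m. z * c i j m)) = mat_pnorm r p (\<lambda>i j. z *\<^sub>C torus_series \<theta> (c i j))"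
    by (rule mat_pnorm_cong) (use c in \<open>simp add: torus_series_scale\<close>)
  also have "\<dots> = cmod z * mat_pnorm r p (\<lambda>i j. torus_series \<theta> (c i j))"
    by (rule mat_pnorm_scaleC[where \<theta> = \<theta>]) (use c p in \<open>auto intro: torus_series_mem\<close>)
  finally show "mat_pnorm r p (\<lambda>i j. torus_series \<theta> (\<lambda>m. z * c i j m))
      \<le> cmod z * mat_pnorm r p (\<lambda>i j. torus_series \<theta> (c i j))" by simp
qed

lemma cb_multiplier_mult:
  fixes \<phi> \<psi> :: "'n::{finite,linorder} ivec \<Rightarrow> complex"
  assumes "cb_multiplier K \<phi>" "cb_multiplier L \<psi>" shows "cb_multiplier (K * L) (\<lambda>m. \<phi> m * \<psi> m)"
proof (rule cb_multiplierI)
  note \<phi> = cb_multiplierD[OF assms(1)] and \<psi> = cb_multiplierD[OF assms(2)]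
  show "moderate (\<lambda>m. \<phi> m * \<psi> m)" by (rule moderate_mult[OF \<phi>(1) \<psi>(1)])
  show "0 \<le> K * L" by (rule mult_nonneg_nonneg[OF \<phi>(2) \<psi>(2)])
  fix \<theta> :: "'n rmat" and r :: nat and p :: real and c :: "nat \<Rightarrow> nat \<Rightarrow> 'n ivec \<Rightarrow> complex"
  assume p: "1 < p" and c: "\<forall>i<r. \<forall>j<r. rapidly_decreasing (c i j)"
  have "\<forall>i<r. \<forall>j<r. rapidly_decreasing (\<lambda>m. \<psi> m * c i j m)"
    using c rapidly_decreasing_moderate_mult[OF \<psi>(1)] by blast
  from \<phi>(3)[OF p this, of \<theta>]
  have "mat_pnorm r p (\<lambda>i j. torus_series \<theta> (\<lambda>m. \<phi> m * \<psi> m * c i j m))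
     \<le> K * mat_pnorm r p (\<lambda>i j. torus_series \<theta> (\<lambda>m. \<psi> m * c i j m))" by (simp only: mult.assoc)
  also have "\<dots> \<le> K * (L * mat_pnorm r p (\<lambda>i j. torus_series \<theta> (c i j)))"
    by (intro mult_left_mono \<psi>(3)[OF p c] \<phi>(2))
  finally show "mat_pnorm r p (\<lambda>i j. torus_series \<theta> (\<lambda>m. \<phi> m * \<psi> m * c i j m))
     \<le> K * L * mat_pnorm r p (\<lambda>i j. torus_series \<theta> (c i j))" by (simp only: mult.assoc)
qed

lemma cb_multiplier_add:
  fixes \<phi> \<psi> :: "'n::{finite,linorder} ivec \<Rightarrow> complex"
  assumes "cb_multiplier K \<phi>" "cb_multiplier L \<psi>" shows "cb_multiplier (K + L) (\<lambda>m. \<phi> m + \<psi> m)"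
proof (rule cb_multiplierI)
  note \<phi> = cb_multiplierD[OF assms(1)] and \<psi> = cb_multiplierD[OF assms(2)]
  show "moderate (\<lambda>m. \<phi> m + \<psi> m)" by (rule moderate_add[OF \<phi>(1) \<psi>(1)])
  show "0 \<le> K + L" by (rule add_nonneg_nonneg[OF \<phi>(2) \<psi>(2)])
  fix \<theta> :: "'n rmat" and r :: nat and p :: real and c :: "nat \<Rightarrow> nat \<Rightarrow> 'n ivec \<Rightarrow> complex"
  assume p: "1 < p" and c: "\<forall>i<r. \<forall>j<r. rapidly_decreasing (c i j)"
  have r1: "\<forall>i<r. \<forall>j<r. rapidly_decreasing (\<lambda>m. \<phi> m * c i j m)"
    using c rapidly_decreasing_moderate_mult[OF \<phi>(1)] by blast
  have r2: "\<forall>i<r. \<forall>j<r. rapidly_decreasing (\<lambda>m. \<psi> m * c i j m)"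
    using c rapidly_decreasing_moderate_mult[OF \<psi>(1)] by blast
  have "mat_pnorm r p (\<lambda>i j. torus_series \<theta> (\<lambda>m. (\<phi> m + \<psi> m) * c i j m))
     = mat_pnorm r p (\<lambda>i j. torus_series \<theta> (\<lambda>m. \<phi> m * c i j m) + torus_series \<theta> (\<lambda>m. \<psi> m * c i j m))"
    by (rule mat_pnorm_cong) (use r1 r2 in \<open>simp add: distrib_right torus_series_add\<close>)
  also have "\<dots> \<le> mat_pnorm r p (\<lambda>i j. torus_series \<theta> (\<lambda>m. \<phi> m * c i j m))
      + mat_pnorm r p (\<lambda>i j. torus_series \<theta> (\<lambda>m. \<psi> m * c i j m))"
    by (rule mat_pnorm_triangle[where \<theta> = \<theta>]) (use r1 r2 p in \<open>auto intro: torus_series_mem\<close>)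
  also have "\<dots> \<le> K * mat_pnorm r p (\<lambda>i j. torus_series \<theta> (c i j)) + L * mat_pnorm r p (\<lambda>i j. torus_series \<theta> (c i j))"
    by (intro add_mono \<phi>(3)[OF p c] \<psi>(3)[OF p c])
  finally show "mat_pnorm r p (\<lambda>i j. torus_series \<theta> (\<lambda>m. (\<phi> m + \<psi> m) * c i j m))
     \<le> (K + L) * mat_pnorm r p (\<lambda>i j. torus_series \<theta> (c i j))" by (simp only: distrib_right)
qed

lemma cb_multiplier_scale: "cb_multiplier K \<phi> \<Longrightarrow> cb_multiplier (cmod z * K) (\<lambda>m. z * \<phi> m)"
  by (rule cb_multiplier_mult[OF cb_multiplier_const])

lemma cb_multiplier_sum:
  assumes "finite F" "\<And>i. i \<in> F \<Longrightarrow> cb_multiplier (K i) (\<phi> i)"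
  shows "cb_multiplier (\<Sum>i\<in>F. K i) (\<lambda>m. \<Sum>i\<in>F. \<phi> i m)"
  using assms
proof (induction F)
  case empty
  then show ?case using cb_multiplier_const[of 0] by simp
next
  case (insert i F)
  then show ?case by (simp add: cb_multiplier_add)
qed

lemma cb_multiplier_prod:
  assumes "finite F" "\<And>i. i \<in> F \<Longrightarrow> cb_multiplier (K i) (\<phi> i)"
  shows "cb_multiplier (\<Prod>i\<in>F. K i) (\<lambda>m. \<Prod>i\<in>F. \<phi> i m)"
  using assms
proof (induction F)
  case empty
  then show ?case using cb_multiplier_const[of 1] by simp
next
  case (insert i F)
  then show ?case by (simp add: cb_multiplier_mult)
qed

lemma cb_multiplier_power: "cb_multiplier K \<phi> \<Longrightarrow> cb_multiplier (K ^ k) (\<lambda>m. \<phi> m ^ k)"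
  using cb_multiplier_prod[of "{..<k}" "\<lambda>_. K" "\<lambda>_. \<phi>"] by simp

lemma cb_multiplier_character: "cb_multiplier 1 (\<lambda>m :: 'n::{finite,linorder} ivec. cis (h * real_of_int (m $ k)))"
proof (rule cb_multiplierI)
  show "moderate (\<lambda>m :: 'n ivec. cis (h * real_of_int (m $ k)))" by (rule moderate_bounded[of _ 1]) simp
  fix \<theta> :: "'n rmat" and r :: nat and p :: real and c :: "nat \<Rightarrow> nat \<Rightarrow> 'n ivec \<Rightarrow> complex"
  assume p: "1 < p" and c: "\<forall>i<r. \<forall>j<r. rapidly_decreasing (c i j)"
  have "mat_pnorm r p (\<lambda>i j. torus_series \<theta> (\<lambda>m. cis (h * real_of_int (m $ k)) * c i j m))
      = mat_pnorm r p (\<lambda>i j. dual_action h k (torus_series \<theta> (c i j)))"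
    by (rule mat_pnorm_cong) (use c in \<open>simp add: dual_action_series\<close>)
  also have "\<dots> = mat_pnorm r p (\<lambda>i j. torus_series \<theta> (c i j))"
    by (rule mat_pnorm_dual_action[where \<theta> = \<theta>]) (use c p in \<open>auto intro: torus_series_mem\<close>)
  finally show "mat_pnorm r p (\<lambda>i j. torus_series \<theta> (\<lambda>m. cis (h * real_of_int (m $ k)) * c i j m))
      \<le> 1 * mat_pnorm r p (\<lambda>i j. torus_series \<theta> (c i j))" by simp
qed simp

section \<open>Dominated convergence for sums and limits of multipliers\<close>

lemma infsum_dominated_null:
  fixes f :: "nat \<Rightarrow> 'a \<Rightarrow> real"
  assumes D: "D summable_on UNIV" and f: "\<And>n x. 0 \<le> f n x" "\<And>n x. f n x \<le> D x"
    and lim: "\<And>x. (\<lambda>n. f n x) \<longlonglongrightarrow> 0"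
  shows "(\<lambda>n. \<Sum>\<^sub>\<infinity>x. f n x) \<longlonglongrightarrow> 0"
proof (rule LIMSEQ_I)
  fix e :: real assume e: "0 < e"
  obtain F where F: "finite F" "dist (sum D F) (infsum D UNIV) \<le> e / 3"
    using infsum_finite_approximation[OF D, of "e / 3"] e by auto
  have fs: "f n summable_on A" for n A
    by (rule summable_on_subset_banach[OF summable_on_comparison_test[OF D]]) (use f in auto)
  have Ds: "D summable_on A" for A by (rule summable_on_subset_banach[OF D]) simp
  have "infsum D UNIV = sum D F + infsum D (- F)"
    using infsum_Un_disjoint[OF Ds Ds, of F "- F"] F(1) by (simp add: Compl_partition)
  then have tail: "infsum D (- F) \<le> e / 3" using F(2) by (simp add: dist_real_def)
  have "(\<lambda>n. \<Sum>x\<in>F. f n x) \<longlonglongrightarrow> (\<Sum>x\<in>F. 0)" by (intro tendsto_sum lim)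
  then have "(\<lambda>n. \<Sum>x\<in>F. f n x) \<longlonglongrightarrow> 0" by simp
  from LIMSEQ_D[OF this, of "e / 3"] e obtain N where N: "\<And>n. n \<ge> N \<Longrightarrow> \<bar>\<Sum>x\<in>F. f n x\<bar> < e / 3"
    by auto
  have "norm ((\<Sum>\<^sub>\<infinity>x. f n x) - 0) < e" if "n \<ge> N" for n
  proof -
    have "(\<Sum>\<^sub>\<infinity>x. f n x) = (\<Sum>x\<in>F. f n x) + infsum (f n) (- F)"
      using infsum_Un_disjoint[OF fs fs, of F "- F"] F(1) by (simp add: Compl_partition)
    moreover have "infsum (f n) (- F) \<le> infsum D (- F)" by (intro infsum_mono fs Ds f)
    moreover have "0 \<le> (\<Sum>\<^sub>\<infinity>x. f n x)" by (intro infsum_nonneg f)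
    ultimately show ?thesis using N[OF that] tail e by simp
  qed
  then show "\<exists>N. \<forall>n\<ge>N. norm ((\<Sum>\<^sub>\<infinity>x. f n x) - 0) < e" by blast
qed

lemma torus_series_tendsto:
  assumes c: "rapidly_decreasing c" and lim: "\<And>m. (\<lambda>n. \<phi> n m) \<longlonglongrightarrow> \<psi> m"
    and dom: "\<And>n m. cmod (\<phi> n m) \<le> C * (1 + sqlen m) ^ k"
  shows "(\<lambda>n. norm (torus_series \<theta> (\<lambda>m. \<phi> n m * c m) - torus_series \<theta> (\<lambda>m. \<psi> m * c m))) \<longlonglongrightarrow> 0"
proof (rule tendsto_sandwich[OF _ _ tendsto_const])
  have dom': "cmod (\<psi> m) \<le> C * (1 + sqlen m) ^ k" for m
    by (rule tendsto_upperbound[OF tendsto_norm[OF lim]]) (use dom in auto)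
  have rd: "rapidly_decreasing (\<lambda>m. \<phi> n m * c m)" "rapidly_decreasing (\<lambda>m. \<psi> m * c m)" for n
    by (rule rapidly_decreasing_moderate_mult[OF moderateI[OF dom] c],
        rule rapidly_decreasing_moderate_mult[OF moderateI[OF dom'] c])
  show "\<forall>\<^sub>F n in sequentially. norm (torus_series \<theta> (\<lambda>m. \<phi> n m * c m) - torus_series \<theta> (\<lambda>m. \<psi> m * c m))
      \<le> (\<Sum>\<^sub>\<infinity>m. cmod (\<phi> n m - \<psi> m) * cmod (c m))"
  proof (intro always_eventually allI)
    fix n
    have "torus_series \<theta> (\<lambda>m. \<phi> n m * c m) - torus_series \<theta> (\<lambda>m. \<psi> m * c m)
        = torus_series \<theta> (\<lambda>m. \<phi> n m * c m - \<psi> m * c m)"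
      by (rule torus_series_diff[OF rd, symmetric])
    then show "norm (torus_series \<theta> (\<lambda>m. \<phi> n m * c m) - torus_series \<theta> (\<lambda>m. \<psi> m * c m))
      \<le> (\<Sum>\<^sub>\<infinity>m. cmod (\<phi> n m - \<psi> m) * cmod (c m))"
      using norm_torus_series_le[OF rapidly_decreasing_diff[OF rd(1)[of n] rd(2)], of \<theta>]
      by (simp add: left_diff_distrib[symmetric] norm_mult)
  qed
  show "(\<lambda>n. \<Sum>\<^sub>\<infinity>m. cmod (\<phi> n m - \<psi> m) * cmod (c m)) \<longlonglongrightarrow> 0"
  proof (rule infsum_dominated_null)
    show "(\<lambda>m. (2 * C) * ((1 + sqlen m) ^ k * cmod (c m))) summable_on UNIV"
      by (intro summable_on_cmult_right rapidly_decreasing_summable c)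
    fix n :: nat and m
    have "cmod (\<phi> n m - \<psi> m) \<le> C * (1 + sqlen m) ^ k + C * (1 + sqlen m) ^ k"
      by (rule order.trans[OF norm_triangle_ineq4 add_mono[OF dom dom']])
    then have "cmod (\<phi> n m - \<psi> m) * cmod (c m) \<le> (C * (1 + sqlen m) ^ k + C * (1 + sqlen m) ^ k) * cmod (c m)"
      by (rule mult_right_mono) simp
    then show "cmod (\<phi> n m - \<psi> m) * cmod (c m) \<le> (2 * C) * ((1 + sqlen m) ^ k * cmod (c m))"
      by (simp add: algebra_simps)
    have "(\<lambda>n. cmod (\<phi> n m - \<psi> m) * cmod (c m)) \<longlonglongrightarrow> cmod (\<psi> m - \<psi> m) * cmod (c m)"
      by (intro tendsto_mult tendsto_norm tendsto_diff tendsto_const lim)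
    then show "(\<lambda>n. cmod (\<phi> n m - \<psi> m) * cmod (c m)) \<longlonglongrightarrow> 0" by simp
  qed simp
qed simp

text \<open>Rapidly decreasing coefficients absorb the common polynomial bound, so the series
  converge in operator norm by dominated convergence. The operator norm dominates the torus norm of
  each entry, hence the matrix norms converge too.\<close>

lemma cb_multiplier_limit:
  fixes \<phi> :: "nat \<Rightarrow> 'n::{finite,linorder} ivec \<Rightarrow> complex"
  assumes mult: "\<And>n. cb_multiplier K (\<phi> n)" and lim: "\<And>m. (\<lambda>n. \<phi> n m) \<longlonglongrightarrow> \<psi> m"
    and dom: "\<And>n m. cmod (\<phi> n m) \<le> C * (1 + sqlen m) ^ k"
  shows "cb_multiplier K \<psi>"
proof (rule cb_multiplierI)
  have dom': "cmod (\<psi> m) \<le> C * (1 + sqlen m) ^ k" for m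
    by (rule tendsto_upperbound[OF tendsto_norm[OF lim]]) (use dom in auto)
  show mod: "moderate \<psi>" by (rule moderateI[OF dom'])
  show "0 \<le> K" using cb_multiplierD(2)[OF mult] .
  fix \<theta> :: "'n rmat" and r :: nat and p :: real and c :: "nat \<Rightarrow> nat \<Rightarrow> 'n ivec \<Rightarrow> complex"
  assume p: "1 < p" and c: "\<forall>i<r. \<forall>j<r. rapidly_decreasing (c i j)"
  define a where "a n i j = torus_series \<theta> (\<lambda>m. \<phi> n m * c i j m)" for n i j
  define b where "b i j = torus_series \<theta> (\<lambda>m. \<psi> m * c i j m)" for i j
  have ab: "torus_matrix \<theta> r (a n)" "torus_matrix \<theta> r b" for n
    unfolding a_def b_def
    using c rapidly_decreasing_moderate_mult[OF mod] rapidly_decreasing_moderate_mult[OF cb_multiplierD(1)[OF mult]]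
    by (simp_all add: torus_series_mem)
  have "(\<lambda>n. \<Sum>i<r. \<Sum>j<r. norm (a n i j - b i j)) \<longlonglongrightarrow> (\<Sum>i<r. \<Sum>j<r. 0)"
    unfolding a_def b_def by (intro tendsto_sum torus_series_tendsto[OF _ lim dom]) (use c in auto)
  then have null: "(\<lambda>n. \<Sum>i<r. \<Sum>j<r. norm (a n i j - b i j)) \<longlonglongrightarrow> 0" by simp
  have "(\<lambda>n. mat_pnorm r p (a n) - mat_pnorm r p b) \<longlonglongrightarrow> 0"
  proof (rule Lim_null_comparison[OF _ null], intro always_eventually allI)
    fix n
    have "\<bar>mat_pnorm r p (a n) - mat_pnorm r p b\<bar> \<le> mat_pnorm r p (\<lambda>i j. a n i j - b i j)"
      by (rule mat_pnorm_diff_le[OF ab(1) ab(2) p])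
    also have "\<dots> \<le> (\<Sum>i<r. \<Sum>j<r. torus_pnorm p (a n i j - b i j))"
      by (rule mat_pnorm_le_sum[OF torus_matrix_diff[OF ab(1) ab(2)] p])
    also have "\<dots> \<le> (\<Sum>i<r. \<Sum>j<r. norm (a n i j - b i j))"
      using ab p by (intro sum_mono torus_pnorm_le_norm[of _ \<theta>] torus_algebra_diff) auto
    finally show "norm (mat_pnorm r p (a n) - mat_pnorm r p b) \<le> (\<Sum>i<r. \<Sum>j<r. norm (a n i j - b i j))"
      by simp
  qed
  then have "(\<lambda>n. mat_pnorm r p (a n)) \<longlonglongrightarrow> mat_pnorm r p b" by (rule LIM_zero_cancel)
  then have "mat_pnorm r p b \<le> K * mat_pnorm r p (\<lambda>i j. torus_series \<theta> (c i j))"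
  proof (rule tendsto_upperbound)
    show "\<forall>\<^sub>F n in sequentially. mat_pnorm r p (a n) \<le> K * mat_pnorm r p (\<lambda>i j. torus_series \<theta> (c i j))"
      unfolding a_def using cb_multiplierD(3)[OF mult p c] by (intro always_eventually allI)
  qed simp
  then show "mat_pnorm r p (\<lambda>i j. torus_series \<theta> (\<lambda>m. \<psi> m * c i j m))
      \<le> K * mat_pnorm r p (\<lambda>i j. torus_series \<theta> (c i j))" by (simp add: b_def[abs_def])
qed

subsection \<open>Gaussian multipliers from the simple random walk\<close>

lemma cis_sum: "(cis y + cis (- y)) / 2 = complex_of_real (cos y)"
  by (simp add: complex_eq_iff)

lemma cb_multiplier_cos_power: "cb_multiplier 1 (\<lambda>m. complex_of_real (cos (h * real_of_int (m $ k))) ^ n)"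
proof -
  have "cb_multiplier (1 + 1) (\<lambda>m. cis (h * real_of_int (m $ k)) + cis ((- h) * real_of_int (m $ k)))"
    by (intro cb_multiplier_add cb_multiplier_character)
  from cb_multiplier_scale[OF this, of "1 / 2"]
  have "cb_multiplier 1 (\<lambda>m. (cis (h * real_of_int (m $ k)) + cis (- (h * real_of_int (m $ k)))) / 2)"
    by simp
  then have "cb_multiplier 1 (\<lambda>m. complex_of_real (cos (h * real_of_int (m $ k))))"
    by (simp only: cis_sum)
  from cb_multiplier_power[OF this, of n] show ?thesis by simp
qed

lemma cos_power_expansion:
  "complex_of_real (cos y) ^ N = (\<Sum>k\<le>N. complex_of_real (Bernstein N k (1/2)) * cis ((2 * real k - real N) * y))"
proof -
  have "complex_of_real (cos y) ^ N = (cis y / 2 + cis (- y) / 2) ^ N"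
    unfolding cis_sum[symmetric] add_divide_distrib ..
  also have "\<dots> = (\<Sum>k\<le>N. of_nat (N choose k) * (cis y / 2) ^ k * (cis (- y) / 2) ^ (N - k))"
    by (rule binomial_ring)
  also have "\<dots> = (\<Sum>k\<le>N. complex_of_real (Bernstein N k (1/2)) * cis ((2 * real k - real N) * y))"
  proof (rule sum.cong[OF refl])
    fix k assume k: "k \<in> {..N}"
    then have "cis y ^ k * cis (- y) ^ (N - k) = cis ((2 * real k - real N) * y)"
      unfolding Complex.DeMoivre cis_mult by (simp add: of_nat_diff algebra_simps)
    then show "of_nat (N choose k) * (cis y / 2) ^ k * (cis (- y) / 2) ^ (N - k)
      = complex_of_real (Bernstein N k (1/2)) * cis ((2 * real k - real N) * y)"
      by (simp add: Bernstein_def power_divide mult_ac)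
  qed
  finally show ?thesis .
qed

text \<open>Differentiating the expansion of \<open>cos\<^sup>N\<close>.\<close>

lemma sin_cos_power_expansion:
  "\<i> * complex_of_real (sin y) * complex_of_real (cos y) ^ n
    = (\<Sum>k\<le>Suc n. complex_of_real (Bernstein (Suc n) k (1/2) * (2 * real k - real (Suc n)) / real (Suc n))
        * cis ((2 * real k - real (Suc n)) * y))"
proof -
  define N where "N = Suc n"
  define b where "b k = 2 * real k - real N" for k
  have "((\<lambda>y. cos y ^ Suc n) has_real_derivative (1 + real n) * (- sin y * cos y ^ n)) (at y)"
    by (rule DERIV_power_Suc[OF DERIV_cos])
  moreover have "(1 + real n) * (- sin y * cos y ^ n) = real (Suc n) * cos y ^ n * (- sin y)" by simp
  ultimately have "((\<lambda>y. cos y ^ Suc n) has_real_derivative real (Suc n) * cos y ^ n * (- sin y)) (at y)"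
    by (simp only:)
  then have "((\<lambda>y. complex_of_real (cos y ^ N)) has_vector_derivative complex_of_real (real N * cos y ^ n * (- sin y))) (at y)"
    unfolding N_def by (intro has_vector_derivative_of_real) (simp only: has_real_derivative_iff_has_vector_derivative)
  moreover have "((\<lambda>y. \<Sum>k\<le>N. complex_of_real (Bernstein N k (1/2)) * cis (b k * y)) has_vector_derivative
      (\<Sum>k\<le>N. complex_of_real (Bernstein N k (1/2)) * (b k *\<^sub>R (\<i> * cis (b k * y))))) (at y)"
    by (intro has_vector_derivative_sum has_vector_derivative_mult_right)
      (auto simp: cis_conv_exp scaleR_conv_of_real mult_ac intro!: derivative_eq_intros has_vector_derivative_real_field)
  ultimately have "complex_of_real (real N * cos y ^ n * (- sin y))
      = (\<Sum>k\<le>N. complex_of_real (Bernstein N k (1/2)) * (b k *\<^sub>R (\<i> * cis (b k * y))))"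
    unfolding of_real_power cos_power_expansion b_def[symmetric] by (rule vector_derivative_unique_at)
  then have "- (\<i> / of_nat N) * complex_of_real (real N * cos y ^ n * (- sin y))
      = - (\<i> / of_nat N) * (\<Sum>k\<le>N. complex_of_real (Bernstein N k (1/2)) * (b k *\<^sub>R (\<i> * cis (b k * y))))"
    by simp
  moreover have "- (\<i> / of_nat N) * complex_of_real (real N * cos y ^ n * (- sin y))
      = \<i> * complex_of_real (sin y) * complex_of_real (cos y) ^ n"
  proof -
    have "of_nat N \<noteq> (0 :: complex)" by (simp add: N_def del: of_nat_Suc)
    then show ?thesis by (simp add: field_simps)
  qed
  moreover have "- (\<i> / of_nat N) * (\<Sum>k\<le>N. complex_of_real (Bernstein N k (1/2)) * (b k *\<^sub>R (\<i> * cis (b k * y))))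
      = (\<Sum>k\<le>N. complex_of_real (Bernstein N k (1/2) * b k / real N) * cis (b k * y))"
    unfolding sum_distrib_left by (rule sum.cong[OF refl]) (simp add: scaleR_conv_of_real field_simps)
  ultimately show ?thesis by (simp add: N_def b_def)
qed

text \<open>The position of a simple random walk after \<open>N\<close> steps has variance
  \<open>N\<close>, so its mean absolute value is at most the square root of
  \<open>N\<close>.\<close>

lemma random_walk_abs_mean_le:
  assumes "0 < N"
  shows "(\<Sum>k\<le>N. Bernstein N k (1/2) * \<bar>2 * real k - real N\<bar>) \<le> sqrt (real N)"
proof -
  have var: "(\<Sum>k\<le>N. Bernstein N k (1/2) * (2 * real k - real N)\<^sup>2) = real N"
  proof -
    have "(\<Sum>k\<le>N. Bernstein N k (1/2) * (2 * real k - real N)\<^sup>2)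
        = (\<Sum>k\<le>N. 4 * (real k * (real k - 1) * Bernstein N k (1/2)) + (4 - 4 * real N) * (real k * Bernstein N k (1/2))
           + (real N)\<^sup>2 * Bernstein N k (1/2))"
      by (rule sum.cong[OF refl]) (simp add: power2_eq_square algebra_simps)
    also have "\<dots> = 4 * (real N * (real N - 1) * (1/2)\<^sup>2) + (4 - 4 * real N) * (real N * (1/2)) + (real N)\<^sup>2 * 1"
      by (simp only: sum.distrib sum_distrib_left[symmetric] sum_Bernstein sum_k_Bernstein sum_kk_Bernstein)
    also have "\<dots> = real N" by (simp add: power2_eq_square field_simps)
    finally show ?thesis .
  qed
  define s where "s = sqrt (real N)"
  have s: "0 < s" "s\<^sup>2 = real N" using assms by (auto simp: s_def)
  \<comment> \<open>Linear in the square, so only the variance is needed; at the standard deviation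
    \<open>s\<close> the two halves contribute s/2 each.\<close>
  have amgm: "\<bar>x\<bar> \<le> s / 2 + x\<^sup>2 / (2 * s)" for x :: real
  proof -
    have "0 \<le> (\<bar>x\<bar> - s)\<^sup>2" by simp
    then have "2 * (\<bar>x\<bar> * s) \<le> s\<^sup>2 + x\<^sup>2" unfolding power2_diff by simp
    then show ?thesis using s(1) by (simp add: field_simps power2_eq_square)
  qed
  have "(\<Sum>k\<le>N. Bernstein N k (1/2) * \<bar>2 * real k - real N\<bar>)
      \<le> (\<Sum>k\<le>N. Bernstein N k (1/2) * (s / 2 + (2 * real k - real N)\<^sup>2 / (2 * s)))"
    by (intro sum_mono mult_left_mono amgm Bernstein_nonneg) auto
  also have "\<dots> = s / 2 * (\<Sum>k\<le>N. Bernstein N k (1/2)) + (\<Sum>k\<le>N. Bernstein N k (1/2) * (2 * real k - real N)\<^sup>2) / (2 * s)"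
  proof -
    have "Bernstein N k (1/2) * (s / 2 + (2 * real k - real N)\<^sup>2 / (2 * s))
      = s / 2 * Bernstein N k (1/2) + (Bernstein N k (1/2) * (2 * real k - real N)\<^sup>2) / (2 * s)" for k
      by (simp add: distrib_left mult.commute)
    then show ?thesis by (simp only: sum.distrib sum_distrib_left sum_divide_distrib)
  qed
  also have "\<dots> = s" unfolding var using s by (simp add: field_simps power2_eq_square)
  finally show ?thesis by (simp add: s_def)
qed

text \<open>The coefficients are walk probabilities times displacement over \<open>Suc n\<close>.
  Their absolute sum is therefore the mean displacement divided by the number of steps.\<close>

lemma cb_multiplier_sin_cos_power:
  "cb_multiplier (1 / sqrt (real (Suc n)))
    (\<lambda>m. \<i> * complex_of_real (sin (h * real_of_int (m $ k))) * complex_of_real (cos (h * real_of_int (m $ k))) ^ n)"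
proof -
  define w where "w q = Bernstein (Suc n) q (1/2) * (2 * real q - real (Suc n)) / real (Suc n)" for q
  have "cb_multiplier (\<Sum>q\<le>Suc n. cmod (complex_of_real (w q)) * 1)
      (\<lambda>m. \<Sum>q\<le>Suc n. complex_of_real (w q) * cis (((2 * real q - real (Suc n)) * h) * real_of_int (m $ k)))"
    by (intro cb_multiplier_sum cb_multiplier_scale cb_multiplier_character finite_atMost)
  moreover have "(\<Sum>q\<le>Suc n. cmod (complex_of_real (w q)) * 1) \<le> 1 / sqrt (real (Suc n))"
  proof -
    have "(\<Sum>q\<le>Suc n. cmod (complex_of_real (w q)) * 1)
        = (\<Sum>q\<le>Suc n. Bernstein (Suc n) q (1/2) * \<bar>2 * real q - real (Suc n)\<bar>) / real (Suc n)"
      unfolding sum_divide_distrib w_def norm_of_real mult_1_right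
      by (rule sum.cong[OF refl]) (simp add: abs_mult Bernstein_nonneg del: of_nat_Suc)
    also have "\<dots> \<le> sqrt (real (Suc n)) / real (Suc n)"
      by (intro divide_right_mono random_walk_abs_mean_le) auto
    also have "\<dots> = 1 / sqrt (real (Suc n))"
    proof -
      define q where "q = sqrt (real (Suc n))"
      have "q > 0" "real (Suc n) = q * q" by (simp_all add: q_def del: of_nat_Suc)
      then show ?thesis unfolding q_def[symmetric] by simp
    qed
    finally show ?thesis .
  qed
  ultimately have "cb_multiplier (1 / sqrt (real (Suc n)))
      (\<lambda>m. \<Sum>q\<le>Suc n. complex_of_real (w q) * cis (((2 * real q - real (Suc n)) * h) * real_of_int (m $ k)))"
    by (rule cb_multiplier_mono)
  then show ?thesis
    unfolding sin_cos_power_expansion w_def by (simp only: mult.assoc)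
qed

text \<open>The central limit theorem for the simple random walk in terms of characteristic
  functions. The scale uses \<open>Suc n\<close>, the degree of the expansion for the derivative
  symbol; the exponent \<open>n\<close> changes nothing in the limit.\<close>

lemma cos_power_limit: "(\<lambda>n::nat. cos (x / sqrt (real (Suc n))) ^ n) \<longlonglongrightarrow> exp (- (x\<^sup>2 / 2))"
proof (cases "x = 0")
  case False
  then show ?thesis by (simp add: power2_eq_square) real_asymp
qed simp

lemma sin_scaled_limit: "(\<lambda>n::nat. sqrt (real (Suc n)) * sin (x / sqrt (real (Suc n)))) \<longlonglongrightarrow> x"
proof (cases "x = 0")
  case False
  then show ?thesis by real_asymp
qed simp

definition heat1 :: "real \<Rightarrow> 'n \<Rightarrow> 'n::finite ivec \<Rightarrow> complex" where
  "heat1 s k m = complex_of_real (exp (- (4 * pi\<^sup>2 * (real_of_int (m $ k))\<^sup>2 * s)))"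

lemma cb_multiplier_heat1:
  assumes s: "0 < s" shows "cb_multiplier 1 (heat1 s k)"
proof (rule cb_multiplier_limit)
  \<comment> \<open>Chosen so that half the square of \<open>a * x\<close> is the heat exponent
    \<open>4 * pi\<^sup>2 * x\<^sup>2 * s\<close>.\<close>
  define a where "a = 2 * pi * sqrt (2 * s)"
  show "cb_multiplier 1 (\<lambda>m. complex_of_real (cos (a / sqrt (real (Suc n)) * real_of_int (m $ k))) ^ n)" for n
    by (rule cb_multiplier_cos_power)
  show "cmod (complex_of_real (cos (a / sqrt (real (Suc n)) * real_of_int (m $ k))) ^ n) \<le> 1 * (1 + sqlen m) ^ 0"
    for n and m :: "'a ivec"
    by (simp add: norm_power power_le_one)
  fix m :: "'a ivec"
  have "(a * real_of_int (m $ k))\<^sup>2 / 2 = 4 * pi\<^sup>2 * (real_of_int (m $ k))\<^sup>2 * s"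
    using s by (simp add: a_def power_mult_distrib)
  with cos_power_limit[of "a * real_of_int (m $ k)"]
  have "(\<lambda>n. cos (a / sqrt (real (Suc n)) * real_of_int (m $ k)) ^ n)
      \<longlonglongrightarrow> exp (- (4 * pi\<^sup>2 * (real_of_int (m $ k))\<^sup>2 * s))" by simp
  from tendsto_of_real[OF this, where 'a = complex]
  show "(\<lambda>n. complex_of_real (cos (a / sqrt (real (Suc n)) * real_of_int (m $ k))) ^ n) \<longlonglongrightarrow> heat1 s k m"
    by (simp only: heat1_def of_real_power)
qed

text \<open>Rescaling by 2 pi sqrt(N) / a turns the sine into the symbol of the derivative in the
  limit. The factor sqrt(N) cancels the N^(-1/2) of the sine-cosine multiplier, with N =
  \<open>Suc n\<close>, and 2 pi / a is 1 / sqrt(2 s).\<close>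

lemma cb_multiplier_deriv_heat1:
  assumes s: "0 < s" shows "cb_multiplier (1 / sqrt (2 * s)) (\<lambda>m. deriv_symbol k m * heat1 s k m)"
proof (rule cb_multiplier_limit)
  define a where "a = 2 * pi * sqrt (2 * s)"
  have a: "0 < a" using s by (simp add: a_def)
  define \<phi> where "\<phi> n m = complex_of_real (2 * pi * sqrt (real (Suc n)) / a) *
      (\<i> * complex_of_real (sin (a / sqrt (real (Suc n)) * real_of_int (m $ k)))
        * complex_of_real (cos (a / sqrt (real (Suc n)) * real_of_int (m $ k))) ^ n)" for n and m :: "'a ivec"
  have "cb_multiplier (cmod (complex_of_real (2 * pi * sqrt (real (Suc n)) / a)) * (1 / sqrt (real (Suc n)))) (\<phi> n)" for n
    unfolding \<phi>_def by (intro cb_multiplier_scale cb_multiplier_sin_cos_power)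
  moreover have "cmod (complex_of_real (2 * pi * sqrt (real (Suc n)) / a)) * (1 / sqrt (real (Suc n))) = 1 / sqrt (2 * s)" for n
    unfolding norm_of_real using s by (simp add: a_def abs_mult del: of_nat_Suc)
  ultimately show "cb_multiplier (1 / sqrt (2 * s)) (\<phi> n)" for n by simp
  show "cmod (\<phi> n m) \<le> (2 * pi) * (1 + sqlen m) ^ 1" for n and m :: "'a ivec"
  proof -
    define q where "q = sqrt (real (Suc n))"
    have q: "0 < q" by (simp add: q_def)
    define x where "x = real_of_int (m $ k)"
    have "cmod (\<phi> n m) = (2 * pi * q / a) * (\<bar>sin (a / q * x)\<bar> * \<bar>cos (a / q * x)\<bar> ^ n)"
      unfolding \<phi>_def q_def[symmetric] x_def[symmetric] norm_mult norm_power norm_of_real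
      using a q by (simp add: abs_mult)
    \<comment> \<open>The linear bound on the sine cancels the growing prefactor and gives a
      domination uniform in \<open>n\<close>.\<close>
    also have "\<dots> \<le> (2 * pi * q / a) * (\<bar>a / q * x\<bar> * 1)"
      using a q by (intro mult_left_mono mult_mono abs_sin_x_le_abs_x power_le_one) auto
    also have "\<dots> = 2 * pi * \<bar>x\<bar>" using a q by (simp add: abs_mult)
    also have "\<dots> \<le> 2 * pi * (1 + sqlen m)"
      unfolding x_def by (intro mult_left_mono abs_coord_le) auto
    finally show ?thesis by simp
  qed
  fix m :: "'a ivec"
  define x where "x = real_of_int (m $ k)"
  have "(a * x)\<^sup>2 / 2 = 4 * pi\<^sup>2 * x\<^sup>2 * s"
    using s by (simp add: a_def power_mult_distrib)
  with cos_power_limit[of "a * x"]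
  have "(\<lambda>n. cos (a * x / sqrt (real (Suc n))) ^ n) \<longlonglongrightarrow> exp (- (4 * pi\<^sup>2 * x\<^sup>2 * s))" by simp
  then have "(\<lambda>n. (2 * pi / a) * (sqrt (real (Suc n)) * sin (a * x / sqrt (real (Suc n)))) * cos (a * x / sqrt (real (Suc n))) ^ n)
      \<longlonglongrightarrow> (2 * pi / a) * (a * x) * exp (- (4 * pi\<^sup>2 * x\<^sup>2 * s))"
    by (intro tendsto_mult tendsto_const sin_scaled_limit)
  from tendsto_mult[OF tendsto_const[of \<i>] tendsto_of_real[OF this, where 'a = complex]]
  have "(\<lambda>n. \<phi> n m) \<longlonglongrightarrow> \<i> * complex_of_real ((2 * pi / a) * (a * x) * exp (- (4 * pi\<^sup>2 * x\<^sup>2 * s)))"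
    by (simp add: \<phi>_def x_def mult_ac del: of_nat_Suc)
  also have "\<i> * complex_of_real ((2 * pi / a) * (a * x) * exp (- (4 * pi\<^sup>2 * x\<^sup>2 * s))) = deriv_symbol k m * heat1 s k m"
    using a by (simp add: deriv_symbol_def heat1_def x_def mult_ac)
  finally show "(\<lambda>n. \<phi> n m) \<longlonglongrightarrow> deriv_symbol k m * heat1 s k m" .
qed

section \<open>From one coordinate to several, and to higher derivatives\<close>

lemma heat_symbol_prod: "heat_symbol s m = (\<Prod>k\<in>UNIV. heat1 s k m)"
proof -
  have "exp (- (4 * pi\<^sup>2 * sqlen m * s)) = (\<Prod>k\<in>UNIV. exp (- (4 * pi\<^sup>2 * (real_of_int (m $ k))\<^sup>2 * s)))"
    unfolding exp_sum[OF finite, symmetric]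
    by (simp add: sqlen_def sum_negf sum_distrib_left sum_distrib_right)
  then show ?thesis by (simp add: heat_symbol_def heat1_def)
qed

lemma cb_multiplier_heat:
  assumes "0 < s" shows "cb_multiplier 1 (heat_symbol s)"
proof -
  have "cb_multiplier (\<Prod>k\<in>(UNIV :: 'a set). 1) (\<lambda>m. \<Prod>k\<in>(UNIV :: 'a set). heat1 s k m)"
    by (rule cb_multiplier_prod) (auto intro: cb_multiplier_heat1 assms)
  then show ?thesis unfolding heat_symbol_prod[abs_def] by simp
qed

lemma cb_multiplier_deriv_heat:
  assumes s: "0 < s" shows "cb_multiplier (1 / sqrt (2 * s)) (\<lambda>m. deriv_symbol k m * heat_symbol s m)"
proof -
  have "cb_multiplier (\<Prod>j\<in>UNIV - {k}. 1) (\<lambda>m. \<Prod>j\<in>UNIV - {k}. heat1 s j m)"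
    by (rule cb_multiplier_prod) (auto intro: cb_multiplier_heat1 s)
  from cb_multiplier_mult[OF cb_multiplier_deriv_heat1[OF s, of k] this]
  have "cb_multiplier (1 / sqrt (2 * s)) (\<lambda>m. deriv_symbol k m * heat1 s k m * (\<Prod>j\<in>UNIV - {k}. heat1 s j m))"
    by simp
  moreover have "heat_symbol s m = heat1 s k m * (\<Prod>j\<in>UNIV - {k}. heat1 s j m)" for m
    unfolding heat_symbol_prod by (rule prod.remove) auto
  ultimately show ?thesis by (simp add: mult.assoc)
qed

definition heat_op_symbol :: "'n nvec \<Rightarrow> nat \<Rightarrow> real \<Rightarrow> 'n::finite ivec \<Rightarrow> complex" where
  "heat_op_symbol \<alpha> l t m = multi_symbol \<alpha> m * lap_symbol m ^ l * heat_symbol t m"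

lemma heat_symbol_power: "heat_symbol s m ^ N = heat_symbol (real N * s) m"
  unfolding heat_symbol_def of_real_power[symmetric] exp_of_nat_mult[symmetric] by (simp add: mult_ac)

text \<open>With M = |\<alpha>| + 2l each of M first-order factors runs for time t/(M + 1) and costs
  sqrt((M + 1)/2) / sqrt(t). Each Laplacian is a sum over the n coordinates, whence n^l. The
  successor counts the factor that carries no derivative.\<close>

definition heat_constant :: "nat \<Rightarrow> 'n::finite nvec \<Rightarrow> real" where
  "heat_constant l \<alpha> = real CARD('n) ^ l * sqrt (real (Suc (multi_degree \<alpha> + 2 * l)) / 2) ^ (multi_degree \<alpha> + 2 * l)"

lemma heat_constant_pos: "0 < heat_constant l \<alpha>"
  unfolding heat_constant_def by (intro mult_pos_pos zero_less_power) auto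

text \<open>Split \<open>P\<^sub>t\<close> into \<open>N = |\<alpha>| + 2l + 1\<close> equal factors and absorb one first-order
  derivative into each of the first \<open>|\<alpha>| + 2l\<close> of them.\<close>

lemma cb_multiplier_heat_op:
  fixes \<alpha> :: "'n::{finite,linorder} nvec"
  assumes t: "0 < t"
  shows "cb_multiplier (heat_constant l \<alpha> / t powr (real l + real (multi_degree \<alpha>) / 2)) (heat_op_symbol \<alpha> l t)"
proof -
  define M where "M = multi_degree \<alpha> + 2 * l"
  define s where "s = t / real (Suc M)"
  define \<kappa> where "\<kappa> = 1 / sqrt (2 * s)"
  have s: "0 < s" using t by (simp add: s_def)
  define D where "D k m = deriv_symbol k m * heat_symbol s m" for k and m :: "'n ivec"
  have D: "cb_multiplier \<kappa> (D k)" for k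
    unfolding \<kappa>_def D_def by (rule cb_multiplier_deriv_heat[OF s])
  have "cb_multiplier ((\<Prod>k\<in>UNIV. \<kappa> ^ (\<alpha> $ k)) * (cmod (-1) * (\<Sum>k\<in>(UNIV :: 'n set). \<kappa> * \<kappa>)) ^ l * 1)
     (\<lambda>m. (\<Prod>k\<in>UNIV. D k m ^ (\<alpha> $ k)) * (- 1 * (\<Sum>k\<in>UNIV. D k m * D k m)) ^ l * heat_symbol s m)"
    by (intro cb_multiplier_mult cb_multiplier_prod cb_multiplier_power cb_multiplier_const cb_multiplier_sum
        cb_multiplier_heat s D finite)
  moreover have "(\<Prod>k\<in>UNIV. D k m ^ (\<alpha> $ k)) * (- 1 * (\<Sum>k\<in>UNIV. D k m * D k m)) ^ l * heat_symbol s m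
      = heat_op_symbol \<alpha> l t m" for m
  proof -
    have "(\<Prod>k\<in>UNIV. D k m ^ (\<alpha> $ k)) = multi_symbol \<alpha> m * heat_symbol s m ^ multi_degree \<alpha>"
      by (simp add: D_def power_mult_distrib prod.distrib multi_symbol_def multi_degree_def power_sum)
    moreover have "- 1 * (\<Sum>k\<in>UNIV. D k m * D k m) = lap_symbol m * heat_symbol s m ^ 2"
    proof -
      have "(\<Sum>k\<in>UNIV. D k m * D k m) = (\<Sum>k\<in>UNIV. deriv_symbol k m * deriv_symbol k m) * heat_symbol s m ^ 2"
      proof -
        have "D k m * D k m = deriv_symbol k m * deriv_symbol k m * heat_symbol s m ^ 2" for k
          by (simp add: D_def power2_eq_square mult_ac)
        then show ?thesis by (simp only: sum_distrib_right)
      qed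
      then show ?thesis unfolding lap_symbol_def deriv_symbol_square_sum[symmetric] by simp
    qed
    moreover have "heat_symbol t m = heat_symbol s m ^ Suc M"
      unfolding heat_symbol_power by (simp add: s_def del: of_nat_Suc)
    then have "heat_symbol t m = heat_symbol s m ^ multi_degree \<alpha> * (heat_symbol s m ^ 2) ^ l * heat_symbol s m"
      by (simp add: M_def power_add power_mult[symmetric] mult_ac)
    ultimately show ?thesis by (simp add: heat_op_symbol_def power_mult_distrib mult_ac)
  qed
  moreover have "(\<Prod>k\<in>UNIV. \<kappa> ^ (\<alpha> $ k)) * (cmod (-1) * (\<Sum>k\<in>(UNIV :: 'n set). \<kappa> * \<kappa>)) ^ l * 1
      = heat_constant l \<alpha> / t powr (real l + real (multi_degree \<alpha>) / 2)"
  proof -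
    have "(\<Prod>k\<in>UNIV. \<kappa> ^ (\<alpha> $ k)) * (cmod (-1) * (\<Sum>k\<in>(UNIV :: 'n set). \<kappa> * \<kappa>)) ^ l * 1
        = real CARD('n) ^ l * \<kappa> ^ M"
      by (simp add: power_sum[symmetric] multi_degree_def[symmetric] M_def power_add power_mult power_mult_distrib
          power2_eq_square mult_ac)
    also have "\<kappa> ^ M = (sqrt (real (Suc M) / 2) / sqrt t) ^ M"
      using t by (simp add: \<kappa>_def s_def real_sqrt_divide real_sqrt_mult)
    also have "(sqrt (real (Suc M) / 2) / sqrt t) ^ M = sqrt (real (Suc M) / 2) ^ M / t powr (real M / 2)"
      using t by (simp add: power_divide powr_half_sqrt[symmetric] powr_realpow[symmetric] powr_powr)
    also have "real M / 2 = real l + real (multi_degree \<alpha>) / 2" by (simp add: M_def)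
    finally show ?thesis by (simp add: heat_constant_def M_def)
  qed
  ultimately show ?thesis by (simp only:)
qed

section \<open>Differentiation of the heat semigroup in time\<close>

text \<open>For u \<ge> 0 the upper bound comes from 1 - u \<le> exp(-u) multiplied by 1 + u. For u
  < 0 it comes from exp(u) \<le> 1/(1 - u) \<le> 1 + u + u^2, the last step because (1 + u + u^2)(1
  - u) = 1 - u^3.\<close>

lemma exp_remainder_bounds:
  fixes u :: real
  shows "0 \<le> exp u - 1 - u" "exp u - 1 - u \<le> u\<^sup>2 * max 1 (exp u)"
proof -
  show "0 \<le> exp u - 1 - u" using exp_ge_add_one_self[of u] by linarith
  show "exp u - 1 - u \<le> u\<^sup>2 * max 1 (exp u)"
  proof (cases "0 \<le> u")
    case True
    have "(1 + u) * (1 - u) \<le> (1 + u) * exp (- u)"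
      using exp_ge_add_one_self[of "- u"] True by (intro mult_left_mono) auto
    then have "exp u * (1 - u\<^sup>2) \<le> exp u * ((1 + u) * exp (- u))"
      by (intro mult_left_mono) (auto simp: power2_eq_square algebra_simps)
    also have "\<dots> = 1 + u" by (simp add: exp_minus)
    finally show ?thesis using True by (simp add: algebra_simps max_def)
  next
    case False
    have "exp u * (1 - u) \<le> exp u * exp (- u)"
      using exp_ge_add_one_self[of "- u"] by (intro mult_left_mono) auto
    also have "\<dots> = 1" by (simp add: exp_minus)
    also have "\<dots> \<le> (1 + u + u\<^sup>2) * (1 - u)"
    proof -
      have "u ^ 3 \<le> 0" using False by (simp add: power_less_zero_eq less_imp_le)
      then show ?thesis by (simp add: algebra_simps power2_eq_square power3_eq_cube)
    qed
    finally have "exp u \<le> 1 + u + u\<^sup>2" using False by simp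
    moreover have "u\<^sup>2 * 1 \<le> u\<^sup>2 * max 1 (exp u)" by (intro mult_left_mono) auto
    ultimately show ?thesis by simp
  qed
qed

text \<open>After factoring out the exponential at \<open>t\<close>, the maximum in the remainder is
  one of two exponentials, both at most 1. The frequency then enters only through its square, which
  rapid decrease absorbs.\<close>

lemma exp_difference_bound:
  fixes \<mu> s t :: real
  assumes "0 \<le> \<mu>" "0 \<le> s" "0 \<le> t"
  shows "\<bar>exp (- (\<mu> * s)) - exp (- (\<mu> * t)) + (s - t) * (\<mu> * exp (- (\<mu> * t)))\<bar> \<le> (s - t)\<^sup>2 * \<mu>\<^sup>2"
proof -
  define u where "u = - (\<mu> * (s - t))"
  have e: "exp (- (\<mu> * t)) * exp u = exp (- (\<mu> * s))"
    by (simp add: u_def exp_add[symmetric] algebra_simps)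
  have le1: "exp (- (\<mu> * t)) \<le> 1" "exp (- (\<mu> * s)) \<le> 1" using assms by auto
  have "exp (- (\<mu> * s)) - exp (- (\<mu> * t)) + (s - t) * (\<mu> * exp (- (\<mu> * t))) = exp (- (\<mu> * t)) * (exp u - 1 - u)"
    unfolding e[symmetric] by (simp add: u_def algebra_simps)
  moreover have "exp (- (\<mu> * t)) * (exp u - 1 - u) \<le> exp (- (\<mu> * t)) * (u\<^sup>2 * max 1 (exp u))"
    by (intro mult_left_mono exp_remainder_bounds) auto
  moreover have "exp (- (\<mu> * t)) * (u\<^sup>2 * max 1 (exp u)) = u\<^sup>2 * max (exp (- (\<mu> * t))) (exp (- (\<mu> * s)))"
    unfolding e[symmetric] by (simp add: max_def)
  moreover have "u\<^sup>2 * max (exp (- (\<mu> * t))) (exp (- (\<mu> * s))) \<le> u\<^sup>2 * 1"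
    using le1 by (intro mult_left_mono) auto
  moreover have "0 \<le> exp (- (\<mu> * t)) * (exp u - 1 - u)"
    by (intro mult_nonneg_nonneg exp_remainder_bounds) auto
  ultimately have "0 \<le> exp (- (\<mu> * s)) - exp (- (\<mu> * t)) + (s - t) * (\<mu> * exp (- (\<mu> * t)))"
    "exp (- (\<mu> * s)) - exp (- (\<mu> * t)) + (s - t) * (\<mu> * exp (- (\<mu> * t))) \<le> u\<^sup>2" by linarith+
  moreover have "u\<^sup>2 = (s - t)\<^sup>2 * \<mu>\<^sup>2" by (simp add: u_def power_mult_distrib mult.commute)
  ultimately show ?thesis by simp
qed

lemma heat_has_vector_derivative:
  fixes c :: "'n::{finite,linorder} ivec \<Rightarrow> complex"
  assumes c: "rapidly_decreasing c" and t: "0 < t"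
  shows "((\<lambda>s. torus_series \<theta> (\<lambda>m. heat_symbol s m * c m)) has_vector_derivative
    torus_series \<theta> (\<lambda>m. (- lap_symbol m) * (heat_symbol t m * c m))) (at t)"
proof -
  define d where "d m = (- lap_symbol m) * (heat_symbol t m * c m)" for m :: "'n ivec"
  define B where "B = (\<Sum>\<^sub>\<infinity>m. cmod (lap_symbol m ^ 2 * c m))"
  have lc: "rapidly_decreasing (\<lambda>m. lap_symbol m ^ 2 * c m)"
    by (rule rapidly_decreasing_moderate_mult[OF moderate_power[OF moderate_lap_symbol] c])
  have h: "rapidly_decreasing (\<lambda>m. heat_symbol s m * c m)" if "0 \<le> s" for s
    by (rule rapidly_decreasing_moderate_mult[OF moderate_heat_symbol[OF that] c])
  have "rapidly_decreasing (\<lambda>m. lap_symbol m * (heat_symbol t m * c m))"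
    by (rule rapidly_decreasing_moderate_mult[OF moderate_lap_symbol h]) (use t in simp)
  from rapidly_decreasing_scale[OF this, of "-1"] have d: "rapidly_decreasing d"
    by (simp add: d_def[abs_def])
  have B0: "0 \<le> B" unfolding B_def by (rule infsum_nonneg) simp
  have est: "norm (torus_series \<theta> (\<lambda>m. heat_symbol s m * c m) - torus_series \<theta> (\<lambda>m. heat_symbol t m * c m)
      - (s - t) *\<^sub>R torus_series \<theta> d) \<le> (s - t)\<^sup>2 * B" if s: "0 \<le> s" for s
  proof -
    define e where "e m = heat_symbol s m * c m - heat_symbol t m * c m - complex_of_real (s - t) * d m" for m :: "'n ivec"
    have t0: "0 \<le> t" using t by simp
    have sd: "rapidly_decreasing (\<lambda>m. complex_of_real (s - t) * d m)" by (rule rapidly_decreasing_scale[OF d])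
    have "torus_series \<theta> (\<lambda>m. heat_symbol s m * c m) - torus_series \<theta> (\<lambda>m. heat_symbol t m * c m)
      - (s - t) *\<^sub>R torus_series \<theta> d = torus_series \<theta> e"
      unfolding e_def scaleR_eq_scaleC torus_series_scale[OF d, symmetric]
      by (simp only: torus_series_diff[OF rapidly_decreasing_diff[OF h[OF s] h[OF t0]] sd] torus_series_diff[OF h[OF s] h[OF t0]])
    moreover have e: "rapidly_decreasing e"
      unfolding e_def by (rule rapidly_decreasing_diff[OF rapidly_decreasing_diff[OF h[OF s] h[OF t0]] sd])
    ultimately have "norm (torus_series \<theta> (\<lambda>m. heat_symbol s m * c m) - torus_series \<theta> (\<lambda>m. heat_symbol t m * c m)
      - (s - t) *\<^sub>R torus_series \<theta> d) \<le> (\<Sum>\<^sub>\<infinity>m. cmod (e m))"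
      using norm_torus_series_le[OF e, of \<theta>] by simp
    also have "\<dots> \<le> (\<Sum>\<^sub>\<infinity>m. (s - t)\<^sup>2 * cmod (lap_symbol m ^ 2 * c m))"
    proof (rule infsum_mono)
      show "(\<lambda>m. cmod (e m)) summable_on UNIV" by (rule rapidly_decreasing_abs_summable[OF e])
      show "(\<lambda>m. (s - t)\<^sup>2 * cmod (lap_symbol m ^ 2 * c m)) summable_on UNIV"
        by (intro summable_on_cmult_right rapidly_decreasing_abs_summable lc)
      fix m :: "'n ivec"
      define \<mu> where "\<mu> = 4 * pi\<^sup>2 * sqlen m"
      have "0 \<le> \<mu>" by (simp add: \<mu>_def)
      have "e m = complex_of_real (exp (- (\<mu> * s)) - exp (- (\<mu> * t)) + (s - t) * (\<mu> * exp (- (\<mu> * t)))) * c m"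
        by (simp add: e_def d_def heat_symbol_def lap_symbol_def \<mu>_def algebra_simps)
      then have "cmod (e m) = \<bar>exp (- (\<mu> * s)) - exp (- (\<mu> * t)) + (s - t) * (\<mu> * exp (- (\<mu> * t)))\<bar> * cmod (c m)"
        by (simp only: norm_mult norm_of_real)
      also have "\<dots> \<le> (s - t)\<^sup>2 * \<mu>\<^sup>2 * cmod (c m)"
        by (intro mult_right_mono exp_difference_bound \<open>0 \<le> \<mu>\<close> s t0) simp
      also have "\<dots> = (s - t)\<^sup>2 * cmod (lap_symbol m ^ 2 * c m)"
        unfolding lap_symbol_def \<mu>_def[symmetric] norm_mult norm_power norm_of_real by simp
      finally show "cmod (e m) \<le> (s - t)\<^sup>2 * cmod (lap_symbol m ^ 2 * c m)" .
    qed
    also have "\<dots> = (s - t)\<^sup>2 * B"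
      unfolding B_def by (rule infsum_cmult_right) (rule rapidly_decreasing_abs_summable[OF lc])
    finally show ?thesis .
  qed
  show ?thesis
    unfolding has_vector_derivative_def has_derivative_at_alt d_def[symmetric]
  proof (intro conjI allI impI)
    show "bounded_linear (\<lambda>x. x *\<^sub>R torus_series \<theta> d)" by (rule bounded_linear_scaleR_left)
    fix e :: real assume e: "0 < e"
    show "\<exists>r>0. \<forall>s. norm (s - t) < r \<longrightarrow> norm (torus_series \<theta> (\<lambda>m. heat_symbol s m * c m)
        - torus_series \<theta> (\<lambda>m. heat_symbol t m * c m) - (s - t) *\<^sub>R torus_series \<theta> d) \<le> e * norm (s - t)"
    \<comment> \<open>The bound \<open>t\<close> keeps \<open>s\<close> nonnegative, where the
      estimate applies; the 1 in the denominator covers \<open>B = 0\<close>.\<close>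
    proof (intro exI[of _ "min t (e / (B + 1))"] conjI allI impI)
      show "0 < min t (e / (B + 1))" using t e B0 by simp
      fix s assume s: "norm (s - t) < min t (e / (B + 1))"
      then have "0 \<le> s" by (simp add: real_norm_def) linarith
      have "\<bar>s - t\<bar> * (B + 1) \<le> e" using s B0 by (simp add: field_simps)
      then have "\<bar>s - t\<bar> * B \<le> e" using B0 by (simp add: distrib_left)
      then have "\<bar>s - t\<bar> * (\<bar>s - t\<bar> * B) \<le> \<bar>s - t\<bar> * e" by (rule mult_left_mono) simp
      then have "(s - t)\<^sup>2 * B \<le> e * norm (s - t)"
      proof -
        assume *: "\<bar>s - t\<bar> * (\<bar>s - t\<bar> * B) \<le> \<bar>s - t\<bar> * e"
        have "(s - t)\<^sup>2 = \<bar>s - t\<bar> * \<bar>s - t\<bar>" by (simp add: power2_eq_square)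
        then show ?thesis using * by (simp only: mult.assoc real_norm_def mult.commute[of e])
      qed
      with est[OF \<open>0 \<le> s\<close>] show "norm (torus_series \<theta> (\<lambda>m. heat_symbol s m * c m)
        - torus_series \<theta> (\<lambda>m. heat_symbol t m * c m) - (s - t) *\<^sub>R torus_series \<theta> d) \<le> e * norm (s - t)"
        by linarith
    qed
  qed
qed

lemma heat_time_deriv_series:
  assumes c: "rapidly_decreasing c" and t: "0 < t"
  shows "heat_time_deriv \<theta> l t (torus_series \<theta> c)
    = torus_series \<theta> (\<lambda>m. heat_symbol t m * ((- lap_symbol m) ^ l * c m))"
  using t unfolding heat_time_deriv_def
proof (induction l arbitrary: t)
  case 0
  then show ?case by (simp add: heat_series c)
next
  case (Suc l)
  have "moderate (\<lambda>m. (-1) * lap_symbol m)" by (rule moderate_mult[OF moderate_const moderate_lap_symbol])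
  then have "moderate (\<lambda>m. (- lap_symbol m) ^ l)" using moderate_power by fastforce
  then have rd: "rapidly_decreasing (\<lambda>m. (- lap_symbol m) ^ l * c m)"
    using c by (rule rapidly_decreasing_moderate_mult)
  define G where "G = ((\<lambda>f s. vector_derivative f (at s)) ^^ l) (\<lambda>s. heat \<theta> s (torus_series \<theta> c))"
  have "(G has_vector_derivative torus_series \<theta> (\<lambda>m. (- lap_symbol m) * (heat_symbol t m * ((- lap_symbol m) ^ l * c m)))) (at t)"
  \<comment> \<open>The induction hypothesis identifies the previous derivative only for positive
    times, so the derivative is compared on the open half-line.\<close>
  proof (rule has_vector_derivative_transform_within_open[OF heat_has_vector_derivative[OF rd Suc.prems]])
    show "open {0::real<..}" "t \<in> {0<..}" using Suc.prems by auto
    show "torus_series \<theta> (\<lambda>m. heat_symbol s m * ((- lap_symbol m) ^ l * c m)) = G s" if "s \<in> {0<..}" for s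
      using Suc.IH[of s] that by (simp add: G_def)
  qed
  then have "vector_derivative G (at t) = torus_series \<theta> (\<lambda>m. (- lap_symbol m) * (heat_symbol t m * ((- lap_symbol m) ^ l * c m)))"
    by (rule vector_derivative_at)
  then show ?case by (simp add: G_def mult_ac)
qed

section \<open>The completed spaces\<close>

lemma torus_pnorm_triangle:
  "a \<in> torus_algebra \<theta> \<Longrightarrow> b \<in> torus_algebra \<theta> \<Longrightarrow> 1 < p \<Longrightarrow> torus_pnorm p (a + b) \<le> torus_pnorm p a + torus_pnorm p b"
  unfolding torus_trace_eq by (rule torus.pnorm_triangle)

lemma torus_pnorm_scaleC:
  "a \<in> torus_algebra \<theta> \<Longrightarrow> 1 < p \<Longrightarrow> torus_pnorm p (z *\<^sub>C a) = cmod z * torus_pnorm p a"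
  unfolding torus_trace_eq by (rule torus.pnorm_scaleC)

lemma torus_pnorm_minus_commute:
  assumes "a \<in> torus_algebra \<theta>" "b \<in> torus_algebra \<theta>" "1 < p"
  shows "torus_pnorm p (a - b) = torus_pnorm p (b - a)"
  using torus_pnorm_scaleC[OF torus_algebra_diff[OF assms(1,2)] assms(3), of "-1"] minus_eq_scaleC[of "a - b"]
  by simp

lemma torus_pnorm_diff_triangle:
  assumes "a \<in> torus_algebra \<theta>" "b \<in> torus_algebra \<theta>" "c \<in> torus_algebra \<theta>" "1 < p"
  shows "torus_pnorm p (a - c) \<le> torus_pnorm p (a - b) + torus_pnorm p (b - c)"
  using torus_pnorm_triangle[OF torus_algebra_diff[OF assms(1,2)] torus_algebra_diff[OF assms(2,3)] assms(4)] by simp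

lemma torus_pnorm_0: "1 < p \<Longrightarrow> torus_pnorm p (0 :: 'n::{finite,linorder} ivec op) = 0"
  using torus_pnorm_scaleC[OF torus_algebra_0[of "0 :: 'n rmat"], of p 0] by (simp add: op_comp.zero_right)

lemma smooth_torusE:
  assumes "a \<in> smooth_torus \<theta>" obtains c where "rapidly_decreasing c" "a = torus_series \<theta> c"
  using assms unfolding smooth_torus_eq by blast

lemma torus_series_smooth: "rapidly_decreasing c \<Longrightarrow> torus_series \<theta> c \<in> smooth_torus \<theta>"
  unfolding smooth_torus_eq by blast

lemma smooth_torus_add: "a \<in> smooth_torus \<theta> \<Longrightarrow> b \<in> smooth_torus \<theta> \<Longrightarrow> a + b \<in> smooth_torus \<theta>"
  by (elim smooth_torusE) (simp add: torus_series_add[symmetric] torus_series_smooth rapidly_decreasing_add)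

lemma smooth_torus_scaleC: "a \<in> smooth_torus \<theta> \<Longrightarrow> z *\<^sub>C a \<in> smooth_torus \<theta>"
  by (elim smooth_torusE) (simp add: torus_series_scale[symmetric] torus_series_smooth rapidly_decreasing_scale)

lemma torus_mono_smooth: "torus_mono \<theta> m \<in> smooth_torus \<theta>"
  unfolding smooth_torus_eq torus_series_single[symmetric] using rapidly_decreasing_single by blast

locale lp_torus =
  fixes \<theta> :: "'n::{finite,linorder} rmat" and p :: real
  assumes p: "1 < p"
begin

abbreviation "cls X \<equiv> lp_rel \<theta> p `` {X}"

section \<open>Cauchy sequences of smooth elements\<close>

lemma CauchyI:
  "(\<And>k. X k \<in> smooth_torus \<theta>) \<Longrightarrow> (\<And>e. 0 < e \<Longrightarrow> \<exists>N. \<forall>k\<ge>N. \<forall>l\<ge>N. torus_pnorm p (X k - X l) < e)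
    \<Longrightarrow> X \<in> lp_Cauchy \<theta> p"
  by (simp add: lp_Cauchy_def)

lemma Cauchy_smooth: "X \<in> lp_Cauchy \<theta> p \<Longrightarrow> X k \<in> smooth_torus \<theta>"
  by (simp add: lp_Cauchy_def)

lemma Cauchy_mem: "X \<in> lp_Cauchy \<theta> p \<Longrightarrow> X k \<in> torus_algebra \<theta>"
  by (simp add: lp_Cauchy_def smooth_torus_mem)

lemma CauchyD:
  "X \<in> lp_Cauchy \<theta> p \<Longrightarrow> 0 < e \<Longrightarrow> \<exists>N. \<forall>k\<ge>N. \<forall>l\<ge>N. torus_pnorm p (X k - X l) < e"
  by (simp add: lp_Cauchy_def)

lemma Cauchy_const: "a \<in> smooth_torus \<theta> \<Longrightarrow> (\<lambda>_. a) \<in> lp_Cauchy \<theta> p"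
  by (rule CauchyI) (auto simp: torus_pnorm_0 p)

lemma Cauchy_add:
  assumes X: "X \<in> lp_Cauchy \<theta> p" and Y: "Y \<in> lp_Cauchy \<theta> p" shows "(\<lambda>k. X k + Y k) \<in> lp_Cauchy \<theta> p"
proof (rule CauchyI)
  show "X k + Y k \<in> smooth_torus \<theta>" for k by (intro smooth_torus_add Cauchy_smooth X Y)
  fix e :: real assume e: "0 < e"
  obtain N1 where N1: "\<And>k l. k \<ge> N1 \<Longrightarrow> l \<ge> N1 \<Longrightarrow> torus_pnorm p (X k - X l) < e / 2"
    using CauchyD[OF X, of "e / 2"] e by auto
  obtain N2 where N2: "\<And>k l. k \<ge> N2 \<Longrightarrow> l \<ge> N2 \<Longrightarrow> torus_pnorm p (Y k - Y l) < e / 2"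
    using CauchyD[OF Y, of "e / 2"] e by auto
  have "torus_pnorm p (X k + Y k - (X l + Y l)) < e" if "k \<ge> max N1 N2" "l \<ge> max N1 N2" for k l
  proof -
    have "torus_pnorm p ((X k - X l) + (Y k - Y l)) \<le> torus_pnorm p (X k - X l) + torus_pnorm p (Y k - Y l)"
      by (intro torus_pnorm_triangle[of _ \<theta>] torus_algebra_diff Cauchy_mem X Y p)
    then show ?thesis using N1[of k l] N2[of k l] that by (simp add: algebra_simps)
  qed
  then show "\<exists>N. \<forall>k\<ge>N. \<forall>l\<ge>N. torus_pnorm p (X k + Y k - (X l + Y l)) < e" by blast
qed

lemma Cauchy_bounded_image:
  assumes X: "X \<in> lp_Cauchy \<theta> p" and K: "0 \<le> K" and S: "\<And>k. S (X k) \<in> smooth_torus \<theta>"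
    and bound: "\<And>k l. torus_pnorm p (S (X k) - S (X l)) \<le> K * torus_pnorm p (X k - X l)"
  shows "(\<lambda>k. S (X k)) \<in> lp_Cauchy \<theta> p"
proof (rule CauchyI[OF S])
  fix e :: real assume e: "0 < e"
  \<comment> \<open>The 1 avoids a division by zero for \<open>K = 0\<close>.\<close>
  have "0 < e / (K + 1)" using e K by simp
  from CauchyD[OF X this] obtain N where N: "\<And>k l. k \<ge> N \<Longrightarrow> l \<ge> N \<Longrightarrow> torus_pnorm p (X k - X l) < e / (K + 1)"
    by blast
  have "torus_pnorm p (S (X k) - S (X l)) < e" if "k \<ge> N" "l \<ge> N" for k l
  proof -
    have "K * torus_pnorm p (X k - X l) \<le> (K + 1) * torus_pnorm p (X k - X l)"
      by (intro mult_right_mono torus_pnorm_nonneg) simp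
    also have "\<dots> < e" using N[OF that] K by (simp add: field_simps)
    finally show ?thesis using bound[of k l] by linarith
  qed
  then show "\<exists>N. \<forall>k\<ge>N. \<forall>l\<ge>N. torus_pnorm p (S (X k) - S (X l)) < e" by blast
qed

lemma Cauchy_scale: "X \<in> lp_Cauchy \<theta> p \<Longrightarrow> (\<lambda>k. z *\<^sub>C X k) \<in> lp_Cauchy \<theta> p"
proof (rule Cauchy_bounded_image[where S = "\<lambda>a. z *\<^sub>C a" and K = "cmod z"])
  fix k l assume X: "X \<in> lp_Cauchy \<theta> p"
  show "z *\<^sub>C X k \<in> smooth_torus \<theta>" by (intro smooth_torus_scaleC Cauchy_smooth X)
  show "torus_pnorm p (z *\<^sub>C X k - z *\<^sub>C X l) \<le> cmod z * torus_pnorm p (X k - X l)"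
    unfolding op_comp.diff_right[symmetric]
    using torus_pnorm_scaleC[OF torus_algebra_diff[OF Cauchy_mem[OF X] Cauchy_mem[OF X]] p] by simp
qed auto

section \<open>Equality modulo null sequences and the induced operations\<close>

lemma relI: "X \<in> lp_Cauchy \<theta> p \<Longrightarrow> Y \<in> lp_Cauchy \<theta> p \<Longrightarrow> (\<lambda>k. torus_pnorm p (X k - Y k)) \<longlonglongrightarrow> 0 \<Longrightarrow> (X, Y) \<in> lp_rel \<theta> p"
  by (simp add: lp_rel_def)

lemma relD:
  assumes "(X, Y) \<in> lp_rel \<theta> p"
  shows "X \<in> lp_Cauchy \<theta> p" "Y \<in> lp_Cauchy \<theta> p" "(\<lambda>k. torus_pnorm p (X k - Y k)) \<longlonglongrightarrow> 0"
  using assms by (simp_all add: lp_rel_def)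

lemma equiv_rel: "equiv (lp_Cauchy \<theta> p) (lp_rel \<theta> p)"
proof (rule equivI)
  show "lp_rel \<theta> p \<subseteq> lp_Cauchy \<theta> p \<times> lp_Cauchy \<theta> p" by (auto simp: lp_rel_def)
  show "refl_on (lp_Cauchy \<theta> p) (lp_rel \<theta> p)"
    by (rule refl_onI) (auto intro!: relI simp: torus_pnorm_0 p)
  show "sym (lp_rel \<theta> p)"
  proof (rule symI)
    fix X Y assume r: "(X, Y) \<in> lp_rel \<theta> p"
    note D = relD[OF r]
    have "torus_pnorm p (Y k - X k) = torus_pnorm p (X k - Y k)" for k
      by (rule torus_pnorm_minus_commute[OF Cauchy_mem[OF D(2)] Cauchy_mem[OF D(1)] p])
    then show "(Y, X) \<in> lp_rel \<theta> p" using D by (intro relI) auto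
  qed
  show "trans (lp_rel \<theta> p)"
  proof (rule transI)
    fix X Y Z assume "(X, Y) \<in> lp_rel \<theta> p" "(Y, Z) \<in> lp_rel \<theta> p"
    note D = relD[OF this(1)] relD[OF this(2)]
    have "(\<lambda>k. torus_pnorm p (X k - Y k) + torus_pnorm p (Y k - Z k)) \<longlonglongrightarrow> 0"
      using tendsto_add[OF D(3) D(6)] by simp
    moreover have "norm (torus_pnorm p (X k - Z k)) \<le> torus_pnorm p (X k - Y k) + torus_pnorm p (Y k - Z k)" for k
      using torus_pnorm_diff_triangle[OF Cauchy_mem[OF D(1)] Cauchy_mem[OF D(2)] Cauchy_mem[OF D(5)] p, of k k k]
        torus_pnorm_nonneg[of p "X k - Z k"] by simp
    then have "\<forall>\<^sub>F k in sequentially. norm (torus_pnorm p (X k - Z k)) \<le> torus_pnorm p (X k - Y k) + torus_pnorm p (Y k - Z k)"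
      by simp
    ultimately have "(\<lambda>k. torus_pnorm p (X k - Z k)) \<longlonglongrightarrow> 0"
      by (rule Lim_null_comparison[rotated])
    then show "(X, Z) \<in> lp_rel \<theta> p" using D by (intro relI)
  qed
qed

lemma cls_space: "X \<in> lp_Cauchy \<theta> p \<Longrightarrow> cls X \<in> lp_space \<theta> p"
  by (simp add: lp_space_def quotientI)

lemma spaceE:
  assumes "x \<in> lp_space \<theta> p" obtains X where "X \<in> lp_Cauchy \<theta> p" "x = cls X"
  using assms unfolding lp_space_def by (rule quotientE)

lemma self_in_cls: "X \<in> lp_Cauchy \<theta> p \<Longrightarrow> X \<in> cls X"
  by (rule equiv_class_self[OF equiv_rel])

lemma rel_refl: "X \<in> lp_Cauchy \<theta> p \<Longrightarrow> (X, X) \<in> lp_rel \<theta> p"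
  using self_in_cls by simp

lemma cls_eqI: "(X, Y) \<in> lp_rel \<theta> p \<Longrightarrow> cls X = cls Y"
  by (rule equiv_class_eq[OF equiv_rel])

lemma cls_memD: "x \<in> lp_space \<theta> p \<Longrightarrow> X \<in> x \<Longrightarrow> X \<in> lp_Cauchy \<theta> p \<and> x = cls X"
  using equiv_class_eq[OF equiv_rel] by (elim spaceE) (auto dest: relD)

lemma embed_eq: "lp_embed \<theta> p a = cls (\<lambda>_. a)"
  by (simp add: lp_embed_def)

lemma rel_add:
  assumes "(X, X') \<in> lp_rel \<theta> p" "(Y, Y') \<in> lp_rel \<theta> p"
  shows "(\<lambda>k. X k + Y k, \<lambda>k. X' k + Y' k) \<in> lp_rel \<theta> p"
proof -
  note D = relD[OF assms(1)] relD[OF assms(2)]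
  have "(\<lambda>k. torus_pnorm p (X k - X' k) + torus_pnorm p (Y k - Y' k)) \<longlonglongrightarrow> 0"
    using tendsto_add[OF D(3) D(6)] by simp
  moreover have "norm (torus_pnorm p (X k + Y k - (X' k + Y' k))) \<le> torus_pnorm p (X k - X' k) + torus_pnorm p (Y k - Y' k)" for k
  proof -
    have "torus_pnorm p ((X k - X' k) + (Y k - Y' k)) \<le> torus_pnorm p (X k - X' k) + torus_pnorm p (Y k - Y' k)"
      by (intro torus_pnorm_triangle[of _ \<theta>] torus_algebra_diff Cauchy_mem D p)
    then show ?thesis by (simp add: torus_pnorm_nonneg algebra_simps)
  qed
  then have "\<forall>\<^sub>F k in sequentially. norm (torus_pnorm p (X k + Y k - (X' k + Y' k)))
      \<le> torus_pnorm p (X k - X' k) + torus_pnorm p (Y k - Y' k)" by simp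
  ultimately have "(\<lambda>k. torus_pnorm p (X k + Y k - (X' k + Y' k))) \<longlonglongrightarrow> 0"
    by (rule Lim_null_comparison[rotated])
  then show ?thesis by (intro relI Cauchy_add D)
qed

lemma rel_bounded_image:
  assumes "(X, Y) \<in> lp_rel \<theta> p" "(\<lambda>k. S (X k)) \<in> lp_Cauchy \<theta> p" "(\<lambda>k. S (Y k)) \<in> lp_Cauchy \<theta> p"
    and bound: "\<And>k. torus_pnorm p (S (X k) - S (Y k)) \<le> K * torus_pnorm p (X k - Y k)"
  shows "(\<lambda>k. S (X k), \<lambda>k. S (Y k)) \<in> lp_rel \<theta> p"
proof (rule relI[OF assms(2,3)], rule Lim_null_comparison)
  show "(\<lambda>k. K * torus_pnorm p (X k - Y k)) \<longlonglongrightarrow> 0"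
    using tendsto_mult[OF tendsto_const relD(3)[OF assms(1)], of K] by simp
  show "\<forall>\<^sub>F k in sequentially. norm (torus_pnorm p (S (X k) - S (Y k))) \<le> K * torus_pnorm p (X k - Y k)"
    using bound by (intro always_eventually allI) (simp add: torus_pnorm_nonneg)
qed

lemma add_cls:
  assumes X: "X \<in> lp_Cauchy \<theta> p" and Y: "Y \<in> lp_Cauchy \<theta> p"
  shows "lp_add \<theta> p (cls X) (cls Y) = cls (\<lambda>k. X k + Y k)"
proof -
  have "cls (\<lambda>k. X' k + Y' k) = cls (\<lambda>k. X k + Y k)" if "X' \<in> cls X" "Y' \<in> cls Y" for X' Y'
    using that rel_add[of X X' Y Y'] by (intro cls_eqI[symmetric]) auto
  then have "(\<Union>X'\<in>cls X. \<Union>Y'\<in>cls Y. cls (\<lambda>k. X' k + Y' k)) = (\<Union>X'\<in>cls X. \<Union>Y'\<in>cls Y. cls (\<lambda>k. X k + Y k))"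
    by (intro SUP_cong refl) blast
  also have "\<dots> = cls (\<lambda>k. X k + Y k)" using self_in_cls[OF X] self_in_cls[OF Y] by blast
  finally show ?thesis by (simp add: lp_add_def)
qed

text \<open>The union over representatives, the form used for defining operations on classes,
  collapses to a single class when \<open>S\<close> is Lipschitz. This serves scalar multiplication
  and the extension of multipliers alike.\<close>

lemma image_cls:
  assumes X: "X \<in> lp_Cauchy \<theta> p" and "0 \<le> K"
    and S: "\<And>a. a \<in> smooth_torus \<theta> \<Longrightarrow> S a \<in> smooth_torus \<theta>"
    and bound: "\<And>a b. a \<in> smooth_torus \<theta> \<Longrightarrow> b \<in> smooth_torus \<theta> \<Longrightarrow> torus_pnorm p (S a - S b) \<le> K * torus_pnorm p (a - b)"
  shows "(\<Union>Y\<in>cls X. cls (\<lambda>k. S (Y k))) = cls (\<lambda>k. S (X k))"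
proof -
  have C: "(\<lambda>k. S (Y k)) \<in> lp_Cauchy \<theta> p" if "Y \<in> lp_Cauchy \<theta> p" for Y
    by (rule Cauchy_bounded_image[OF that \<open>0 \<le> K\<close>]) (auto intro: S bound Cauchy_smooth that)
  have "cls (\<lambda>k. S (Y k)) = cls (\<lambda>k. S (X k))" if "Y \<in> cls X" for Y
  proof (rule cls_eqI[symmetric], rule rel_bounded_image[where S = S and K = K])
    show r: "(X, Y) \<in> lp_rel \<theta> p" using that by simp
    show "(\<lambda>k. S (X k)) \<in> lp_Cauchy \<theta> p" "(\<lambda>k. S (Y k)) \<in> lp_Cauchy \<theta> p" using C relD[OF r] by auto
    show "torus_pnorm p (S (X k) - S (Y k)) \<le> K * torus_pnorm p (X k - Y k)" for k
      using relD[OF r] by (intro bound Cauchy_smooth)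
  qed
  then have "(\<Union>Y\<in>cls X. cls (\<lambda>k. S (Y k))) = (\<Union>Y\<in>cls X. cls (\<lambda>k. S (X k)))" by (intro SUP_cong refl) blast
  also have "\<dots> = cls (\<lambda>k. S (X k))" using self_in_cls[OF X] by blast
  finally show ?thesis .
qed

lemma scale_cls:
  assumes X: "X \<in> lp_Cauchy \<theta> p" shows "lp_scale \<theta> p z (cls X) = cls (\<lambda>k. z *\<^sub>C X k)"
  unfolding lp_scale_def
proof (rule image_cls[OF X, of "cmod z"])
  fix a b assume "a \<in> smooth_torus \<theta>" "b \<in> smooth_torus \<theta>"
  then have "a - b \<in> torus_algebra \<theta>" by (intro torus_algebra_diff smooth_torus_mem)
  from torus_pnorm_scaleC[OF this p] show "torus_pnorm p (z *\<^sub>C a - z *\<^sub>C b) \<le> cmod z * torus_pnorm p (a - b)"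
    unfolding op_comp.diff_right[symmetric] by simp
qed (auto intro: smooth_torus_scaleC)

text \<open>Changing representatives alters each entry by a null sequence, hence the matrix norm by
  a null sequence. So the limit exists and is the same for all choices, which makes the definite
  description of the norm meaningful.\<close>

lemma mat_norm_tendsto:
  assumes x: "x \<in> lp_mat_space \<theta> p r" and X: "\<And>i j. i < r \<Longrightarrow> j < r \<Longrightarrow> X i j \<in> x i j"
  shows "(\<lambda>k. mat_pnorm r p (\<lambda>i j. X i j k)) \<longlonglongrightarrow> lp_mat_norm p r x"
proof -
  have rep: "Y i j \<in> lp_Cauchy \<theta> p \<and> x i j = cls (Y i j)" if "i < r" "j < r" "Y i j \<in> x i j" for Y i j
    using x that cls_memD unfolding lp_mat_space_def by blast
  have diff: "\<bar>mat_pnorm r p (\<lambda>i j. Y i j k) - mat_pnorm r p (\<lambda>i j. Z i j l)\<bar>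
      \<le> (\<Sum>i<r. \<Sum>j<r. torus_pnorm p (Y i j k - Z i j l))"
    if "\<And>i j. i < r \<Longrightarrow> j < r \<Longrightarrow> Y i j \<in> x i j" "\<And>i j. i < r \<Longrightarrow> j < r \<Longrightarrow> Z i j \<in> x i j" for Y Z k l
  proof -
    have m: "torus_matrix \<theta> r (\<lambda>i j. Y i j k)" "torus_matrix \<theta> r (\<lambda>i j. Z i j l)"
      using rep that Cauchy_mem by blast+
    show ?thesis
      by (rule order.trans[OF mat_pnorm_diff_le[OF m p] mat_pnorm_le_sum[OF torus_matrix_diff[OF m] p]])
  qed
  have "Cauchy (\<lambda>k. mat_pnorm r p (\<lambda>i j. X i j k))"
    unfolding Cauchy_def
  proof (intro allI impI)
    fix e :: real assume e: "0 < e"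
    \<comment> \<open>There are \<open>r * r\<close> entries; the added 1 makes the final estimate
      strict and also covers \<open>r = 0\<close>.\<close>
    define d where "d = e / (real r * real r + 1)"
    have d: "0 < d" using e by (simp add: d_def add_nonneg_pos)
    have "\<forall>ij\<in>{..<r} \<times> {..<r}. \<exists>N. \<forall>k\<ge>N. \<forall>l\<ge>N. torus_pnorm p (X (fst ij) (snd ij) k - X (fst ij) (snd ij) l) < d"
    proof
      fix ij assume "ij \<in> {..<r} \<times> {..<r}"
      then have "X (fst ij) (snd ij) \<in> lp_Cauchy \<theta> p" using rep[of "fst ij" "snd ij" X] X by auto
      then show "\<exists>N. \<forall>k\<ge>N. \<forall>l\<ge>N. torus_pnorm p (X (fst ij) (snd ij) k - X (fst ij) (snd ij) l) < d"
        using d by (rule CauchyD)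
    qed
    then obtain N where "\<forall>ij\<in>{..<r} \<times> {..<r}. \<forall>k\<ge>N ij. \<forall>l\<ge>N ij. torus_pnorm p (X (fst ij) (snd ij) k - X (fst ij) (snd ij) l) < d"
      unfolding bchoice_iff by blast
    then have N: "torus_pnorm p (X i j k - X i j l) < d" if "i < r" "j < r" "k \<ge> N (i, j)" "l \<ge> N (i, j)" for i j k l
      using that by fastforce
    define M where "M = Max (insert 0 (N ` ({..<r} \<times> {..<r})))"
    have M: "N (i, j) \<le> M" if "i < r" "j < r" for i j
      unfolding M_def using that by (intro Max_ge) auto
    have "dist (mat_pnorm r p (\<lambda>i j. X i j k)) (mat_pnorm r p (\<lambda>i j. X i j l)) < e" if "k \<ge> M" "l \<ge> M" for k l
    proof -
      have "\<bar>mat_pnorm r p (\<lambda>i j. X i j k) - mat_pnorm r p (\<lambda>i j. X i j l)\<bar>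
          \<le> (\<Sum>i<r. \<Sum>j<r. torus_pnorm p (X i j k - X i j l))" by (rule diff[OF X X])
      also have "\<dots> \<le> (\<Sum>i<r. \<Sum>j<r. d)"
      proof (intro sum_mono less_imp_le)
        fix i j assume "i \<in> {..<r}" "j \<in> {..<r}"
        then show "torus_pnorm p (X i j k - X i j l) < d" using N[of i j k l] M[of i j] that by auto
      qed
      also have "\<dots> = real r * real r * d" by simp
      also have "\<dots> < (real r * real r + 1) * d" using d by (simp add: distrib_right)
      also have "\<dots> = e"
      proof -
        have "0 < real r * real r + 1" by (simp add: add_nonneg_pos)
        then show ?thesis unfolding d_def by simp
      qed
      finally show ?thesis by (simp add: dist_real_def)
    qed
    then show "\<exists>M. \<forall>m\<ge>M. \<forall>n\<ge>M. dist (mat_pnorm r p (\<lambda>i j. X i j m)) (mat_pnorm r p (\<lambda>i j. X i j n)) < e" by blast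
  qed
  then obtain L where L: "(\<lambda>k. mat_pnorm r p (\<lambda>i j. X i j k)) \<longlonglongrightarrow> L"
    using Cauchy_convergent convergent_def by blast
  have "lp_mat_norm p r x = L"
    unfolding lp_mat_norm_def
  proof (rule the_equality)
    show "\<exists>Y. (\<forall>i<r. \<forall>j<r. Y i j \<in> x i j) \<and> (\<lambda>k. mat_pnorm r p (\<lambda>i j. Y i j k)) \<longlonglongrightarrow> L"
      using L X by blast
    fix L' assume "\<exists>Y. (\<forall>i<r. \<forall>j<r. Y i j \<in> x i j) \<and> (\<lambda>k. mat_pnorm r p (\<lambda>i j. Y i j k)) \<longlonglongrightarrow> L'"
    then obtain Y where Y: "\<And>i j. i < r \<Longrightarrow> j < r \<Longrightarrow> Y i j \<in> x i j"
      "(\<lambda>k. mat_pnorm r p (\<lambda>i j. Y i j k)) \<longlonglongrightarrow> L'" by blast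
    have "(\<lambda>k. torus_pnorm p (X i j k - Y i j k)) \<longlonglongrightarrow> 0" if "i < r" "j < r" for i j
    proof -
      have "Y i j \<in> cls (X i j)" using rep[of i j X] that X[OF that] Y(1)[OF that] by simp
      then have "(X i j, Y i j) \<in> lp_rel \<theta> p" by simp
      then show ?thesis by (rule relD)
    qed
    then have "(\<lambda>k. \<Sum>i<r. \<Sum>j<r. torus_pnorm p (X i j k - Y i j k)) \<longlonglongrightarrow> (\<Sum>i<r. \<Sum>j<r. 0)"
      by (intro tendsto_sum) auto
    then have null: "(\<lambda>k. \<Sum>i<r. \<Sum>j<r. torus_pnorm p (X i j k - Y i j k)) \<longlonglongrightarrow> 0" by simp
    have "(\<lambda>k. mat_pnorm r p (\<lambda>i j. X i j k) - mat_pnorm r p (\<lambda>i j. Y i j k)) \<longlonglongrightarrow> 0"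
      by (rule Lim_null_comparison[OF always_eventually null]) (use diff[OF X Y(1)] in simp)
    moreover have "(\<lambda>k. mat_pnorm r p (\<lambda>i j. X i j k) - mat_pnorm r p (\<lambda>i j. Y i j k)) \<longlonglongrightarrow> L - L'"
      by (intro tendsto_diff L Y)
    ultimately show "L' = L" using LIMSEQ_unique by force
  qed
  with L show ?thesis by simp
qed

section \<open>The norm of the completion and boundedness of completely bounded extensions\<close>

abbreviation lp_norm :: "'n lp \<Rightarrow> real" where
  "lp_norm x \<equiv> lp_mat_norm p 1 (\<lambda>i j. x)"

lemma lp_norm_tendsto:
  assumes X: "X \<in> lp_Cauchy \<theta> p"
  shows "(\<lambda>k. torus_pnorm p (X k)) \<longlonglongrightarrow> lp_norm (cls X)"
proof -
  have "(\<lambda>k. mat_pnorm 1 p (\<lambda>i j. X k)) \<longlonglongrightarrow> lp_norm (cls X)"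
    by (rule mat_norm_tendsto) (use X in \<open>auto simp: lp_mat_space_def cls_space rel_refl\<close>)
  then show ?thesis by (simp add: torus_pnorm_eq_mat_pnorm[OF Cauchy_mem[OF X] p])
qed

lemma lp_norm_embed: "a \<in> smooth_torus \<theta> \<Longrightarrow> lp_norm (lp_embed \<theta> p a) = torus_pnorm p a"
  using lp_norm_tendsto[OF Cauchy_const[of a]] by (simp add: embed_eq LIMSEQ_const_iff)

lemma lp_norm_nonneg: "X \<in> lp_Cauchy \<theta> p \<Longrightarrow> 0 \<le> lp_norm (cls X)"
  by (rule tendsto_lowerbound[OF lp_norm_tendsto]) (auto simp: torus_pnorm_nonneg)

lemma lp_norm_scale:
  assumes X: "X \<in> lp_Cauchy \<theta> p"
  shows "lp_norm (lp_scale \<theta> p z (cls X)) = cmod z * lp_norm (cls X)"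
proof -
  have "(\<lambda>k. torus_pnorm p (z *\<^sub>C X k)) \<longlonglongrightarrow> cmod z * lp_norm (cls X)"
    unfolding torus_pnorm_scaleC[OF Cauchy_mem[OF X] p] by (intro tendsto_mult tendsto_const lp_norm_tendsto X)
  then show ?thesis
    unfolding scale_cls[OF X] using lp_norm_tendsto[OF Cauchy_scale[OF X]] LIMSEQ_unique by blast
qed

lemma ampl_norm_upper:
  assumes "x \<in> lp_space \<theta> p" "lp_norm x \<le> 1"
  shows "ereal (lp_norm (T x)) \<le> cb_norm \<theta> p T"
proof -
  have "ereal (lp_norm (T x)) \<le> ampl_norm \<theta> p 1 T"
    unfolding ampl_norm_def
    by (rule SUP_upper2[of "\<lambda>i j. x"]) (use assms in \<open>auto simp: lp_mat_space_def\<close>)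
  also have "\<dots> \<le> cb_norm \<theta> p T" unfolding cb_norm_def by (rule SUP_upper) simp
  finally show ?thesis .
qed

text \<open>Finiteness of the supremum over the unit ball, taken for one by one matrices, is
  converted by homogeneity into the continuity that uniqueness of the extension needs.\<close>

lemma cb_extension_bounded:
  assumes T: "cb_extension \<theta> p S T"
  obtains B where "0 \<le> B" "\<And>x. x \<in> lp_space \<theta> p \<Longrightarrow> lp_norm (T x) \<le> B * lp_norm x"
proof -
  have fin: "cb_norm \<theta> p T < \<infinity>" and lin: "lp_linear \<theta> p T" and map: "T \<in> lp_space \<theta> p \<rightarrow>\<^sub>E lp_space \<theta> p"
    using T by (auto simp: cb_extension_def)
  obtain B0 where B0: "cb_norm \<theta> p T \<le> ereal B0"
    using fin by (cases "cb_norm \<theta> p T") auto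
  define B where "B = max B0 0"
  have B: "cb_norm \<theta> p T \<le> ereal B" using B0 by (rule order.trans) (simp add: B_def)
  have "lp_norm (T x) \<le> B * lp_norm x" if x: "x \<in> lp_space \<theta> p" for x
  proof (rule field_le_epsilon)
    fix e :: real assume e: "0 < e"
    obtain X where X: "X \<in> lp_Cauchy \<theta> p" "x = cls X" using x by (rule spaceE)
    obtain Y where Y: "Y \<in> lp_Cauchy \<theta> p" "T x = cls Y" using map x by (meson PiE_mem spaceE)
    \<comment> \<open>The norm of \<open>x\<close> may be 0, so the division is by a slightly larger
      number. The surplus costs B e / (B + 1), which is at most \<open>e\<close>.\<close>
    define d where "d = lp_norm x + e / (B + 1)"
    have "0 \<le> lp_norm x" using lp_norm_nonneg X by simp
    moreover have "0 < e / (B + 1)" using e by (simp add: B_def)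
    ultimately have d: "0 < d" "lp_norm x \<le> d" by (auto simp: d_def)
    define y where "y = lp_scale \<theta> p (complex_of_real (1 / d)) x"
    have "lp_norm y = (1 / d) * lp_norm x"
      unfolding y_def X(2) lp_norm_scale[OF X(1)] norm_of_real using d by simp
    then have "lp_norm y \<le> 1" using d by simp
    moreover have "y \<in> lp_space \<theta> p" unfolding y_def X(2) scale_cls[OF X(1)] by (intro cls_space Cauchy_scale X)
    ultimately have "ereal (lp_norm (T y)) \<le> ereal B" using ampl_norm_upper B by (meson order.trans)
    moreover have "T y = lp_scale \<theta> p (complex_of_real (1 / d)) (T x)"
      using lin x unfolding lp_linear_def y_def by blast
    then have "lp_norm (T y) = (1 / d) * lp_norm (T x)"
      unfolding Y(2) using lp_norm_scale[OF Y(1), of "complex_of_real (1 / d)"] d by (simp only: norm_of_real) simp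
    then have "lp_norm (T x) = lp_norm (T y) * d" using d by simp
    ultimately have "lp_norm (T x) \<le> B * d" using d by (simp add: mult_right_mono)
    also have "\<dots> = B * lp_norm x + B * e / (B + 1)" by (simp add: d_def distrib_left)
    also have "\<dots> \<le> B * lp_norm x + e"
    proof -
      have "B * e \<le> e * (B + 1)" "0 < B + 1" using e by (auto simp: algebra_simps B_def)
      then show ?thesis by (simp add: pos_divide_le_eq)
    qed
    finally show "lp_norm (T x) \<le> B * lp_norm x + e" .
  qed
  then show ?thesis by (intro that[of B]) (auto simp: B_def)
qed

end

section \<open>Extension of multipliers to the completions\<close>

locale lp_multiplier = lp_torus \<theta> p for \<theta> :: "'n::{finite,linorder} rmat" and p +
  fixes K :: real and \<phi> :: "'n ivec \<Rightarrow> complex" and S :: "'n ivec op \<Rightarrow> 'n ivec op"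
  assumes mult: "cb_multiplier K \<phi>"
    and S: "rapidly_decreasing c \<Longrightarrow> S (torus_series \<theta> c) = torus_series \<theta> (\<lambda>m. \<phi> m * c m)"
begin

lemma rd: "rapidly_decreasing c \<Longrightarrow> rapidly_decreasing (\<lambda>m. \<phi> m * c m)"
  by (rule rapidly_decreasing_moderate_mult[OF cb_multiplierD(1)[OF mult]])

lemma S_smooth: "a \<in> smooth_torus \<theta> \<Longrightarrow> S a \<in> smooth_torus \<theta>"
  by (elim smooth_torusE) (simp add: S torus_series_smooth rd)

lemma S_add: "a \<in> smooth_torus \<theta> \<Longrightarrow> b \<in> smooth_torus \<theta> \<Longrightarrow> S (a + b) = S a + S b"
  by (elim smooth_torusE)
    (simp add: torus_series_add[symmetric] S rd rapidly_decreasing_add distrib_left)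

lemma S_scale: "a \<in> smooth_torus \<theta> \<Longrightarrow> S (z *\<^sub>C a) = z *\<^sub>C S a"
  by (elim smooth_torusE)
    (simp add: torus_series_scale[symmetric] S rd rapidly_decreasing_scale mult.left_commute)

lemma S_diff: "a \<in> smooth_torus \<theta> \<Longrightarrow> b \<in> smooth_torus \<theta> \<Longrightarrow> S (a - b) = S a - S b"
  using S_add[of a "(-1) *\<^sub>C b"] S_scale[of b "-1"] smooth_torus_scaleC[of b \<theta> "-1"]
  by (simp add: minus_eq_scaleC[symmetric])

lemma smooth_diff: "a \<in> smooth_torus \<theta> \<Longrightarrow> b \<in> smooth_torus \<theta> \<Longrightarrow> a - b \<in> smooth_torus \<theta>"
  using smooth_torus_add[of a \<theta> "(-1) *\<^sub>C b"] smooth_torus_scaleC[of b \<theta> "-1"]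
  by (simp add: minus_eq_scaleC[symmetric])

lemma S_mat_bound:
  assumes a: "\<And>i j. i < r \<Longrightarrow> j < r \<Longrightarrow> a i j \<in> smooth_torus \<theta>"
  shows "mat_pnorm r p (\<lambda>i j. S (a i j)) \<le> K * mat_pnorm r p a"
proof -
  have "\<exists>c. rapidly_decreasing c \<and> (i < r \<and> j < r \<longrightarrow> a i j = torus_series \<theta> c)" for i j
  proof (cases "i < r \<and> j < r")
    case True
    then have "a i j \<in> smooth_torus \<theta>" using a by simp
    then obtain c where "rapidly_decreasing c" "a i j = torus_series \<theta> c" by (rule smooth_torusE)
    then show ?thesis by (intro exI[of _ c]) simp
  next
    case False
    then show ?thesis by (intro exI[of _ "\<lambda>m. if m = 0 then 0 else 0"]) (simp only: rapidly_decreasing_single simp_thms)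
  qed
  then have "\<forall>i j. \<exists>c. rapidly_decreasing c \<and> (i < r \<and> j < r \<longrightarrow> a i j = torus_series \<theta> c)"
    by (intro allI)
  then obtain c where "\<forall>i j. rapidly_decreasing (c i j) \<and> (i < r \<and> j < r \<longrightarrow> a i j = torus_series \<theta> (c i j))"
    unfolding choice_iff by (rule exE)
  then have c: "rapidly_decreasing (c i j)"
    "i < r \<Longrightarrow> j < r \<Longrightarrow> a i j = torus_series \<theta> (c i j)" for i j
    by simp_all
  have "mat_pnorm r p (\<lambda>i j. S (a i j)) = mat_pnorm r p (\<lambda>i j. torus_series \<theta> (\<lambda>m. \<phi> m * c i j m))"
  proof (rule mat_pnorm_cong)
    fix i j assume ij: "i < r" "j < r"
    show "S (a i j) = torus_series \<theta> (\<lambda>m. \<phi> m * c i j m)"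
      unfolding c(2)[OF ij] by (intro S c(1))
  qed
  also have "\<dots> \<le> K * mat_pnorm r p (\<lambda>i j. torus_series \<theta> (c i j))"
    by (rule cb_multiplierD(3)[OF mult p]) (simp add: c(1))
  also have "mat_pnorm r p (\<lambda>i j. torus_series \<theta> (c i j)) = mat_pnorm r p a"
  proof (rule mat_pnorm_cong)
    fix i j assume "i < r" "j < r"
    then show "torus_series \<theta> (c i j) = a i j" by (rule c(2)[symmetric])
  qed
  finally show ?thesis .
qed

lemma S_bound:
  assumes "a \<in> smooth_torus \<theta>" shows "torus_pnorm p (S a) \<le> K * torus_pnorm p a"
proof -
  have "mat_pnorm 1 p (\<lambda>i j. S a) \<le> K * mat_pnorm 1 p (\<lambda>i j. a)"
    by (rule S_mat_bound) (rule assms)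
  then show ?thesis
    unfolding torus_pnorm_eq_mat_pnorm[OF smooth_torus_mem[OF assms] p]
      torus_pnorm_eq_mat_pnorm[OF smooth_torus_mem[OF S_smooth[OF assms]] p] .
qed

lemma S_diff_bound:
  "a \<in> smooth_torus \<theta> \<Longrightarrow> b \<in> smooth_torus \<theta> \<Longrightarrow> torus_pnorm p (S a - S b) \<le> K * torus_pnorm p (a - b)"
  using S_bound[OF smooth_diff] by (simp add: S_diff)

lemma K_nonneg: "0 \<le> K"
  using cb_multiplierD(2)[OF mult] .

lemma S_Cauchy: "X \<in> lp_Cauchy \<theta> p \<Longrightarrow> (\<lambda>k. S (X k)) \<in> lp_Cauchy \<theta> p"
  by (rule Cauchy_bounded_image[OF _ K_nonneg]) (auto intro: S_smooth S_diff_bound Cauchy_smooth)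

text \<open>The union is one class, since \<open>S\<close> respects the null relation. The
  restriction makes the map extensional, as uniqueness of a function on the whole type
  requires.\<close>

definition ext :: "'n lp \<Rightarrow> 'n lp" where
  "ext = restrict (\<lambda>x. \<Union>X\<in>x. cls (\<lambda>k. S (X k))) (lp_space \<theta> p)"

lemma ext_cls: "X \<in> lp_Cauchy \<theta> p \<Longrightarrow> ext (cls X) = cls (\<lambda>k. S (X k))"
  by (simp add: ext_def cls_space image_cls[OF _ K_nonneg S_smooth S_diff_bound])

lemma ext_mat_norm_le:
  assumes x: "x \<in> lp_mat_space \<theta> p r"
  shows "lp_mat_norm p r (\<lambda>i j. ext (x i j)) \<le> K * lp_mat_norm p r x"
proof -
  define X where "X i j = (SOME X. X \<in> lp_Cauchy \<theta> p \<and> x i j = cls X)" for i j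
  have X: "X i j \<in> lp_Cauchy \<theta> p \<and> x i j = cls (X i j)" if "i < r" "j < r" for i j
  proof -
    from x that have "x i j \<in> lp_space \<theta> p" by (simp add: lp_mat_space_def)
    then have "\<exists>X. X \<in> lp_Cauchy \<theta> p \<and> x i j = cls X" by (rule spaceE) (intro exI conjI)
    then show ?thesis unfolding X_def by (rule someI_ex)
  qed
  have e: "ext (x i j) = cls (\<lambda>k. S (X i j k))" if "i < r" "j < r" for i j
    using X[OF that] by (simp add: ext_cls)
  show ?thesis
  proof (rule tendsto_le)
    show "(\<lambda>k. K * mat_pnorm r p (\<lambda>i j. X i j k)) \<longlonglongrightarrow> K * lp_mat_norm p r x"
    proof (intro tendsto_mult tendsto_const mat_norm_tendsto x)
      fix i j assume "i < r" "j < r"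
      from X[OF this] show "X i j \<in> x i j" using self_in_cls by blast
    qed
    show "(\<lambda>k. mat_pnorm r p (\<lambda>i j. S (X i j k))) \<longlonglongrightarrow> lp_mat_norm p r (\<lambda>i j. ext (x i j))"
    proof (rule mat_norm_tendsto[of _ r "\<lambda>i j k. S (X i j k)"])
      show "(\<lambda>i j. ext (x i j)) \<in> lp_mat_space \<theta> p r"
        using e X S_Cauchy cls_space by (simp add: lp_mat_space_def)
      show "(\<lambda>k. S (X i j k)) \<in> ext (x i j)" if "i < r" "j < r" for i j
        unfolding e[OF that] by (intro self_in_cls S_Cauchy) (use X[OF that] in blast)
    qed
    show "\<forall>\<^sub>F k in sequentially. mat_pnorm r p (\<lambda>i j. S (X i j k)) \<le> K * mat_pnorm r p (\<lambda>i j. X i j k)"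
      by (intro always_eventually allI S_mat_bound Cauchy_smooth) (use X in blast)
  qed simp
qed

lemma ext_cb_norm: "cb_norm \<theta> p ext \<le> ereal K"
  unfolding cb_norm_def ampl_norm_def
proof (intro SUP_least)
  fix r x assume x: "x \<in> {x \<in> lp_mat_space \<theta> p r. lp_mat_norm p r x \<le> 1}"
  then have "lp_mat_norm p r (\<lambda>i j. ext (x i j)) \<le> K * lp_mat_norm p r x" by (intro ext_mat_norm_le) simp
  also have "\<dots> \<le> K * 1" using x K_nonneg by (intro mult_left_mono) auto
  finally show "ereal (lp_mat_norm p r (\<lambda>i j. ext (x i j))) \<le> ereal K" by simp
qed

lemma ext_cb_extension: "cb_extension \<theta> p S ext"
  unfolding cb_extension_def
proof (intro conjI ballI)
  show "ext \<in> lp_space \<theta> p \<rightarrow>\<^sub>E lp_space \<theta> p"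
  proof
    show "ext x \<in> lp_space \<theta> p" if "x \<in> lp_space \<theta> p" for x
      using that by (elim spaceE) (simp add: ext_cls cls_space S_Cauchy)
  qed (simp add: ext_def)
  show "cb_norm \<theta> p ext < \<infinity>" using ext_cb_norm by (rule le_less_trans) simp
  show "ext (lp_embed \<theta> p a) = lp_embed \<theta> p (S a)" if "a \<in> smooth_torus \<theta>" for a
    using that by (simp add: embed_eq ext_cls Cauchy_const)
  show "lp_linear \<theta> p ext"
    unfolding lp_linear_def
  proof (intro conjI ballI allI)
    fix x y assume "x \<in> lp_space \<theta> p" "y \<in> lp_space \<theta> p"
    then obtain X Y where X: "X \<in> lp_Cauchy \<theta> p" "x = cls X" and Y: "Y \<in> lp_Cauchy \<theta> p" "y = cls Y"
      by (elim spaceE) blast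
    show "ext (lp_add \<theta> p x y) = lp_add \<theta> p (ext x) (ext y)"
      unfolding X(2) Y(2)
      by (simp add: add_cls ext_cls Cauchy_add S_Cauchy X(1) Y(1) S_add Cauchy_smooth)
  next
    fix z x assume "x \<in> lp_space \<theta> p"
    then obtain X where X: "X \<in> lp_Cauchy \<theta> p" "x = cls X" by (rule spaceE)
    show "ext (lp_scale \<theta> p z x) = lp_scale \<theta> p z (ext x)"
      unfolding X(2)
      by (simp add: scale_cls ext_cls Cauchy_scale S_Cauchy X(1) S_scale Cauchy_smooth)
  qed
qed

text \<open>Any extension is bounded and agrees with \<open>S\<close> on the dense smooth part.
  Applied to \<open>x\<close> minus a late term of its sequence, it differs little from zero, so a
  sequence for the image is equivalent to the image sequence.\<close>

lemma cb_extension_unique: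
  assumes T: "cb_extension \<theta> p S T"
  shows "T = ext"
proof -
  have map: "T \<in> lp_space \<theta> p \<rightarrow>\<^sub>E lp_space \<theta> p" and lin: "lp_linear \<theta> p T"
    and emb: "\<And>a. a \<in> smooth_torus \<theta> \<Longrightarrow> T (lp_embed \<theta> p a) = lp_embed \<theta> p (S a)"
    using T by (auto simp: cb_extension_def)
  obtain B where B: "0 \<le> B" "\<And>x. x \<in> lp_space \<theta> p \<Longrightarrow> lp_norm (T x) \<le> B * lp_norm x"
    using T by (rule cb_extension_bounded) blast
  have eq: "T x = ext x" if x: "x \<in> lp_space \<theta> p" for x
  proof -
    obtain X where X: "X \<in> lp_Cauchy \<theta> p" "x = cls X" using x by (rule spaceE)
    obtain Y where Y: "Y \<in> lp_Cauchy \<theta> p" "T x = cls Y" using map x by (meson PiE_mem spaceE)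
    note Xs = Cauchy_smooth[OF X(1)] and SX = S_Cauchy[OF X(1)]
    have key: "lp_norm (cls (\<lambda>l. Y l + (-1) *\<^sub>C S (X k))) \<le> B * lp_norm (cls (\<lambda>l. X l + (-1) *\<^sub>C X k))" for k
    proof -
      have c: "(\<lambda>l. X k) \<in> lp_Cauchy \<theta> p" "(\<lambda>l. S (X k)) \<in> lp_Cauchy \<theta> p"
        by (intro Cauchy_const Xs S_smooth)+
      have "cls (\<lambda>l. X l + (-1) *\<^sub>C X k) = lp_add \<theta> p x (lp_scale \<theta> p (-1) (lp_embed \<theta> p (X k)))"
        unfolding X(2) embed_eq by (simp add: scale_cls add_cls X(1) c Cauchy_scale)
      moreover have "T (lp_add \<theta> p x (lp_scale \<theta> p (-1) (lp_embed \<theta> p (X k))))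
          = lp_add \<theta> p (T x) (lp_scale \<theta> p (-1) (T (lp_embed \<theta> p (X k))))"
      proof -
        have e: "lp_embed \<theta> p (X k) \<in> lp_space \<theta> p" unfolding embed_eq by (intro cls_space c)
        moreover have "lp_scale \<theta> p (-1) (lp_embed \<theta> p (X k)) \<in> lp_space \<theta> p"
          unfolding embed_eq scale_cls[OF c(1)] by (intro cls_space Cauchy_scale c)
        ultimately show ?thesis using lin x unfolding lp_linear_def by simp
      qed
      moreover have "\<dots> = cls (\<lambda>l. Y l + (-1) *\<^sub>C S (X k))"
        unfolding emb[OF Xs] unfolding Y(2) embed_eq by (simp add: scale_cls add_cls Y(1) c Cauchy_scale)
      ultimately have "T (cls (\<lambda>l. X l + (-1) *\<^sub>C X k)) = cls (\<lambda>l. Y l + (-1) *\<^sub>C S (X k))" by simp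
      then show ?thesis using B(2)[of "cls (\<lambda>l. X l + (-1) *\<^sub>C X k)"]
        by (simp add: cls_space Cauchy_add Cauchy_scale X(1) c)
    qed
    have sub: "a + (-1) *\<^sub>C b = a - b" for a b :: "'n ivec op"
      using minus_eq_scaleC[of b] by simp
    have "(\<lambda>k. torus_pnorm p (Y k - S (X k))) \<longlonglongrightarrow> 0"
    proof (rule LIMSEQ_I)
      fix e :: real assume e: "0 < e"
      \<comment> \<open>The final estimate is \<open>B * d + d\<close>, which stays strictly below
        \<open>e\<close>.\<close>
      define d where "d = e / (B + 2)"
      have d: "0 < d" using e B(1) by (simp add: d_def)
      obtain N1 where N1: "\<And>k l. k \<ge> N1 \<Longrightarrow> l \<ge> N1 \<Longrightarrow> torus_pnorm p (X k - X l) < d"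
        using CauchyD[OF X(1) d] by blast
      obtain N2 where N2: "\<And>k l. k \<ge> N2 \<Longrightarrow> l \<ge> N2 \<Longrightarrow> torus_pnorm p (Y k - Y l) < d"
        using CauchyD[OF Y(1) d] by blast
      have "torus_pnorm p (Y k - S (X k)) < e" if k: "k \<ge> max N1 N2" for k
      proof -
        have c: "(\<lambda>l. X l - X k) \<in> lp_Cauchy \<theta> p" "(\<lambda>l. Y l - S (X k)) \<in> lp_Cauchy \<theta> p"
          unfolding sub[symmetric]
          by (intro Cauchy_add Cauchy_scale Cauchy_const X(1) Y(1) Xs S_smooth)+
        have "lp_norm (cls (\<lambda>l. X l - X k)) \<le> d"
        proof (rule tendsto_upperbound[OF lp_norm_tendsto[OF c(1)]])
          show "\<forall>\<^sub>F l in sequentially. torus_pnorm p (X l - X k) \<le> d"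
            using N1 k by (intro eventually_sequentiallyI[of N1] less_imp_le) auto
        qed simp
        then have "B * lp_norm (cls (\<lambda>l. X l - X k)) \<le> B * d" using B(1) by (rule mult_left_mono)
        with key[of k] have "lp_norm (cls (\<lambda>l. Y l - S (X k))) \<le> B * d" unfolding sub by linarith
        \<comment> \<open>The norm of the class is a limit over \<open>l\<close>; replacing
          \<open>Y k\<close> by a late \<open>Y l\<close> costs less than \<open>d\<close>.\<close>
        moreover have "torus_pnorm p (Y k - S (X k)) - d \<le> lp_norm (cls (\<lambda>l. Y l - S (X k)))"
        proof (rule tendsto_lowerbound[OF lp_norm_tendsto[OF c(2)]])
          have "torus_pnorm p (Y k - S (X k)) - d \<le> torus_pnorm p (Y l - S (X k))" if "l \<ge> N2" for l
            using torus_pnorm_diff_triangle[OF Cauchy_mem[OF Y(1), of k] Cauchy_mem[OF Y(1), of l] Cauchy_mem[OF SX, of k] p]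
              N2[of k l] that k by simp
          then show "\<forall>\<^sub>F l in sequentially. torus_pnorm p (Y k - S (X k)) - d \<le> torus_pnorm p (Y l - S (X k))"
            by (rule eventually_sequentiallyI)
        qed simp
        ultimately have "torus_pnorm p (Y k - S (X k)) \<le> B * d + d" by linarith
        also have "\<dots> < (B + 2) * d" using d by (simp add: distrib_right)
        also have "\<dots> = e" using B(1) by (simp add: d_def)
        finally show ?thesis .
      qed
      then show "\<exists>N. \<forall>k\<ge>N. norm (torus_pnorm p (Y k - S (X k)) - 0) < e"
        by (intro exI[of _ "max N1 N2"]) (simp add: torus_pnorm_nonneg)
    qed
    then have "cls Y = cls (\<lambda>k. S (X k))" by (intro cls_eqI relI Y SX)
    then show ?thesis unfolding Y(2) unfolding X(2) ext_cls[OF X(1)] .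
  qed
  show ?thesis
  proof (rule PiE_ext[OF map])
    show "ext \<in> lp_space \<theta> p \<rightarrow>\<^sub>E lp_space \<theta> p" using ext_cb_extension by (simp add: cb_extension_def)
  qed (rule eq)
qed

lemma cb_norm_lower:
  assumes T: "cb_extension \<theta> p S T" and a: "a \<in> smooth_torus \<theta>" "torus_pnorm p a \<le> 1"
  shows "ereal (torus_pnorm p (S a)) \<le> cb_norm \<theta> p T"
proof -
  have "lp_embed \<theta> p a \<in> lp_space \<theta> p" unfolding embed_eq by (intro cls_space Cauchy_const a)
  moreover have "lp_norm (lp_embed \<theta> p a) \<le> 1"
    unfolding lp_norm_embed[OF a(1)] by (rule a(2))
  ultimately have "ereal (lp_norm (T (lp_embed \<theta> p a))) \<le> cb_norm \<theta> p T" by (rule ampl_norm_upper)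
  moreover have "T (lp_embed \<theta> p a) = lp_embed \<theta> p (S a)" using T a by (simp add: cb_extension_def)
  ultimately show ?thesis using lp_norm_embed[OF S_smooth[OF a(1)]] by simp
qed

text \<open>A monomial is an eigenvector of every multiplier, and being unitary it has norm 1 for
  every p because the trace is normalised. Lower bounds thus reduce to the size of the
  symbol.\<close>

lemma S_mono: "torus_pnorm p (S (torus_mono \<theta> m)) = cmod (\<phi> m)"
proof -
  have "S (torus_mono \<theta> m) = torus_series \<theta> (\<lambda>k. \<phi> m * (if k = m then 1 else 0))"
    unfolding torus_series_single[symmetric] S[OF rapidly_decreasing_single]
    by (rule arg_cong[where f="torus_series \<theta>"]) auto
  also have "\<dots> = \<phi> m *\<^sub>C torus_mono \<theta> m"
    by (simp only: torus_series_scale[OF rapidly_decreasing_single] torus_series_single)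
  finally show ?thesis
    by (simp add: torus_pnorm_scaleC[OF torus_mono_mem p] torus_pnorm_unitary[OF torus_mono_unitary p])
qed

end

lemma lp_multiplier_heat_op:
  fixes \<theta> :: "'n::{finite,linorder} rmat"
  assumes p: "1 < p" and t: "0 < t"
  shows "lp_multiplier \<theta> p (heat_constant l \<alpha> / t powr (real l + real (multi_degree \<alpha>) / 2))
    (heat_op_symbol \<alpha> l t) (heat_op \<theta> \<alpha> l t)"
proof unfold_locales
  show "1 < p" by (rule p)
  show "cb_multiplier (heat_constant l \<alpha> / t powr (real l + real (multi_degree \<alpha>) / 2)) (heat_op_symbol \<alpha> l t)"
    by (rule cb_multiplier_heat_op[OF t])
  show "heat_op \<theta> \<alpha> l t (torus_series \<theta> c) = torus_series \<theta> (\<lambda>m. heat_op_symbol \<alpha> l t m * c m)"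
    if "rapidly_decreasing c" for c
    using heat_op_series[OF that less_imp_le[OF t]] by (simp add: heat_op_symbol_def mult_ac)
qed

section \<open>The lower bound\<close>

text \<open>The exponential is the heat factor at the chosen frequency, whose coordinates are at
  most t^(-1/2). The power of 2 is the loss from rounding these coordinates down.\<close>

definition heat_lower_constant :: "nat \<Rightarrow> 'n::finite nvec \<Rightarrow> real" where
  "heat_lower_constant l \<alpha> = exp (- (4 * pi\<^sup>2 * real CARD('n))) / 2 ^ (multi_degree \<alpha> + 2 * l)"

lemma heat_lower_constant_pos: "0 < heat_lower_constant l \<alpha>"
  by (simp add: heat_lower_constant_def)

text \<open>The frequency \<open>(q, \<dots>, q)\<close> with \<open>q\<close> close to \<open>t\<^bsup>-1/2\<^esup>\<close> is a near-maximiser of the symbol.\<close>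

lemma heat_op_symbol_lower:
  fixes \<alpha> :: "'n::finite nvec"
  assumes t: "0 < t" "t \<le> 1"
  obtains m where "heat_lower_constant l \<alpha> / t powr (real l + real (multi_degree \<alpha>) / 2) \<le> cmod (heat_op_symbol \<alpha> l t m)"
proof -
  define M where "M = multi_degree \<alpha> + 2 * l"
  define x where "x = 1 / sqrt t"
  have x: "1 \<le> x" "x\<^sup>2 * t = 1" using t by (auto simp: x_def power_divide)
  \<comment> \<open>As \<open>t\<close> is at most 1, \<open>x\<close> is at least 1, so rounding
    down gives a positive integer that loses at most a factor 2.\<close>
  define q where "q = real_of_int \<lfloor>x\<rfloor>"
  have q: "q \<le> x" "1 \<le> q" using x(1) by (simp_all add: q_def)
  moreover have "x < q + 1" by (simp add: q_def)
  ultimately have q': "x / 2 \<le> q" by simp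
  define m :: "'n ivec" where "m = (\<chi> j. \<lfloor>x\<rfloor>)"
  have m: "real_of_int (m $ j) = q" for j by (simp add: m_def q_def)
  have pi1: "1 \<le> pi" using pi_gt3 by simp
  have "cmod (deriv_symbol j m) = 2 * pi * q" for j
  proof -
    have "cmod (deriv_symbol j m) = 2 * pi * \<bar>real_of_int (m $ j)\<bar>"
      by (simp add: deriv_symbol_def norm_mult)
    then show ?thesis using q by (simp add: m)
  qed
  then have "cmod (multi_symbol \<alpha> m) = (2 * pi * q) ^ multi_degree \<alpha>"
    by (simp add: multi_symbol_def prod_norm[symmetric] norm_power multi_degree_def power_sum)
  moreover have "q ^ multi_degree \<alpha> \<le> (2 * pi * q) ^ multi_degree \<alpha>"
    using q pi1 mult_right_mono[of 1 "2 * pi" q] by (intro power_mono) auto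
  ultimately have 1: "q ^ multi_degree \<alpha> \<le> cmod (multi_symbol \<alpha> m)" by simp
  have sq: "sqlen m = real CARD('n) * q\<^sup>2" by (simp add: sqlen_def m)
  have "1 \<le> 4 * pi\<^sup>2 * real CARD('n)"
  proof -
    have "1 * 1 * 1 \<le> 4 * pi\<^sup>2 * real CARD('n)"
      using pi1 by (intro mult_mono) (auto simp: Suc_leI)
    then show ?thesis by simp
  qed
  then have "1 * q\<^sup>2 \<le> 4 * pi\<^sup>2 * real CARD('n) * q\<^sup>2" by (intro mult_right_mono) auto
  moreover have "cmod (lap_symbol m) = 4 * pi\<^sup>2 * real CARD('n) * q\<^sup>2"
    unfolding lap_symbol_def sq norm_of_real by (simp add: abs_mult)
  ultimately have "q\<^sup>2 \<le> cmod (lap_symbol m)" by simp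
  then have 2: "(q\<^sup>2) ^ l \<le> cmod (lap_symbol m) ^ l" by (intro power_mono) auto
  have "q\<^sup>2 * t \<le> x\<^sup>2 * t" using q t by (intro mult_right_mono power_mono) auto
  then have "4 * pi\<^sup>2 * real CARD('n) * (q\<^sup>2 * t) \<le> 4 * pi\<^sup>2 * real CARD('n) * 1"
    unfolding x(2) by (intro mult_left_mono) auto
  then have 3: "exp (- (4 * pi\<^sup>2 * real CARD('n))) \<le> cmod (heat_symbol t m)"
    by (simp add: heat_symbol_def sq mult_ac)
  have "heat_lower_constant l \<alpha> / t powr (real l + real (multi_degree \<alpha>) / 2)
      = (x / 2) ^ M * exp (- (4 * pi\<^sup>2 * real CARD('n)))"
  proof -
    have "t powr (real l + real (multi_degree \<alpha>) / 2) = sqrt t ^ M"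
    proof -
      have e: "real l + real (multi_degree \<alpha>) / 2 = (1 / 2) * real M" by (simp add: M_def)
      show ?thesis
        unfolding e powr_powr[symmetric] powr_half_sqrt[OF less_imp_le[OF t(1)]]
        using t by (simp add: powr_realpow)
    qed
    then show ?thesis by (simp add: heat_lower_constant_def x_def M_def power_divide)
  qed
  also have "\<dots> \<le> q ^ M * exp (- (4 * pi\<^sup>2 * real CARD('n)))"
    using q' x by (intro mult_right_mono power_mono) auto
  also have "\<dots> = q ^ multi_degree \<alpha> * (q\<^sup>2) ^ l * exp (- (4 * pi\<^sup>2 * real CARD('n)))"
    by (simp add: M_def power_add power_mult)
  also have "\<dots> \<le> cmod (multi_symbol \<alpha> m) * cmod (lap_symbol m) ^ l * cmod (heat_symbol t m)"
    using 1 2 3 q by (intro mult_mono) auto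
  also have "\<dots> = cmod (heat_op_symbol \<alpha> l t m)"
    by (simp add: heat_op_symbol_def norm_mult norm_power)
  finally show ?thesis by (rule that)
qed

lemma heat_op_exists_lower:
  fixes \<theta> :: "'n::{finite,linorder} rmat"
  assumes "1 < p" "0 < t" "t \<le> 1"
  obtains a where "a \<in> smooth_torus \<theta>" "torus_pnorm p a = 1"
    "heat_lower_constant l \<alpha> / t powr (real l + real (multi_degree \<alpha>) / 2) \<le> torus_pnorm p (heat_op \<theta> \<alpha> l t a)"
proof -
  interpret lp_multiplier \<theta> p "heat_constant l \<alpha> / t powr (real l + real (multi_degree \<alpha>) / 2)"
    "heat_op_symbol \<alpha> l t" "heat_op \<theta> \<alpha> l t"
    using assms by (intro lp_multiplier_heat_op)
  obtain m where "heat_lower_constant l \<alpha> / t powr (real l + real (multi_degree \<alpha>) / 2) \<le> cmod (heat_op_symbol \<alpha> l t m)"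
    using assms(2,3) by (rule heat_op_symbol_lower[of t l \<alpha>])
  then show ?thesis
    by (intro that[of "torus_mono \<theta> m"] torus_mono_smooth torus_pnorm_unitary[OF torus_mono_unitary assms(1)])
      (simp only: S_mono)
qed

text \<open>The l-th time derivative of the heat semigroup is the l-th power of minus the Laplacian
  applied to it, so the two operators differ only by the sign (-1)^l.\<close>

lemma deriv_heat_time_deriv_bound:
  fixes \<theta> :: "'n::{finite,linorder} rmat"
  assumes p: "1 < p" and t: "0 < t" and a: "a \<in> smooth_torus \<theta>"
  shows "torus_pnorm p (deriv_multi \<theta> \<alpha> (heat_time_deriv \<theta> l t a)) = torus_pnorm p (heat_op \<theta> \<alpha> l t a)"
proof -
  obtain c where c: "rapidly_decreasing c" "a = torus_series \<theta> c" using a by (rule smooth_torusE)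
  have "moderate (\<lambda>m. ((-1) * lap_symbol m) ^ l)"
    by (rule moderate_power[OF moderate_mult[OF moderate_const moderate_lap_symbol]])
  then have "moderate (\<lambda>m. (- lap_symbol m) ^ l)" by simp
  then have r: "rapidly_decreasing (\<lambda>m. heat_symbol t m * ((- lap_symbol m) ^ l * c m))"
    by (intro rapidly_decreasing_moderate_mult[OF moderate_heat_symbol] rapidly_decreasing_moderate_mult[OF _ c(1)]) (use t in auto)
  have h: "rapidly_decreasing (\<lambda>m. multi_symbol \<alpha> m * lap_symbol m ^ l * heat_symbol t m * c m)"
    by (intro rapidly_decreasing_moderate_mult[OF _ c(1)] moderate_mult moderate_power moderate_multi_symbol
        moderate_lap_symbol moderate_heat_symbol) (use t in simp)
  have "deriv_multi \<theta> \<alpha> (heat_time_deriv \<theta> l t a)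
      = torus_series \<theta> (\<lambda>m. (-1) ^ l * (multi_symbol \<alpha> m * lap_symbol m ^ l * heat_symbol t m * c m))"
    unfolding c(2) heat_time_deriv_series[OF c(1) t] deriv_multi_series[OF r]
    by (simp add: power_minus[of "lap_symbol _"] mult_ac)
  also have "\<dots> = (-1) ^ l *\<^sub>C heat_op \<theta> \<alpha> l t a"
    unfolding c(2) using t by (simp add: torus_series_scale[OF h] heat_op_series[OF c(1)])
  finally have "deriv_multi \<theta> \<alpha> (heat_time_deriv \<theta> l t a) = (-1) ^ l *\<^sub>C heat_op \<theta> \<alpha> l t a" .
  moreover have "heat_op \<theta> \<alpha> l t a \<in> torus_algebra \<theta>"
    unfolding c(2) using t by (simp add: heat_op_series[OF c(1)] torus_series_mem[OF h])
  ultimately show ?thesis by (simp add: torus_pnorm_scaleC[OF _ p] norm_power)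
qed

theorem theorem1p1:
  fixes \<alpha> :: "'n::{finite,linorder} nvec" and l :: nat
  shows
    "(\<exists>C>0. \<forall>(\<theta> :: 'n rmat) p t. transpose \<theta> = - \<theta> \<longrightarrow> 1 < p \<longrightarrow> 0 < t \<longrightarrow>
        (\<exists>!T. cb_extension \<theta> p (heat_op \<theta> \<alpha> l t) T) \<and>
        (\<forall>T. cb_extension \<theta> p (heat_op \<theta> \<alpha> l t) T \<longrightarrow>
           cb_norm \<theta> p T \<le> ereal (C / t powr (real l + real (multi_degree \<alpha>) / 2))) \<and>
        (\<forall>a\<in>smooth_torus \<theta>.
           torus_pnorm p (deriv_multi \<theta> \<alpha> (heat_time_deriv \<theta> l t a))
             \<le> C / t powr (real l + real (multi_degree \<alpha>) / 2) * torus_pnorm p a)) \<and>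
     ((\<alpha>, l) \<noteq> (0, 0) \<longrightarrow>
        (\<exists>c>0. \<forall>(\<theta> :: 'n rmat) p. transpose \<theta> = - \<theta> \<longrightarrow> 1 < p \<longrightarrow>
           (\<forall>\<^sub>F t in at_right 0.
              ereal (c / t powr (real l + real (multi_degree \<alpha>) / 2))
                \<le> (SUP a\<in>{a \<in> smooth_torus \<theta>. torus_pnorm p a = 1}.
                     ereal (torus_pnorm p (heat_op \<theta> \<alpha> l t a))))) \<and>
        (\<forall>(\<theta> :: 'n rmat) p (g :: real \<Rightarrow> real). transpose \<theta> = - \<theta> \<longrightarrow> 1 < p \<longrightarrow>
           g \<in> o[at_right 0](\<lambda>t. t powr (- real l - real (multi_degree \<alpha>) / 2)) \<longrightarrow>
           \<not> (\<forall>\<^sub>F t in at_right 0. \<forall>T. cb_extension \<theta> p (heat_op \<theta> \<alpha> l t) T \<longrightarrow>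
                cb_norm \<theta> p T \<le> ereal (g t))))"
proof (intro conjI impI)
  show "\<exists>C>0. \<forall>(\<theta> :: 'n rmat) p t. transpose \<theta> = - \<theta> \<longrightarrow> 1 < p \<longrightarrow> 0 < t \<longrightarrow>
        (\<exists>!T. cb_extension \<theta> p (heat_op \<theta> \<alpha> l t) T) \<and>
        (\<forall>T. cb_extension \<theta> p (heat_op \<theta> \<alpha> l t) T \<longrightarrow>
           cb_norm \<theta> p T \<le> ereal (C / t powr (real l + real (multi_degree \<alpha>) / 2))) \<and>
        (\<forall>a\<in>smooth_torus \<theta>.
           torus_pnorm p (deriv_multi \<theta> \<alpha> (heat_time_deriv \<theta> l t a))
             \<le> C / t powr (real l + real (multi_degree \<alpha>) / 2) * torus_pnorm p a)"
  proof (intro exI[of _ "heat_constant l \<alpha>"] conjI[OF heat_constant_pos] allI impI)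
    fix \<theta> :: "'n rmat" and p t :: real
    assume p: "1 < p" and t: "0 < t"
    interpret lp_multiplier \<theta> p "heat_constant l \<alpha> / t powr (real l + real (multi_degree \<alpha>) / 2)"
      "heat_op_symbol \<alpha> l t" "heat_op \<theta> \<alpha> l t"
      by (rule lp_multiplier_heat_op[OF p t])
    show "(\<exists>!T. cb_extension \<theta> p (heat_op \<theta> \<alpha> l t) T) \<and>
        (\<forall>T. cb_extension \<theta> p (heat_op \<theta> \<alpha> l t) T \<longrightarrow>
           cb_norm \<theta> p T \<le> ereal (heat_constant l \<alpha> / t powr (real l + real (multi_degree \<alpha>) / 2))) \<and>
        (\<forall>a\<in>smooth_torus \<theta>.
           torus_pnorm p (deriv_multi \<theta> \<alpha> (heat_time_deriv \<theta> l t a))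
             \<le> heat_constant l \<alpha> / t powr (real l + real (multi_degree \<alpha>) / 2) * torus_pnorm p a)"
    proof (intro conjI allI impI ballI)
      show "\<exists>!T. cb_extension \<theta> p (heat_op \<theta> \<alpha> l t) T"
        by (rule ex1I[of _ ext]) (rule ext_cb_extension, rule cb_extension_unique)
      show "cb_norm \<theta> p T \<le> ereal (heat_constant l \<alpha> / t powr (real l + real (multi_degree \<alpha>) / 2))"
        if "cb_extension \<theta> p (heat_op \<theta> \<alpha> l t) T" for T
        unfolding cb_extension_unique[OF that] by (rule ext_cb_norm)
      show "torus_pnorm p (deriv_multi \<theta> \<alpha> (heat_time_deriv \<theta> l t a))
             \<le> heat_constant l \<alpha> / t powr (real l + real (multi_degree \<alpha>) / 2) * torus_pnorm p a"
        if "a \<in> smooth_torus \<theta>" for a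
        unfolding deriv_heat_time_deriv_bound[OF p t that] by (rule S_bound[OF that])
    qed
  qed
next
  have small: "\<forall>\<^sub>F t in at_right (0::real). 0 < t \<and> t \<le> 1"
    using eventually_at_right_real[OF zero_less_one] by (rule eventually_mono) auto
  show "\<exists>c>0. \<forall>(\<theta> :: 'n rmat) p. transpose \<theta> = - \<theta> \<longrightarrow> 1 < p \<longrightarrow>
           (\<forall>\<^sub>F t in at_right 0.
              ereal (c / t powr (real l + real (multi_degree \<alpha>) / 2))
                \<le> (SUP a\<in>{a \<in> smooth_torus \<theta>. torus_pnorm p a = 1}.
                     ereal (torus_pnorm p (heat_op \<theta> \<alpha> l t a))))"
  proof (intro exI[of _ "heat_lower_constant l \<alpha>"] conjI[OF heat_lower_constant_pos] allI impI)
    fix \<theta> :: "'n rmat" and p :: real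
    assume p: "1 < p"
    show "\<forall>\<^sub>F t in at_right 0. ereal (heat_lower_constant l \<alpha> / t powr (real l + real (multi_degree \<alpha>) / 2))
        \<le> (SUP a\<in>{a \<in> smooth_torus \<theta>. torus_pnorm p a = 1}. ereal (torus_pnorm p (heat_op \<theta> \<alpha> l t a)))"
      using small
    proof eventually_elim
      case (elim t)
      obtain a where "a \<in> smooth_torus \<theta>" "torus_pnorm p a = 1"
        "heat_lower_constant l \<alpha> / t powr (real l + real (multi_degree \<alpha>) / 2) \<le> torus_pnorm p (heat_op \<theta> \<alpha> l t a)"
        using heat_op_exists_lower[of p t \<theta> l \<alpha>] p elim by blast
      then show ?case by (intro SUP_upper2[of a]) auto
    qed
  qed
  show "\<forall>(\<theta> :: 'n rmat) p (g :: real \<Rightarrow> real). transpose \<theta> = - \<theta> \<longrightarrow> 1 < p \<longrightarrow>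
           g \<in> o[at_right 0](\<lambda>t. t powr (- real l - real (multi_degree \<alpha>) / 2)) \<longrightarrow>
           \<not> (\<forall>\<^sub>F t in at_right 0. \<forall>T. cb_extension \<theta> p (heat_op \<theta> \<alpha> l t) T \<longrightarrow>
                cb_norm \<theta> p T \<le> ereal (g t))"
  proof (intro allI impI notI)
    fix \<theta> :: "'n rmat" and p :: real and g :: "real \<Rightarrow> real"
    assume p: "1 < p" and g: "g \<in> o[at_right 0](\<lambda>t. t powr (- real l - real (multi_degree \<alpha>) / 2))"
      and upper: "\<forall>\<^sub>F t in at_right 0. \<forall>T. cb_extension \<theta> p (heat_op \<theta> \<alpha> l t) T \<longrightarrow> cb_norm \<theta> p T \<le> ereal (g t)"
    define c where "c = heat_lower_constant l \<alpha>"
    have c: "0 < c" unfolding c_def by (rule heat_lower_constant_pos)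
    \<comment> \<open>With half of the lower constant the little-o hypothesis puts \<open>g\<close>
      eventually below \<open>c / 2\<close> times the power of \<open>t\<close>, while the test
      monomials keep the completely bounded norm above \<open>c\<close> times it.\<close>
    have "0 < c / 2" using c by simp
    from landau_o.smallD[OF g this] upper small have "\<forall>\<^sub>F t in at_right (0::real). False"
    proof eventually_elim
      case (elim t)
      define w where "w = t powr (real l + real (multi_degree \<alpha>) / 2)"
      have w: "0 < w" using elim by (simp add: w_def)
      have "- real l - real (multi_degree \<alpha>) / 2 = - (real l + real (multi_degree \<alpha>) / 2)" by simp
      then have "t powr (- real l - real (multi_degree \<alpha>) / 2) = 1 / w"
        unfolding w_def by (simp only: powr_minus_divide)
      then have "\<bar>g t\<bar> \<le> c / 2 * (1 / w)" using elim(1) w by simp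
      moreover have "c / 2 * (1 / w) < c / w" using c w by (simp add: field_simps)
      moreover have "c / w \<le> g t"
      proof -
        interpret lp_multiplier \<theta> p "heat_constant l \<alpha> / t powr (real l + real (multi_degree \<alpha>) / 2)"
          "heat_op_symbol \<alpha> l t" "heat_op \<theta> \<alpha> l t"
          using p elim by (intro lp_multiplier_heat_op) auto
        obtain a where a: "a \<in> smooth_torus \<theta>" "torus_pnorm p a = 1"
          "c / w \<le> torus_pnorm p (heat_op \<theta> \<alpha> l t a)"
          using heat_op_exists_lower[of p t \<theta> l \<alpha>] p elim unfolding c_def w_def by blast
        have "ereal (torus_pnorm p (heat_op \<theta> \<alpha> l t a)) \<le> cb_norm \<theta> p ext"
          by (rule cb_norm_lower[OF ext_cb_extension a(1)]) (simp add: a(2))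
        also have "\<dots> \<le> ereal (g t)" using elim(2) ext_cb_extension by blast
        finally show ?thesis using a(3) by simp
      qed
      ultimately show False by linarith
    qed
    then show False by (simp add: eventually_False)
  qed
qed

end
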